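(* Let $(G,c)$ be an MOY graph with at least one vertex which is isotopic to a plane MOY graph, i.e. $(G,c)$ has some diagram without double points. Then $\Delta_{(G,c)}(t)\in\mathbb{Z}_{\ge 0}[t^{\pm\frac12}]$, that is, $\Delta_{(G,c)}(t)$ is a Laurent polynomial in $t^{1/2}$ with non-negative integer coefficients. (The ambiguity of $\Delta_{(G,c)}(t)$ by a power of $t$ does not affect this.)
   Context: MOY graphs. An abstract MOY graph is a finite oriented graph (closed loops without vertices are allowed as edges) with a balanced coloring $c:E\to\mathbb{Z}_{\ge 0}$: at each vertex the sum of the colors of the entering edges equals the sum of the colors of the leaving edges. An MOY graph diagram $D$ is a generic immersion of an abstract MOY graph in $\mathbb{R}^2$ (finitely many transverse double points, away from vertices, with over/under information) such that near each vertex $v$ a straight line $L_v$ through $v$ separates the edges entering $v$ from the edges leaving $v$. Graphs have no vertices of valence 1, and colorings are non-trivial (not identically $0$). An MOY graph is an equivalence class of MOY graph diagrams under isotopies of $\mathbb{R}^2$ and the Reidemeister moves: (I) insertion/deletion of a kink in an edge; (II), (III) the usual second and third Reidemeister moves; (IV) moving a strand entirely over, or entirely under, a vertex $v$, so that a strand crossing all edges on one side of $L_v$ is replaced by one crossing all edges on the other side; (V) insertion/deletion, next to a vertex $v$, of one crossing (of either kind) between two edges that are adjacent on the same side of $L_v$ (both entering or both leaving). Kauffman state sum. Draw a small circle around each vertex of $D$. $\operatorname{Cr}(D)$ is the set consisting of the double points of $D$ and, for each vertex, the points where its entering edges meet the circle around it. $\operatorname{Re}(D)$ is the set consisting of the regular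 regions (the complementary regions of $D$ in $\mathbb{R}^2$ with the vertex discs removed) and the circle regions (one disc for each vertex, regarded as a single region). Rotate a double point so that both strands point upward; it then has four corners N, S, E, W. A crossing on a vertex circle has three corners: N (inside the circle), W (outside, to the left of the entering edge) and E (outside, to the right of the entering edge). Every corner lies in a unique region. Local weights at a corner of $C\in\operatorname{Cr}(D)$: for a double point, $M=-1$ at N and $M=1$ at S, E, W; for a crossing on a vertex circle, $M=1$ at all corners. For a positive double point (over-strand from bottom left to top right) whose over-strand has color $i$: $A=t^{-i}$ at N and W, $A=1$ at S and E. For a negative double point (over-strand from bottom right to top left) whose over-strand has color $i$: $A=t^{i}$ at N and E, $A=1$ at S and W. For a crossing on a vertex circle whose entering edge has color $i$: $A=t^{-i/2}-t^{i/2}$ at N, $A=t^{-i/2}$ at W, $A=t^{i/2}$ at E. Choose a base point $\delta$ on an edge of non-zero color, adjacent to regular regions $R_u,R_v$. A Kauffman state $s\in S(D,\delta)$ is a choice of a corner at each element of $\operatorname{Cr}(D)$ such that the induced map $\operatorname{Cr}(D)\to\operatorname{Re}(D)\setminus\{R_u,R_v\}$ is a bijection. $M(s)$ and $A(s)$ are the products of the local weights over the chosen corners (empty products equal $1$). The index of regular regions is defined by: the unbounded region has index $0$, and traversing an edge of color $i$ along its orientation, the index of the region on its left minus the index of the region on its right equals $i$. If $\delta$ lies on an edge of color $i\neq 0$ with adjacent indices $n$ (left) and $n-i$ (right), put $|\delta|=t^{n-i}-t^{n}$. Then $\langle D,c\rangle:=|\delta|^{-1}\sum_{s\in S(D,\delta)}M(s)A(s)$,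 which is $0$ if $S(D,\delta)=\emptyset$ (in particular if $D$ is disconnected). It does not depend on $\delta$. Alexander polynomial. For an MOY graph $(G,c)$ with vertex set $V$ and any diagram $D$ of it, $\Delta_{(G,c)}(t):=\langle D,c\rangle/(t^{-1/2}-t^{1/2})^{|V|-1}$; it is well defined up to multiplication by $t^k$, $k\in\mathbb{Z}$. *)

theory Defs
  imports "HOL-Library.FuncSet" "HOL-Computational_Algebra.Computational_Algebra"
begin

section \<open>MOY graph diagrams\<close>

text \<open>
  A diagram is recorded up to isotopy of the plane by its combinatorial data.  The double points
  and the vertices cut the immersed graph into oriented arcs; a closed loop that meets neither is
  one arc as well.  An edge of the underlying abstract graph is therefore a chain of arcs passing
  straight through double points.  The data consist of the regular regions, one of which is the
  unbounded one, of the region to the left and to the right of every arc, and of the way in which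
  arcs are attached at double points and vertices.

  A double point is rotated so that both strands point upward.  The entering arcs are then the
  bottom left one (\<open>sw\<close>) and the bottom right one (\<open>se\<close>), the leaving arcs the top left one
  (\<open>nw\<close>) and the top right one (\<open>ne\<close>); the strands are \<open>sw\<close> to \<open>ne\<close> and \<open>se\<close> to \<open>nw\<close>.  The
  double point is positive if the strand from \<open>sw\<close> to \<open>ne\<close> is the upper one.

  A vertex is rotated so that the separating line is horizontal, with the entering edges below and
  the leaving edges above it; \<open>ins\<close> and \<open>outs\<close> list them from left to right, and \<open>wreg\<close> and
  \<open>ereg\<close> are the regions that contain the left and the right end of the line near the vertex.

  Field values outside the finite sets concerned are irrelevant.
\<close>

record moy =
  arcs :: "nat set"
  color :: "nat \<Rightarrow> nat"
  lreg :: "nat \<Rightarrow> nat"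
  rreg :: "nat \<Rightarrow> nat"
  regs :: "nat set"
  unbounded :: nat
  dpts :: "nat set"
  positive :: "nat \<Rightarrow> bool"
  sw :: "nat \<Rightarrow> nat"
  se :: "nat \<Rightarrow> nat"
  nw :: "nat \<Rightarrow> nat"
  ne :: "nat \<Rightarrow> nat"
  verts :: "nat set"
  ins :: "nat \<Rightarrow> nat list"
  outs :: "nat \<Rightarrow> nat list"
  wreg :: "nat \<Rightarrow> nat"
  ereg :: "nat \<Rightarrow> nat"

text \<open>The places where an arc can end (\<open>in_slots\<close>) or start (\<open>out_slots\<close>).\<close>

datatype slot = LeftSlot nat | RightSlot nat | VertexSlot nat nat

definition in_slots :: "moy \<Rightarrow> slot set" where
  "in_slots D = LeftSlot ` dpts D \<union> RightSlot ` dpts D \<union>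
     {VertexSlot v j |v j. v \<in> verts D \<and> j < length (ins D v)}"

definition out_slots :: "moy \<Rightarrow> slot set" where
  "out_slots D = LeftSlot ` dpts D \<union> RightSlot ` dpts D \<union>
     {VertexSlot v j |v j. v \<in> verts D \<and> j < length (outs D v)}"

fun in_arc :: "moy \<Rightarrow> slot \<Rightarrow> nat" where
  "in_arc D (LeftSlot x) = sw D x"
| "in_arc D (RightSlot x) = se D x"
| "in_arc D (VertexSlot v j) = ins D v ! j"

fun out_arc :: "moy \<Rightarrow> slot \<Rightarrow> nat" where
  "out_arc D (LeftSlot x) = nw D x"
| "out_arc D (RightSlot x) = ne D x"
| "out_arc D (VertexSlot v j) = outs D v ! j"

text \<open>
  The arcs that have end points at all.  The remaining arcs are the closed loops.
\<close>

definition open_arcs :: "moy \<Rightarrow> nat set" where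
  "open_arcs D = in_arc D ` in_slots D"

text \<open>
  \<open>fan D w as e\<close>: the upward arcs \<open>as\<close>, listed from left to right, consecutively separate
  regions of which the first is \<open>w\<close> and the last is \<open>e\<close>.
\<close>

fun fan :: "moy \<Rightarrow> nat \<Rightarrow> nat list \<Rightarrow> nat \<Rightarrow> bool" where
  "fan D w [] e \<longleftrightarrow> w = e"
| "fan D w (a # as) e \<longleftrightarrow> lreg D a = w \<and> fan D (rreg D a) as e"

definition dpt_ok :: "moy \<Rightarrow> nat \<Rightarrow> bool" where
  "dpt_ok D x \<longleftrightarrow>
     color D (sw D x) = color D (ne D x) \<and> color D (se D x) = color D (nw D x) \<and>
     lreg D (sw D x) = lreg D (nw D x) \<and> rreg D (sw D x) = lreg D (se D x) \<and>
     rreg D (nw D x) = lreg D (ne D x) \<and> rreg D (se D x) = rreg D (ne D x)"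

definition vert_ok :: "moy \<Rightarrow> nat \<Rightarrow> bool" where
  "vert_ok D v \<longleftrightarrow>
     sum_list (map (color D) (ins D v)) = sum_list (map (color D) (outs D v)) \<and>
     length (ins D v) + length (outs D v) \<noteq> 1 \<and>
     wreg D v \<in> regs D \<and>
     fan D (wreg D v) (ins D v) (ereg D v) \<and> fan D (wreg D v) (outs D v) (ereg D v)"

datatype cell = Arc nat | DPt nat | Vert nat | Rgn nat

definition graph_cells :: "moy \<Rightarrow> cell set" where
  "graph_cells D = Arc ` arcs D \<union> DPt ` dpts D \<union> Vert ` verts D"

definition graph_inc :: "moy \<Rightarrow> (cell \<times> cell) set" where
  "graph_inc D =
     {(Arc a, DPt x) |a x. x \<in> dpts D \<and> a \<in> {sw D x, se D x, nw D x, ne D x}} \<union>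
     {(Arc a, Vert v) |a v. v \<in> verts D \<and> a \<in> set (ins D v) \<union> set (outs D v)}"

definition reg_inc :: "moy \<Rightarrow> (cell \<times> cell) set" where
  "reg_inc D =
     {(Arc a, Rgn r) |a r. a \<in> arcs D \<and> r \<in> {lreg D a, rreg D a}} \<union>
     {(Vert v, Rgn (wreg D v)) |v. v \<in> verts D}"

definition linked :: "(cell \<times> cell) set \<Rightarrow> (cell \<times> cell) set" where
  "linked R = (R \<union> R\<inverse>)\<^sup>*"

text \<open>The connected components of the immersed graph.\<close>

definition components :: "moy \<Rightarrow> cell set set" where
  "components D = graph_cells D // linked (graph_inc D)"

text \<open>
  The following says that the data come from the plane.  The incidences between the connected
  components of the graph and the regions have to form a connected bipartite graph, and Euler's
  formula has to hold.  (Write \<open>B\<close> for the number of boundary cycles of all components.  Summing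
  the Euler characteristics of the surfaces with genus \<open>g\<close> that the components span gives
  \<open>V - E + B = 2 C - 2 g\<close>, a closed loop contributing \<open>0\<close> to \<open>V - E\<close>.  Euler's formula turns
  this into \<open>C + F = B + 1 + 2 g\<close>, whereas a connected bipartite graph with \<open>C + F\<close> nodes and at
  most \<open>B\<close> edges has \<open>C + F \<le> B + 1\<close>.  So both together mean that all components are spherical
  and that the components are nested in each other's regions in the manner of a tree.)
\<close>

definition planar :: "moy \<Rightarrow> bool" where
  "planar D \<longleftrightarrow>
     (\<forall>c \<in> graph_cells D \<union> Rgn ` regs D. \<forall>d \<in> graph_cells D \<union> Rgn ` regs D.
        (c, d) \<in> linked (graph_inc D \<union> reg_inc D)) \<and>
     int (card (dpts D) + card (verts D)) - int (card (open_arcs D)) + int (card (regs D))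
       = 1 + int (card (components D))"

definition moy_diagram :: "moy \<Rightarrow> bool" where
  "moy_diagram D \<longleftrightarrow>
     finite (arcs D) \<and> finite (dpts D) \<and> finite (verts D) \<and> finite (regs D) \<and>
     inj_on (in_arc D) (in_slots D) \<and> inj_on (out_arc D) (out_slots D) \<and>
     in_arc D ` in_slots D = out_arc D ` out_slots D \<and> open_arcs D \<subseteq> arcs D \<and>
     lreg D ` arcs D \<subseteq> regs D \<and> rreg D ` arcs D \<subseteq> regs D \<and> unbounded D \<in> regs D \<and>
     (\<forall>x \<in> dpts D. dpt_ok D x) \<and> (\<forall>v \<in> verts D. vert_ok D v) \<and>
     planar D \<and> (\<exists>a \<in> arcs D. color D a \<noteq> 0)"


section \<open>Isotopy and Reidemeister moves\<close>

text \<open>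
  Each move replaces what lies inside some disc.  \<open>inside\<close> collects the double points, arcs and
  regions that lie entirely in the disc; everything else is kept.
\<close>

record inside =
  idpts :: "nat set"
  iarcs :: "nat set"
  iregs :: "nat set"

definition nothing :: inside where
  "nothing = \<lparr>idpts = {}, iarcs = {}, iregs = {}\<rparr>"

text \<open>
  Outside the discs the diagrams \<open>D\<close> and \<open>D'\<close> are related by maps \<open>f\<close> (arcs), \<open>g\<close> (regions),
  \<open>h\<close> (double points) and \<open>k\<close> (vertices).  The maps \<open>f\<close> and \<open>g\<close> need not be injective: when double
  points are removed, arcs are joined and regions may run together.  What exactly is identified
  is prescribed separately by \<open>identifies\<close>.  The vertices in \<open>X\<close> are those that a move modifies.
\<close>

definition agree_outside ::
  "moy \<Rightarrow> inside \<Rightarrow> moy \<Rightarrow> inside \<Rightarrow> nat set \<Rightarrow>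
   (nat \<Rightarrow> nat) \<Rightarrow> (nat \<Rightarrow> nat) \<Rightarrow> (nat \<Rightarrow> nat) \<Rightarrow> (nat \<Rightarrow> nat) \<Rightarrow> bool" where
  "agree_outside D I D' I' X f g h k \<longleftrightarrow>
     bij_betw h (dpts D - idpts I) (dpts D' - idpts I') \<and>
     (\<forall>x \<in> dpts D - idpts I. positive D' (h x) = positive D x \<and>
        sw D' (h x) = f (sw D x) \<and> se D' (h x) = f (se D x) \<and>
        nw D' (h x) = f (nw D x) \<and> ne D' (h x) = f (ne D x)) \<and>
     bij_betw k (verts D) (verts D') \<and>
     (\<forall>v \<in> verts D - X. ins D' (k v) = map f (ins D v) \<and> outs D' (k v) = map f (outs D v) \<and>
        wreg D' (k v) = g (wreg D v) \<and> ereg D' (k v) = g (ereg D v)) \<and>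
     f ` (arcs D - iarcs I) = arcs D' - iarcs I' \<and>
     (\<forall>a \<in> arcs D - iarcs I. color D' (f a) = color D a \<and>
        lreg D' (f a) = g (lreg D a) \<and> rreg D' (f a) = g (rreg D a)) \<and>
     g ` (regs D - iregs I) = regs D' - iregs I' \<and>
     unbounded D' = g (unbounded D)"

definition identifies :: "(nat \<Rightarrow> nat) \<Rightarrow> nat set \<Rightarrow> (nat \<times> nat) set \<Rightarrow> bool" where
  "identifies f A P \<longleftrightarrow> (\<forall>a \<in> A. \<forall>b \<in> A. f a = f b \<longleftrightarrow> (a, b) \<in> (P \<union> P\<inverse>)\<^sup>*)"

text \<open>Isotopy of the plane.\<close>

definition isotopic :: "moy \<Rightarrow> moy \<Rightarrow> bool" where
  "isotopic D D' \<longleftrightarrow> (\<exists>f g h k. agree_outside D nothing D' nothing {} f g h k \<and>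
     identifies f (arcs D) {} \<and> identifies g (regs D) {})"

datatype side = L | R

fun side_reg :: "moy \<Rightarrow> side \<Rightarrow> nat \<Rightarrow> nat" where
  "side_reg D L a = lreg D a"
| "side_reg D R a = rreg D a"

text \<open>
  \<open>r\<close> is a bounded region whose boundary consists of the listed sides of arcs, and of no isolated
  vertex.  Where this is used below the sides form a single closed curve, and so \<open>r\<close> is a disc.
\<close>

definition bounded_by :: "moy \<Rightarrow> nat \<Rightarrow> (nat \<times> side) set \<Rightarrow> bool" where
  "bounded_by D r S \<longleftrightarrow>
     r \<in> regs D \<and> r \<noteq> unbounded D \<and> {(a, s). a \<in> arcs D \<and> side_reg D s a = r} = S \<and>
     (\<forall>v \<in> verts D. ins D v = [] \<and> outs D v = [] \<longrightarrow> wreg D v \<noteq> r)"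

text \<open>
  Move (I), \<open>D'\<close> being the diagram without the kink.  The kink at \<open>x\<close> consists of the arc \<open>l\<close>
  and encloses the region \<open>r\<close>; when it is removed the arcs \<open>a\<close> and \<open>b\<close> are joined.
\<close>

definition kink :: "moy \<Rightarrow> nat \<Rightarrow> nat \<Rightarrow> nat \<Rightarrow> nat \<Rightarrow> nat \<Rightarrow> bool" where
  "kink D x l r a b \<longleftrightarrow> x \<in> dpts D \<and>
     (ne D x = l \<and> se D x = l \<and> bounded_by D r {(l, R)} \<and> a = sw D x \<and> b = nw D x \<or>
      nw D x = l \<and> sw D x = l \<and> bounded_by D r {(l, L)} \<and> a = se D x \<and> b = ne D x)"

definition move1 :: "moy \<Rightarrow> moy \<Rightarrow> bool" where
  "move1 D D' \<longleftrightarrow> (\<exists>x l r a b f g h k.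
     kink D x l r a b \<and>
     agree_outside D \<lparr>idpts = {x}, iarcs = {l}, iregs = {r}\<rparr> D' nothing {} f g h k \<and>
     identifies f (arcs D - {l}) {(a, b)} \<and> identifies g (regs D - {r}) {})"

text \<open>
  Move (II), \<open>D'\<close> being the diagram with two double points less.  The bigon \<open>r\<close> has the corners
  \<open>x\<close> and \<open>y\<close>, and its sides are the arcs \<open>p\<close> and \<open>q\<close>.  The opposite signs of \<open>x\<close> and \<open>y\<close> say that
  the same strand is the upper one at both.  When the two strands are pulled apart, the arcs \<open>a\<close>,
  \<open>a'\<close> and the arcs \<open>b\<close>, \<open>b'\<close> are joined and the regions \<open>u\<close>, \<open>u'\<close> opposite to \<open>r\<close> at \<open>x\<close> and
  \<open>y\<close> run together.  In the first case the strands are parallel; in the others they are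
  antiparallel with the bigon to the right, respectively to the left, of both.
\<close>

definition bigon :: "moy \<Rightarrow> nat \<Rightarrow> nat \<Rightarrow> nat \<Rightarrow> nat \<Rightarrow> nat \<Rightarrow> nat \<times> nat \<Rightarrow> nat \<times> nat \<Rightarrow> nat \<times> nat \<Rightarrow> bool" where
  "bigon D x y p q r aa' bb' uu' \<longleftrightarrow>
     x \<in> dpts D \<and> y \<in> dpts D \<and> x \<noteq> y \<and> positive D x \<noteq> positive D y \<and>
     (nw D x = p \<and> sw D y = p \<and> ne D x = q \<and> se D y = q \<and> bounded_by D r {(p, R), (q, L)} \<and>
        aa' = (sw D x, nw D y) \<and> bb' = (se D x, ne D y) \<and>
        uu' = (rreg D (sw D x), rreg D (nw D y)) \<or>
      ne D x = p \<and> se D y = p \<and> se D x = q \<and> ne D y = q \<and> bounded_by D r {(p, R), (q, R)} \<and>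
        aa' = (sw D x, nw D y) \<and> bb' = (sw D y, nw D x) \<and>
        uu' = (lreg D (sw D x), lreg D (sw D y)) \<or>
      nw D x = p \<and> sw D y = p \<and> sw D x = q \<and> nw D y = q \<and> bounded_by D r {(p, L), (q, L)} \<and>
        aa' = (se D x, ne D y) \<and> bb' = (se D y, ne D x) \<and>
        uu' = (rreg D (se D x), rreg D (se D y)))"

definition move2 :: "moy \<Rightarrow> moy \<Rightarrow> bool" where
  "move2 D D' \<longleftrightarrow> (\<exists>x y p q r aa' bb' uu' f g h k.
     bigon D x y p q r aa' bb' uu' \<and>
     agree_outside D \<lparr>idpts = {x, y}, iarcs = {p, q}, iregs = {r}\<rparr> D' nothing {} f g h k \<and>
     identifies f (arcs D - {p, q}) {aa', bb'} \<and> identifies g (regs D - {r}) {uu'})"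

text \<open>
  Move (III).  The strands are numbered from top to bottom.  Strand \<open>i\<close> enters through the arc
  \<open>a\<^sub>i\<close>, has its side \<open>m\<^sub>i\<close> of the triangle between its two double points, and leaves through
  \<open>b\<^sub>i\<close>.  The double point of strands \<open>i < j\<close> is called \<open>xij\<close>, and \<open>lij\<close> tells whether strand \<open>i\<close>
  runs from bottom left to top right there (so that, being the upper one, it makes \<open>xij\<close>
  positive).  \<open>o1\<close>, \<open>o2\<close>, \<open>o3\<close> give the order in which the strands meet their two double points.
  The move turns around these three orders and keeps the rest.
\<close>

definition passes :: "moy \<Rightarrow> nat \<Rightarrow> bool \<Rightarrow> nat \<Rightarrow> nat \<Rightarrow> bool" where
  "passes D x l a b \<longleftrightarrow> (if l then sw D x = a \<and> ne D x = b else se D x = a \<and> nw D x = b)"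

definition passes2 ::
  "moy \<Rightarrow> bool \<Rightarrow> nat \<Rightarrow> bool \<Rightarrow> nat \<Rightarrow> bool \<Rightarrow> nat \<Rightarrow> nat \<Rightarrow> nat \<Rightarrow> bool" where
  "passes2 D fwd x l y l' a m b \<longleftrightarrow>
     (if fwd then passes D x l a m \<and> passes D y l' m b
      else passes D y l' a m \<and> passes D x l m b)"

fun triangle ::
  "moy \<Rightarrow> nat \<times> nat \<times> nat \<Rightarrow> bool \<times> bool \<times> bool \<Rightarrow> bool \<times> bool \<times> bool \<Rightarrow>
   nat \<times> nat \<times> nat \<Rightarrow> nat \<times> nat \<times> nat \<Rightarrow> nat \<times> nat \<times> nat \<Rightarrow> nat \<Rightarrow> bool" where
  "triangle D (x12, x13, x23) (l12, l13, l23) (o1, o2, o3) (a1, a2, a3) (m1, m2, m3) (b1, b2, b3) r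
   \<longleftrightarrow>
     x12 \<in> dpts D \<and> x13 \<in> dpts D \<and> x23 \<in> dpts D \<and> distinct [x12, x13, x23] \<and>
     positive D x12 = l12 \<and> positive D x13 = l13 \<and> positive D x23 = l23 \<and>
     passes2 D o1 x12 l12 x13 l13 a1 m1 b1 \<and>
     passes2 D o2 x12 (\<not> l12) x23 l23 a2 m2 b2 \<and>
     passes2 D o3 x13 (\<not> l13) x23 (\<not> l23) a3 m3 b3 \<and>
     (\<exists>s1 s2 s3. bounded_by D r {(m1, s1), (m2, s2), (m3, s3)})"

definition move3 :: "moy \<Rightarrow> moy \<Rightarrow> bool" where
  "move3 D D' \<longleftrightarrow> (\<exists>x12 x13 x23 y12 y13 y23 ls o1 o2 o3 a1 a2 a3 b1 b2 b3
       m1 m2 m3 n1 n2 n3 r r' f g h k.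
     triangle D (x12, x13, x23) ls (o1, o2, o3) (a1, a2, a3) (m1, m2, m3) (b1, b2, b3) r \<and>
     triangle D' (y12, y13, y23) ls (\<not> o1, \<not> o2, \<not> o3)
       (f a1, f a2, f a3) (n1, n2, n3) (f b1, f b2, f b3) r' \<and>
     agree_outside D \<lparr>idpts = {x12, x13, x23}, iarcs = {m1, m2, m3}, iregs = {r}\<rparr>
       D' \<lparr>idpts = {y12, y13, y23}, iarcs = {n1, n2, n3}, iregs = {r'}\<rparr> {} f g h k \<and>
     identifies f (arcs D - {m1, m2, m3}) {} \<and> identifies g (regs D - {r}) {})"

text \<open>
  Move (IV).  \<open>across D v up lr over xs ss es\<close>: a strand crosses, next to \<open>v\<close>, all edges that
  leave \<open>v\<close> (if \<open>up\<close>) or all edges that enter \<open>v\<close> (otherwise); it runs from left to right iff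
  \<open>lr\<close>, and is the upper strand everywhere if \<open>over\<close>, the lower one everywhere otherwise.  The
  double points are \<open>xs\<close>, the pieces of the strand are \<open>ss\<close>, both listed from left to right.  The
  arcs between \<open>v\<close> and \<open>xs\<close> are the \<open>beams\<close> on that side, and \<open>es\<close> are their continuations beyond
  the strand.  The beams cut the space between \<open>v\<close> and the strand into triangles.  The last two
  equations follow from the others unless there are no beams.
\<close>

definition beams :: "moy \<Rightarrow> bool \<Rightarrow> nat \<Rightarrow> nat list" where
  "beams D up v = (if up then outs D v else ins D v)"

definition toward :: "bool \<Rightarrow> bool \<Rightarrow> side" where
  "toward up lr = (if up = lr then R else L)"

definition away :: "bool \<Rightarrow> bool \<Rightarrow> side" where
  "away up lr = (if up = lr then L else R)"

definition crosses_beam ::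
  "moy \<Rightarrow> bool \<Rightarrow> bool \<Rightarrow> nat \<Rightarrow> nat \<Rightarrow> nat \<Rightarrow> nat \<Rightarrow> nat \<Rightarrow> bool" where
  "crosses_beam D up lr x west east b e \<longleftrightarrow>
     (let low = (if up then b else e); high = (if up then e else b)
      in if lr then sw D x = west \<and> ne D x = east \<and> se D x = low \<and> nw D x = high
         else se D x = east \<and> nw D x = west \<and> sw D x = low \<and> ne D x = high)"

definition across ::
  "moy \<Rightarrow> nat \<Rightarrow> bool \<Rightarrow> bool \<Rightarrow> bool \<Rightarrow> nat list \<Rightarrow> nat list \<Rightarrow> nat list \<Rightarrow> bool" where
  "across D v up lr over xs ss es \<longleftrightarrow>
     v \<in> verts D \<and> distinct xs \<and> set xs \<subseteq> dpts D \<and> set ss \<subseteq> arcs D \<and>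
     length ss = Suc (length xs) \<and> length es = length xs \<and> length (beams D up v) = length xs \<and>
     (\<forall>j < length xs. (positive D (xs ! j) \<longleftrightarrow> over = lr) \<and>
        crosses_beam D up lr (xs ! j) (ss ! j) (ss ! Suc j) (beams D up v ! j) (es ! j)) \<and>
     (\<forall>j. Suc j < length xs \<longrightarrow> bounded_by D (rreg D (beams D up v ! j))
        {(beams D up v ! j, R), (beams D up v ! Suc j, L), (ss ! Suc j, toward up lr)}) \<and>
     side_reg D (toward up lr) (hd ss) = wreg D v \<and>
     side_reg D (toward up lr) (last ss) = ereg D v"

definition inside_across :: "moy \<Rightarrow> nat \<Rightarrow> bool \<Rightarrow> nat list \<Rightarrow> nat list \<Rightarrow> inside" where
  "inside_across D v up xs ss =
     \<lparr>idpts = set xs,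
      iarcs = set (beams D up v) \<union> set (butlast (tl ss)),
      iregs = {rreg D (beams D up v ! j) |j. Suc j < length xs}\<rparr>"

text \<open>
  The strand is moved across \<open>v\<close> from the side given by \<open>up\<close> to the other side.  If \<open>v\<close> has no
  edges on the other side, the strand becomes a single arc and the regions beyond it, on its left
  and right ends, run together.  The case that \<open>v\<close> has edges on the other side only is obtained
  by exchanging \<open>D\<close> and \<open>D'\<close>.
\<close>

definition move4 :: "moy \<Rightarrow> moy \<Rightarrow> bool" where
  "move4 D D' \<longleftrightarrow> (\<exists>v up lr over xs ss es xs' ss' es' f g h k.
     across D v up lr over xs ss es \<and> across D' (k v) (\<not> up) lr over xs' ss' es' \<and>
     (xs = [] \<longrightarrow> xs' = []) \<and>
     agree_outside D (inside_across D v up xs ss)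
       D' (inside_across D' (k v) (\<not> up) xs' ss') {v} f g h k \<and>
     beams D' up (k v) = map f es \<and> es' = map f (beams D (\<not> up) v) \<and>
     hd ss' = f (hd ss) \<and> last ss' = f (last ss) \<and>
     identifies f (arcs D - iarcs (inside_across D v up xs ss))
       (if xs' = [] then {(hd ss, last ss)} else {}) \<and>
     identifies g (regs D - iregs (inside_across D v up xs ss))
       (if xs' = []
        then {(side_reg D (away up lr) (hd ss), side_reg D (away up lr) (last ss))} else {}))"

text \<open>
  Move (V), \<open>D'\<close> being the diagram without the double point \<open>x\<close>.  The arcs \<open>p\<close> and \<open>q\<close> join \<open>x\<close>
  to \<open>v\<close> and enclose the region \<open>r\<close>.
\<close>

definition move5 :: "moy \<Rightarrow> moy \<Rightarrow> bool" where
  "move5 D D' \<longleftrightarrow> (\<exists>x v p q r as bs f g h k.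
     x \<in> dpts D \<and> v \<in> verts D \<and> bounded_by D r {(p, R), (q, L)} \<and>
     (nw D x = p \<and> ne D x = q \<and> ins D v = as @ [p, q] @ bs \<and>
        ins D' (k v) = map f (as @ [sw D x, se D x] @ bs) \<and>
        outs D' (k v) = map f (outs D v) \<or>
      sw D x = p \<and> se D x = q \<and> outs D v = as @ [p, q] @ bs \<and>
        outs D' (k v) = map f (as @ [nw D x, ne D x] @ bs) \<and>
        ins D' (k v) = map f (ins D v)) \<and>
     agree_outside D \<lparr>idpts = {x}, iarcs = {p, q}, iregs = {r}\<rparr> D' nothing {v} f g h k \<and>
     identifies f (arcs D - {p, q}) {} \<and> identifies g (regs D - {r}) {})"

definition moy_move :: "moy \<Rightarrow> moy \<Rightarrow> bool" where
  "moy_move D D' \<longleftrightarrow> moy_diagram D \<and> moy_diagram D' \<and>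
     (isotopic D D' \<or> move1 D D' \<or> move2 D D' \<or> move3 D D' \<or> move4 D D' \<or> move5 D D')"

text \<open>An MOY graph is an equivalence class of diagrams.\<close>

definition moy_equiv :: "(moy \<times> moy) set" where
  "moy_equiv = {(D, D'). moy_diagram D \<and> moy_diagram D' \<and> equivclp moy_move D D'}"

definition moy_graphs :: "moy set set" where
  "moy_graphs = {D. moy_diagram D} // moy_equiv"


section \<open>The Kauffman state sum\<close>

text \<open>
  Values are rational functions in \<open>t\<^sup>1\<^sup>/\<^sup>2\<close>, so that \<open>t\<^sup>k\<close> is \<open>thalf powi (2 * k)\<close>.
\<close>

definition thalf :: "int poly fract" where
  "thalf = Fract [:0, 1:] 1"

text \<open>
  \<open>Circ v j\<close> is the point where the \<open>j\<close>-th edge entering \<open>v\<close> meets the circle around \<open>v\<close>.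
  Removing the vertex discs does not change the set of regular regions.
\<close>

datatype crossing = Dbl nat | Circ nat nat

datatype corner = North | South | East | West

datatype region = Regular nat | Disc nat

definition Cr :: "moy \<Rightarrow> crossing set" where
  "Cr D = Dbl ` dpts D \<union> {Circ v j |v j. v \<in> verts D \<and> j < length (ins D v)}"

definition Re :: "moy \<Rightarrow> region set" where
  "Re D = Regular ` regs D \<union> Disc ` verts D"

fun corners :: "crossing \<Rightarrow> corner set" where
  "corners (Dbl x) = {North, South, East, West}"
| "corners (Circ v j) = {North, West, East}"

fun corner_region :: "moy \<Rightarrow> crossing \<Rightarrow> corner \<Rightarrow> region" where
  "corner_region D (Dbl x) North = Regular (rreg D (nw D x))"
| "corner_region D (Dbl x) South = Regular (rreg D (sw D x))"
| "corner_region D (Dbl x) East = Regular (rreg D (se D x))"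
| "corner_region D (Dbl x) West = Regular (lreg D (sw D x))"
| "corner_region D (Circ v j) North = Disc v"
| "corner_region D (Circ v j) West = Regular (lreg D (ins D v ! j))"
| "corner_region D (Circ v j) East = Regular (rreg D (ins D v ! j))"
| "corner_region D (Circ v j) South = undefined"

fun weight_M :: "crossing \<Rightarrow> corner \<Rightarrow> int poly fract" where
  "weight_M (Dbl x) c = (if c = North then - 1 else 1)"
| "weight_M (Circ v j) c = 1"

definition over_color :: "moy \<Rightarrow> nat \<Rightarrow> int" where
  "over_color D x = int (color D (if positive D x then sw D x else se D x))"

fun weight_A :: "moy \<Rightarrow> crossing \<Rightarrow> corner \<Rightarrow> int poly fract" where
  "weight_A D (Dbl x) c =
     (if positive D x
      then (if c \<in> {North, West} then thalf powi (- 2 * over_color D x) else 1)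
      else (if c \<in> {North, East} then thalf powi (2 * over_color D x) else 1))"
| "weight_A D (Circ v j) c =
     (let i = int (color D (ins D v ! j)) in
      case c of North \<Rightarrow> thalf powi (- i) - thalf powi i
              | West \<Rightarrow> thalf powi (- i)
              | East \<Rightarrow> thalf powi i
              | South \<Rightarrow> 0)"

text \<open>The base point \<open>\<delta>\<close> is given by the arc on which it lies.\<close>

definition base_point :: "moy \<Rightarrow> nat \<Rightarrow> bool" where
  "base_point D \<delta> \<longleftrightarrow> \<delta> \<in> arcs D \<and> color D \<delta> \<noteq> 0"

definition states :: "moy \<Rightarrow> nat \<Rightarrow> (crossing \<Rightarrow> corner) set" where
  "states D \<delta> = {s \<in> (\<Pi>\<^sub>E C \<in> Cr D. corners C).
     bij_betw (\<lambda>C. corner_region D C (s C)) (Cr D)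
       (Re D - {Regular (lreg D \<delta>), Regular (rreg D \<delta>)})}"

definition state_M :: "moy \<Rightarrow> (crossing \<Rightarrow> corner) \<Rightarrow> int poly fract" where
  "state_M D s = (\<Prod>C \<in> Cr D. weight_M C (s C))"

definition state_A :: "moy \<Rightarrow> (crossing \<Rightarrow> corner) \<Rightarrow> int poly fract" where
  "state_A D s = (\<Prod>C \<in> Cr D. weight_A D C (s C))"

text \<open>
  For a diagram, the conditions have exactly one solution on the regions; the values of the
  function elsewhere play no role.
\<close>

definition region_index :: "moy \<Rightarrow> nat \<Rightarrow> int" where
  "region_index D = (SOME ind. ind (unbounded D) = 0 \<and>
     (\<forall>a \<in> arcs D. ind (lreg D a) - ind (rreg D a) = int (color D a)))"

definition base_value :: "moy \<Rightarrow> nat \<Rightarrow> int poly fract" where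
  "base_value D \<delta> =
     (let n = region_index D (lreg D \<delta>); i = int (color D \<delta>)
      in thalf powi (2 * (n - i)) - thalf powi (2 * n))"

definition bracket :: "moy \<Rightarrow> nat \<Rightarrow> int poly fract" where
  "bracket D \<delta> = inverse (base_value D \<delta>) * (\<Sum>s \<in> states D \<delta>. state_M D s * state_A D s)"

definition alexander :: "moy \<Rightarrow> nat \<Rightarrow> int poly fract" where
  "alexander D \<delta> =
     bracket D \<delta> / (thalf powi (- 1) - thalf) powi (int (card (verts D)) - 1)"

text \<open>
  The Alexander polynomial of an MOY graph, which is defined up to multiplication by powers of
  \<open>t\<close>, as the set of all its representatives, arising from all diagrams and all base points.
\<close>

definition Alexander :: "moy set \<Rightarrow> int poly fract set" where
  "Alexander G = {thalf powi (2 * k) * alexander D \<delta> |k D \<delta>. D \<in> G \<and> base_point D \<delta>}"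

text \<open>The Laurent polynomials in \<open>t\<^sup>1\<^sup>/\<^sup>2\<close> with non-negative integer coefficients.\<close>

definition nonneg_laurent :: "int poly fract set" where
  "nonneg_laurent = {\<Sum>k \<in> K. of_nat (c k) * thalf powi k |(K :: int set) (c :: int \<Rightarrow> nat). finite K}"

end

theory Submission
  imports Defs "HOL-Combinatorics.Permutations" "HOL-Combinatorics.Cycles" "Jordan_Normal_Form.Determinant"
begin

text \<open>
 For a diagram without double points positivity can be read off term by term. A base point
 lies on an edge that enters some vertex, and a state has to choose the corner N there; the weight
 of this corner cancels against the value of the base point. Every other vertex disc is covered by
 exactly one corner N, whose weight is \<open>t\<^sup>-\<^sup>1\<^sup>/\<^sup>2 - t\<^sup>1\<^sup>/\<^sup>2\<close> times a quantum integer, and these factors cancel against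
 the denominator. All remaining weights are powers of \<open>t\<^sup>1\<^sup>/\<^sup>2\<close> (\<open>plane_nonneg\<close>).

 What takes work is to carry this over to all diagrams of the same graph and to all base points.
 A state sum is a signless permanent; two ideas make it manageable.

 \<^item> The state sum is a determinant. The corners carry signs for which all states contribute
 with the same sign (\<open>coherence\<close>). Two states that differ
 form closed curves through the crossings concerned, and Euler's formula counts what lies inside. The rows of the
 signed matrix annihilate the constant vector and the vector of the powers \<open>t\<^sup>i\<^sup>n\<^sup>d\<close>, and so its maximal minors
 are proportional: the bracket does not depend on the base point (\<open>bracket_base_independent\<close>).

 \<^item> The state sum is a coefficient of a product of linear forms, one for each crossing, in
 variables with square zero, one for each region (\<open>state_total_zcoef\<close>). A move changes the factors inside a
 disc only. It suffices that the coefficients, inside, of the variables of the inner regions agree up to a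
 monomial (\<open>total_transfer\<close>). For base points outside the disc this gives invariance under every
 move, and the base point can be chosen outside by the first idea.
\<close>

section \<open>Components of multigraphs\<close>

definition joined :: "('e => 'v) => ('e => 'v) => 'e set => ('v \<times> 'v) set" where
 "joined s t E = ((%e. (s e, t e)) ` E Un (%e. (t e, s e)) ` E)\<^sup>*"

definition ncomp :: "('e => 'v) => ('e => 'v) => 'v set => 'e set => nat" where
 "ncomp s t V E = card ((%v. joined s t E `` {v}) ` V)"

lemma joined_refl [simp]: "(v, v) : joined s t E" by (simp add: joined_def)

lemma joined_trans: "(u, v) : joined s t E ==> (v, w) : joined s t E ==> (u, w) : joined s t E" unfolding joined_def by (rule rtrancl_trans)

lemma joined_sym: "(u, v) : joined s t E ==> (v, u) : joined s t E"
proof -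
 have "sym ((%e. (s e, t e)) ` E Un (%e. (t e, s e)) ` E)" by (auto simp: sym_def)
 thus "(u, v) : joined s t E ==> (v, u) : joined s t E" unfolding joined_def by (meson sym_rtrancl symD)
qed

lemma joined_edge: "e : E ==> (s e, t e) : joined s t E" unfolding joined_def by (rule r_into_rtrancl) auto

lemma joined_mono: "E \<subseteq> E' ==> joined s t E \<subseteq> joined s t E'" unfolding joined_def by (rule rtrancl_mono) auto

lemma joined_induct [consumes 1, case_names base step]:
 assumes "(u, v) : joined s t E"
  and "P u"
  and "!!e x y. (u, x) : joined s t E ==> P x ==> e : E ==> {x, y} = {s e, t e} ==> P y"
 shows "P v" using assms(1)[unfolded joined_def]
proof (induction rule: rtrancl_induct)
 case base
 show ?case by (rule assms(2))
next
 case (step y z)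
 thus ?case using assms(3)[of y _ z] unfolding joined_def by auto
qed

lemma joined_invariant:
 assumes "(u, v) : joined s t E" and "!!e. e : E ==> s e : X \<longleftrightarrow> t e : X"
 shows "u : X \<longleftrightarrow> v : X"
proof -
 have "(u : X) = (v : X)" using assms(1)
 proof (induction rule: joined_induct)
  case (step e x y)
  thus ?case using assms(2)[of e] by (auto simp: doubleton_eq_iff)
 qed simp
 thus ?thesis .
qed

lemma joined_class_eq:
 "joined s t E `` {u} = joined s t E `` {v} \<longleftrightarrow> (u, v) : joined s t E"
proof
 assume "joined s t E `` {u} = joined s t E `` {v}"
 moreover have "v : joined s t E `` {v}" by simp
 ultimately show "(u, v) : joined s t E" by (metis Image_singleton_iff)
next
 assume "(u, v) : joined s t E"
 thus "joined s t E `` {u} = joined s t E `` {v}" by (auto intro: joined_trans joined_sym)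
qed

lemma joined_empty [simp]: "joined s t {} = Id" by (simp add: joined_def)

lemma ncomp_empty: "ncomp s t V {} = card V"
proof -
 have "(%v. Id `` {v}) ` V = (%v. {v}) ` V" by auto
 thus ?thesis by (simp add: ncomp_def card_image)
qed

lemma joined_insert:
 "(u, v) : joined s t (insert e E) \<longleftrightarrow>
  (u, v) : joined s t E \<or> (u, s e) : joined s t E & (t e, v) : joined s t E \<or>
  (u, t e) : joined s t E & (s e, v) : joined s t E" (is "?Ls \<longleftrightarrow> ?Rs v")
proof
 assume ?Ls
 thus "?Rs v"
 proof (induction rule: joined_induct)
  case (step f x y)
  show ?case
 proof (cases "f = e")
  case True
  thus ?thesis using step by (auto simp: doubleton_eq_iff intro: joined_trans joined_sym)
 next
  case False
  hence "(x, y) : joined s t E" using step joined_edge[of f E s t] joined_sym by (fastforce simp: doubleton_eq_iff)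
  thus ?thesis using step by (meson joined_trans)
 qed
 qed simp
next
 have J: "joined s t E \<subseteq> joined s t (insert e E)" by (rule joined_mono) auto
 have "(s e, t e) : joined s t (insert e E)" by (rule joined_edge) simp
 thus "?Rs v ==> ?Ls" using J by (meson joined_trans joined_sym subsetD)
qed

lemma ncomp_insert_joined:
 assumes "(s e, t e) : joined s t E"
 shows "ncomp s t V (insert e E) = ncomp s t V E"
proof -
 have "(u, v) : joined s t E" if "(u, v) : joined s t (insert e E)" for u v
 using that assms unfolding joined_insert by (meson joined_sym joined_trans)
 moreover have "joined s t E \<subseteq> joined s t (insert e E)" by (rule joined_mono) blast
 ultimately have "joined s t (insert e E) = joined s t E" by auto
 thus ?thesis by (simp add: ncomp_def)
qed

lemma ncomp_insert_separate:
 assumes fin: "finite V" and e: "s e : V" "t e : V" and sep: "(s e, t e) ~: joined s t E"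
 shows "ncomp s t V E = Suc (ncomp s t V (insert e E))"
proof -
 define c where "c v = joined s t E `` {v}" for v
 define c' where "c' v = joined s t (insert e E) `` {v}" for v
 have c: "c u = c v \<longleftrightarrow> (u, v) : joined s t E" for u v unfolding c_def by (rule joined_class_eq)
 have new: "c' v = (if c v = c (s e) \<or> c v = c (t e) then c (s e) Un c (t e) else c v)" for v
 proof -
  have J: "(v, x) : joined s t (insert e E) \<longleftrightarrow> x : c v \<or> s e : c v & x : c (t e) \<or> t e : c v & x : c (s e)" for x
 by (simp add: joined_insert c_def)
  have m: "x : c y \<longleftrightarrow> c y = c x" for x y unfolding c by (simp add: c_def)
  show ?thesis
 proof -
  have "c' v = {x. x : c v \<or> s e : c v & x : c (t e) \<or> t e : c v & x : c (s e)}" by (simp add: c'_def Image_singleton J)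
  also have "... = (if c v = c (s e) \<or> c v = c (t e) then c (s e) Un c (t e) else c v)" unfolding m[of "s e" v] m[of "t e" v] by auto
  finally show ?thesis .
 qed
 qed
 have notin: "c (s e) Un c (t e) ~: c ` V"
 proof
  assume "c (s e) Un c (t e) : c ` V"
  then obtain v where v: "c v = c (s e) Un c (t e)" by auto
  have "s e : c v" "t e : c v" unfolding v by (auto simp: c_def)
  hence "(v, s e) : joined s t E" "(v, t e) : joined s t E" by (auto simp: c_def)
  with sep show False by (meson joined_sym joined_trans)
 qed
 have "c' ` V = insert (c (s e) Un c (t e)) (c ` V - {c (s e), c (t e)})" using e by (auto simp: new image_iff)
 hence "card (c' ` V) = Suc (card (c ` V - {c (s e), c (t e)}))" using notin fin by simp
 also have "card (c ` V - {c (s e), c (t e)}) = card (c ` V) - 2" using e sep fin by (subst card_Diff_subset) (auto simp: c card_insert_if)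
 also have "card (c ` V) >= 2"
 proof -
  have "card {c (s e), c (t e)} <= card (c ` V)" using e fin by (intro card_mono) auto
  thus ?thesis using sep by (simp add: c)
 qed
 ultimately show ?thesis unfolding ncomp_def c_def c'_def by simp
qed

lemma ncomp_eq_1_iff:
 assumes "V ~= {}"
 shows "ncomp s t V E = 1 \<longleftrightarrow> (ALL u:V. ALL v:V. (u, v) : joined s t E)"
proof
 assume "ncomp s t V E = 1"
 then obtain X where X: "(%v. joined s t E `` {v}) ` V = {X}" unfolding ncomp_def by (metis card_1_singletonE)
 show "ALL u:V. ALL v:V. (u, v) : joined s t E"
 proof (intro ballI)
  fix u v assume "u : V" "v : V"
  hence "joined s t E `` {u} : {X}" "joined s t E `` {v} : {X}" unfolding X[symmetric] by simp_all
  hence "joined s t E `` {u} = X" "joined s t E `` {v} = X" by simp_all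
  thus "(u, v) : joined s t E" by (metis joined_class_eq)
 qed
next
 assume *: "ALL u:V. ALL v:V. (u, v) : joined s t E"
 obtain v where "v : V" using assms by auto
 hence "(%v. joined s t E `` {v}) ` V = {joined s t E `` {v}}" (is "?c ` V = _")
 proof -
  assume v: "v : V"
  have "?c u = ?c v" if "u : V" for u using * that v by (simp add: joined_class_eq)
  hence "?c ` V = (%_. ?c v) ` V" by (intro image_cong) auto
  thus ?thesis using v by auto
 qed
 thus "ncomp s t V E = 1" by (simp add: ncomp_def)
qed

text \<open>One big component and isolated nodes.\<close>

lemma ncomp_one_big:
 assumes fin: "finite V" and "X \<subseteq> V" "X ~= {}"
  and E: "!!e. e : E ==> s e : X & t e : X"
  and J: "!!u v. u : X ==> v : X ==> (u, v) : joined s t E"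
 shows "ncomp s t V E + card X = Suc (card V)"
proof -
 have cl: "joined s t E `` {v} = (if v : X then X else {v})" for v
 proof (cases "v : X")
  case True
  have "w : X" if "(v, w) : joined s t E" for w using joined_invariant[OF that, of X] E True by blast
  thus ?thesis using True J by auto
 next
  case False
  have "w = v" if "(v, w) : joined s t E" for w
 proof -
  have "v : {v} \<longleftrightarrow> w : {v}"
 proof (rule joined_invariant[OF that])
  fix e assume "e : E"
  hence "s e ~= v & t e ~= v" using E[of e] False by auto
  thus "(s e : {v}) = (t e : {v})" by auto
 qed
  thus ?thesis by simp
 qed
  thus ?thesis using False by auto
 qed
 have "(%v. joined s t E `` {v}) ` V = insert X ((%v. {v}) ` (V - X))" using assms(2,3) by (auto simp: cl image_iff)
 moreover have "X ~: (%v. {v}) ` (V - X)" by auto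
 ultimately have "ncomp s t V E = Suc (card (V - X))" using fin by (simp add: ncomp_def card_image)
 also have "card (V - X) + card X = card V" using assms(1,2) by (metis card_Diff_subset card_mono finite_subset le_add_diff_inverse2)
 ultimately show ?thesis by simp
qed

section \<open>Dual graphs on the sphere\<close>

locale dual_graphs =
 fixes P :: "'p set" and A :: "'a set" and F :: "'f set"
  and tail head :: "'a => 'p" and lf rf :: "'a => 'f"
 assumes fin: "finite P" "finite A" "finite F"
  and ends: "a : A ==> tail a : P" "a : A ==> head a : P"
  and sides: "a : A ==> lf a : F" "a : A ==> rf a : F"
  and orth: "p : P ==> f : F ==>
  (SUM a:A. (of_bool (head a = p) - of_bool (tail a = p)) *
  (of_bool (lf a = f) - of_bool (rf a = f)) :: int) = 0"
  and around: "p : P ==> a : A ==> b : A ==> p : {tail a, head a} ==> p : {tail b, head b} ==>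
  (lf a, lf b) : joined lf rf {c : A. p : {tail c, head c}}"
  and P_connected: "p : P ==> q : P ==> (p, q) : joined tail head A"
  and F_touched: "f : F ==> EX a:A. f : {lf a, rf a}"
  and nonempty: "A ~= {}"
  and euler: "card P + card F = card A + 2"
begin

lemma orth_sets:
 assumes "I \<subseteq> P" "Y \<subseteq> F"
 shows "(SUM a:A. (of_bool (head a : I) - of_bool (tail a : I)) *
  (of_bool (lf a : Y) - of_bool (rf a : Y)) :: int) = 0"
proof -
 have fI: "finite I" and fY: "finite Y" using assms fin finite_subset by blast+
 have 1: "of_bool (x : I) = (SUM p:I. of_bool (x = p) :: int)" for x using fI by (simp add: sum.delta of_bool_def)
 have 2: "of_bool (x : Y) = (SUM p:Y. of_bool (x = p) :: int)" for x using fY by (simp add: sum.delta of_bool_def)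
 have "(SUM a:A. (of_bool (head a : I) - of_bool (tail a : I)) *
  (of_bool (lf a : Y) - of_bool (rf a : Y)) :: int) =
  (SUM a:A. SUM p:I. SUM f:Y. (of_bool (head a = p) - of_bool (tail a = p)) *
  (of_bool (lf a = f) - of_bool (rf a = f)))" unfolding 1 2 sum_subtractf[symmetric] sum_product ..
 also have "... = (SUM p:I. SUM f:Y. SUM a:A. (of_bool (head a = p) - of_bool (tail a = p)) *
  (of_bool (lf a = f) - of_bool (rf a = f)))" by (subst sum.swap, rule sum.cong[OF refl], subst sum.swap, rule refl)
 also have "... = 0" by (intro sum.neutral ballI orth) (use assms in auto)
 finally show ?thesis .
qed

abbreviation "cP S \<equiv> ncomp tail head P S"
abbreviation "cF S \<equiv> ncomp lf rf F S"

lemma F_connected: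
 assumes "f : F" "g : F"
 shows "(f, g) : joined lf rf A"
proof -
 have at: "(lf a, lf b) : joined lf rf A"
  if "p : P" "a : A" "b : A" "p : {tail a, head a}" "p : {tail b, head b}" for p a b
 using around[OF that] joined_mono[of "{c : A. p : {tail c, head c}}" A lf rf] by blast
 have path: "ALL a:A. ALL b:A. p : {tail a, head a} --> q : {tail b, head b} --> (lf a, lf b) : joined lf rf A"
  if "(p, q) : joined tail head A" "p : P" for p q using that
 proof (induction rule: joined_induct)
  case base
  thus ?case using at by blast
 next
  case (step e x y)
  show ?case
 proof (intro ballI impI)
  fix a b assume a: "a : A" "p : {tail a, head a}" and b: "b : A" "y : {tail b, head b}"
  have "x : {tail e, head e}" "y : {tail e, head e}" using step.hyps by blast+
  hence "(lf a, lf e) : joined lf rf A" "(lf e, lf b) : joined lf rf A" using step a b at[of y e b] ends by blast+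
  thus "(lf a, lf b) : joined lf rf A" by (rule joined_trans)
 qed
 qed
 have side: "(f, lf a) : joined lf rf A" if "a : A" "f : {lf a, rf a}" for f a using that joined_edge[of a A lf rf] by (auto intro: joined_sym)
 obtain a b where ab: "a : A" "f : {lf a, rf a}" "b : A" "g : {lf b, rf b}" using F_touched assms by meson
 have "(lf a, lf b) : joined lf rf A" using path[OF P_connected[OF ends(1)[OF ab(1)] ends(1)[OF ab(3)]]] ab ends by blast
 thus ?thesis using side[OF ab(1,2)] side[OF ab(3,4)] by (meson joined_sym joined_trans)
qed

lemma cP_A: "cP A = 1"
proof -
 have "P ~= {}" using ends nonempty by blast
 thus ?thesis unfolding ncomp_eq_1_iff[OF \<open>P ~= {}\<close>] using P_connected by blast
qed

lemma cF_A: "cF A = 1"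
proof -
 have "F ~= {}" using sides nonempty by blast
 thus ?thesis unfolding ncomp_eq_1_iff[OF \<open>F ~= {}\<close>] using F_connected by blast
qed

lemma cut_not_bridge:
 assumes "a : A" "S \<subseteq> A" "a ~: S" "(tail a, head a) ~: joined tail head S"
 shows "(lf a, rf a) : joined lf rf (A - S - {a})"
proof (rule ccontr)
 assume n: "~ ?thesis"
 define I where "I = {p : P. (head a, p) : joined tail head S}"
 define Y where "Y = {f : F. (lf a, f) : joined lf rf (A - S - {a})}"
 have I: "head b : I \<longleftrightarrow> tail b : I" if "b : S" for b using that assms ends joined_edge[OF that, of tail head] unfolding I_def
 by (auto intro: joined_trans joined_sym)
 have Y: "lf b : Y \<longleftrightarrow> rf b : Y" if "b : A - S - {a}" for b using that assms sides joined_edge[OF that, of lf rf] unfolding Y_def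
 by (auto intro: joined_trans joined_sym)
 have "(SUM b:A. (of_bool (head b : I) - of_bool (tail b : I)) *
  (of_bool (lf b : Y) - of_bool (rf b : Y)) :: int) =
  (of_bool (head a : I) - of_bool (tail a : I)) *
  (of_bool (lf a : Y) - of_bool (rf a : Y))"
 proof -
  have 0: "(of_bool (head b : I) - of_bool (tail b : I)) *
  (of_bool (lf b : Y) - of_bool (rf b : Y)) = (0::int)" if "b : A - {a}" for b
 proof (cases "b : S")
  case True
  thus ?thesis using I[of b] by simp
 next
  case False
  thus ?thesis using Y[of b] that by simp
 qed
  show ?thesis by (subst sum.remove[OF fin(2) assms(1)], subst sum.neutral) (use 0 in auto)
 qed
 also have "... = 1" using assms n ends sides by (auto simp: I_def Y_def joined_sym)
 finally show False using orth_sets[of I Y] by (auto simp: I_def Y_def)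
qed

text \<open>The defect of the equation never increases when an edge is added to \<open>S\<close>: an edge whose dual joins two parts of the remaining dual graph closes a cycle. It vanishes for \<open>S = {}\<close> and, by Euler's formula, for \<open>S = A\<close>.\<close>

lemma duality:
 assumes "S \<subseteq> A"
 shows "cF (A - S) + card P = 1 + card S + cP S"
proof -
 define d where "d S = int (cF (A - S)) + int (card P) - 1 - int (card S) - int (cP S)" for S
 have step: "d (insert a S) <= d S" if a: "a : A" "a ~: S" "S \<subseteq> A" for a S
 proof -
  have finS: "finite S" using a fin finite_subset by blast
  have eq: "A - insert a S = A - S - {a}" "A - S = insert a (A - S - {a})" using a by auto
  have F: "cF (A - S - {a}) =
  (if (lf a, rf a) : joined lf rf (A - S - {a}) then cF (A - S) else Suc (cF (A - S)))" using ncomp_insert_joined[of lf a rf "A - S - {a}" F]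
  ncomp_insert_separate[of F lf a rf "A - S - {a}"] sides[OF a(1)] fin unfolding eq(2)[symmetric] by simp
  have P: "cP S = (if (tail a, head a) : joined tail head S then cP (insert a S) else Suc (cP (insert a S)))"
 using ncomp_insert_joined[of tail a head S P]
  ncomp_insert_separate[of P tail a head S] ends[OF a(1)] fin by simp
  show ?thesis using cut_not_bridge[OF a(1) a(3) a(2)] F P finS a unfolding d_def eq(1) by (auto split: if_splits)
 qed
 have up: "d (S Un S') <= d S" if "finite S'" "S \<subseteq> A" "S' \<subseteq> A" for S S' using that
 proof (induction S' rule: finite_induct)
  case (insert x S')
  show ?case
 proof (cases "x : S Un S'")
  case True
  hence "S Un insert x S' = S Un S'" by auto
  thus ?thesis using insert by simp
 next
  case False
  hence "d (insert x (S Un S')) <= d (S Un S')" using insert by (intro step) auto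
  thus ?thesis using insert by simp
 qed
 qed simp
 have "d {} = 0" unfolding d_def using cF_A by (simp add: ncomp_empty)
 moreover have "d A = 0" unfolding d_def using cP_A euler by (simp add: ncomp_empty)
 moreover have "d S <= d {}" "d A <= d S" using up[of S "{}"] up[of A S] assms fin finite_subset[OF assms] by (auto simp: Un_absorb1)
 ultimately have "d S = 0" by simp
 thus ?thesis unfolding d_def by linarith
qed

end

lemma ncomp_lower:
 assumes "finite V" "finite E" and "!!e. e : E ==> s e : V & t e : V"
 shows "card V <= ncomp s t V E + card E" using assms(2,3)
proof (induction E rule: finite_induct)
 case (insert e E)
 thus ?case using ncomp_insert_joined[of s e t E V] ncomp_insert_separate[OF assms(1), of s e t E] by (cases "(s e, t e) : joined s t E") auto
qed (simp add: ncomp_empty)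

context dual_graphs
begin

definition "arcs_in T I = {a : A - T. head a : I}"
definition "regions_in T I = {f : F. ALL a:A. f : {lf a, rf a} --> a : arcs_in T I}"

lemma region_count:
 assumes T: "T \<subseteq> A" "T ~= {}"
  and IO: "I Un J = P" "I Int J = {}" "I ~= {}"
  and cut: "!!t. t : T ==> head t : I \<longleftrightarrow> tail t ~: I"
  and keep: "!!a. a : A - T ==> head a : I \<longleftrightarrow> tail a : I"
  and I: "!!p q. p : I ==> q : I ==> (p, q) : joined tail head (A - T)"
  and J: "!!p q. p : J ==> q : J ==> (p, q) : joined tail head (A - T)"
 shows "card (regions_in T I) + card I = 1 + card (arcs_in T I)"
proof -
 define S where "S = arcs_in T I"
 have S: "S \<subseteq> A" by (auto simp: S_def arcs_in_def)
 have memS: "a : S \<longleftrightarrow> tail a : I & head a : I" if "a : A" for a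
 using that cut keep by (cases "a : T") (auto simp: S_def arcs_in_def)
 have IS: "(p, q) : joined tail head S" if "p : I" "q : I" for p q
 proof -
  have "(p, q) : joined tail head S & q : I" using I[OF that]
 proof (induction rule: joined_induct)
  case base
  thus ?case using that by simp
 next
  case (step e x y)
  hence "e : S" "y : I" using keep[of e] memS[of e] by (auto simp: doubleton_eq_iff)
  moreover have "(x, y) : joined tail head S"
 using joined_edge[OF \<open>e : S\<close>, of tail head] step.hyps by (auto simp: doubleton_eq_iff intro: joined_sym)
  ultimately show ?case using step.IH by (meson joined_trans)
 qed
  thus ?thesis by simp
 qed
 have 1: "cP S + card I = Suc (card P)" using fin IO memS S IS by (intro ncomp_one_big) auto
 define Rs where "Rs = F - regions_in T I"
 have Rmem: "f : Rs \<longleftrightarrow> f : F & (EX a:A - S. f : {lf a, rf a})" for f by (auto simp: Rs_def regions_in_def S_def)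
 have Jend: "EX p:J. p : {tail a, head a}" if "a : A - S" for a
 proof -
  have "tail a ~: I \<or> head a ~: I" using that memS by blast
  thus ?thesis using ends[of a] that IO by blast
 qed
 have J_arc: "a : A - S" if "a : A" "p : J" "p : {tail a, head a}" for a p using that memS IO by blast
 have at: "(lf a, lf b) : joined lf rf (A - S)"
  if "p : J" "a : A" "b : A" "p : {tail a, head a}" "p : {tail b, head b}" for p a b
 proof -
  have "p : P" using that IO by blast
  have "{c : A. p : {tail c, head c}} \<subseteq> A - S" using J_arc that by blast
  thus ?thesis using around[OF \<open>p : P\<close> that(2-)] joined_mono by blast
 qed
 have path: "q : J & (ALL a:A. ALL b:A. p : {tail a, head a} --> q : {tail b, head b} -->
  (lf a, lf b) : joined lf rf (A - S))"
  if "(p, q) : joined tail head (A - T)" "p : J" for p q using that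
 proof (induction rule: joined_induct)
  case base
  thus ?case using at by blast
 next
  case (step e x y)
  hence x: "x : J" by blast
  have exy: "x : {tail e, head e}" "y : {tail e, head e}" and e: "e : A" using step.hyps by blast+
  have "x ~: I" using x IO by blast
  hence "y ~: I" using keep[OF step.hyps(2)] step.hyps(3) by (auto simp: doubleton_eq_iff)
  hence y: "y : J" using exy ends[OF e] IO by blast
  show ?case
 proof (intro conjI y ballI impI)
  fix a b assume a: "a : A" "p : {tail a, head a}" and b: "b : A" "y : {tail b, head b}"
  have "(lf a, lf e) : joined lf rf (A - S)" using step a e exy by blast
  moreover have "(lf e, lf b) : joined lf rf (A - S)" using at[OF y e b(1) exy(2) b(2)] .
  ultimately show "(lf a, lf b) : joined lf rf (A - S)" by (rule joined_trans)
 qed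
 qed
 have side: "(f, lf a) : joined lf rf (A - S)" if "a : A - S" "f : {lf a, rf a}" for f a
 using that joined_edge[of a "A - S" lf rf] by (auto intro: joined_sym)
 have RJ: "(f, g) : joined lf rf (A - S)" if fg: "f : Rs" "g : Rs" for f g
 proof -
  obtain a b where ab: "a : A - S" "f : {lf a, rf a}" "b : A - S" "g : {lf b, rf b}" using fg Rmem by meson
  obtain p q where pq: "p : J" "p : {tail a, head a}" "q : J" "q : {tail b, head b}" using Jend ab by meson
  have "(lf a, lf b) : joined lf rf (A - S)" using path[OF J[OF pq(1,3)] pq(1)] ab pq by blast
  thus ?thesis using side[OF ab(1,2)] side[OF ab(3,4)] by (meson joined_sym joined_trans)
 qed
 have "EX t. t : A - S" using T by (auto simp: S_def arcs_in_def)
 hence "Rs ~= {}" using Rmem sides by blast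
 hence 2: "cF (A - S) + card Rs = Suc (card F)" using fin RJ sides by (intro ncomp_one_big) (auto simp: Rmem)
 have "card Rs + card (regions_in T I) = card F"
 proof -
  have "regions_in T I \<subseteq> F" by (auto simp: regions_in_def)
  thus ?thesis unfolding Rs_def using fin by (simp add: card_Diff_subset finite_subset card_mono)
 qed
 thus ?thesis using 1 2 duality[OF S] by (simp add: S_def)
qed

text \<open>A closed curve in the dual graph, running through the regions \<open>X\<close> and across the edges \<open>T\<close>, cuts the points into two parts, by duality; \<open>I\<close> is the part without \<open>q\<close>, for which Euler's formula holds.\<close>

lemma jordan:
 assumes T: "T \<subseteq> A" and X: "X \<subseteq> F" "X ~= {}"
  and TX: "!!t. t : T ==> lf t : X & rf t : X"
  and deg: "!!f. f : X ==> (SUM t:T. of_bool (lf t = f) + of_bool (rf t = f)) = (2::nat)"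
  and conn: "!!f g. f : X ==> g : X ==> (f, g) : joined lf rf T"
  and q: "q : P"
 obtains I where "I \<subseteq> P" "q ~: I"
  and "!!t. t : T ==> head t : I \<longleftrightarrow> tail t ~: I"
  and "!!a. a : A - T ==> head a : I \<longleftrightarrow> tail a : I"
  and "!!f a b. f : F - X ==> a : A ==> b : A ==> f : {lf a, rf a} ==> f : {lf b, rf b} ==>
  head a : I \<longleftrightarrow> head b : I"
  and "card {f : F - X. EX a:A. f : {lf a, rf a} & head a : I} + card I =
  1 + card {a : A - T. head a : I}"
proof -
 have finT: "finite T" and finX: "finite X" using T X fin finite_subset by blast+
 have "2 * card X = (SUM f:X. SUM t:T. of_bool (lf t = f) + of_bool (rf t = f))" using deg by simp
 also have "... = (SUM t:T. SUM f:X. of_bool (lf t = f) + of_bool (rf t = f))" by (rule sum.swap)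
 also have "... = (SUM t:T. 2)" using TX finX by (intro sum.cong) (auto simp: sum.distrib of_bool_def)
 finally have cTX: "card T = card X" by simp
 have "T ~= {}" using cTX X finX by auto
 have "card T <= card A" using T fin by (simp add: card_mono)
 have cAT: "card (A - T) = card A - card T" using T finT by (simp add: card_Diff_subset)
 have 1: "cF T + card X = Suc (card F)" using fin X TX conn by (intro ncomp_one_big) auto
 have AAT: "A - (A - T) = T" using T by auto
 have 2: "cP (A - T) = 2" using duality[of "A - T"] 1 euler cTX \<open>card T <= card A\<close> by (simp add: AAT cAT)
 have bridge: "(tail t, head t) ~: joined tail head (A - T)" if t: "t : T" for t
 proof
  assume "(tail t, head t) : joined tail head (A - T)"
  hence c2: "cP (insert t (A - T)) = 2" using ncomp_insert_joined[of tail t head "A - T" P] 2 by simp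
  have sub: "insert t (A - T) \<subseteq> A" and eq: "A - insert t (A - T) = T - {t}" using T t by auto
  have "(lf t, rf t) : joined lf rf (T - {t})"
 proof (rule ccontr)
  assume n: "~ ?thesis"
  define Y where "Y = {f : X. (lf t, f) : joined lf rf (T - {t})}"
  have finY: "finite Y" using finX by (simp add: Y_def)
  have Y: "lf b : Y \<longleftrightarrow> rf b : Y" if "b : T - {t}" for b using that TX joined_edge[OF that, of lf rf] unfolding Y_def
 by (auto intro: joined_trans joined_sym)
  have "2 * card Y = (SUM f:Y. SUM t:T. of_bool (lf t = f) + of_bool (rf t = f))" using deg by (simp add: Y_def)
  also have "... = (SUM t:T. SUM f:Y. of_bool (lf t = f) + of_bool (rf t = f))" by (rule sum.swap)
  also have "... = (SUM t:T. of_bool (lf t : Y) + of_bool (rf t : Y))" using finY by (intro sum.cong) (auto simp: sum.distrib of_bool_def)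
  also have "... = 1 + (SUM t:T - {t}. 2 * of_bool (lf t : Y))"
 proof -
  have "lf t : Y" "rf t ~: Y" using n TX[OF t] by (auto simp: Y_def)
  moreover have "of_bool (lf b : Y) + of_bool (rf b : Y) = (2 * of_bool (lf b : Y) :: nat)" if "b : T - {t}" for b using Y[OF that] by simp
  hence "(SUM b:T - {t}. of_bool (lf b : Y) + of_bool (rf b : Y)) =
  (SUM b:T - {t}. 2 * of_bool (lf b : Y) :: nat)" by (rule sum.cong[OF refl])
  ultimately show ?thesis unfolding sum.remove[OF finT t] by simp
 qed
  finally have "even (1 + 2 * (SUM t:T - {t}. of_bool (lf t : Y)) :: nat)" by (metis dvd_triv_left sum_distrib_left)
  thus False by simp
 qed
  hence "cF T = cF (T - {t})" using ncomp_insert_joined[of lf t rf "T - {t}" F] t by (simp add: insert_absorb)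
  moreover have "card (insert t (A - T)) = Suc (card A - card T)" using t fin cAT by simp
  ultimately show False using duality[OF sub] c2 1 euler cTX \<open>card T <= card A\<close> unfolding eq by simp
 qed
 define c where "c v = joined tail head (A - T) `` {v}" for v
 have c: "c u = c v \<longleftrightarrow> (u, v) : joined tail head (A - T)" for u v unfolding c_def by (rule joined_class_eq)
 have c_two: "card (c ` P) = 2" using 2 by (simp add: ncomp_def c_def)
 have three: "c u = c v \<or> c u = c w \<or> c v = c w" if "u : P" "v : P" "w : P" for u v w
 proof (rule ccontr)
  assume "~ ?thesis"
  hence "card {c u, c v, c w} = 3" by auto
  moreover have "card {c u, c v, c w} <= card (c ` P)" using that fin by (intro card_mono) auto
  ultimately show False using c_two by simp
 qed
 define J where "J = {p : P. c p = c q}"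
 define I where "I = P - J"
 have IJ: "I Un J = P" "I Int J = {}" by (auto simp: I_def J_def)
 have Jj: "(u, v) : joined tail head (A - T)" if "u : J" "v : J" for u v unfolding c[symmetric] using that by (simp add: J_def)
 have Ij: "(u, v) : joined tail head (A - T)" if "u : I" "v : I" for u v
 unfolding c[symmetric] using that three[of u v q] q by (auto simp: J_def I_def)
 have keep: "head a : I \<longleftrightarrow> tail a : I" if "a : A - T" for a
 proof -
  have "c (tail a) = c (head a)" unfolding c by (rule joined_edge[OF that])
  thus ?thesis using ends[of a] that by (auto simp: I_def J_def)
 qed
 have cut: "head t : I \<longleftrightarrow> tail t ~: I" if "t : T" for t
 using bridge[OF that] T that ends[of t] Ij[of "tail t" "head t"] Jj[of "tail t" "head t"] IJ by blast
 have nI: "I ~= {}" and nJ: "J ~= {}"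
 proof -
  obtain t where t: "t : T" using \<open>T ~= {}\<close> by auto
  show "I ~= {}" using cut[OF t] ends[of t] t T by blast
  show "J ~= {}" using q by (auto simp: J_def)
 qed
 have keepJ: "head a : J \<longleftrightarrow> tail a : J" if "a : A - T" for a using keep[OF that] ends[of a] that IJ by blast
 have cutJ: "head t : J \<longleftrightarrow> tail t ~: J" if "t : T" for t using cut[OF that] ends[of t] that T IJ by blast
 have cI: "card (regions_in T I) + card I = 1 + card (arcs_in T I)"
 by (rule region_count[where J = J]) (use T \<open>T ~= {}\<close> IJ nI cut keep Ij Jj in auto)
 have cJ: "card (regions_in T J) + card J = 1 + card (arcs_in T J)"
 by (rule region_count[where J = I]) (use T \<open>T ~= {}\<close> IJ nJ cutJ keepJ Ij Jj in auto)
 have "card I + card J = card P" using IJ fin card_Un_disjoint[of I J] by (metis finite_Un)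
 moreover have "card (arcs_in T I) + card (arcs_in T J) = card A - card T"
 proof -
  have "A - T = arcs_in T I Un arcs_in T J" "arcs_in T I Int arcs_in T J = {}" using ends IJ by (auto simp: arcs_in_def)
  thus ?thesis using cAT fin card_Un_disjoint[of "arcs_in T I" "arcs_in T J"] by (metis finite_Diff finite_Un)
 qed
 ultimately have tot: "card (regions_in T I) + card (regions_in T J) = card F - card X"
 using cI cJ euler cTX \<open>card T <= card A\<close> by linarith
 have touchX: "EX t:T. f : {lf t, rf t}" if "f : X" for f
 proof (rule ccontr)
  assume "~ ?thesis"
  hence "(SUM t:T. of_bool (lf t = f) + of_bool (rf t = f)) = (0::nat)" by (intro sum.neutral) auto
  thus False using deg[OF that] by simp
 qed
 have subs: "regions_in T I Un regions_in T J \<subseteq> F - X" using touchX T by (fastforce simp: regions_in_def arcs_in_def)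
 have disj: "regions_in T I Int regions_in T J = {}" using F_touched IJ by (fastforce simp: regions_in_def arcs_in_def)
 have "finite (F - X)" using fin by simp
 have "card (regions_in T I Un regions_in T J) = card (F - X)" using tot disj subs fin X finX finite_subset[OF subs \<open>finite (F - X)\<close>]
 by (simp add: card_Un_disjoint card_Diff_subset)
 hence all: "regions_in T I Un regions_in T J = F - X" using subs \<open>finite (F - X)\<close> by (simp add: card_subset_eq)
 show thesis
 proof (rule that[of I])
  show "I \<subseteq> P" "q ~: I" using q by (auto simp: I_def J_def)
  show "head t : I \<longleftrightarrow> tail t ~: I" if "t : T" for t using cut that .
  show "head a : I \<longleftrightarrow> tail a : I" if "a : A - T" for a using keep that .
  show "head a : I \<longleftrightarrow> head b : I"
  if "f : F - X" "a : A" "b : A" "f : {lf a, rf a}" "f : {lf b, rf b}" for f a b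
 proof -
  have "f : regions_in T I Un regions_in T J" using all that by blast
  thus ?thesis
 proof
  assume "f : regions_in T I"
  hence "a : arcs_in T I" "b : arcs_in T I" using that by (auto simp: regions_in_def)
  thus ?thesis by (simp add: arcs_in_def)
 next
  assume "f : regions_in T J"
  hence "a : arcs_in T J" "b : arcs_in T J" using that by (auto simp: regions_in_def)
  thus ?thesis using IJ by (auto simp: arcs_in_def)
 qed
 qed
  have "{f : F - X. EX a:A. f : {lf a, rf a} & head a : I} = regions_in T I"
 proof (intro equalityI subsetI)
  fix f assume "f : {f : F - X. EX a:A. f : {lf a, rf a} & head a : I}"
  then obtain a where a: "f : F - X" "a : A" "f : {lf a, rf a}" "head a : I" by blast
  hence "f ~: regions_in T J" using IJ by (auto simp: regions_in_def arcs_in_def)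
  thus "f : regions_in T I" using all a by blast
 next
  fix f assume f: "f : regions_in T I"
  hence "f : F - X" using all by blast
  moreover obtain a where "a : A" "f : {lf a, rf a}" using F_touched \<open>f : F - X\<close> by blast
  ultimately show "f : {f : F - X. EX a:A. f : {lf a, rf a} & head a : I}" using f by (auto simp: regions_in_def arcs_in_def)
 qed
  thus "card {f : F - X. EX a:A. f : {lf a, rf a} & head a : I} + card I =
  1 + card {a : A - T. head a : I}" using cI by (simp add: arcs_in_def)
 qed
qed

lemma potential_on_forest:
 fixes ph :: "'a => int"
 assumes "finite T" "T \<subseteq> A" "cF T + card T = card F"
 shows "EX ind. ALL a:T. ind (lf a) - ind (rf a) = ph a" using assms
proof (induction T rule: finite_induct)
 case (insert t T)
 have t: "lf t : F" "rf t : F" using sides insert by blast+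
 have sep: "(lf t, rf t) ~: joined lf rf T" using ncomp_insert_joined[of lf t rf T F] ncomp_lower[OF fin(3) insert.hyps(1), of lf rf] insert.prems
  insert.hyps sides by fastforce
 have "cF T + card T = card F" using ncomp_insert_separate[OF fin(3) t sep] insert by simp
 then obtain ind where ind: "ALL a:T. ind (lf a) - ind (rf a) = ph a" using insert by auto
 define k where "k = ph t - (ind (lf t) - ind (rf t))"
 define ind' where "ind' f = ind f + (if (lf t, f) : joined lf rf T then k else 0)" for f
 have "ind' (lf a) - ind' (rf a) = ph a" if "a : T" for a
 proof -
  have "(lf t, lf a) : joined lf rf T \<longleftrightarrow> (lf t, rf a) : joined lf rf T"
 using joined_edge[OF that, of lf rf] by (meson joined_sym joined_trans)
  thus ?thesis using ind that by (simp add: ind'_def)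
 qed
 moreover have "ind' (lf t) - ind' (rf t) = ph t" using sep by (simp add: ind'_def k_def)
 ultimately show ?case by blast
qed simp

text \<open>A conserved flow on the arcs is the coboundary of a function on the regions.\<close>

lemma potential:
 fixes ph :: "'a => int"
 assumes flow: "!!p. p : P ==> (SUM a:A. ph a * (of_bool (head a = p) - of_bool (tail a = p))) = 0"
 shows "EX ind. ALL a:A. ind (lf a) - ind (rf a) = ph a"
proof -
 define Q where "Q T \<longleftrightarrow> T \<subseteq> A & cF T + card T = card F" for T
 have "Q {}" by (simp add: Q_def ncomp_empty)
 moreover have bound: "!!T. Q T ==> card T < Suc (card A)" using fin by (auto simp: Q_def card_mono less_Suc_eq_le)
 ultimately obtain T where T: "Q T" and max: "!!T'. Q T' ==> card T' <= card T" using ex_has_greatest_nat[of Q "{}" card "Suc (card A)"] by blast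
 have TA: "T \<subseteq> A" and cT: "cF T + card T = card F" using T by (auto simp: Q_def)
 have finT: "finite T" using TA fin finite_subset by blast
 have span: "(lf a, rf a) : joined lf rf T" if "a : A" for a
 proof (rule ccontr)
  assume n: "~ ?thesis"
  hence "a ~: T" using joined_edge[of a T lf rf] by blast
  hence "Q (insert a T)" using ncomp_insert_separate[OF fin(3) _ _ n] sides[OF that] TA that cT finT by (simp add: Q_def)
  thus False using max[of "insert a T"] \<open>a ~: T\<close> finT by simp
 qed
 have JT: "(f, g) : joined lf rf T" if "f : F" "g : F" for f g using F_connected[OF that]
 proof (induction rule: joined_induct)
  case (step e x y)
  hence "(x, y) : joined lf rf T" using span[of e] joined_sym[OF span[of e]] by (auto simp: doubleton_eq_iff)
  thus ?case by (rule joined_trans[OF step.IH])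
 qed simp
 have "F ~= {}" using sides nonempty by blast
 hence "cF T = 1" unfolding ncomp_eq_1_iff[OF \<open>F ~= {}\<close>] using JT by blast
 define S where "S = A - T"
 have AS: "A - S = T" "S \<subseteq> A" and finS: "finite S" using TA fin by (auto simp: S_def)
 have cS: "card P = card S + cP S" using duality[OF AS(2)] \<open>cF T = 1\<close> by (simp add: AS)
 have bridge: "(tail a, head a) ~: joined tail head (S - {a})" if "a : S" for a
 proof
  assume "(tail a, head a) : joined tail head (S - {a})"
  hence "cP S = cP (S - {a})" using ncomp_insert_joined[of tail a head "S - {a}" P] that by (simp add: insert_absorb)
  moreover have "card P <= cP (S - {a}) + card (S - {a})" using fin finS AS ends by (intro ncomp_lower) auto
  moreover have "card S = Suc (card (S - {a}))" using card_Suc_Diff1[OF finS that] by simp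
  ultimately show False using cS by simp
 qed
 obtain ind where ind: "ALL a:T. ind (lf a) - ind (rf a) = ph a" using potential_on_forest[OF finT TA cT] by blast
 define ps where "ps a = ph a - (ind (lf a) - ind (rf a))" for a
 have "(SUM a:A. (ind (lf a) - ind (rf a)) * (of_bool (head a = p) - of_bool (tail a = p))) = 0"
  if p: "p : P" for p
 proof -
  have "(SUM a:A. (ind (lf a) - ind (rf a)) * (of_bool (head a = p) - of_bool (tail a = p))) =
  (SUM a:A. SUM f:F. ind f * ((of_bool (head a = p) - of_bool (tail a = p)) * (of_bool (lf a = f) - of_bool (rf a = f))))"
 proof (rule sum.cong[OF refl])
  fix a assume "a : A"
  have *: "(SUM f:F. ind f * of_bool (x = f)) = ind x" if "x : F" for x using that fin by (simp add: of_bool_def sum.delta if_distrib cong: if_cong)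
  have "(SUM f:F. ind f * ((of_bool (head a = p) - of_bool (tail a = p)) * (of_bool (lf a = f) - of_bool (rf a = f))))
  = (of_bool (head a = p) - of_bool (tail a = p)) *
  ((SUM f:F. ind f * of_bool (lf a = f)) - (SUM f:F. ind f * of_bool (rf a = f)))"
 by (simp add: sum_subtractf[symmetric] sum_distrib_left algebra_simps)
  thus "(ind (lf a) - ind (rf a)) * (of_bool (head a = p) - of_bool (tail a = p)) =
  (SUM f:F. ind f * ((of_bool (head a = p) - of_bool (tail a = p)) * (of_bool (lf a = f) - of_bool (rf a = f))))"
 using sides[OF \<open>a : A\<close>] by (simp add: *)
 qed
  also have "... = (SUM f:F. ind f * (SUM a:A. (of_bool (head a = p) - of_bool (tail a = p)) * (of_bool (lf a = f) - of_bool (rf a = f))))"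
 by (subst sum.swap) (simp add: sum_distrib_left)
  also have "... = 0" using orth p by (intro sum.neutral) simp
  finally show ?thesis .
 qed
 hence ps: "(SUM a:A. ps a * (of_bool (head a = p) - of_bool (tail a = p))) = 0" if "p : P" for p
 using flow that by (simp add: ps_def left_diff_distrib sum_subtractf)
 have "ps a = 0" if a: "a : S" for a
 proof -
  define I where "I = {p : P. (head a, p) : joined tail head (S - {a})}"
  have finI: "finite I" using fin by (simp add: I_def)
  have I: "head b : I \<longleftrightarrow> tail b : I" if "b : S - {a}" for b using that AS ends joined_edge[OF that, of tail head] unfolding I_def
 by (auto intro: joined_trans joined_sym)
  have ob: "of_bool (x : I) = (SUM p:I. of_bool (x = p) :: int)" for x using finI by (simp add: sum.delta of_bool_def)
  have "0 = (SUM p:I. SUM b:A. ps b * (of_bool (head b = p) - of_bool (tail b = p)))" using ps by (intro sum.neutral[symmetric]) (auto simp: I_def)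
  also have "... = (SUM b:A. ps b * (of_bool (head b : I) - of_bool (tail b : I)))"
 unfolding ob sum_subtractf[symmetric] sum_distrib_left by (rule sum.swap)
  also have "... = ps a * (of_bool (head a : I) - of_bool (tail a : I))"
 proof -
  have 0: "ps b * (of_bool (head b : I) - of_bool (tail b : I)) = 0" if "b : A - {a}" for b
 proof (cases "b : T")
  case True
  thus ?thesis using ind by (simp add: ps_def)
 next
  case False
  thus ?thesis using I[of b] that by (simp add: S_def)
 qed
  have "a : A" using a AS by blast
  thus ?thesis by (subst sum.remove[OF fin(2)], assumption, subst sum.neutral) (use 0 in auto)
 qed
  also have "... = ps a" using bridge[OF a] ends[of a] a AS by (auto simp: I_def joined_sym)
  finally show ?thesis by simp
 qed
 hence "ALL a:A. ind (lf a) - ind (rf a) = ph a" using ind by (auto simp: ps_def S_def)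
 thus ?thesis by blast
qed

end

section \<open>Maps on the sphere\<close>

definition prev :: "nat => nat => nat" where
 "prev n i = (if i = 0 then n - 1 else i - 1)"

lemma prev_less: "i < n ==> prev n i < n" by (auto simp: prev_def)

lemma sum_prev_range:
 fixes x :: "nat => int"
 assumes "i <= j"
 shows "(SUM l:{i<..j}. x (prev n l) - x l) = x i - x j" using assms
proof (induction j rule: dec_induct)
 case (step j)
 have "{i<..Suc j} = insert (Suc j) {i<..j}" using step by auto
 thus ?case using step by (simp add: prev_def)
qed simp

lemma sum_prev_cycle:
 fixes x :: "nat => int"
 assumes "0 < n"
 shows "(SUM l<n. x (prev n l) - x l) = 0"
proof -
 have "{..<n} = insert 0 {0<..n-1}" using assms by auto
 hence "(SUM l<n. x (prev n l) - x l) = (x (n - 1) - x 0) + (SUM l:{0<..n-1}. x (prev n l) - x l)" by (simp add: prev_def)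
 thus ?thesis using sum_prev_range[of 0 "n - 1" x n] by simp
qed

locale sphere_map =
 fixes P :: "'p set" and deg :: "'p => nat" and A :: "'a set"
  and src tgt :: "'a => 'p \<times> nat" and cor :: "'p => nat => 'f" and F :: "'f set"
 assumes finP: "finite P" and finA: "finite A"
  and deg_pos: "p : P ==> 0 < deg p"
  and inj: "inj_on src A" "inj_on tgt A" "src ` A Int tgt ` A = {}"
  and slots: "src ` A Un tgt ` A = Sigma P (%p. {..<deg p})"
  and glue: "a : A ==> cor (fst (src a)) (snd (src a)) =
  cor (fst (tgt a)) (prev (deg (fst (tgt a))) (snd (tgt a)))"
  "a : A ==> cor (fst (src a)) (prev (deg (fst (src a))) (snd (src a))) =
  cor (fst (tgt a)) (snd (tgt a))"
  and F_eq: "F = (\<Union>p\<in>P. cor p ` {..<deg p})"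
  and connected: "p : P ==> q : P ==> (p, q) : joined (fst \<circ> src) (fst \<circ> tgt) A"
  and P_nonempty: "P ~= {}"
  and euler: "card P + card F = card A + 2"
begin

definition lf :: "'a => 'f" where "lf a = cor (fst (src a)) (snd (src a))"
definition rf :: "'a => 'f" where "rf a = cor (fst (src a)) (prev (deg (fst (src a))) (snd (src a)))"

definition half :: "'p set => ('p => nat) => ('p => nat) => 'p \<times> nat => 'p \<times> bool" where
 "half Gm i0 j0 = (%(p, i). (p, p : Gm & i0 p < i & i <= j0 p))"

definition split_P :: "'p set => ('p \<times> bool) set" where
 "split_P Gm = (%p. (p, False)) ` P Un (%p. (p, True)) ` Gm"
definition split_A :: "'p set => ('a + 'p) set" where
 "split_A Gm = Inl ` A Un Inr ` Gm"
definition split_tail where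
 "split_tail Gm i0 j0 = case_sum (half Gm i0 j0 \<circ> src) (%p. (p, False))"
definition split_head where
 "split_head Gm i0 j0 = case_sum (half Gm i0 j0 \<circ> tgt) (%p. (p, True))"
definition split_lf :: "('p => nat) => ('p => nat) => 'a + 'p => 'f" where
 "split_lf i0 j0 = case_sum lf (%p. cor p (j0 p))"
definition split_rf :: "('p => nat) => ('p => nat) => 'a + 'p => 'f" where
 "split_rf i0 j0 = case_sum rf (%p. cor p (i0 p))"

lemmas split_defs = split_tail_def split_head_def split_lf_def split_rf_def

lemma finF: "finite F" unfolding F_eq using finP by auto

lemma src_slot: "a : A ==> fst (src a) : P & snd (src a) < deg (fst (src a))"
proof -
 assume "a : A"
 hence "src a : Sigma P (%p. {..<deg p})" using slots by blast
 thus ?thesis by auto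
qed

lemma tgt_slot: "a : A ==> fst (tgt a) : P & snd (tgt a) < deg (fst (tgt a))"
proof -
 assume "a : A"
 hence "tgt a : Sigma P (%p. {..<deg p})" using slots by blast
 thus ?thesis by auto
qed

lemma slot_arc:
 assumes "p : P" "i < deg p"
 obtains a where "a : A" "src a = (p, i) \<or> tgt a = (p, i)"
  "{lf a, rf a} = {cor p i, cor p (prev (deg p) i)}"
proof -
 have "(p, i) : src ` A Un tgt ` A" using slots assms by auto
 then obtain a where a: "a : A" "src a = (p, i) \<or> tgt a = (p, i)" by auto
 moreover have "{lf a, rf a} = {cor p i, cor p (prev (deg p) i)}" using a(2) glue[OF a(1)] unfolding lf_def rf_def by auto
 ultimately show thesis by (rule that)
qed

lemma sum_slots:
 fixes g :: "'p \<times> nat => int"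
 shows "(SUM a:A. (g (tgt a) - g (src a)) * (of_bool (lf a = f) - of_bool (rf a = f))) =
  (SUM p:P. SUM i<deg p. g (p, i) * (of_bool (cor p (prev (deg p) i) = f) - of_bool (cor p i = f)))"
proof -
 define \<chi> where "\<chi> = (%(p, i). of_bool (cor p (prev (deg p) i) = f) - of_bool (cor p i = f) :: int)"
 have "(SUM a:A. (g (tgt a) - g (src a)) * (of_bool (lf a = f) - of_bool (rf a = f))) =
  (SUM a:A. g (tgt a) * \<chi> (tgt a)) + (SUM a:A. g (src a) * \<chi> (src a))" unfolding sum.distrib[symmetric]
 proof (rule sum.cong[OF refl])
  fix a assume a: "a : A"
  have c1: "\<chi> (src a) = of_bool (rf a = f) - of_bool (lf a = f)" by (simp add: \<chi>_def lf_def rf_def case_prod_beta)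
  have c2: "\<chi> (tgt a) = of_bool (lf a = f) - of_bool (rf a = f)" using glue[OF a] by (simp add: \<chi>_def lf_def rf_def case_prod_beta)
  show "(g (tgt a) - g (src a)) * (of_bool (lf a = f) - of_bool (rf a = f)) =
  g (tgt a) * \<chi> (tgt a) + g (src a) * \<chi> (src a)" unfolding c1 c2 by (simp add: algebra_simps)
 qed
 also have "... = (SUM s:tgt ` A. g s * \<chi> s) + (SUM s:src ` A. g s * \<chi> s)" using inj by (simp add: sum.reindex)
 also have "... = (SUM s:Sigma P (%p. {..<deg p}). g s * \<chi> s)" using finA inj(3) unfolding slots[symmetric] by (subst sum.union_disjoint) auto
 also have "... = (SUM p:P. SUM i<deg p. g (p, i) * \<chi> (p, i))" using finP by (subst sum.Sigma) auto
 finally show ?thesis by (simp add: \<chi>_def)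
qed

text \<open>Where a curve passes through a crossing, the point is cut into two halves joined by a new edge, which the curve crosses. The map stays spherical.\<close>

lemma split_dual:
 assumes Gm: "Gm \<subseteq> P" and ij: "!!p. p : Gm ==> i0 p < j0 p & j0 p < deg p"
 shows "dual_graphs (split_P Gm) (split_A Gm) F (split_tail Gm i0 j0) (split_head Gm i0 j0)
  (split_lf i0 j0) (split_rf i0 j0)"
proof -
 define h where "h = half Gm i0 j0"
 have finGm: "finite Gm" using Gm finP finite_subset by blast
 have hP: "h s : split_P Gm" if "fst s : P" for s using that by (cases s) (auto simp: h_def half_def split_P_def)
 have memF: "(p, False) : split_P Gm" if "p : P" for p using that by (simp add: split_P_def)
 have memT: "(p, True) : split_P Gm" if "p : Gm" for p using that by (simp add: split_P_def)
 have sides: "lf a : F" "rf a : F" if "a : A" for a using src_slot[OF that] prev_less unfolding lf_def rf_def F_eq by auto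
 show ?thesis
 proof
  show "finite (split_P Gm)" "finite (split_A Gm)" "finite F" using finP finA finGm finF by (auto simp: split_P_def split_A_def)
  show "split_tail Gm i0 j0 a : split_P Gm" if "a : split_A Gm" for a
 using that hP[OF conjunct1[OF src_slot]] memF memT Gm by (auto simp: split_A_def split_defs h_def[symmetric])
  show "split_head Gm i0 j0 a : split_P Gm" if "a : split_A Gm" for a
 using that hP[OF conjunct1[OF tgt_slot]] memF memT Gm by (auto simp: split_A_def split_defs h_def[symmetric])
  show "split_lf i0 j0 a : F" if "a : split_A Gm" for a using that sides Gm ij by (fastforce simp: split_A_def split_defs F_eq)
  show "split_rf i0 j0 a : F" if "a : split_A Gm" for a using that sides Gm ij by (fastforce simp: split_A_def split_defs F_eq)
  show "(SUM a:split_A Gm. (of_bool (split_head Gm i0 j0 a = q) - of_bool (split_tail Gm i0 j0 a = q)) *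
  (of_bool (split_lf i0 j0 a = f) - of_bool (split_rf i0 j0 a = f)) :: int) = 0"
  if q: "q : split_P Gm" for q f
 proof -
  obtain p b where pb: "q = (p, b)" by (cases q)
  have p: "p : P" and bG: "b ==> p : Gm" using q Gm by (auto simp: pb split_P_def)
  define x where "x i = (of_bool (cor p i = f) :: int)" for i
  have "(SUM a:split_A Gm. (of_bool (split_head Gm i0 j0 a = q) - of_bool (split_tail Gm i0 j0 a = q)) *
  (of_bool (split_lf i0 j0 a = f) - of_bool (split_rf i0 j0 a = f)) :: int) =
  (SUM a:A. (of_bool (h (tgt a) = q) - of_bool (h (src a) = q)) * (of_bool (lf a = f) - of_bool (rf a = f)))
  + (SUM r:Gm. (of_bool ((r, True) = q) - of_bool ((r, False) = q)) *
  (of_bool (cor r (j0 r) = f) - of_bool (cor r (i0 r) = f)))" unfolding split_A_def using finA finGm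
 by (subst sum.union_disjoint) (auto simp: sum.reindex split_defs h_def)
  also have "(SUM a:A. (of_bool (h (tgt a) = q) - of_bool (h (src a) = q)) * (of_bool (lf a = f) - of_bool (rf a = f)))
  = (SUM r:P. SUM i<deg r. of_bool (h (r, i) = q) * (of_bool (cor r (prev (deg r) i) = f) - of_bool (cor r i = f)) :: int)"
 by (rule sum_slots[of "%s. of_bool (h s = q)"])
  also have "... = (SUM i<deg p. of_bool (h (p, i) = q) * (x (prev (deg p) i) - x i))"
 proof -
  have "(SUM r:P - {p}. SUM i<deg r. of_bool (h (r, i) = q) * (of_bool (cor r (prev (deg r) i) = f) - of_bool (cor r i = f))) = (0::int)"
 by (intro sum.neutral) (auto simp: h_def half_def pb)
  thus ?thesis by (simp add: sum.remove[OF finP p] x_def)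
 qed
  also have "(SUM r:Gm. (of_bool ((r, True) = q) - of_bool ((r, False) = q)) *
  (of_bool (cor r (j0 r) = f) - of_bool (cor r (i0 r) = f)))
  = (if p : Gm then (if b then 1 else -1) * (x (j0 p) - x (i0 p)) else 0)"
 proof -
  have 0: "(SUM r:Gm - {p}. (of_bool ((r, True) = q) - of_bool ((r, False) = q)) *
  (of_bool (cor r (j0 r) = f) - of_bool (cor r (i0 r) = f))) = (0::int)" by (intro sum.neutral) (auto simp: pb)
  show ?thesis
 proof (cases "p : Gm")
  case True
  thus ?thesis using 0 by (simp add: sum.remove[OF finGm True] pb x_def)
 next
  case False
  thus ?thesis using 0 by simp
 qed
 qed
  also have "(SUM i<deg p. of_bool (h (p, i) = q) * (x (prev (deg p) i) - x i)) =
  (if p : Gm then (if b then 1 else -1) * (x (i0 p) - x (j0 p)) else 0)"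
 proof -
  have all: "(SUM i<deg p. x (prev (deg p) i) - x i) = 0" by (rule sum_prev_cycle[OF deg_pos[OF p]])
  show ?thesis
 proof (cases "p : Gm")
  case True
  have Rs: "{i0 p<..j0 p} \<subseteq> {..<deg p}" using ij[OF True] by auto
  have T: "(SUM i:{i0 p<..j0 p}. x (prev (deg p) i) - x i) = x (i0 p) - x (j0 p)" using ij[OF True] by (intro sum_prev_range) simp
  have C: "(SUM i:{..<deg p} - {i0 p<..j0 p}. x (prev (deg p) i) - x i) = - (x (i0 p) - x (j0 p))"
 using all T sum.subset_diff[OF Rs, of "%i. x (prev (deg p) i) - x i"] by simp
  have "(SUM i<deg p. of_bool (h (p, i) = q) * (x (prev (deg p) i) - x i)) =
  (SUM i:{..<deg p} - {i0 p<..j0 p}. of_bool (h (p, i) = q) * (x (prev (deg p) i) - x i)) +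
  (SUM i:{i0 p<..j0 p}. of_bool (h (p, i) = q) * (x (prev (deg p) i) - x i))" by (rule sum.subset_diff[OF Rs]) simp
  also have "(SUM i:{i0 p<..j0 p}. of_bool (h (p, i) = q) * (x (prev (deg p) i) - x i)) =
  of_bool b * (SUM i:{i0 p<..j0 p}. x (prev (deg p) i) - x i)" using True unfolding sum_distrib_left
 by (intro sum.cong) (auto simp: h_def half_def pb)
  also have "(SUM i:{..<deg p} - {i0 p<..j0 p}. of_bool (h (p, i) = q) * (x (prev (deg p) i) - x i)) =
  of_bool (~ b) * (SUM i:{..<deg p} - {i0 p<..j0 p}. x (prev (deg p) i) - x i)" using True unfolding sum_distrib_left
 by (intro sum.cong) (auto simp: h_def half_def pb)
  finally show ?thesis using True T C by simp
 next
  case False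
  hence "~ b" using bG by blast
  hence "(SUM i<deg p. of_bool (h (p, i) = q) * (x (prev (deg p) i) - x i)) =
  (SUM i<deg p. x (prev (deg p) i) - x i)" using False by (intro sum.cong) (auto simp: h_def half_def pb)
  thus ?thesis using all False by simp
 qed
 qed
  finally show ?thesis by simp
 qed
  show "(split_lf i0 j0 a, split_lf i0 j0 b) : joined (split_lf i0 j0) (split_rf i0 j0)
  {c : split_A Gm. q : {split_tail Gm i0 j0 c, split_head Gm i0 j0 c}}"
  if q: "q : split_P Gm" and ab: "a : split_A Gm" "b : split_A Gm"
  "q : {split_tail Gm i0 j0 a, split_head Gm i0 j0 a}" "q : {split_tail Gm i0 j0 b, split_head Gm i0 j0 b}" for q a b
 proof -
  obtain p t where pt: "q = (p, t)" by (cases q)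
  have p: "p : P" and tG: "t ==> p : Gm" using q Gm by (auto simp: pt split_P_def)
  let ?J = "joined (split_lf i0 j0) (split_rf i0 j0)
  {c : split_A Gm. q : {split_tail Gm i0 j0 c, split_head Gm i0 j0 c}}"
  have step: "(cor p i, cor p (prev (deg p) i)) : ?J" if i: "i < deg p" "h (p, i) = q" for i
 proof -
  obtain c where c: "c : A" "src c = (p, i) \<or> tgt c = (p, i)"
  "{lf c, rf c} = {cor p i, cor p (prev (deg p) i)}" using slot_arc[OF p i(1)] by blast
  have "(split_lf i0 j0 (Inl c), split_rf i0 j0 (Inl c)) : ?J" using c that(2) by (intro joined_edge) (auto simp: split_A_def split_defs h_def)
  hence "(lf c, rf c) : ?J" by (simp add: split_defs)
  thus ?thesis using c(3) by (auto simp: doubleton_eq_iff intro: joined_sym)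
 qed
  define base where "base = (if t then cor p (i0 p) else cor p (deg p - 1))"
  have range: "(cor p j, cor p i) : ?J"
  if "i <= j" "j < deg p" "!!l. i < l ==> l <= j ==> h (p, l) = q" for i j using that
 proof (induction j rule: dec_induct)
  case (step j)
  have "(cor p (Suc j), cor p j) : ?J"
 using \<open>!!i. i < deg p ==> h (p, i) = q ==> (cor p i, cor p (prev (deg p) i)) : ?J\<close>[of "Suc j"] step by (simp add: prev_def)
  moreover have "(cor p j, cor p i) : ?J" using step by simp
  ultimately show ?case by (rule joined_trans)
 qed simp
  have zero: "(cor p 0, cor p (deg p - 1)) : ?J" if "~ t" using step[of 0] deg_pos[OF p] that by (simp add: prev_def h_def half_def pt)
  have low: "(cor p i, cor p (deg p - 1)) : ?J"
  if "~ t" "i < deg p" "p : Gm --> i <= i0 p" for i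
 proof -
  have "(cor p i, cor p 0) : ?J" using that by (intro range) (auto simp: h_def half_def pt)
  thus ?thesis using zero that by (meson joined_trans)
 qed
  have high: "(cor p i, cor p (deg p - 1)) : ?J"
  if "~ t" "i < deg p" "p : Gm" "j0 p <= i" for i
 proof -
  have "(cor p i, cor p (j0 p)) : ?J" using that by (intro range) (auto simp: h_def half_def pt)
  moreover have "(cor p (deg p - 1), cor p (j0 p)) : ?J" using that by (intro range) (auto simp: h_def half_def pt)
  ultimately show ?thesis by (meson joined_sym joined_trans)
 qed
  have slot: "(cor p i, base) : ?J" if "i < deg p" "h (p, i) = q" for i
 proof (cases t)
  case True
  hence G: "p : Gm" "i0 p < i" "i <= j0 p" using that by (auto simp: h_def half_def pt)
  have "(cor p i, cor p (i0 p)) : ?J" using G that True by (intro range) (auto simp: h_def half_def pt)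
  thus ?thesis by (simp add: base_def True)
 next
  case False
  thus ?thesis using that low[of i] high[of i] by (cases "p : Gm") (auto simp: h_def half_def pt base_def not_less)
 qed
  have main: "(split_lf i0 j0 c, base) : ?J"
  if c: "c : split_A Gm" "q : {split_tail Gm i0 j0 c, split_head Gm i0 j0 c}" for c
 proof (cases c)
  case (Inl d)
  hence d: "d : A" "h (src d) = q \<or> h (tgt d) = q" using c by (auto simp: split_A_def split_defs h_def)
  from d(2) show ?thesis
 proof
  assume hs: "h (src d) = q"
  hence "fst (src d) = p" by (cases "src d") (auto simp: h_def half_def pt)
  hence "src d = (p, snd (src d))" by (metis prod.collapse)
  hence "(cor p (snd (src d)), base) : ?J" using slot[of "snd (src d)"] src_slot[OF d(1)] hs \<open>fst (src d) = p\<close> by auto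
  thus ?thesis using \<open>fst (src d) = p\<close> by (simp add: Inl split_defs lf_def)
 next
  assume ht: "h (tgt d) = q"
  hence f: "fst (tgt d) = p" by (cases "tgt d") (auto simp: h_def half_def pt)
  hence e: "tgt d = (p, snd (tgt d))" by (metis prod.collapse)
  have l: "snd (tgt d) < deg p" using tgt_slot[OF d(1)] f by auto
  have "(cor p (snd (tgt d)), base) : ?J" using slot[OF l] ht e by auto
  moreover have "(cor p (snd (tgt d)), cor p (prev (deg p) (snd (tgt d)))) : ?J" using step[OF l] ht e by auto
  ultimately have "(cor p (prev (deg p) (snd (tgt d))), base) : ?J" by (meson joined_sym joined_trans)
  thus ?thesis using f glue(1)[OF d(1)] by (simp add: Inl split_defs lf_def)
 qed
 next
  case (Inr r)
  hence r: "r = p" "p : Gm" using c by (auto simp: split_A_def split_defs pt)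
  have "(cor p (j0 p), base) : ?J"
 proof (cases t)
  case True
  have "(cor p (j0 p), cor p (i0 p)) : ?J" using ij[OF r(2)] True r by (intro range) (auto simp: h_def half_def pt)
  thus ?thesis by (simp add: base_def True)
 next
  case False
  thus ?thesis using high[of "j0 p"] ij[OF r(2)] r by (simp add: base_def)
 qed
  thus ?thesis by (simp add: Inr r split_defs)
 qed
  show ?thesis using main[OF ab(1,3)] main[OF ab(2,4)] by (meson joined_sym joined_trans)
 qed
  show "(q, q') : joined (split_tail Gm i0 j0) (split_head Gm i0 j0) (split_A Gm)"
  if q: "q : split_P Gm" "q' : split_P Gm" for q q'
 proof -
  let ?J = "joined (split_tail Gm i0 j0) (split_head Gm i0 j0) (split_A Gm)"
  have tf: "((p, True), (p, False)) : ?J" if "p : Gm" for p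
 proof -
  have "(split_tail Gm i0 j0 (Inr p), split_head Gm i0 j0 (Inr p)) : ?J" using that by (intro joined_edge) (auto simp: split_A_def)
  thus ?thesis by (auto simp: split_defs intro: joined_sym)
 qed
  have toF: "((p, b), (p, False)) : ?J" if "(p, b) : split_P Gm" for p b using that tf by (cases b) (auto simp: split_P_def)
  have base: "((p, False), (p', False)) : ?J" if "(p, p') : joined (fst \<circ> src) (fst \<circ> tgt) A" for p p' using that
 proof (induction rule: joined_induct)
  case (step e x y)
  have "(h (src e), h (tgt e)) : ?J"
 proof -
  have "(split_tail Gm i0 j0 (Inl e), split_head Gm i0 j0 (Inl e)) : ?J" using step by (intro joined_edge) (auto simp: split_A_def)
  thus ?thesis by (simp add: split_defs h_def)
 qed
  moreover have "(h (src e), (fst (src e), False)) : ?J" using toF[of "fst (src e)" "snd (h (src e))"] hP src_slot[OF step.hyps(2)]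
 by (metis (no_types, lifting) fst_conv h_def half_def case_prod_beta prod.collapse)
  moreover have "(h (tgt e), (fst (tgt e), False)) : ?J" using toF[of "fst (tgt e)" "snd (h (tgt e))"] hP tgt_slot[OF step.hyps(2)]
 by (metis (no_types, lifting) fst_conv h_def half_def case_prod_beta prod.collapse)
  ultimately have "((fst (src e), False), (fst (tgt e), False)) : ?J" by (meson joined_sym joined_trans)
  hence "((x, False), (y, False)) : ?J" using step.hyps(3) by (auto simp: doubleton_eq_iff intro: joined_sym)
  thus ?case by (rule joined_trans[OF step.IH])
 qed simp
  obtain p b p' b' where eq: "q = (p, b)" "q' = (p', b')" by (cases q, cases q')
  have "p : P" "p' : P" using q Gm by (auto simp: eq split_P_def)
  hence "((p, False), (p', False)) : ?J" by (intro base connected)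
  thus ?thesis using toF[of p b] toF[of p' b'] q unfolding eq by (meson joined_sym joined_trans)
 qed
  show "EX a:split_A Gm. f : {split_lf i0 j0 a, split_rf i0 j0 a}" if "f : F" for f
 proof -
  obtain p i where pi: "p : P" "i < deg p" "f = cor p i" using \<open>f : F\<close> by (auto simp: F_eq)
  obtain a where "a : A" "{lf a, rf a} = {cor p i, cor p (prev (deg p) i)}" using slot_arc[OF pi(1,2)] by blast
  hence "Inl a : split_A Gm" "f : {split_lf i0 j0 (Inl a), split_rf i0 j0 (Inl a)}" using pi by (auto simp: split_A_def split_defs)
  thus ?thesis by blast
 qed
  show "split_A Gm ~= {}"
 proof -
  obtain p where p: "p : P" using P_nonempty by auto
  obtain a where "a : A" using slot_arc[OF p deg_pos[OF p]] by blast
  thus ?thesis by (auto simp: split_A_def)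
 qed
  show "card (split_P Gm) + card F = card (split_A Gm) + 2"
 proof -
  have "card (split_P Gm) = card P + card Gm" unfolding split_P_def using finP finGm by (subst card_Un_disjoint) (auto simp: card_image inj_on_def)
  moreover have "card (split_A Gm) = card A + card Gm" unfolding split_A_def using finA finGm
 by (subst card_Un_disjoint) (auto simp: card_image inj_on_def)
  ultimately show ?thesis using euler by simp
 qed
 qed
qed

end

section \<open>The sign of a permutation and its cycles\<close>

lemma sign_cycle_of_list:
 "distinct cs ==> cs ~= [] ==> sign (cycle_of_list cs) = (-1) ^ (length cs - 1)"
proof (induction cs rule: cycle_of_list.induct)
 case (1 i j cs)
 have "sign (cycle_of_list (i # j # cs)) = sign (transpose i j) * sign (cycle_of_list (j # cs))"
 unfolding cycle_of_list.simps by (intro sign_compose permutation_of_cycle permutation_swap_id)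
 thus ?case using 1 by (simp add: sign_swap_id del: cycle_of_list.simps)
qed auto

lemma cycle_of_list_reaches:
 assumes "distinct cs" "f : set cs" "g : set cs"
 shows "EX n. (cycle_of_list cs ^^ n) f = g"
proof -
 obtain i j where i: "i < length cs" "cs ! i = f" and j: "j < length cs" "cs ! j = g" using assms by (metis in_set_conv_nth)
 define n where "n = length cs - i + j"
 have "map (cycle_of_list cs ^^ n) cs = rotate n cs" using cyclic_rotation[OF assms(1)] .
 hence "(cycle_of_list cs ^^ n) (cs ! i) = rotate n cs ! i" using i(1) by (metis nth_map)
 also have "... = cs ! ((n + i) mod length cs)" using i(1) by (simp add: nth_rotate add.commute)
 also have "(n + i) mod length cs = j" using i(1) j(1) by (simp add: n_def)
 finally show ?thesis using i j by auto
qed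

definition blocks :: "('f => 'f) => 'f set => 'f set set => bool" where
 "blocks pm S \<X> \<longleftrightarrow> finite \<X> & \<Union>\<X> = S & pairwise disjnt \<X> \<and>
  (ALL X:\<X>. finite X & X ~= {} & pm ` X \<subseteq> X & (ALL f:X. ALL g:X. EX n. (pm ^^ n) f = g)) \<and>
  sign pm = (PROD X:\<X>. (-1) ^ (card X - 1))"

lemma blocks_exist_aux:
 assumes "cycle_decomp S pm"
 shows "permutation pm & (ALL x. x ~: S --> pm x = x) & (EX \<X>. blocks pm S \<X>)" using assms
proof (induction rule: cycle_decomp.induct)
 case empty
 have "blocks id {} {}" by (simp add: blocks_def)
 hence "EX \<X>. blocks (id :: 'a => 'a) {} \<X>" by blast
 thus ?case by (metis id_apply permutation_id)
next
 case (comp I p cs)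
 let ?c = "cycle_of_list cs"
 define pm where "pm = ?c \<circ> p"
 have p: "permutation p" "!!x. x ~: I ==> p x = x" using comp.IH by auto
 obtain \<X> where X: "blocks p I \<X>" using comp.IH by blast
 have c: "?c x = x" if "x ~: set cs" for x using id_outside_supp[OF that] .
 have c_in: "?c x : set cs" if "x : set cs" for x using cycle_permutes[of cs] that by (metis permutes_in_image)
 have perm: "permutation pm" unfolding pm_def by (intro permutation_compose p permutation_of_cycle)
 have out: "pm x = x" if "x ~: set cs Un I" for x using that p c by (simp add: pm_def)
 have sgn: "sign pm = sign ?c * sign p" unfolding pm_def by (intro sign_compose p permutation_of_cycle)
 show ?case
 proof (cases "cs = []")
  case True
  hence "pm = p" by (simp add: pm_def)
  thus ?thesis using X perm out True by (auto simp: pm_def[symmetric])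
 next
  case False
  have old: "pm x = p x" if "Y : \<X>" "x : Y" for x Y
 proof -
  have "p x : Y" using X that by (auto simp: blocks_def)
  hence "p x : I" using X that by (auto simp: blocks_def)
  thus ?thesis using c comp.hyps by (auto simp: pm_def)
 qed
  have old_pow: "(pm ^^ n) x = (p ^^ n) x & (p ^^ n) x : Y" if "Y : \<X>" "x : Y" for x n Y
 proof (induction n)
  case (Suc n)
  have "p ((p ^^ n) x) : Y" using X that Suc by (auto simp: blocks_def)
  thus ?case using Suc old[OF that(1), of "(p ^^ n) x"] by simp
 qed (use that in simp)
  have new: "pm x = ?c x" if "x : set cs" for x
 proof -
  have "x ~: I" using comp.hyps(3) that by blast
  thus ?thesis using p(2) by (simp add: pm_def)
 qed
  have new_pow: "(pm ^^ n) x = (?c ^^ n) x & (?c ^^ n) x : set cs" if "x : set cs" for x n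
 proof (induction n)
  case (Suc n)
  thus ?case using new[of "(?c ^^ n) x"] c_in by simp
 qed (use that in simp)
  have notin: "set cs ~: \<X>"
 proof
  assume "set cs : \<X>"
  hence "set cs \<subseteq> I" using X by (auto simp: blocks_def)
  hence "set cs Int I = set cs" by (rule Int_absorb2)
  hence "set cs = {}" using comp.hyps(3) by simp
  thus False using False by simp
 qed
  have "blocks pm (set cs Un I) (insert (set cs) \<X>)" unfolding blocks_def
 proof (intro conjI ballI)
  show "finite (insert (set cs) \<X>)" "\<Union> (insert (set cs) \<X>) = set cs Un I" using X by (auto simp: blocks_def)
  have "disjnt (set cs) Y" if "Y : \<X>" for Y
 proof -
  have "Y \<subseteq> I" using X that by (auto simp: blocks_def)
  thus ?thesis using comp.hyps by (auto simp: disjnt_def)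
 qed
  thus "pairwise disjnt (insert (set cs) \<X>)" using X by (auto simp: blocks_def pairwise_insert disjnt_sym)
  show "sign pm = (PROD X:insert (set cs) \<X>. (-1) ^ (card X - 1))" using X notin comp.hyps False
 by (simp add: blocks_def sgn sign_cycle_of_list distinct_card)
  fix Y assume Y: "Y : insert (set cs) \<X>"
  show "finite Y" "Y ~= {}" using Y X False by (auto simp: blocks_def)
  show "pm ` Y \<subseteq> Y" using Y X old new c_in by (auto simp: blocks_def) blast
  fix f g assume fg: "f : Y" "g : Y"
  show "EX n. (pm ^^ n) f = g"
 proof (cases "Y = set cs")
  case True
  thus ?thesis using cycle_of_list_reaches[of cs f g] comp.hyps fg new_pow[of f] by auto
 next
  case False
  hence "Y : \<X>" using Y by simp
  have "ALL X:\<X>. ALL f:X. ALL g:X. EX n. (p ^^ n) f = g" using X unfolding blocks_def by metis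
  then obtain n where "(p ^^ n) f = g" using \<open>Y : \<X>\<close> fg by meson
  with \<open>Y : \<X>\<close> show ?thesis using old_pow[of Y f n] fg by auto
 qed
 qed
  thus ?thesis using perm out by (auto simp: pm_def[symmetric])
 qed
qed

lemma blocks_exist:
 assumes "finite S" "pm permutes S"
 shows "EX \<X>. blocks pm S \<X>" using blocks_exist_aux[OF cycle_decomposition[OF assms(2,1)]] by blast

section \<open>All states have the same sign\<close>

locale signed_map = sphere_map P deg A src tgt cor F
 for P :: "'p set" and deg A and src tgt :: "'a => 'p \<times> nat" and cor :: "'p => nat => 'f" and F +
 fixes C :: "'p set" and K :: "'p => nat => int"
 assumes C: "C \<subseteq> P"
  and K_sign: "p : C ==> i < deg p ==> K p i = 1 \<or> K p i = -1"
  and K_step: "p : C ==> i < deg p ==> K p (prev (deg p) i) * K p i = (if (p, i) : tgt ` A then -1 else 1)"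
  and odd_rest: "p : P - C ==> (PROD i<deg p. if (p, i) : tgt ` A then -1 else 1 :: int) = -1"
begin

definition \<eta> :: "'p \<times> nat => int" where "\<eta> s = (if s : tgt ` A then -1 else 1)"

definition state :: "'a => ('p => nat) => bool" where
 "state dl s \<longleftrightarrow> (ALL p:C. s p < deg p) & bij_betw (%p. cor p (s p)) C (F - {lf dl, rf dl})"

lemma eta_range:
 assumes "p : C" "i <= j" "j < deg p"
 shows "(PROD l:{i<..j}. \<eta> (p, l)) = K p i * K p j" using assms(2,3)
proof (induction j rule: dec_induct)
 case base
 thus ?case using K_sign[OF assms(1), of i] by auto
next
 case (step j)
 have "{i<..Suc j} = insert (Suc j) {i<..j}" using step by auto
 hence "(PROD l:{i<..Suc j}. \<eta> (p, l)) = \<eta> (p, Suc j) * (K p i * K p j)" using step by simp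
 also have "\<eta> (p, Suc j) = K p j * K p (Suc j)" using K_step[OF assms(1), of "Suc j"] step by (simp add: \<eta>_def prev_def)
 finally show ?case using K_sign[OF assms(1), of j] step by auto
qed

lemma eta_cycle:
 assumes "p : C"
 shows "(PROD l<deg p. \<eta> (p, l)) = 1"
proof -
 have d: "0 < deg p" using assms C deg_pos by auto
 have "{..<deg p} = insert 0 {0<..deg p - 1}" using d by auto
 hence "(PROD l<deg p. \<eta> (p, l)) = \<eta> (p, 0) * (K p 0 * K p (deg p - 1))" using eta_range[OF assms, of 0 "deg p - 1"] d by simp
 also have "\<eta> (p, 0) = K p (deg p - 1) * K p 0" using K_step[OF assms, of 0] d by (simp add: \<eta>_def prev_def)
 finally show ?thesis using K_sign[OF assms, of 0] K_sign[OF assms, of "deg p - 1"] d by auto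
qed

lemma covered_once:
 assumes "state dl s" "Gm = {p : C. cor p (s p) : X}" "f : X" "X \<subseteq> F"
 shows "(SUM p:Gm. of_bool (cor p (s p) = f) :: nat) = of_bool (f ~: {lf dl, rf dl})"
proof -
 have bij: "bij_betw (%p. cor p (s p)) C (F - {lf dl, rf dl})" using assms by (simp add: state_def)
 have finC: "finite C" using C finP finite_subset by blast
 show ?thesis
 proof (cases "f : {lf dl, rf dl}")
  case True
  hence "cor p (s p) ~= f" if "p : C" for p using bij_betwE[OF bij] that by auto
  thus ?thesis using True assms(2) by (auto intro!: sum.neutral)
 next
  case False
  hence "f : (%p. cor p (s p)) ` C" using bij assms(3,4) by (auto simp: bij_betw_def)
  then obtain p0 where p0: "p0 : C" "cor p0 (s p0) = f" by auto
  hence eq: "cor p (s p) = f \<longleftrightarrow> p = p0" if "p : C" for p using bij that by (auto simp: bij_betw_def inj_on_def)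
  have "(SUM p:Gm. of_bool (cor p (s p) = f) :: nat) = (SUM p:Gm. of_bool (p = p0))" by (rule sum.cong) (use eq assms(2) in auto)
  also have "... = 1" using p0 assms(2,3) finC by (simp add: of_bool_def sum.delta)
  finally show ?thesis using False by simp
 qed
qed

text \<open>The case of a single closed curve: the product of the corner signs along it is a parity of crossings and regions inside, which Euler's formula determines.\<close>

lemma curve_sign:
 assumes dl: "dl : A" "lf dl ~= rf dl" "dl' : A" "lf dl' ~= rf dl'"
  and st: "state dl s" "state dl' s'"
  and X: "X \<subseteq> F" "X ~= {}"
  and inv: "!!p. p : C ==> cor p (s p) : X \<longleftrightarrow> cor p (s' p) : X"
  and Gm: "Gm = {p : C. cor p (s p) : X}"
  and diff: "!!p. p : Gm ==> s p ~= s' p"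
  and cases: "{lf dl, rf dl, lf dl', rf dl'} Int X = {} & Dt = {} \<or>
  dl ~= dl' & {lf dl, rf dl, lf dl', rf dl'} \<subseteq> X & Dt = {dl, dl'}"
  and i0: "i0 = (%p. min (s p) (s' p))" and j0: "j0 = (%p. max (s p) (s' p))"
  and T: "T = Inr ` Gm Un Inl ` Dt"
  and conn: "!!f g. f : X ==> g : X ==> (f, g) : joined (split_lf i0 j0) (split_rf i0 j0) T"
 shows "EX ph::'a + 'p => int. (ALL t:T. ph t = 1 \<or> ph t = -1) \<and>
  (ALL f:F. (SUM t:T. ph t * (of_bool (split_lf i0 j0 t = f) - of_bool (split_rf i0 j0 t = f))) = 0) \<and>
  (PROD p:Gm. K p (s p) * K p (s' p)) = (-1) ^ (card Gm + 1) * (PROD t:Dt. ph (Inl t))"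
proof -
 have GmC: "Gm \<subseteq> C" and GmP: "Gm \<subseteq> P" using Gm C by auto
 have finC: "finite C" using C finP finite_subset by blast
 have finGm: "finite Gm" using finC GmC finite_subset by blast
 have sdeg: "s p < deg p" "s' p < deg p" if "p : C" for p using st that by (auto simp: state_def)
 have ij: "i0 p < j0 p & j0 p < deg p" if "p : Gm" for p using diff[OF that] sdeg[of p] GmC that by (auto simp: i0 j0)
 interpret D: dual_graphs "split_P Gm" "split_A Gm" F "split_tail Gm i0 j0" "split_head Gm i0 j0"
  "split_lf i0 j0" "split_rf i0 j0" by (rule split_dual[OF GmP ij])
 have DtA: "Dt \<subseteq> A" and finDt: "finite Dt" using cases dl by auto
 have TA: "T \<subseteq> split_A Gm" using DtA by (auto simp: T split_A_def)
 have DtX: "lf t : X & rf t : X" if "t : Dt" for t using cases that by auto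
 have GmX: "cor p (i0 p) : X" "cor p (j0 p) : X" if "p : Gm" for p using that inv[of p] by (auto simp: Gm i0 j0 min_def max_def)
 have TX: "split_lf i0 j0 t : X & split_rf i0 j0 t : X" if "t : T" for t using that DtX GmX by (auto simp: T split_defs)
 have Gm': "Gm = {p : C. cor p (s' p) : X}" using Gm inv by auto
 have degX: "(SUM t:T. of_bool (split_lf i0 j0 t = f) + of_bool (split_rf i0 j0 t = f)) = (2::nat)"
  if f: "f : X" for f
 proof -
  have "(SUM t:T. of_bool (split_lf i0 j0 t = f) + of_bool (split_rf i0 j0 t = f) :: nat) =
  (SUM p:Gm. of_bool (cor p (j0 p) = f) + of_bool (cor p (i0 p) = f)) +
  (SUM t:Dt. of_bool (lf t = f) + of_bool (rf t = f))" unfolding T using finGm finDt by (subst sum.union_disjoint) (auto simp: sum.reindex split_defs)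
  also have "(SUM p:Gm. of_bool (cor p (j0 p) = f) + of_bool (cor p (i0 p) = f) :: nat) =
  (SUM p:Gm. of_bool (cor p (s p) = f) + of_bool (cor p (s' p) = f))" by (rule sum.cong) (auto simp: i0 j0 min_def max_def)
  also have "... = of_bool (f ~: {lf dl, rf dl}) + of_bool (f ~: {lf dl', rf dl'})"
 unfolding sum.distrib using covered_once[OF st(1) Gm f X(1)] covered_once[OF st(2) Gm' f X(1)] by simp
  finally show ?thesis using cases f dl by auto
 qed
 define q where "q = split_head Gm i0 j0 (Inl dl)"
 have q: "q : split_P Gm" unfolding q_def using dl by (intro D.ends) (auto simp: split_A_def)
 obtain I where I: "I \<subseteq> split_P Gm" "q ~: I"
  and cut: "!!t. t : T ==> split_head Gm i0 j0 t : I \<longleftrightarrow> split_tail Gm i0 j0 t ~: I"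
  and keep: "!!a. a : split_A Gm - T ==> split_head Gm i0 j0 a : I \<longleftrightarrow> split_tail Gm i0 j0 a : I"
  and same: "!!f a b. f : F - X ==> a : split_A Gm ==> b : split_A Gm ==>
  f : {split_lf i0 j0 a, split_rf i0 j0 a} ==> f : {split_lf i0 j0 b, split_rf i0 j0 b} ==>
  split_head Gm i0 j0 a : I \<longleftrightarrow> split_head Gm i0 j0 b : I"
  and count: "card {f : F - X. EX a:split_A Gm. f : {split_lf i0 j0 a, split_rf i0 j0 a} & split_head Gm i0 j0 a : I} + card I =
  1 + card {a : split_A Gm - T. split_head Gm i0 j0 a : I}" using D.jordan[OF TA X TX degX conn q] by blast
 let ?h = "half Gm i0 j0"
 have finI: "finite I" using I(1) D.fin finite_subset by blast
 have half_out: "?h (p, i) = (p, False)" if "p ~: Gm" for p i using that by (simp add: half_def)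
 have inT: "Inl a : T \<longleftrightarrow> a : Dt" for a by (auto simp: T)
 \<comment> \<open>a region off the curve lies on the same side as any crossing at one of its corners\<close>
 have corner_side: "(p, False) : I \<longleftrightarrow> split_head Gm i0 j0 b : I"
  if pi: "p : P" "p ~: Gm" "i < deg p" "cor p i ~: X" and b: "b : split_A Gm" "cor p i : {split_lf i0 j0 b, split_rf i0 j0 b}"
  for p i b
 proof -
  obtain a where a: "a : A" "src a = (p, i) \<or> tgt a = (p, i)" "{lf a, rf a} = {cor p i, cor p (prev (deg p) i)}"
 using slot_arc[OF pi(1,3)] by blast
  have "a ~: Dt" using DtX[of a] a(3) pi(4) by (auto simp: doubleton_eq_iff)
  hence aT: "Inl a : split_A Gm - T" using a inT by (auto simp: split_A_def)
  have "split_tail Gm i0 j0 (Inl a) = (p, False) \<or> split_head Gm i0 j0 (Inl a) = (p, False)"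
 using a(2) half_out[OF pi(2)] by (auto simp: split_defs)
  hence "(p, False) : I \<longleftrightarrow> split_head Gm i0 j0 (Inl a) : I" using keep[OF aT] by auto
  also have "... \<longleftrightarrow> split_head Gm i0 j0 b : I"
 proof (rule same)
  show "cor p i : F - X" using pi by (auto simp: F_eq)
  show "cor p i : {split_lf i0 j0 (Inl a), split_rf i0 j0 (Inl a)}" using a(3) by (auto simp: split_defs)
 qed (use aT b in auto)
  finally show ?thesis .
 qed
 define CI where "CI = {p : C - Gm. (p, False) : I}"
 define NI where "NI = {p : P - C. (p, False) : I}"
 define RI where "RI = {f : F - X. EX a:split_A Gm. f : {split_lf i0 j0 a, split_rf i0 j0 a} & split_head Gm i0 j0 a : I}"
 define SI where "SI = {a : A - Dt. ?h (tgt a) : I}"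
 have bij: "bij_betw (%p. cor p (s p)) C (F - {lf dl, rf dl})" using st by (simp add: state_def)
 have "(%p. cor p (s p)) ` CI = RI"
 proof (intro equalityI subsetI)
  fix f assume "f : (%p. cor p (s p)) ` CI"
  then obtain p where p: "p : C" "p ~: Gm" "(p, False) : I" "f = cor p (s p)" by (auto simp: CI_def)
  hence fX: "f ~: X" using Gm by auto
  have f: "f : F" using bij_betwE[OF bij] p by auto
  then obtain b where b: "b : split_A Gm" "f : {split_lf i0 j0 b, split_rf i0 j0 b}" using D.F_touched by blast
  have "split_head Gm i0 j0 b : I" using corner_side[of p "s p" b] p b fX C sdeg by auto
  thus "f : RI" using f fX b by (auto simp: RI_def)
 next
  fix f assume "f : RI"
  then obtain b where b: "f : F" "f ~: X" "b : split_A Gm" "f : {split_lf i0 j0 b, split_rf i0 j0 b}" "split_head Gm i0 j0 b : I"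
 by (auto simp: RI_def)
  have "f ~: {lf dl, rf dl}"
 proof
  assume f: "f : {lf dl, rf dl}"
  have "Inl dl : split_A Gm" using dl by (auto simp: split_A_def)
  hence "split_head Gm i0 j0 (Inl dl) : I \<longleftrightarrow> split_head Gm i0 j0 b : I" using same[of f "Inl dl" b] b f by (auto simp: split_defs)
  thus False using I(2) b(5) by (simp add: q_def)
 qed
  hence "f : (%p. cor p (s p)) ` C" using bij b(1) by (auto simp: bij_betw_def)
  then obtain p where p: "p : C" "f = cor p (s p)" by auto
  hence "p ~: Gm" using b(2) by (auto simp: Gm)
  moreover have "(p, False) : I" using corner_side[of p "s p" b] p b \<open>p ~: Gm\<close> C sdeg by auto
  ultimately show "f : (%p. cor p (s p)) ` CI" using p by (auto simp: CI_def)
 qed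
 moreover have "inj_on (%p. cor p (s p)) CI" using bij by (auto simp: bij_betw_def CI_def intro: inj_on_subset)
 ultimately have cRI: "card RI = card CI" by (metis card_image)
 have one_half: "(p, True) : I \<longleftrightarrow> (p, False) ~: I" if "p : Gm" for p using cut[of "Inr p"] that by (auto simp: T split_defs)
 have cI: "card I = card Gm + card CI + card NI"
 proof -
  define G where "G = {x : I. fst x : Gm}"
  have "bij_betw fst G Gm"
 proof (rule bij_betw_imageI)
  show "inj_on fst G"
 proof (rule inj_onI)
  fix x y assume xy: "x : G" "y : G" "fst x = fst y"
  thus "x = y" using one_half[of "fst x"] by (cases x; cases y; cases "snd x"; cases "snd y") (auto simp: G_def)
 qed
  show "fst ` G = Gm" using one_half by (force simp: G_def)
 qed
  hence 1: "card G = card Gm" by (rule bij_betw_same_card)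
  have "I = G Un ((%p. (p, False)) ` CI Un (%p. (p, False)) ` NI)"
 proof (intro equalityI subsetI)
  fix x assume x: "x : I"
  hence "x = (fst x, False) & fst x : P \<or> fst x : Gm" using I(1) by (auto simp: split_P_def)
  thus "x : G Un ((%p. (p, False)) ` CI Un (%p. (p, False)) ` NI)" using x by (cases "fst x : Gm"; cases x) (auto simp: G_def CI_def NI_def image_iff)
 qed (auto simp: G_def CI_def NI_def)
  moreover have "finite CI" "finite NI" "finite G" using finC finP finI by (auto simp: CI_def NI_def G_def)
  moreover have "G Int ((%p. (p, False)) ` CI Un (%p. (p, False)) ` NI) = {}" using GmC by (auto simp: G_def CI_def NI_def)
  moreover have "(%p. (p, False)) ` CI Int (%p. (p, False)) ` NI = {}" by (auto simp: CI_def NI_def)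
  ultimately have "card I = card G + (card CI + card NI)" by (simp add: card_Un_disjoint card_image inj_on_def)
  thus ?thesis using 1 by simp
 qed
 have cSI: "{a : split_A Gm - T. split_head Gm i0 j0 a : I} = Inl ` SI" by (auto simp: split_A_def T SI_def split_defs)
 have "card RI + card I = 1 + card SI" using count unfolding cSI RI_def[symmetric] by (simp add: card_image)
 hence parity: "card SI + 1 = card Gm + 2 * card CI + card NI" using cRI cI by simp
 define E where "E = (PROD p:P. PROD i<deg p. if ?h (p, i) : I then \<eta> (p, i) else 1)"
 have E1: "E = (PROD p:Gm. K p (s p) * K p (s' p)) * (-1) ^ card NI"
 proof -
  have G: "(PROD i<deg p. if ?h (p, i) : I then \<eta> (p, i) else 1) = K p (s p) * K p (s' p)" if p: "p : Gm" for p
 proof -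
  have pC: "p : C" using p GmC by auto
  have Rs: "{i0 p<..j0 p} \<subseteq> {..<deg p}" using ij[OF p] by auto
  have KK: "K p (s p) * K p (s' p) = K p (i0 p) * K p (j0 p)" by (simp add: i0 j0 min_def max_def mult.commute)
  have t: "(PROD i:{i0 p<..j0 p}. \<eta> (p, i)) = K p (i0 p) * K p (j0 p)" using ij[OF p] by (intro eta_range pC) auto
  have KK1: "(K p (i0 p) * K p (j0 p)) * (K p (i0 p) * K p (j0 p)) = 1" using K_sign[OF pC, of "i0 p"] K_sign[OF pC, of "j0 p"] ij[OF p] by auto
  have "(PROD i:{..<deg p} - {i0 p<..j0 p}. \<eta> (p, i)) * (K p (i0 p) * K p (j0 p)) = 1"
 using eta_cycle[OF pC] prod.subset_diff[OF Rs, of "%i. \<eta> (p, i)"] t by simp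
  hence c: "(PROD i:{..<deg p} - {i0 p<..j0 p}. \<eta> (p, i)) = K p (i0 p) * K p (j0 p)" using KK1 by (metis mult.assoc mult_1_left mult_1_right)
  have "(PROD i<deg p. if ?h (p, i) : I then \<eta> (p, i) else 1) =
  (PROD i:{..<deg p} - {i0 p<..j0 p}. if ?h (p, i) : I then \<eta> (p, i) else 1) *
  (PROD i:{i0 p<..j0 p}. if ?h (p, i) : I then \<eta> (p, i) else 1)" by (rule prod.subset_diff[OF Rs]) simp
  also have "(PROD i:{..<deg p} - {i0 p<..j0 p}. if ?h (p, i) : I then \<eta> (p, i) else 1) =
  (PROD i:{..<deg p} - {i0 p<..j0 p}. if (p, False) : I then \<eta> (p, i) else 1)" by (rule prod.cong) (use p in \<open>auto simp: half_def\<close>)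
  also have "(PROD i:{i0 p<..j0 p}. if ?h (p, i) : I then \<eta> (p, i) else 1) =
  (PROD i:{i0 p<..j0 p}. if (p, True) : I then \<eta> (p, i) else 1)" by (rule prod.cong) (use p in \<open>auto simp: half_def\<close>)
  finally show ?thesis using one_half[OF p] c t KK by (cases "(p, False) : I") simp_all
 qed
  have N: "(PROD i<deg p. if ?h (p, i) : I then \<eta> (p, i) else 1) = (if p : NI then -1 else 1)" if p: "p : P - Gm" for p
 proof -
  have "(PROD i<deg p. if ?h (p, i) : I then \<eta> (p, i) else 1) =
  (if (p, False) : I then PROD i<deg p. \<eta> (p, i) else 1)" using p by (simp add: half_out)
  also have "... = (if p : NI then -1 else 1)" using p eta_cycle[of p] odd_rest[of p] by (auto simp: NI_def \<eta>_def)
  finally show ?thesis .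
 qed
  have "E = (PROD p:P - Gm. PROD i<deg p. if ?h (p, i) : I then \<eta> (p, i) else 1) *
  (PROD p:Gm. PROD i<deg p. if ?h (p, i) : I then \<eta> (p, i) else 1)" unfolding E_def by (rule prod.subset_diff[OF GmP finP])
  also have "... = (PROD p:P - Gm. if p : NI then -1 else 1) * (PROD p:Gm. K p (s p) * K p (s' p))" using G N by simp
  also have "(PROD p:P - Gm. if p : NI then -1 else 1 :: int) = (-1) ^ card NI"
 proof -
  have "(P - Gm) Int {p. p : NI} = NI" using GmC by (auto simp: NI_def)
  thus ?thesis using finP by (simp add: prod.If_cases)
 qed
  finally show ?thesis by (simp add: mult.commute)
 qed
 define ph where "ph t = (if split_head Gm i0 j0 t : I then 1 else -1 :: int)" for t
 have E2: "E = (-1) ^ card SI * (PROD t:Dt. - ph (Inl t))"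
 proof -
  have "E = (PROD x:Sigma P (%p. {..<deg p}). if ?h x : I then \<eta> x else 1)"
 unfolding E_def using finP by (subst prod.Sigma) (auto intro!: prod.cong)
  also have "... = (PROD x:src ` A. if ?h x : I then \<eta> x else 1) * (PROD x:tgt ` A. if ?h x : I then \<eta> x else 1)"
 unfolding slots[symmetric] using finA inj(3) by (subst prod.union_disjoint) auto
  also have "(PROD x:src ` A. if ?h x : I then \<eta> x else 1) = 1" using inj(3) by (intro prod.neutral) (auto simp: \<eta>_def)
  also have "(PROD x:tgt ` A. if ?h x : I then \<eta> x else 1) = (PROD a:A. if ?h (tgt a) : I then -1 else 1)"
 unfolding prod.reindex[OF inj(2)] by (rule prod.cong) (auto simp: \<eta>_def)
  also have "... = (PROD a:A - Dt. if ?h (tgt a) : I then -1 else 1) * (PROD a:Dt. if ?h (tgt a) : I then -1 else 1)"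
 by (rule prod.subset_diff[OF DtA finA])
  also have "(PROD a:A - Dt. if ?h (tgt a) : I then -1 else 1 :: int) = (-1) ^ card SI"
 proof -
  have "(A - Dt) Int {a. ?h (tgt a) : I} = SI" by (auto simp: SI_def)
  thus ?thesis using finA by (simp add: prod.If_cases)
 qed
  also have "(PROD a:Dt. if ?h (tgt a) : I then -1 else 1 :: int) = (PROD t:Dt. - ph (Inl t))" by (rule prod.cong) (auto simp: ph_def split_defs)
  finally show ?thesis by simp
 qed
 have "(PROD t:Dt. - ph (Inl t)) = (PROD t:Dt. ph (Inl t))" using cases by auto
 hence NS: "(PROD p:Gm. K p (s p) * K p (s' p)) * (-1) ^ card NI = (-1) ^ card SI * (PROD t:Dt. ph (Inl t))" using E1 E2 by simp
 have "(PROD p:Gm. K p (s p) * K p (s' p)) * ((-1) ^ card NI * (-1) ^ card NI) =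
  (-1) ^ (card SI + card NI) * (PROD t:Dt. ph (Inl t))" unfolding mult.assoc[symmetric] NS power_add by (simp only: ac_simps)
 moreover have "(-1::int) ^ card NI * (-1) ^ card NI = 1" by (simp flip: power_add)
 moreover have "(-1::int) ^ (card SI + card NI) = (-1) ^ (card Gm + 1)"
 proof -
  have "card SI + card NI + 2 = card Gm + 1 + 2 * (card CI + card NI)" using parity by simp
  hence "even (card SI + card NI) \<longleftrightarrow> even (card Gm + 1)" by presburger
  thus ?thesis by (simp add: minus_one_power_iff)
 qed
 ultimately have main: "(PROD p:Gm. K p (s p) * K p (s' p)) = (-1) ^ (card Gm + 1) * (PROD t:Dt. ph (Inl t))" by simp
 have "(SUM t:T. ph t * (of_bool (split_lf i0 j0 t = f) - of_bool (split_rf i0 j0 t = f))) = 0" if "f : F" for f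
 proof -
  have "(SUM a:split_A Gm. (of_bool (split_head Gm i0 j0 a : I) - of_bool (split_tail Gm i0 j0 a : I)) *
  (of_bool (split_lf i0 j0 a : {f}) - of_bool (split_rf i0 j0 a : {f})) :: int) = 0" using that I(1) by (intro D.orth_sets) auto
  moreover have "(SUM a:split_A Gm - T. (of_bool (split_head Gm i0 j0 a : I) - of_bool (split_tail Gm i0 j0 a : I)) *
  (of_bool (split_lf i0 j0 a : {f}) - of_bool (split_rf i0 j0 a : {f})) :: int) = 0" using keep by (intro sum.neutral) auto
  moreover have "(SUM a:T. (of_bool (split_head Gm i0 j0 a : I) - of_bool (split_tail Gm i0 j0 a : I)) *
  (of_bool (split_lf i0 j0 a : {f}) - of_bool (split_rf i0 j0 a : {f})) :: int) =
  (SUM t:T. ph t * (of_bool (split_lf i0 j0 t = f) - of_bool (split_rf i0 j0 t = f)))" using cut by (intro sum.cong) (auto simp: ph_def)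
  ultimately show ?thesis by (simp add: sum.subset_diff[OF TA D.fin(2)])
 qed
 thus ?thesis using main by (intro exI[of _ ph]) (auto simp: ph_def)
qed

text \<open>The permutation that compares two states splits into cycles, each of which is a closed curve on the sphere; the signs are multiplicative over the curves.\<close>

theorem coherence:
 assumes dl: "dl : A" "lf dl ~= rf dl" "dl' : A" "lf dl' ~= rf dl'"
  and st: "state dl s" "state dl' s'"
  and pm: "pm permutes F" "!!p. p : C ==> pm (cor p (s p)) = cor p (s' p)"
  "pm (lf dl) = lf dl'" "pm (rf dl) = rf dl'"
 shows "sign pm = (PROD p:C. K p (s p) * K p (s' p))"
proof -
 obtain \<X> where \<X>: "blocks pm F \<X>" using blocks_exist[OF finF pm(1)] by blast
 have fin\<X>: "finite \<X>" and Un: "\<Union>\<X> = F" and disj: "pairwise disjnt \<X>"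
  and XX: "!!X. X : \<X> ==> finite X & X ~= {} & pm ` X \<subseteq> X"
  and reach: "!!X f g. X : \<X> ==> f : X ==> g : X ==> EX n. (pm ^^ n) f = g"
  and sgn: "sign pm = (PROD X:\<X>. (-1) ^ (card X - 1))" using \<X> by (auto simp: blocks_def)
 have XF: "X \<subseteq> F" if "X : \<X>" for X using that Un by blast
 have same: "X = Y" if "X : \<X>" "Y : \<X>" "f : X" "f : Y" for X Y f using disj that by (auto simp: pairwise_def disjnt_def)
 have finC: "finite C" using C finP finite_subset by blast
 have bij: "bij_betw (%p. cor p (s p)) C (F - {lf dl, rf dl})" using st by (simp add: state_def)
 have corF: "cor p (s p) : F - {lf dl, rf dl}" if "p : C" for p using bij_betwE[OF bij] that by blast
 have dlF: "lf dl : F" "rf dl : F" using src_slot[OF dl(1)] prev_less by (auto simp: lf_def rf_def F_eq)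
 have pm_inv: "pm f : X \<longleftrightarrow> f : X" if X: "X : \<X>" "f : F" for X f
 proof
  assume f: "pm f : X"
  obtain Y where Y: "Y : \<X>" "f : Y" using X Un by blast
  hence "pm f : Y" using XX by blast
  thus "f : X" using same[OF X(1) Y(1) f] Y by blast
 qed (use XX X in blast)
 define rows where "rows X = {p : C. cor p (s p) : X}" for X
 define kp where "kp X = (PROD p:rows X. K p (s p) * K p (s' p))" for X
 have inv: "cor p (s p) : X \<longleftrightarrow> cor p (s' p) : X" if "X : \<X>" "p : C" for X p
 using pm_inv[OF that(1), of "cor p (s p)"] corF[OF that(2)] pm(2)[OF that(2)] by auto
 have union_rows: "(PROD X:\<Y>. kp X) = (PROD p:rows (\<Union>\<Y>). K p (s p) * K p (s' p))" if "\<Y> \<subseteq> \<X>" for \<Y>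
 proof -
  have "rows (\<Union>\<Y>) = (\<Union>X\<in>\<Y>. rows X)" by (auto simp: rows_def)
  moreover have "rows X Int rows Y = {}" if "X : \<Y>" "Y : \<Y>" "X ~= Y" for X Y
 using same[of X Y] that \<open>\<Y> \<subseteq> \<X>\<close> by (auto simp: rows_def)
  moreover have "finite \<Y>" using that fin\<X> finite_subset by blast
  ultimately show ?thesis unfolding kp_def using finC by (subst prod.UNION_disjoint[symmetric]) (auto simp: rows_def)
 qed
 have card_rows: "card (rows X) = card (X - {lf dl, rf dl})" if "X \<subseteq> F" for X
 proof -
  have "bij_betw (%p. cor p (s p)) (rows X) (X - {lf dl, rf dl})"
 proof (rule bij_betw_imageI)
  show "inj_on (%p. cor p (s p)) (rows X)" using bij by (auto simp: bij_betw_def rows_def intro: inj_on_subset)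
  have "EX p:C. f = cor p (s p)" if "f : X - {lf dl, rf dl}" for f
 proof -
  have "f : (%p. cor p (s p)) ` C" using bij that \<open>X \<subseteq> F\<close> by (auto simp: bij_betw_def)
  thus ?thesis by auto
 qed
  thus "(%p. cor p (s p)) ` rows X = X - {lf dl, rf dl}" using corF by (fastforce simp: rows_def)
 qed
  thus ?thesis by (rule bij_betw_same_card)
 qed
 have fixed: "X = {f}" if "X : \<X>" "f : X" "pm f = f" for X f
 proof -
  have pow: "(pm ^^ n) f = f" for n by (induction n) (simp_all add: that(3))
  have "g = f" if "g : X" for g using reach[OF \<open>X : \<X>\<close> \<open>f : X\<close> that] by (metis pow)
  thus ?thesis using that(2) by blast
 qed
 define i0 where "i0 = (%p. min (s p) (s' p))"
 define j0 where "j0 = (%p. max (s p) (s' p))"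
 have row_edge: "(f, pm f) : joined (split_lf i0 j0) (split_rf i0 j0) T"
  if "f : F" "f ~: {lf dl, rf dl}" "f : X" "Inr ` rows X \<subseteq> T" for f X and T :: "('a + 'p) set"
 proof -
  have "f : (%p. cor p (s p)) ` C" using bij that by (auto simp: bij_betw_def)
  then obtain p where p: "p : C" "f = cor p (s p)" by auto
  hence "Inr p : T" using that by (auto simp: rows_def)
  hence "(split_lf i0 j0 (Inr p), split_rf i0 j0 (Inr p)) : joined (split_lf i0 j0) (split_rf i0 j0) T" by (rule joined_edge)
  thus ?thesis using p pm(2)[OF p(1)] by (cases "s p <= s' p") (auto simp: split_defs i0_def j0_def min_def max_def intro: joined_sym)
 qed
 have ordinary: "kp X = (-1) ^ (card X - 1)" if X: "X : \<X>" and o: "dl = dl' \<or> {lf dl, rf dl} Int X = {}" for X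
 proof (cases "{lf dl, rf dl} Int X = {}")
  case False
  then obtain f where f: "f : {lf dl, rf dl}" "f : X" "pm f = f" using o pm(3,4) by auto
  hence "X = {f}" using fixed[OF X] by blast
  thus ?thesis using f corF by (auto simp: kp_def rows_def intro!: prod.neutral)
 next
  case True
  have cr: "card (rows X) = card X"
 proof -
  have "X - {lf dl, rf dl} = X" using True by auto
  thus ?thesis using card_rows[OF XF[OF X]] by simp
 qed
  show ?thesis
 proof (cases "EX p:rows X. s p = s' p")
  case same_corner: True
  then obtain p where p: "p : C" "cor p (s p) : X" "s p = s' p" by (auto simp: rows_def)
  have "X = {cor p (s p)}" using fixed[OF X p(2)] pm(2)[OF p(1)] p(3) by simp
  hence c1: "card X = 1" by simp
  then obtain p' where "rows X = {p'}" using cr by (metis card_1_singletonE)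
  moreover have "p : rows X" using p by (auto simp: rows_def)
  ultimately have "rows X = {p}" by auto
  moreover have "K p (s p) * K p (s' p) = 1" using K_sign[OF p(1), of "s p"] p st by (auto simp: state_def)
  ultimately show ?thesis using c1 by (simp add: kp_def)
 next
  case diff: False
  have nX: "{lf dl, rf dl, lf dl', rf dl'} Int X = {}" using True pm_inv[OF X dlF(1)] pm_inv[OF X dlF(2)] pm(3,4) by auto
  have "EX ph::'a + 'p => int. (ALL t:Inr ` rows X. ph t = 1 \<or> ph t = -1) \<and>
  (ALL f:F. (SUM t:Inr ` rows X. ph t * (of_bool (split_lf i0 j0 t = f) - of_bool (split_rf i0 j0 t = f))) = 0) \<and>
  (PROD p:rows X. K p (s p) * K p (s' p)) = (-1) ^ (card (rows X) + 1) * (PROD t:{}. ph (Inl t))"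
 proof (rule curve_sign[OF dl st XF[OF X] _ inv[OF X] rows_def _ _ i0_def j0_def])
  show "X ~= {}" using XX X by blast
  show "{lf dl, rf dl, lf dl', rf dl'} Int X = {} & {} = {} \<or>
  dl ~= dl' & {lf dl, rf dl, lf dl', rf dl'} \<subseteq> X & {} = {dl, dl'}" using nX by simp
  show "s p ~= s' p" if "p : rows X" for p using diff that by blast
  fix f g assume fg: "f : X" "g : X"
  obtain n where n: "(pm ^^ n) f = g" using reach[OF X fg] by blast
  have "(pm ^^ n) f : X & (f, (pm ^^ n) f) : joined (split_lf i0 j0) (split_rf i0 j0) (Inr ` rows X)" for n
 proof (induction n)
  case (Suc n)
  have "((pm ^^ n) f, pm ((pm ^^ n) f)) : joined (split_lf i0 j0) (split_rf i0 j0) (Inr ` rows X)"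
 using Suc XF[OF X] nX by (intro row_edge[where X = X]) auto
  thus ?case using Suc XX[OF X] by (auto intro: joined_trans)
 qed (use fg in simp)
  thus "(f, g) : joined (split_lf i0 j0) (split_rf i0 j0) (Inr ` rows X)" using n by blast
 next
  show "Inr ` rows X = Inr ` rows X Un Inl ` ({} :: 'a set)" by (metis Un_empty_right image_empty)
 qed
  hence "kp X = (-1) ^ (card X + 1)" unfolding kp_def by (elim exE conjE) (simp add: cr)
  moreover have "card X > 0" using XX[OF X] by (simp add: card_gt_0_iff)
  ultimately show ?thesis by (simp add: minus_one_power_iff)
 qed
 qed
 define \<S> where "\<S> = {X : \<X>. {lf dl, rf dl} Int X ~= {}}"
 have special: "(PROD X:\<S>. kp X) = (PROD X:\<S>. (-1) ^ (card X - 1))"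
 proof (cases "dl = dl'")
  case True
  show ?thesis
 proof (rule prod.cong[OF refl])
  fix X assume "X : \<S>"
  hence "X : \<X>" by (simp add: \<S>_def)
  thus "kp X = (-1) ^ (card X - 1)" using True by (intro ordinary) simp_all
 qed
 next
  case False
  obtain X1 where X1: "X1 : \<X>" "lf dl : X1" using dlF Un by blast
  obtain X2 where X2: "X2 : \<X>" "rf dl : X2" using dlF Un by blast
  have \<S>: "\<S> = {X1, X2}" using X1 X2 same unfolding \<S>_def by blast
  define X0 where "X0 = X1 Un X2"
  have X0F: "X0 \<subseteq> F" using XF X1 X2 by (auto simp: X0_def)
  have pmX0: "pm f : X0 \<longleftrightarrow> f : X0" if "f : F" for f using pm_inv[OF X1(1) that] pm_inv[OF X2(1) that] by (simp add: X0_def)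
  define T where "T = Inr ` rows X0 Un Inl ` {dl, dl'}"
  let ?J = "joined (split_lf i0 j0) (split_rf i0 j0) T"
  have lr: "(lf dl, rf dl) : ?J"
 proof -
  have "(split_lf i0 j0 (Inl dl), split_rf i0 j0 (Inl dl)) : ?J" by (rule joined_edge) (simp add: T_def)
  thus ?thesis by (simp add: split_defs)
 qed
  have to_l: "(f, lf dl) : ?J" if "f : X0" for f
 proof -
  have ex: "EX n. (pm ^^ n) f : {lf dl, rf dl}" using that reach[OF X1(1) _ X1(2)] reach[OF X2(1) _ X2(2)] by (auto simp: X0_def)
  define n where "n = (LEAST n. (pm ^^ n) f : {lf dl, rf dl})"
  have n: "(pm ^^ n) f : {lf dl, rf dl}" unfolding n_def using ex by (rule LeastI_ex)
  have below: "(pm ^^ i) f ~: {lf dl, rf dl}" if "i < n" for i using that not_less_Least unfolding n_def by blast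
  have "(pm ^^ i) f : X0 & (f, (pm ^^ i) f) : ?J" if "i <= n" for i using that
 proof (induction i)
  case (Suc i)
  have "((pm ^^ i) f, pm ((pm ^^ i) f)) : ?J" using Suc X0F below[of i] by (intro row_edge[where X = X0]) (auto simp: T_def)
  thus ?case using Suc pmX0[of "(pm ^^ i) f"] X0F by (auto intro: joined_trans)
 qed (use \<open>f : X0\<close> in simp)
  hence "(f, (pm ^^ n) f) : ?J" by blast
  thus ?thesis using n lr by (auto intro: joined_trans joined_sym)
 qed
  have "EX ph::'a + 'p => int. (ALL t:T. ph t = 1 \<or> ph t = -1) \<and>
  (ALL f:F. (SUM t:T. ph t * (of_bool (split_lf i0 j0 t = f) - of_bool (split_rf i0 j0 t = f))) = 0) \<and>
  (PROD p:rows X0. K p (s p) * K p (s' p)) = (-1) ^ (card (rows X0) + 1) * (PROD t:{dl, dl'}. ph (Inl t))"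
 proof (rule curve_sign[OF dl st X0F _ _ rows_def _ _ i0_def j0_def])
  show "X0 ~= {}" using X1 by (auto simp: X0_def)
  show "cor p (s p) : X0 \<longleftrightarrow> cor p (s' p) : X0" if "p : C" for p using inv[OF X1(1) that] inv[OF X2(1) that] by (simp add: X0_def)
  show "{lf dl, rf dl, lf dl', rf dl'} Int X0 = {} & {dl, dl'} = {} \<or>
  dl ~= dl' & {lf dl, rf dl, lf dl', rf dl'} \<subseteq> X0 & {dl, dl'} = {dl, dl'}"
 using False X1 X2 pmX0[OF dlF(1)] pmX0[OF dlF(2)] pm(3,4) by (auto simp: X0_def)
  show "T = Inr ` rows X0 Un Inl ` {dl, dl'}" by (fact T_def)
  show "s p ~= s' p" if "p : rows X0" for p
 proof
  assume "s p = s' p"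
  moreover have p: "p : C" "cor p (s p) : X0" using that by (auto simp: rows_def)
  ultimately have "pm (cor p (s p)) = cor p (s p)" using pm(2)[OF p(1)] by simp
  hence "X1 = {cor p (s p)} \<or> X2 = {cor p (s p)}" using fixed[OF X1(1)] fixed[OF X2(1)] p by (auto simp: X0_def)
  thus False using X1 X2 corF[OF p(1)] by auto
 qed
  show "(f, g) : ?J" if "f : X0" "g : X0" for f g using to_l that by (meson joined_sym joined_trans)
 qed
  then obtain ph :: "'a + 'p => int" where ph: "!!t. t : T ==> ph t = 1 \<or> ph t = -1"
  and bal: "!!f. f : F ==> (SUM t:T. ph t * (of_bool (split_lf i0 j0 t = f) - of_bool (split_rf i0 j0 t = f))) = 0"
  and prod: "(PROD p:rows X0. K p (s p) * K p (s' p)) = (-1) ^ (card (rows X0) + 1) * (PROD t:{dl, dl'}. ph (Inl t))" by blast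
  define a where "a = ph (Inl dl)"
  define b where "b = ph (Inl dl')"
  have ab: "a = 1 \<or> a = -1" "b = 1 \<or> b = -1" using ph by (auto simp: a_def b_def T_def)
  define val where "val p = ph (Inr p) * (if s p = j0 p then 1 else -1)" for p
  define out where "out f = (SUM p:rows X0. val p * of_bool (cor p (s p) = f))" for f
  define W where "W f = out f + a * (of_bool (lf dl = f) - of_bool (rf dl = f))" for f
  have finr: "finite (rows X0)" using finC by (simp add: rows_def)
  have pmeq: "pm x = pm y \<longleftrightarrow> x = y" for x y using permutes_inj[OF pm(1)] by (auto dest: injD)
  \<comment> \<open>the flow along the curve is the same before and after each region\<close>
  have flow: "W (pm g) = out g - b * (of_bool (lf dl = g) - of_bool (rf dl = g))" if g: "g : F" for g
 proof -
  have "pm g : F" using g pm(1) by (simp add: permutes_in_image)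
  hence "0 = (SUM t:T. ph t * (of_bool (split_lf i0 j0 t = pm g) - of_bool (split_rf i0 j0 t = pm g)))" using bal by simp
  also have "... = (SUM p:rows X0. ph (Inr p) * (of_bool (cor p (j0 p) = pm g) - of_bool (cor p (i0 p) = pm g))) +
  (a * (of_bool (lf dl = pm g) - of_bool (rf dl = pm g)) + b * (of_bool (lf dl' = pm g) - of_bool (rf dl' = pm g)))" unfolding T_def using finr False
 by (subst sum.union_disjoint) (auto simp: sum.reindex split_defs a_def b_def)
  also have "(SUM p:rows X0. ph (Inr p) * (of_bool (cor p (j0 p) = pm g) - of_bool (cor p (i0 p) = pm g))) =
  (SUM p:rows X0. val p * (of_bool (cor p (s p) = pm g) - of_bool (cor p (s' p) = pm g)))"
 by (intro sum.cong) (auto simp: val_def i0_def j0_def min_def max_def)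
  also have "... = out (pm g) - out g"
 proof -
  have "cor p (s' p) = pm g \<longleftrightarrow> cor p (s p) = g" if "p : rows X0" for p using that pm(2)[of p] pmeq by (auto simp: rows_def)
  thus ?thesis unfolding out_def sum_subtractf[symmetric] by (intro sum.cong) (auto simp: algebra_simps)
 qed
  finally show ?thesis unfolding W_def pm(3)[symmetric] pm(4)[symmetric] pmeq by (simp add: algebra_simps)
 qed
  have out0: "out f = 0" if "f : {lf dl, rf dl}" for f unfolding out_def using that corF by (intro sum.neutral) (auto simp: rows_def)
  have Wl: "W (lf dl) = a" "W (rf dl) = - a" using out0 dl(2) by (auto simp: W_def)
  have Wl': "W (pm (lf dl)) = - b" using flow[OF dlF(1)] out0 dl(2) by simp
  have Wstep: "W (pm g) = W g" if "g : F" "g ~: {lf dl, rf dl}" for g using flow[OF that(1)] that(2) by (auto simp: W_def)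
  have returns: "EX n. (pm ^^ Suc n) (lf dl) : {lf dl, rf dl}"
 proof -
  have "pm (lf dl) : X1" using XX X1 by blast
  then obtain n where "(pm ^^ n) (pm (lf dl)) = lf dl" using reach[OF X1(1) _ X1(2)] by blast
  hence "(pm ^^ Suc n) (lf dl) = lf dl" by (simp add: funpow_swap1)
  thus ?thesis by (intro exI[of _ n]) simp
 qed
  define n where "n = (LEAST n. (pm ^^ Suc n) (lf dl) : {lf dl, rf dl})"
  have n: "(pm ^^ Suc n) (lf dl) : {lf dl, rf dl}" unfolding n_def using returns by (rule LeastI_ex)
  have below: "(pm ^^ Suc i) (lf dl) ~: {lf dl, rf dl}" if "i < n" for i using that not_less_Least unfolding n_def by blast
  have inF: "(pm ^^ i) (lf dl) : F" for i using dlF(1) permutes_in_image[OF permutes_funpow[OF pm(1)]] by blast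
  have Wn: "W ((pm ^^ Suc i) (lf dl)) = - b" if "i <= n" for i using that
 proof (induction i)
  case 0
  thus ?case using Wl' by simp
 next
  case (Suc i)
  thus ?case using Wstep[OF inF[of "Suc i"]] below[of i] by simp
 qed
  have cX0: "card X0 >= 2"
 proof -
  have "finite X0" using X0F finF finite_subset by blast
  moreover have "{lf dl, rf dl} \<subseteq> X0" using X1 X2 by (auto simp: X0_def)
  ultimately have "card {lf dl, rf dl} <= card X0" by (rule card_mono)
  thus ?thesis using dl(2) by simp
 qed
  have cr: "card (rows X0) = card X0 - 2" using card_rows[OF X0F] X1 X2 dl(2) by (simp add: X0_def card_Diff_subset)
  have prod': "(PROD p:rows X0. K p (s p) * K p (s' p)) = (-1) ^ (card X0 - 1) * (a * b)"
 using prod cr cX0 False by (simp add: a_def b_def Suc_diff_Suc numeral_2_eq_2)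
  have X0: "\<Union>\<S> = X0" by (auto simp: \<S> X0_def)
  have Ls: "(PROD X:\<S>. kp X) = (-1) ^ (card X0 - 1) * (a * b)" using union_rows[of \<S>] prod' X0 by (simp add: \<S>_def)
  show ?thesis
 proof (cases "(pm ^^ Suc n) (lf dl) = rf dl")
  case True
  have "(pm ^^ i) (lf dl) : X1" for i by (induction i) (use X1 XX in auto)
  hence "rf dl : X1" using True by metis
  hence "X1 = X2" using same X1 X2 by blast
  moreover have "a = b" using Wn[of n] True Wl by simp
  ultimately show ?thesis using Ls ab by (auto simp: \<S> X0_def)
 next
  case False
  hence ret: "(pm ^^ Suc n) (lf dl) = lf dl" using n by simp
  have "a = - b" using Wn[of n] ret Wl by simp
  have "rf dl ~: X1"
 proof
  assume "rf dl : X1"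
  then obtain m where m: "(pm ^^ m) (lf dl) = rf dl" using reach[OF X1] by blast
  define i where "i = m mod Suc n"
  have i: "(pm ^^ i) (lf dl) = rf dl" unfolding i_def using funpow_mod_eq[OF ret, of m] m by simp
  have "i < Suc n" by (simp add: i_def)
  thus False using i below[of "i - 1"] dl(2) by (cases i) auto
 qed
  hence ne: "X1 ~= X2" using X2 by blast
  have "X1 Int X2 = {}" using same[OF X1(1) X2(1)] ne by blast
  hence "card X0 = card X1 + card X2" using XX X1 X2 by (simp add: X0_def card_Un_disjoint)
  moreover have "card X1 > 0" "card X2 > 0" using XX X1 X2 by (simp_all add: card_gt_0_iff)
  ultimately show ?thesis using Ls \<open>a = - b\<close> ab ne by (auto simp: \<S> minus_one_power_iff)
 qed
 qed
 have "(PROD p:C. K p (s p) * K p (s' p)) = (PROD X:\<X>. kp X)"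
 proof -
  have "rows (\<Union>\<X>) = C" using corF Un by (auto simp: rows_def)
  thus ?thesis using union_rows[of \<X>] by simp
 qed
 also have "... = (PROD X:\<X> - \<S>. kp X) * (PROD X:\<S>. kp X)" using fin\<X> by (intro prod.subset_diff) (auto simp: \<S>_def)
 also have "(PROD X:\<X> - \<S>. kp X) = (PROD X:\<X> - \<S>. (-1) ^ (card X - 1))" by (intro prod.cong refl ordinary) (auto simp: \<S>_def)
 also have "... * (PROD X:\<S>. kp X) = (PROD X:\<X>. (-1) ^ (card X - 1))"
 unfolding special using fin\<X> by (intro prod.subset_diff[symmetric]) (auto simp: \<S>_def)
 finally show ?thesis using sgn by simp
qed

end

section \<open>Independence of the base point\<close>

lemma det_two_rows:
 fixes h :: "nat => nat => 'r :: comm_ring_1"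
 assumes ab: "a < n" "b < n" "a ~= b"
 shows "det (mat n n (%(i, j). if i = a \<or> i = b then h i j else if i = j then 1 else 0)) =
  h a a * h b b - h a b * h b a"
proof -
 let ?M = "mat n n (%(i, j). if i = a \<or> i = b then h i j else if i = j then 1 else 0)"
 let ?t = "%q. signof q * (PROD i = 0..<n. ?M $$ (i, q i))"
 have zero: "?t q = 0" if q: "q permutes {0..<n}" "q ~: {id, transpose a b}" for q
 proof -
  have "EX i<n. i ~= a & i ~= b & q i ~= i"
 proof (rule ccontr)
  assume n: "~ ?thesis"
  have fix_q: "q i = i" if "i ~= a" "i ~= b" for i using n that permutes_not_in[OF q(1), of i] by (cases "i < n") auto
  have inj: "q x = q y ==> x = y" for x y using permutes_inj[OF q(1)] by (auto dest: injD)
  have im: "q a : {a, b}" "q b : {a, b}" using fix_q inj by blast+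
  show False
 proof (cases "q a = a")
  case True
  hence "q b = b" using im inj[of a b] ab by auto
  hence "q = id" using fix_q True by (intro ext) (metis id_apply)
  thus False using q by simp
 next
  case False
  hence "q a = b" "q b = a" using im inj[of a b] ab by auto
  hence "q = transpose a b" using fix_q by (intro ext) (metis transpose_apply_first transpose_apply_second transpose_apply_other)
  thus False using q by simp
 qed
 qed
  then obtain i where i: "i < n" "i ~= a" "i ~= b" "q i ~= i" by blast
  have "q i < n" using q(1) i(1) permutes_in_image[of q "{0..<n}" i] by auto
  hence "?M $$ (i, q i) = 0" using i by simp
  hence "(PROD i = 0..<n. ?M $$ (i, q i)) = 0" using i(1) by (intro prod_zero) auto
  thus ?thesis by simp
 qed
 have tr: "transpose a b permutes {0..<n}" using ab by (intro permutes_swap_id) auto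
 have "det ?M = (SUM q | q permutes {0..<n}. ?t q)" by (rule det_def') simp
 also have "... = (SUM q:{id, transpose a b}. ?t q)" using tr permutes_id zero by (intro sum.mono_neutral_right) (auto simp: finite_permutations)
 also have "... = ?t id + ?t (transpose a b)"
 proof -
  have "id ~= transpose a b" using ab by (metis id_apply transpose_apply_first)
  thus ?thesis by simp
 qed
 also have "?t id = h a a * h b b"
 proof -
  have "(PROD i = 0..<n. ?M $$ (i, id i)) = (PROD i:{a, b}. ?M $$ (i, id i))" using ab by (intro prod.mono_neutral_right) auto
  thus ?thesis using ab by simp
 qed
 also have "?t (transpose a b) = - (h a b * h b a)"
 proof -
  have "(PROD i = 0..<n. ?M $$ (i, transpose a b i)) = (PROD i:{a, b}. ?M $$ (i, transpose a b i))"
 using ab by (intro prod.mono_neutral_right) (auto simp: transpose_apply_other)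
  thus ?thesis using ab by (simp add: sign_swap_id)
 qed
 finally show ?thesis by simp
qed

lemma det_on_set:
 fixes Rs :: "'f => 'f => 'r :: comm_ring_1"
 assumes e: "bij_betw e {0..<n} F"
 shows "det (mat n n (%(i, j). Rs (e i) (e j))) =
  (SUM pm | pm permutes F. of_int (sign pm) * (PROD f:F. Rs f (pm f)))"
proof -
 let ?m = "map_permutation {0..<n} e"
 have inj: "inj_on e {0..<n}" and F: "F = e ` {0..<n}" using e by (auto simp: bij_betw_def)
 have e': "bij_betw (inv_into {0..<n} e) F {0..<n}" using e by (rule bij_betw_inv_into)
 have bij: "bij_betw ?m {q. q permutes {0..<n}} {pm. pm permutes F}"
 proof (rule bij_betw_byWitness[where f' = "map_permutation F (inv_into {0..<n} e)"])
  show "ALL q:{q. q permutes {0..<n}}. map_permutation F (inv_into {0..<n} e) (?m q) = q" using e inj by (auto intro!: map_permutation_compose_inv)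
  show "ALL pm:{pm. pm permutes F}. ?m (map_permutation F (inv_into {0..<n} e) pm) = pm"
 using e' F by (auto intro!: map_permutation_compose_inv simp: f_inv_into_f)
  show "?m ` {q. q permutes {0..<n}} \<subseteq> {pm. pm permutes F}" using e by (auto intro!: map_permutation_permutes)
  show "map_permutation F (inv_into {0..<n} e) ` {pm. pm permutes F} \<subseteq> {q. q permutes {0..<n}}"
 using e' by (auto intro!: map_permutation_permutes)
 qed
 have "det (mat n n (%(i, j). Rs (e i) (e j))) =
  (SUM q | q permutes {0..<n}. signof q * (PROD i = 0..<n. Rs (e i) (e (q i))))"
 by (subst det_def'[of _ n], simp) (intro sum.cong refl arg_cong2[of _ _ _ _ "(*)"] prod.cong, auto simp: permutes_in_image)
 also have "... = (SUM q | q permutes {0..<n}. of_int (sign (?m q)) * (PROD f:F. Rs f (?m q f)))"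
 proof (rule sum.cong[OF refl])
  fix q assume "q : {q. q permutes {0..<n}}"
  hence q: "q permutes {0..<n}" by simp
  have "sign (?m q) = sign q" using inj q by (intro sign_map_permutation) auto
  moreover have "(PROD f:F. Rs f (?m q f)) = (PROD i = 0..<n. Rs (e i) (e (q i)))"
 unfolding F prod.reindex[OF inj] using inj by (intro prod.cong) (auto simp: map_permutation_apply)
  ultimately show "signof q * (PROD i = 0..<n. Rs (e i) (e (q i))) =
  of_int (sign (?m q)) * (PROD f:F. Rs f (?m q f))" by simp
 qed
 also have "... = (SUM pm | pm permutes F. of_int (sign pm) * (PROD f:F. Rs f (pm f)))" by (rule sum.reindex_bij_betw[OF bij])
 finally show ?thesis .
qed

context signed_map
begin

definition states_at :: "'a => ('p => nat) set" where
 "states_at dl = {s : (\<Pi>\<^sub>E p\<in>C. {..<deg p}). state dl s}"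

definition state_sum :: "('p => nat => 'r :: comm_ring_1) => 'a => 'r" where
 "state_sum om dl = (SUM s:states_at dl. PROD p:C. om p (s p))"

definition corner_row :: "('p => nat => 'r :: comm_ring_1) => 'p => 'f => 'r" where
 "corner_row om p g = (SUM i<deg p. of_bool (cor p i = g) * (of_int (K p i) * om p i))"

context
 fixes dl0 s0
 assumes dl0: "dl0 : A" "lf dl0 ~= rf dl0" and s0: "state dl0 s0"
begin

definition row_at :: "'f => 'p" where "row_at = inv_into C (%p. cor p (s0 p))"

definition entry :: "('p => nat => 'r :: comm_ring_1) => 'a => 'f => 'f => 'r" where
 "entry om dl f g = (if f = lf dl0 then of_bool (g = lf dl) else if f = rf dl0 then of_bool (g = rf dl)
  else corner_row om (row_at f) g)"

lemma bij0: "bij_betw (%p. cor p (s0 p)) C (F - {lf dl0, rf dl0})" using s0 by (simp add: state_def)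

lemma row_at_cor: "p : C ==> row_at (cor p (s0 p)) = p" unfolding row_at_def by (rule inv_into_f_f[OF bij_betw_imp_inj_on[OF bij0]])

lemma lr_in_F: "dl : A ==> lf dl : F & rf dl : F" using src_slot[of dl] prev_less by (auto simp: lf_def rf_def F_eq)

lemma F_split: "F = insert (lf dl0) (insert (rf dl0) ((%p. cor p (s0 p)) ` C))" using bij0 lr_in_F[OF dl0(1)] by (auto simp: bij_betw_def)

lemma finC: "finite C" using C finP finite_subset by blast

lemma prod_entries:
 "(PROD f:F. entry om dl f (pm f)) = of_bool (pm (lf dl0) = lf dl) * of_bool (pm (rf dl0) = rf dl) *
  (PROD p:C. corner_row om p (pm (cor p (s0 p))))"
proof -
 have ni: "cor p (s0 p) ~= lf dl0" "cor p (s0 p) ~= rf dl0" if "p : C" for p using bij_betwE[OF bij0] that by auto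
 have inj: "inj_on (%p. cor p (s0 p)) C" using bij0 by (simp add: bij_betw_def)
 have "(PROD f:(%p. cor p (s0 p)) ` C. entry om dl f (pm f)) = (PROD p:C. corner_row om p (pm (cor p (s0 p))))"
 unfolding prod.reindex[OF inj] by (intro prod.cong) (auto simp: entry_def ni row_at_cor)
 moreover have "lf dl0 ~: insert (rf dl0) ((%p. cor p (s0 p)) ` C)" "rf dl0 ~: (%p. cor p (s0 p)) ` C" using ni dl0(2) by (metis imageE insertE)+
 ultimately show ?thesis unfolding F_split using finC dl0(2) by (simp add: entry_def mult.assoc)
qed

lemma expand_perms:
 assumes dl: "dl : A" "lf dl ~= rf dl"
 shows "(SUM pm | pm permutes F. of_int (sign pm) * (PROD f:F. entry om dl f (pm f))) =
  of_int (PROD p:C. K p (s0 p)) * state_sum om dl"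
proof -
 define good where "good pm s \<longleftrightarrow> pm (lf dl0) = lf dl & pm (rf dl0) = rf dl \<and>
  (ALL p:C. cor p (s p) = pm (cor p (s0 p)))" for pm s
 define S where "S = (\<Pi>\<^sub>E p\<in>C. {..<deg p})"
 have finS: "finite S" unfolding S_def using finC by (intro finite_PiE) auto
 have finp: "finite {pm. pm permutes F}" using finF by (rule finite_permutations)
 have "(PROD f:F. entry om dl f (pm f)) =
  (SUM s:S. of_bool (good pm s) * (of_int (PROD p:C. K p (s p)) * (PROD p:C. om p (s p))))" for pm
 proof -
  have "(PROD p:C. corner_row om p (pm (cor p (s0 p)))) =
  (SUM s:S. PROD p:C. of_bool (cor p (s p) = pm (cor p (s0 p))) * (of_int (K p (s p)) * om p (s p)))"
 unfolding corner_row_def S_def using finC by (subst prod_sum_PiE) auto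
  also have "... = (SUM s:S. of_bool (ALL p:C. cor p (s p) = pm (cor p (s0 p))) *
  (of_int (PROD p:C. K p (s p)) * (PROD p:C. om p (s p))))"
 proof (rule sum.cong[OF refl])
  fix s
  show "(PROD p:C. of_bool (cor p (s p) = pm (cor p (s0 p))) * (of_int (K p (s p)) * om p (s p))) =
  of_bool (ALL p:C. cor p (s p) = pm (cor p (s0 p))) * (of_int (PROD p:C. K p (s p)) * (PROD p:C. om p (s p)))"
 proof (cases "ALL p:C. cor p (s p) = pm (cor p (s0 p))")
  case False
  hence z: "(PROD p:C. of_bool (cor p (s p) = pm (cor p (s0 p))) * (of_int (K p (s p)) * om p (s p))) = 0" using finC by (intro prod_zero) auto
  show ?thesis by (subst z, simp only: of_bool_def False if_False mult_zero_left)
 qed (simp add: prod.distrib)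
 qed
  finally have E: "(PROD p:C. corner_row om p (pm (cor p (s0 p)))) =
  (SUM s:S. of_bool (ALL p:C. cor p (s p) = pm (cor p (s0 p))) *
  (of_int (PROD p:C. K p (s p)) * (PROD p:C. om p (s p))))" .
  show ?thesis unfolding prod_entries good_def E sum_distrib_left of_bool_conj by (intro sum.cong refl) (simp only: ac_simps)
 qed
 hence "(SUM pm | pm permutes F. of_int (sign pm) * (PROD f:F. entry om dl f (pm f))) =
  (SUM s:S. SUM pm | pm permutes F. of_int (sign pm) * (of_bool (good pm s) * (of_int (PROD p:C. K p (s p)) * (PROD p:C. om p (s p)))))"
 by (simp add: sum_distrib_left) (rule sum.swap)
 also have "... = (SUM s:S. of_bool (state dl s) * (of_int (PROD p:C. K p (s0 p)) * (PROD p:C. om p (s p))))"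
 proof (rule sum.cong[OF refl])
  fix s assume s: "s : S"
  let ?w = "of_int (PROD p:C. K p (s p)) * (PROD p:C. om p (s p))"
  have good_state: "state dl s" if pm: "pm permutes F" "good pm s" for pm
 proof -
  have b: "bij_betw pm (F - {lf dl0, rf dl0}) (F - {lf dl, rf dl})"
 proof -
  have "bij_betw pm F F" using permutes_imp_bij[OF pm(1)] .
  moreover have "pm ` (F - {lf dl0, rf dl0}) = F - {lf dl, rf dl}"
 using pm(2) permutes_image[OF pm(1)] image_set_diff[OF permutes_inj[OF pm(1)], of F "{lf dl0, rf dl0}"] by (simp add: good_def)
  ultimately show ?thesis by (auto simp: bij_betw_def intro: inj_on_subset)
 qed
  have "bij_betw (pm \<circ> (%p. cor p (s0 p))) C (F - {lf dl, rf dl})" by (rule bij_betw_trans[OF bij0 b])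
  hence "bij_betw (%p. cor p (s p)) C (F - {lf dl, rf dl})"
 using pm(2) by (subst bij_betw_cong[of _ _ "pm \<circ> (%p. cor p (s0 p))"]) (auto simp: good_def)
  thus ?thesis using s by (auto simp: state_def S_def)
 qed
  show "(SUM pm | pm permutes F. of_int (sign pm) * (of_bool (good pm s) * ?w)) =
  of_bool (state dl s) * (of_int (PROD p:C. K p (s0 p)) * (PROD p:C. om p (s p)))"
 proof (cases "state dl s")
  case False
  hence "(SUM pm | pm permutes F. of_int (sign pm) * (of_bool (good pm s) * ?w)) = 0" using good_state by (intro sum.neutral) auto
  thus ?thesis using False by simp
 next
  case True
  hence bs: "bij_betw (%p. cor p (s p)) C (F - {lf dl, rf dl})" by (simp add: state_def)
  define pm0 where "pm0 f = (if f = lf dl0 then lf dl else if f = rf dl0 then rf dl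
  else if f : F then cor (row_at f) (s (row_at f)) else f)" for f
  have pmc: "pm0 (cor p (s0 p)) = cor p (s p)" if "p : C" for p using bij_betwE[OF bij0] that row_at_cor by (auto simp: pm0_def)
  have g0: "good pm0 s" using pmc dl0 by (auto simp: good_def pm0_def)
  have im: "pm0 ` F = F"
 proof -
  have "pm0 ` F = insert (lf dl) (insert (rf dl) ((%p. cor p (s p)) ` C))"
 proof -
  have "pm0 ` (%p. cor p (s0 p)) ` C = (%p. cor p (s p)) ` C" unfolding image_image using pmc by (intro image_cong) auto
  thus ?thesis using g0 by (simp add: F_split good_def)
 qed
  also have "... = F" using bs lr_in_F[OF dl(1)] by (auto simp: bij_betw_def)
  finally show ?thesis .
 qed
  have p0: "pm0 permutes F"
 proof (rule bij_imp_permutes)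
  show "bij_betw pm0 F F" using im finF by (simp add: bij_betw_def eq_card_imp_inj_on)
  show "pm0 f = f" if "f ~: F" for f using that lr_in_F[OF dl0(1)] by (auto simp: pm0_def)
 qed
  have uniq: "pm = pm0" if pm: "pm permutes F" "good pm s" for pm
 proof
  fix f
  show "pm f = pm0 f"
 proof (cases "f : F")
  case False
  thus ?thesis using pm(1) p0 by (simp add: permutes_not_in)
 next
  case True
  thus ?thesis using pm(2) g0 unfolding F_split by (auto simp: good_def)
 qed
 qed
  have "sign pm0 = (PROD p:C. K p (s0 p) * K p (s p))" using g0 by (intro coherence[OF dl0 dl s0 True p0]) (auto simp: good_def)
  hence sg: "sign pm0 * (PROD p:C. K p (s p)) = (PROD p:C. K p (s0 p))"
 proof -
  have "K p (s0 p) * K p (s p) * K p (s p) = K p (s0 p)" if "p : C" for p using K_sign[OF that, of "s p"] True that by (auto simp: state_def)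
  thus ?thesis unfolding \<open>sign pm0 = _\<close> prod.distrib[symmetric] by (intro prod.cong refl)
 qed
  have "(SUM pm | pm permutes F. of_int (sign pm) * (of_bool (good pm s) * ?w)) =
  (SUM pm:{pm0}. of_int (sign pm) * (of_bool (good pm s) * ?w))" using p0 uniq finp by (intro sum.mono_neutral_right) auto
  also have "... = of_int (sign pm0 * (PROD p:C. K p (s p))) * (PROD p:C. om p (s p))" using g0 by (simp add: mult.assoc)
  finally show ?thesis using sg True by simp
 qed
 qed
 also have "... = of_int (PROD p:C. K p (s0 p)) * (SUM s:S. of_bool (state dl s) * (PROD p:C. om p (s p)))"
 unfolding sum_distrib_left by (intro sum.cong) (auto simp: of_bool_def)
 also have "(SUM s:S. of_bool (state dl s) * (PROD p:C. om p (s p))) = state_sum om dl"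
 unfolding state_sum_def states_at_def S_def[symmetric] using finS
 by (subst sum.mono_neutral_right[of S "{s : S. state dl s}"]) (auto intro!: sum.cong)
 finally show ?thesis .
qed

lemma determinants_proportional:
 fixes om :: "'p => nat => 'r :: idom"
 assumes x: "!!p. p : C ==> (SUM i<deg p. of_int (K p i) * om p i * x (cor p i)) = 0"
  and y: "!!p. p : C ==> (SUM i<deg p. of_int (K p i) * om p i * y (cor p i)) = 0"
  and dl: "dl : A" "lf dl ~= rf dl"
  and nz: "x (lf dl0) * y (rf dl0) - x (rf dl0) * y (lf dl0) ~= 0"
 shows "state_sum om dl * (x (lf dl0) * y (rf dl0) - x (rf dl0) * y (lf dl0)) =
  state_sum om dl0 * (x (lf dl) * y (rf dl) - x (rf dl) * y (lf dl))"
proof -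
 define n where "n = card F"
 obtain e where e: "bij_betw e {0..<n} F" using ex_bij_betw_nat_finite[OF finF] n_def by auto
 have injE: "e i = e j \<longleftrightarrow> i = j" if "i < n" "j < n" for i j using e that by (auto simp: bij_betw_def inj_on_def)
 have eF: "e i : F" if "i < n" for i using e that by (auto simp: bij_betw_def)
 obtain a where a: "a < n" "e a = lf dl0" using e lr_in_F[OF dl0(1)] by (auto simp: bij_betw_def image_iff)
 obtain b where b: "b < n" "e b = rf dl0" using e lr_in_F[OF dl0(1)] by (auto simp: bij_betw_def image_iff)
 have ab: "a ~= b" using a b dl0 by auto
 define M where "M d = mat n n (%(i, j). entry om d (e i) (e j))" for d
 define Q where "Q = mat n n (%(i, j). if j = a then x (e i) else if j = b then y (e i) else if i = j then 1 else 0)"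
 define N where "N = mat n n (%(i, j). if j = a \<or> j = b then of_bool (i = j)
  else if i = a \<or> i = b then 0 else corner_row om (row_at (e i)) (e j))"
 define H where "H d = mat n n (%(i, j). if i = a \<or> i = b then (M d * Q) $$ (i, j) else if i = j then 1 else 0)" for d
 have carr: "M d : carrier_mat n n" "Q : carrier_mat n n" "N : carrier_mat n n" "H d : carrier_mat n n" for d by (auto simp: M_def Q_def N_def H_def)
 define Dt where "Dt d = x (lf d) * y (rf d) - x (rf d) * y (lf d)" for d
 have detQ: "det Q = Dt dl0"
 proof -
  have "transpose_mat Q = mat n n (%(i, j). if i = a \<or> i = b then (if i = a then x (e j) else y (e j)) else if i = j then 1 else 0)"
 by (rule eq_matI) (auto simp: Q_def)
  thus ?thesis using det_transpose[OF carr(2)] det_two_rows[OF a(1) b(1) ab, of "%i j. if i = a then x (e j) else y (e j)"] ab a b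
 by (simp add: Dt_def mult.commute)
 qed
 have rowsum: "(SUM g:F. corner_row om p g * z g) = (SUM i<deg p. of_int (K p i) * om p i * z (cor p i))" if p: "p : C" for p z
 proof -
  have "(SUM g:F. corner_row om p g * z g) = (SUM i<deg p. SUM g:F. of_bool (cor p i = g) * (of_int (K p i) * om p i) * z g)"
 unfolding corner_row_def sum_distrib_right by (rule sum.swap)
  also have "... = (SUM i<deg p. of_int (K p i) * om p i * z (cor p i))"
 proof (rule sum.cong[OF refl])
  fix i assume "i : {..<deg p}"
  hence "cor p i : F" using p C by (auto simp: F_eq)
  hence "(SUM g:F. of_bool (cor p i = g) * (of_int (K p i) * om p i) * z g) =
  (SUM g:{cor p i}. of_bool (cor p i = g) * (of_int (K p i) * om p i) * z g)" using finF by (intro sum.mono_neutral_right) auto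
  thus "(SUM g:F. of_bool (cor p i = g) * (of_int (K p i) * om p i) * z g) = of_int (K p i) * om p i * z (cor p i)" by simp
 qed
  finally show ?thesis .
 qed
 have entry_sum: "(SUM g:F. entry om d f g * z g) = (if f = lf dl0 then z (lf d) else if f = rf dl0 then z (rf d) else 0)"
  if z: "!!p. p : C ==> (SUM i<deg p. of_int (K p i) * om p i * z (cor p i)) = 0" and f: "f : F" and d: "d : A" for z f d
 proof -
  have *: "(SUM g:F. of_bool (g = h) * z g) = z h" if "h : F" for h
 using finF that by (simp add: of_bool_def if_distrib[of "%t. t * _"] sum.delta cong: if_cong)
  have "row_at f : C" if "f ~= lf dl0" "f ~= rf dl0" using f that row_at_cor F_split by auto
  thus ?thesis using * lr_in_F[OF d] rowsum z by (auto simp: entry_def)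
 qed
 have MQ: "(M d * Q) $$ (i, j) = (if j = a then (if i = a then x (lf d) else if i = b then x (rf d) else 0)
  else if j = b then (if i = a then y (lf d) else if i = b then y (rf d) else 0)
  else entry om d (e i) (e j))" if ij: "i < n" "j < n" and d: "d : A" for d i j
 proof -
  have sumE: "(SUM k = 0..<n. t (e k)) = (SUM g:F. t g)" for t :: "'f => 'r" by (rule sum.reindex_bij_betw[OF e])
  have ia: "e i = lf dl0 \<longleftrightarrow> i = a" and ib: "e i = rf dl0 \<longleftrightarrow> i = b" using injE a b ij by metis+
  have "(M d * Q) $$ (i, j) = (SUM k = 0..<n. entry om d (e i) (e k) * Q $$ (k, j))" using ij by (simp add: M_def Q_def scalar_prod_def)
  also have "... = (if j = a then (SUM k = 0..<n. entry om d (e i) (e k) * x (e k))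
  else if j = b then (SUM k = 0..<n. entry om d (e i) (e k) * y (e k))
  else (SUM k = 0..<n. entry om d (e i) (e k) * (if k = j then 1 else 0)))" using ij by (auto simp: Q_def intro!: sum.cong)
  also have "(SUM k = 0..<n. entry om d (e i) (e k) * (if k = j then 1 else 0)) = entry om d (e i) (e j)"
 using ij by (simp add: if_distrib sum.delta cong: if_cong)
  also have "(SUM k = 0..<n. entry om d (e i) (e k) * x (e k)) = (if i = a then x (lf d) else if i = b then x (rf d) else 0)"
 using sumE[of "%g. entry om d (e i) g * x g"] entry_sum[OF x eF[OF ij(1)] d] ia ib by simp
  also have "(SUM k = 0..<n. entry om d (e i) (e k) * y (e k)) = (if i = a then y (lf d) else if i = b then y (rf d) else 0)"
 using sumE[of "%g. entry om d (e i) g * y g"] entry_sum[OF y eF[OF ij(1)] d] ia ib by simp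
  finally show ?thesis .
 qed
 have fact: "M d * Q = N * H d" if d: "d : A" for d
 proof (rule eq_matI)
  fix i j assume "i < dim_row (N * H d)" "j < dim_col (N * H d)"
  hence ij: "i < n" "j < n" by (auto simp: N_def H_def)
  have ia: "e i = lf dl0 \<longleftrightarrow> i = a" and ib: "e i = rf dl0 \<longleftrightarrow> i = b" using injE a b ij by metis+
  have "(N * H d) $$ (i, j) = (SUM k = 0..<n. N $$ (i, k) * H d $$ (k, j))" using ij by (simp add: N_def H_def scalar_prod_def)
  also have "... = (M d * Q) $$ (i, j)"
 proof (cases "i = a \<or> i = b")
  case True
  hence "(SUM k = 0..<n. N $$ (i, k) * H d $$ (k, j)) = (SUM k = 0..<n. (if k = i then H d $$ (i, j) else 0))"
 using ij by (intro sum.cong) (auto simp: N_def)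
  thus ?thesis using ij True by (auto simp: H_def)
 next
  case False
  have "(SUM k = 0..<n. N $$ (i, k) * H d $$ (k, j)) = (SUM k = 0..<n. if k = j then (if j = a \<or> j = b then 0 else corner_row om (row_at (e i)) (e j)) else 0)"
 using ij False by (intro sum.cong) (auto simp: N_def H_def)
  thus ?thesis using MQ[OF ij d] ij False ia ib by (auto simp: entry_def)
 qed
  finally show "(M d * Q) $$ (i, j) = (N * H d) $$ (i, j)" by simp
 qed (auto simp: M_def Q_def N_def H_def)
 have detH: "det (H d) = Dt d" if d: "d : A" for d
 unfolding H_def using det_two_rows[OF a(1) b(1) ab, of "%i j. (M d * Q) $$ (i, j)"] MQ[OF _ _ d] a b ab by (simp add: Dt_def mult.commute)
 have detM: "det (M d) * Dt dl0 = det N * Dt d" if d: "d : A" for d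
 using arg_cong[OF fact[OF d], of det] det_mult[OF carr(1,2)] det_mult[OF carr(3,4)] detQ detH[OF d] by simp
 have "det N = det (M dl0)" using detM[OF dl0(1)] nz by (simp add: Dt_def)
 hence eq: "det (M dl) * Dt dl0 = det (M dl0) * Dt dl" using detM[OF dl(1)] by simp
 let ?k = "of_int (PROD p:C. K p (s0 p)) :: 'r"
 have "det (M dl) = ?k * state_sum om dl" "det (M dl0) = ?k * state_sum om dl0" unfolding M_def det_on_set[OF e] using expand_perms dl dl0 by auto
 moreover have "?k * ?k = 1"
 proof -
  have "(PROD p:C. K p (s0 p)) * (PROD p:C. K p (s0 p)) = (PROD p:C. 1)" unfolding prod.distrib[symmetric]
 proof (rule prod.cong[OF refl])
  fix p assume p: "p : C"
  thus "K p (s0 p) * K p (s0 p) = 1" using K_sign[OF p, of "s0 p"] s0 by (auto simp: state_def)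
 qed
  thus ?thesis by (metis of_int_1 of_int_mult prod.neutral_const)
 qed
 ultimately have "?k * (state_sum om dl * Dt dl0) = ?k * (state_sum om dl0 * Dt dl)" "?k ~= 0" using eq by (auto simp: mult.assoc)
 thus ?thesis unfolding Dt_def[symmetric] by simp
qed

end

text \<open>For states that all have the same sign the state sums are maximal minors of the signed matrix, and these are proportional to the minors of the kernel vectors \<open>x\<close> and \<open>y\<close>.\<close>

theorem base_change:
 fixes om :: "'p => nat => 'r :: idom"
 assumes x: "!!p. p : C ==> (SUM i<deg p. of_int (K p i) * om p i * x (cor p i)) = 0"
  and y: "!!p. p : C ==> (SUM i<deg p. of_int (K p i) * om p i * y (cor p i)) = 0"
  and dl: "dl : A" "x (lf dl) * y (rf dl) - x (rf dl) * y (lf dl) ~= 0"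
  and dl': "dl' : A" "x (lf dl') * y (rf dl') - x (rf dl') * y (lf dl') ~= 0"
 shows "state_sum om dl * (x (lf dl') * y (rf dl') - x (rf dl') * y (lf dl')) =
  state_sum om dl' * (x (lf dl) * y (rf dl) - x (rf dl) * y (lf dl))"
proof -
 have n: "lf dl ~= rf dl" "lf dl' ~= rf dl'" using dl(2) dl'(2) by (auto simp: mult.commute)
 show ?thesis
 proof (cases "states_at dl = {} & states_at dl' = {}")
  case True
  thus ?thesis by (simp add: state_sum_def)
 next
  case False
  then obtain s where "state dl s \<or> state dl' s" by (auto simp: states_at_def)
  thus ?thesis
 proof
  assume "state dl' s"
  from determinants_proportional[OF dl'(1) n(2) this x y dl(1) n(1) dl'(2)] show ?thesis .
 next
  assume "state dl s"
  from determinants_proportional[OF dl(1) n(1) this x y dl'(1) n(2) dl(2)] show ?thesis by simp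
 qed
 qed
qed

end

section \<open>The spherical map of a diagram\<close>

datatype point = Cross crossing | Out nat nat

datatype edge = AA nat | Seg point

fun corner_of :: "crossing => nat => corner" where
 "corner_of (Dbl x) i = (if i = 0 then South else if i = 1 then East else if i = 2 then North else West)"
| "corner_of (Circ v j) i = (if i = 0 then East else if i = 1 then North else West)"

fun deg_of :: "point => nat" where
 "deg_of (Cross (Dbl x)) = 4"
| "deg_of (Cross (Circ v j)) = 3"
| "deg_of (Out v j) = 3"

fun cor_at :: "moy => point => nat => region" where
 "cor_at D (Cross C) i = corner_region D C (corner_of C i)"
| "cor_at D (Out v j) i = (if i = 0 then Regular (lreg D (outs D v ! j)) else if i = 1 then Disc v
  else Regular (rreg D (outs D v ! j)))"

fun in_pos :: "slot => point \<times> nat" where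
 "in_pos (LeftSlot x) = (Cross (Dbl x), 0)"
| "in_pos (RightSlot x) = (Cross (Dbl x), 1)"
| "in_pos (VertexSlot v j) = (Cross (Circ v j), 0)"

fun out_pos :: "slot => point \<times> nat" where
 "out_pos (LeftSlot x) = (Cross (Dbl x), 3)"
| "out_pos (RightSlot x) = (Cross (Dbl x), 2)"
| "out_pos (VertexSlot v j) = (Out v j, 0)"

definition circ_pts :: "moy => point set" where
 "circ_pts D = {Cross (Circ v j) |v j. v : verts D & j < length (ins D v)} \<union>
  {Out v j |v j. v : verts D & j < length (outs D v)}"

definition mpts :: "moy => point set" where
 "mpts D = (Cross \<circ> Dbl) ` dpts D Un circ_pts D"

definition medges :: "moy => edge set" where
 "medges D = AA ` open_arcs D Un Seg ` circ_pts D"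

fun nxt :: "moy => point => point" where
 "nxt D (Cross (Circ v j)) = (if Suc j < length (ins D v) then Cross (Circ v (Suc j))
  else if outs D v ~= [] then Out v (length (outs D v) - 1) else Cross (Circ v 0))"
| "nxt D (Out v j) = (if 0 < j then Out v (j - 1) else Cross (Circ v 0))"
| "nxt D (Cross (Dbl x)) = Cross (Dbl x)"

fun prv :: "moy => point => point" where
 "prv D (Cross (Circ v j)) = (if 0 < j then Cross (Circ v (j - 1))
  else if outs D v ~= [] then Out v 0 else Cross (Circ v (length (ins D v) - 1)))"
| "prv D (Out v j) = (if Suc j < length (outs D v) then Out v (Suc j) else Cross (Circ v (length (ins D v) - 1)))"
| "prv D (Cross (Dbl x)) = Cross (Dbl x)"

definition esrc :: "moy => edge => point \<times> nat" where
 "esrc D e = (case e of AA a => out_pos (inv_into (out_slots D) (out_arc D) a) | Seg p => (p, 1))"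

definition etgt :: "moy => edge => point \<times> nat" where
 "etgt D e = (case e of AA a => in_pos (inv_into (in_slots D) (in_arc D) a) | Seg p => (nxt D p, 2))"

lemma fan_nth:
 "fan D w as e ==> Suc j < length as ==> rreg D (as ! j) = lreg D (as ! Suc j)"
proof (induction as arbitrary: w j)
 case (Cons a as)
 show ?case
 proof (cases j)
  case 0
  thus ?thesis using Cons.prems by (cases as) auto
 next
  case (Suc i)
  thus ?thesis using Cons.IH[of "rreg D a" i] Cons.prems by simp
 qed
qed simp

lemma fan_last: "fan D w as e ==> as ~= [] ==> rreg D (as ! (length as - 1)) = e"
proof (induction as arbitrary: w)
 case (Cons a as)
 thus ?case by (cases as) auto
qed simp

lemma fan_zero: "fan D w as e ==> as ~= [] ==> lreg D (as ! 0) = w" by (cases as) auto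

lemma inj_in_pos: "inj in_pos"
proof (rule injI)
 fix s s' assume "in_pos s = in_pos s'"
 thus "s = s'" by (cases s; cases s') auto
qed

lemma inj_out_pos: "inj out_pos"
proof (rule injI)
 fix s s' assume "out_pos s = out_pos s'"
 thus "s = s'" by (cases s; cases s') auto
qed

lemma in_out_pos: "in_pos s ~= out_pos s'" by (cases s; cases s') auto

lemma linked_invariant:
 assumes "(c, d) : linked E" and "!!a b. (a, b) : E ==> Q a \<longleftrightarrow> Q b"
 shows "Q c \<longleftrightarrow> Q d" using assms(1)[unfolded linked_def]
proof (induction rule: rtrancl_induct)
 case (step y z)
 thus ?case using assms(2) by auto
qed simp

locale connected_diagram =
 fixes D :: moy
 assumes diagram: "moy_diagram D"
  and one_component: "card (components D) = 1"
  and has_vertex: "verts D ~= {}"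
  and ins_nonempty: "v : verts D ==> ins D v ~= []"
begin

lemma fin: "finite (arcs D)" "finite (dpts D)" "finite (verts D)" "finite (regs D)" using diagram by (auto simp: moy_diagram_def)

lemma vert_fan:
 assumes "v : verts D"
 shows "fan D (wreg D v) (ins D v) (ereg D v)" "fan D (wreg D v) (outs D v) (ereg D v)"
 using diagram assms by (auto simp: moy_diagram_def vert_ok_def)

lemma linked_all:
 assumes "c : graph_cells D" "d : graph_cells D"
 shows "(c, d) : linked (graph_inc D)"
proof -
 obtain Q where Q: "components D = {Q}" using one_component by (metis card_1_singletonE)
 have "linked (graph_inc D) `` {c} : components D" "linked (graph_inc D) `` {d} : components D" using assms by (auto simp: components_def quotientI)
 hence "linked (graph_inc D) `` {c} = linked (graph_inc D) `` {d}" using Q by simp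
 moreover have "d : linked (graph_inc D) `` {d}" by (simp add: linked_def)
 ultimately show ?thesis by blast
qed

lemma arcs_open: "arcs D = open_arcs D"
proof
 show "open_arcs D \<subseteq> arcs D" using diagram by (auto simp: moy_diagram_def)
 show "arcs D \<subseteq> open_arcs D"
 proof
  fix a assume a: "a : arcs D"
  obtain v where v: "v : verts D" using has_vertex by auto
  have io: "in_arc D ` in_slots D = out_arc D ` out_slots D" using diagram by (auto simp: moy_diagram_def)
  have "(Arc a, Vert v) : linked (graph_inc D)" using a v by (intro linked_all) (auto simp: graph_cells_def)
  hence "Arc a = Arc a & a ~: open_arcs D \<longleftrightarrow> Vert v = Arc a & a ~: open_arcs D"
 proof (rule linked_invariant)
  fix c d assume cd: "(c, d) : graph_inc D"
  have "a : open_arcs D" if "c = Arc a" using cd that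
 proof (auto simp: graph_inc_def)
  fix x assume x: "x : dpts D"
  hence s: "LeftSlot x : in_slots D" "RightSlot x : in_slots D" "LeftSlot x : out_slots D" "RightSlot x : out_slots D"
 by (auto simp: in_slots_def out_slots_def)
  show "sw D x : open_arcs D" "se D x : open_arcs D" unfolding open_arcs_def using s by force+
  show "nw D x : open_arcs D" "ne D x : open_arcs D" unfolding open_arcs_def io using s by force+
 next
  fix v assume v: "v : verts D" "a : set (ins D v)"
  then obtain j where "j < length (ins D v)" "ins D v ! j = a" by (metis in_set_conv_nth)
  hence "VertexSlot v j : in_slots D" "in_arc D (VertexSlot v j) = a" using v by (auto simp: in_slots_def)
  thus "a : open_arcs D" unfolding open_arcs_def by force
 next
  fix v assume v: "v : verts D" "a : set (outs D v)"
  then obtain j where "j < length (outs D v)" "outs D v ! j = a" by (metis in_set_conv_nth)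
  hence "VertexSlot v j : out_slots D" "out_arc D (VertexSlot v j) = a" using v by (auto simp: out_slots_def)
  thus "a : open_arcs D" unfolding open_arcs_def io by force
 qed
  moreover have "d ~= Arc a" using cd by (auto simp: graph_inc_def)
  ultimately show "c = Arc a & a ~: open_arcs D \<longleftrightarrow> d = Arc a & a ~: open_arcs D" by blast
 qed
  thus "a : open_arcs D" by simp
 qed
qed

lemma slots_bij:
 shows "inj_on (in_arc D) (in_slots D)" "inj_on (out_arc D) (out_slots D)"
  "in_arc D ` in_slots D = arcs D" "out_arc D ` out_slots D = arcs D" using diagram arcs_open by (auto simp: moy_diagram_def open_arcs_def)

lemma in_arc_arcs: "s : in_slots D ==> in_arc D s : arcs D" unfolding slots_bij(3)[symmetric] by (rule imageI)

lemma out_arc_arcs: "s : out_slots D ==> out_arc D s : arcs D" unfolding slots_bij(4)[symmetric] by (rule imageI)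

lemma tgt_AA: "s : in_slots D ==> etgt D (AA (in_arc D s)) = in_pos s" using slots_bij by (simp add: etgt_def inv_into_f_f)

lemma src_AA: "s : out_slots D ==> esrc D (AA (out_arc D s)) = out_pos s" using slots_bij by (simp add: esrc_def inv_into_f_f)

lemma nxt_prv:
 assumes "p : circ_pts D"
 shows "nxt D p : circ_pts D" "prv D p : circ_pts D" "prv D (nxt D p) = p" "nxt D (prv D p) = p"
proof -
 have "nxt D p : circ_pts D & prv D p : circ_pts D & prv D (nxt D p) = p & nxt D (prv D p) = p"
 proof (cases p rule: point.exhaust)
  case (Cross C)
  then obtain v j where p: "p = Cross (Circ v j)" "v : verts D" "j < length (ins D v)" using assms by (auto simp: circ_pts_def)
  thus ?thesis using ins_nonempty[OF p(2)] by (cases j) (auto simp: circ_pts_def)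
 next
  case (Out v j)
  hence p: "v : verts D" "j < length (outs D v)" using assms by (auto simp: circ_pts_def)
  thus ?thesis using Out ins_nonempty[OF p(1)] by (cases j) (auto simp: circ_pts_def Suc_lessI)
 qed
 thus "nxt D p : circ_pts D" "prv D p : circ_pts D" "prv D (nxt D p) = p" "nxt D (prv D p) = p" by auto
qed

lemma dptD:
 assumes "x : dpts D"
 shows "color D (sw D x) = color D (ne D x)" "color D (se D x) = color D (nw D x)"
  "lreg D (sw D x) = lreg D (nw D x)" "rreg D (sw D x) = lreg D (se D x)"
  "rreg D (nw D x) = lreg D (ne D x)" "rreg D (se D x) = rreg D (ne D x)" using diagram assms by (auto simp: moy_diagram_def dpt_ok_def)

lemma in_pos_corner:
 assumes "s : in_slots D"
 shows "cor_at D (fst (in_pos s)) (prev (deg_of (fst (in_pos s))) (snd (in_pos s))) = Regular (lreg D (in_arc D s))"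
  "cor_at D (fst (in_pos s)) (snd (in_pos s)) = Regular (rreg D (in_arc D s))" using assms by (auto simp: in_slots_def prev_def dptD)

lemma out_pos_corner:
 assumes "s : out_slots D"
 shows "cor_at D (fst (out_pos s)) (prev (deg_of (fst (out_pos s))) (snd (out_pos s))) = Regular (rreg D (out_arc D s))"
  "cor_at D (fst (out_pos s)) (snd (out_pos s)) = Regular (lreg D (out_arc D s))" using assms by (auto simp: out_slots_def prev_def dptD)

lemma circle_corner:
 assumes "p : circ_pts D"
 shows "cor_at D p 1 = cor_at D (nxt D p) 1" "cor_at D p 0 = cor_at D (nxt D p) 2"
proof -
 have "cor_at D p 1 = cor_at D (nxt D p) 1 & cor_at D p 0 = cor_at D (nxt D p) 2"
 proof (cases p rule: point.exhaust)
  case (Cross C)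
  then obtain v j where p: "p = Cross (Circ v j)" "v : verts D" "j < length (ins D v)" using assms by (auto simp: circ_pts_def)
  note f = vert_fan[OF p(2)]
  show ?thesis
 proof (cases "Suc j < length (ins D v)")
  case True
  thus ?thesis using p fan_nth[OF f(1)] by auto
 next
  case False
  hence j: "j = length (ins D v) - 1" using p by auto
  show ?thesis using fan_last[OF f(1) ins_nonempty[OF p(2)]] fan_zero[OF f(1) ins_nonempty[OF p(2)]] fan_last[OF f(2)] p j f False by auto
 qed
 next
  case (Out v j)
  hence p: "v : verts D" "j < length (outs D v)" using assms by (auto simp: circ_pts_def)
  note f = vert_fan[OF p(1)]
  show ?thesis
 proof (cases "0 < j")
  case True
  thus ?thesis using Out p fan_nth[OF f(2), of "j - 1"] by auto
 next
  case False
  thus ?thesis using Out p fan_zero[OF f(2)] fan_zero[OF f(1) ins_nonempty[OF p(1)]] by force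
 qed
 qed
 thus "cor_at D p 1 = cor_at D (nxt D p) 1" "cor_at D p 0 = cor_at D (nxt D p) 2" by auto
qed

lemma fin_circle: "finite (circ_pts D)"
proof -
 have "circ_pts D \<subseteq> (\<Union>v\<in>verts D. (%j. Cross (Circ v j)) ` {..<length (ins D v)} Un Out v ` {..<length (outs D v)})"
 by (auto simp: circ_pts_def)
 thus ?thesis by (rule finite_subset) (use fin in auto)
qed

lemma AA_cases:
 assumes "a : arcs D"
 obtains s s' where "s : in_slots D" "s' : out_slots D" "in_arc D s = a" "out_arc D s' = a"
  "etgt D (AA a) = in_pos s" "esrc D (AA a) = out_pos s'"
proof -
 have "a : in_arc D ` in_slots D" "a : out_arc D ` out_slots D" using slots_bij assms by auto
 thus thesis using that tgt_AA src_AA by force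
qed

lemma medges: "medges D = AA ` arcs D Un Seg ` circ_pts D" by (simp add: medges_def arcs_open)

lemma tgt_image: "etgt D ` medges D = in_pos ` in_slots D Un (%p. (p, 2)) ` circ_pts D"
proof -
 have "etgt D ` AA ` arcs D = in_pos ` in_slots D" unfolding slots_bij(3)[symmetric] image_image using tgt_AA by (auto intro!: image_cong)
 moreover have "etgt D ` Seg ` circ_pts D = (%p. (p, 2)) ` circ_pts D"
 proof -
  have "nxt D ` circ_pts D = circ_pts D" using nxt_prv by (auto simp: image_iff) metis
  hence "(%p. (p, 2)) ` nxt D ` circ_pts D = (%p. (p, 2)) ` circ_pts D" by simp
  thus ?thesis by (simp add: image_image etgt_def)
 qed
 ultimately show ?thesis by (simp add: medges image_Un)
qed

lemma src_image: "esrc D ` medges D = out_pos ` out_slots D Un (%p. (p, 1)) ` circ_pts D"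
proof -
 have "esrc D ` AA ` arcs D = out_pos ` out_slots D" unfolding slots_bij(4)[symmetric] image_image using src_AA by (auto intro!: image_cong)
 moreover have "esrc D ` Seg ` circ_pts D = (%p. (p, 1)) ` circ_pts D" by (simp add: image_image esrc_def)
 ultimately show ?thesis by (simp add: medges image_Un)
qed

lemma edges_joined:
 shows "a : arcs D ==> (fst (esrc D (AA a)), fst (etgt D (AA a))) : joined (fst \<circ> esrc D) (fst \<circ> etgt D) (medges D)"
  "p : circ_pts D ==> (p, nxt D p) : joined (fst \<circ> esrc D) (fst \<circ> etgt D) (medges D)"
 using joined_edge[of "AA a" "medges D" "fst \<circ> esrc D" "fst \<circ> etgt D"]
  joined_edge[of "Seg p" "medges D" "fst \<circ> esrc D" "fst \<circ> etgt D"] by (auto simp: medges esrc_def etgt_def)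

lemma circle_joined:
 assumes v: "v : verts D"
 shows "j < length (ins D v) ==> (Cross (Circ v j), Cross (Circ v 0)) : joined (fst \<circ> esrc D) (fst \<circ> etgt D) (medges D)"
  "j < length (outs D v) ==> (Out v j, Cross (Circ v 0)) : joined (fst \<circ> esrc D) (fst \<circ> etgt D) (medges D)"
proof -
 define J where "J = joined (fst \<circ> esrc D) (fst \<circ> etgt D) (medges D)"
 have trans: "(p, q) : J ==> (q, r) : J ==> (p, r) : J" and sym: "(p, q) : J ==> (q, p) : J"
  and refl: "(p, p) : J" for p q r unfolding J_def by (blast intro: joined_trans joined_sym joined_refl)+
 note step = edges_joined(2)[folded J_def]
 have 1: "(Cross (Circ v j), Cross (Circ v 0)) : J" if "j < length (ins D v)" for j using that
 proof (induction j)
  case (Suc j)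
  have "(Cross (Circ v j), nxt D (Cross (Circ v j))) : J" using Suc.prems v by (intro step) (auto simp: circ_pts_def)
  hence "(Cross (Circ v (Suc j)), Cross (Circ v j)) : J" using Suc.prems sym by simp
  thus ?case using trans Suc.IH Suc.prems Suc_lessD by meson
 qed (rule refl)
 have 2: "(Out v j, Cross (Circ v 0)) : J" if "j < length (outs D v)" for j using that
 proof (induction j)
  case 0
  have "(Out v 0, nxt D (Out v 0)) : J" using 0 v by (intro step) (auto simp: circ_pts_def)
  thus ?case by simp
 next
  case (Suc j)
  have "(Out v (Suc j), nxt D (Out v (Suc j))) : J" using Suc.prems v by (intro step) (auto simp: circ_pts_def)
  hence "(Out v (Suc j), Out v j) : J" by simp
  thus ?case using trans Suc.IH Suc.prems Suc_lessD by meson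
 qed
 show "j < length (ins D v) ==> (Cross (Circ v j), Cross (Circ v 0)) : joined (fst \<circ> esrc D) (fst \<circ> etgt D) (medges D)"
  "j < length (outs D v) ==> (Out v j, Cross (Circ v 0)) : joined (fst \<circ> esrc D) (fst \<circ> etgt D) (medges D)"
 using 1 2 unfolding J_def by blast+
qed

definition rep :: "cell => point" where
 "rep c = (case c of Arc a => fst (esrc D (AA a)) | DPt x => Cross (Dbl x) | Vert v => Cross (Circ v 0) | Rgn r => undefined)"

lemma rep_joined:
 assumes "(c, d) : graph_inc D"
 shows "(rep c, rep d) : joined (fst \<circ> esrc D) (fst \<circ> etgt D) (medges D)"
proof -
 let ?J = "joined (fst \<circ> esrc D) (fst \<circ> etgt D) (medges D)"
 have ins: "(rep (Arc (in_arc D s)), fst (in_pos s)) : ?J" if "s : in_slots D" for s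
 proof -
  have "in_arc D s : arcs D" using in_arc_arcs[OF that] .
  thus ?thesis using edges_joined(1)[of "in_arc D s"] tgt_AA[OF that] by (simp add: rep_def)
 qed
 have outs: "(rep (Arc (out_arc D s)), fst (out_pos s)) : ?J" if "s : out_slots D" for s using src_AA[OF that] by (simp add: rep_def)
 from assms consider (dpt) a x where "c = Arc a" "d = DPt x" "x : dpts D" "a : {sw D x, se D x, nw D x, ne D x}"
  | (vert) a v where "c = Arc a" "d = Vert v" "v : verts D" "a : set (ins D v) Un set (outs D v)" by (auto simp: graph_inc_def)
 thus ?thesis
 proof cases
  case dpt
  have "LeftSlot x : in_slots D" "RightSlot x : in_slots D" "LeftSlot x : out_slots D" "RightSlot x : out_slots D"
 using dpt by (auto simp: in_slots_def out_slots_def)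
  hence "(rep (Arc (sw D x)), Cross (Dbl x)) : ?J" "(rep (Arc (se D x)), Cross (Dbl x)) : ?J"
  "(rep (Arc (nw D x)), Cross (Dbl x)) : ?J" "(rep (Arc (ne D x)), Cross (Dbl x)) : ?J"
 using ins[of "LeftSlot x"] ins[of "RightSlot x"] outs[of "LeftSlot x"] outs[of "RightSlot x"] by simp_all
  thus ?thesis using dpt by (auto simp: rep_def)
 next
  case vert
  from vert(4) show ?thesis
 proof
  assume "a : set (ins D v)"
  then obtain j where j: "j < length (ins D v)" "ins D v ! j = a" by (metis in_set_conv_nth)
  hence "VertexSlot v j : in_slots D" using vert by (auto simp: in_slots_def)
  hence "(rep (Arc a), Cross (Circ v j)) : ?J" using ins[of "VertexSlot v j"] j by simp
  hence "(rep (Arc a), Cross (Circ v 0)) : ?J" using circle_joined(1)[OF vert(3) j(1)] by (rule joined_trans)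
  thus ?thesis using vert by (simp add: rep_def)
 next
  assume "a : set (outs D v)"
  then obtain j where j: "j < length (outs D v)" "outs D v ! j = a" by (metis in_set_conv_nth)
  hence "VertexSlot v j : out_slots D" using vert by (auto simp: out_slots_def)
  hence "(rep (Arc a), Out v j) : ?J" using outs[of "VertexSlot v j"] j by simp
  hence "(rep (Arc a), Cross (Circ v 0)) : ?J" using circle_joined(2)[OF vert(3) j(1)] by (rule joined_trans)
  thus ?thesis using vert by (simp add: rep_def)
 qed
 qed
qed

lemma map_connected:
 assumes "p : mpts D" "q : mpts D"
 shows "(p, q) : joined (fst \<circ> esrc D) (fst \<circ> etgt D) (medges D)"
proof -
 let ?J = "joined (fst \<circ> esrc D) (fst \<circ> etgt D) (medges D)"
 have cells: "(rep c, rep d) : ?J" if cd: "c : graph_cells D" "d : graph_cells D" for c d using linked_all[OF cd, unfolded linked_def]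
 proof (induction rule: rtrancl_induct)
  case (step y z)
  from step.hyps(2) have "(rep y, rep z) : ?J" by (elim UnE) (erule rep_joined, rule joined_sym[OF rep_joined], simp)
  thus ?case by (rule joined_trans[OF step.IH])
 qed simp
 have pt: "EX c:graph_cells D. (p, rep c) : ?J" if p: "p : mpts D" for p
 proof -
  from p consider x where "p = Cross (Dbl x)" "x : dpts D"
  | v j where "p = Cross (Circ v j)" "v : verts D" "j < length (ins D v)"
  | v j where "p = Out v j" "v : verts D" "j < length (outs D v)" by (auto simp: mpts_def circ_pts_def)
  thus ?thesis
 proof cases
  case (1 x)
  thus ?thesis by (intro bexI[of _ "DPt x"]) (auto simp: rep_def graph_cells_def)
 next
  case (2 v j)
  thus ?thesis using circle_joined(1) by (intro bexI[of _ "Vert v"]) (auto simp: rep_def graph_cells_def)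
 next
  case (3 v j)
  thus ?thesis using circle_joined(2) by (intro bexI[of _ "Vert v"]) (auto simp: rep_def graph_cells_def)
 qed
 qed
 obtain c d where "c : graph_cells D" "(p, rep c) : ?J" "d : graph_cells D" "(q, rep d) : ?J" using pt assms by meson
 thus ?thesis using cells by (meson joined_sym joined_trans)
qed

lemma region_touched:
 assumes "r : regs D"
 shows "EX a:arcs D. r : {lreg D a, rreg D a}"
proof -
 obtain v where v: "v : verts D" using has_vertex by auto
 have "planar D" using diagram by (simp add: moy_diagram_def)
 hence "(Rgn r, Vert v) : linked (graph_inc D Un reg_inc D)" unfolding planar_def using assms v by (simp add: graph_cells_def)
 show ?thesis
 proof (rule ccontr)
  assume n: "~ ?thesis"
  have "Rgn r = Rgn r \<longleftrightarrow> Vert v = Rgn r" using \<open>(Rgn r, Vert v) : _\<close>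
 proof (rule linked_invariant)
  fix c d assume cd: "(c, d) : graph_inc D Un reg_inc D"
  have "c ~= Rgn r" using cd by (auto simp: graph_inc_def reg_inc_def)
  moreover have "d ~= Rgn r"
 proof
  assume "d = Rgn r"
  hence "(EX a:arcs D. r : {lreg D a, rreg D a}) \<or> (EX v:verts D. r = wreg D v)" using cd by (auto simp: graph_inc_def reg_inc_def)
  then obtain v where v: "v : verts D" "r = wreg D v" using n by blast
  have "lreg D (ins D v ! 0) = r" using fan_zero[OF vert_fan(1)[OF v(1)] ins_nonempty[OF v(1)]] v by simp
  moreover have "ins D v ! 0 : arcs D"
 proof -
  have "VertexSlot v 0 : in_slots D" using v ins_nonempty[OF v(1)] by (auto simp: in_slots_def)
  thus ?thesis using in_arc_arcs[of "VertexSlot v 0"] by simp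
 qed
  ultimately show False using n by blast
 qed
  ultimately show "c = Rgn r \<longleftrightarrow> d = Rgn r" by simp
 qed
  thus False by simp
 qed
qed

lemma arc_regs: "a : arcs D ==> lreg D a : regs D & rreg D a : regs D" using diagram by (auto simp: moy_diagram_def)

lemma Re_corners: "Re D = (\<Union>p\<in>mpts D. cor_at D p ` {..<deg_of p})"
proof (intro equalityI subsetI)
 fix B assume "B : Re D"
 then consider r where "B = Regular r" "r : regs D" | v where "B = Disc v" "v : verts D" by (auto simp: Re_def)
 thus "B : (\<Union>p\<in>mpts D. cor_at D p ` {..<deg_of p})"
 proof cases
  case (1 r)
  then obtain a where a: "a : arcs D" "r : {lreg D a, rreg D a}" using region_touched by blast
  obtain s where s: "s : in_slots D" "in_arc D s = a" using AA_cases[OF a(1)] by metis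
  have p: "fst (in_pos s) : mpts D" "snd (in_pos s) < deg_of (fst (in_pos s))" using s(1) by (auto simp: in_slots_def mpts_def circ_pts_def)
  have "B = cor_at D (fst (in_pos s)) (prev (deg_of (fst (in_pos s))) (snd (in_pos s))) \<or>
  B = cor_at D (fst (in_pos s)) (snd (in_pos s))" using in_pos_corner[OF s(1)] s(2) a(2) 1 by auto
  thus ?thesis using p prev_less by blast
 next
  case (2 v)
  hence "Cross (Circ v 0) : mpts D" using ins_nonempty by (auto simp: mpts_def circ_pts_def)
  moreover have "B = cor_at D (Cross (Circ v 0)) 1" using 2 by simp
  ultimately show ?thesis by force
 qed
next
 fix B assume "B : (\<Union>p\<in>mpts D. cor_at D p ` {..<deg_of p})"
 then obtain p i where p: "p : mpts D" "B = cor_at D p i" "i < deg_of p" by auto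
 note ia = in_arc_arcs and oa = out_arc_arcs
 from p(1) consider x where "p = Cross (Dbl x)" "x : dpts D"
  | v j where "p = Cross (Circ v j)" "v : verts D" "j < length (ins D v)"
  | v j where "p = Out v j" "v : verts D" "j < length (outs D v)" by (auto simp: mpts_def circ_pts_def)
 thus "B : Re D"
 proof cases
  case (1 x)
  hence "sw D x : arcs D" "se D x : arcs D" "nw D x : arcs D"
 using ia[of "LeftSlot x"] ia[of "RightSlot x"] oa[of "LeftSlot x"] by (auto simp: in_slots_def out_slots_def)
  thus ?thesis using 1 p arc_regs by (auto simp: Re_def)
 next
  case (2 v j)
  hence "ins D v ! j : arcs D" using ia[of "VertexSlot v j"] by (auto simp: in_slots_def)
  thus ?thesis using 2 p arc_regs by (auto simp: Re_def)
 next
  case (3 v j)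
  hence "outs D v ! j : arcs D" using oa[of "VertexSlot v j"] by (auto simp: out_slots_def)
  thus ?thesis using 3 p arc_regs by (auto simp: Re_def)
 qed
qed

lemma map_euler: "card (mpts D) + card (Re D) = card (medges D) + 2"
proof -
 have "card (mpts D) = card (dpts D) + card (circ_pts D)" unfolding mpts_def using fin fin_circle
 by (subst card_Un_disjoint) (auto simp: card_image inj_on_def circ_pts_def)
 moreover have "card (medges D) = card (open_arcs D) + card (circ_pts D)" unfolding medges_def using fin fin_circle arcs_open
 by (subst card_Un_disjoint) (auto simp: card_image inj_on_def)
 moreover have "card (Re D) = card (regs D) + card (verts D)"
 unfolding Re_def using fin by (subst card_Un_disjoint) (auto simp: card_image inj_on_def)
 moreover have "int (card (dpts D) + card (verts D)) - int (card (open_arcs D)) + int (card (regs D)) = 1 + int (card (components D))"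
 using diagram by (auto simp: moy_diagram_def planar_def)
 ultimately show ?thesis using one_component by linarith
qed

sublocale sphere_map "mpts D" deg_of "medges D" "esrc D" "etgt D" "cor_at D" "Re D"
proof
 show "finite (mpts D)" using fin fin_circle by (simp add: mpts_def)
 show "finite (medges D)" using fin fin_circle by (simp add: medges)
 show "0 < deg_of p" for p by (cases p rule: deg_of.cases) auto
 show "inj_on (esrc D) (medges D)"
 proof (rule inj_onI)
  fix e e' assume e: "e : medges D" "e' : medges D" and eq: "esrc D e = esrc D e'"
  have no: "esrc D (AA a) ~= esrc D (Seg p)" if a: "a : arcs D" for a p
 proof -
  obtain s' where "esrc D (AA a) = out_pos s'" using AA_cases[OF a] by metis
  thus ?thesis by (cases s') (auto simp: esrc_def)
 qed
  show "e = e'"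
 proof (cases e)
  case (AA a)
  hence a: "a : arcs D" using e by (auto simp: medges)
  show ?thesis
 proof (cases e')
  case AA': (AA a')
  hence a': "a' : arcs D" using e by (auto simp: medges)
  obtain s where s: "out_arc D s = a" "esrc D (AA a) = out_pos s" using AA_cases[OF a] by metis
  obtain s' where s': "out_arc D s' = a'" "esrc D (AA a') = out_pos s'" using AA_cases[OF a'] by metis
  have "s = s'" using eq s s' AA AA' injD[OF inj_out_pos] by simp
  thus ?thesis using s s' AA AA' by simp
 next
  case (Seg p)
  thus ?thesis using no[OF a, of p] eq AA by simp
 qed
 next
  case (Seg p)
  show ?thesis
 proof (cases e')
  case AA': (AA a')
  hence "a' : arcs D" using e by (auto simp: medges)
  thus ?thesis using no[of a' p] eq Seg AA' by simp
 next
  case (Seg p')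
  note e' = this
  show ?thesis using \<open>e = Seg p\<close> e' eq by (simp add: esrc_def)
 qed
 qed
 qed
 show "inj_on (etgt D) (medges D)"
 proof (rule inj_onI)
  fix e e' assume e: "e : medges D" "e' : medges D" and eq: "etgt D e = etgt D e'"
  have no: "etgt D (AA a) ~= etgt D (Seg p)" if a: "a : arcs D" for a p
 proof -
  obtain s' where "etgt D (AA a) = in_pos s'" using AA_cases[OF a] by metis
  thus ?thesis by (cases s') (auto simp: etgt_def)
 qed
  show "e = e'"
 proof (cases e)
  case (AA a)
  hence a: "a : arcs D" using e by (auto simp: medges)
  show ?thesis
 proof (cases e')
  case AA': (AA a')
  hence a': "a' : arcs D" using e by (auto simp: medges)
  obtain s where s: "in_arc D s = a" "etgt D (AA a) = in_pos s" using AA_cases[OF a] by metis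
  obtain s' where s': "in_arc D s' = a'" "etgt D (AA a') = in_pos s'" using AA_cases[OF a'] by metis
  have "s = s'" using eq s s' AA AA' injD[OF inj_in_pos] by simp
  thus ?thesis using s s' AA AA' by simp
 next
  case (Seg p)
  thus ?thesis using no[OF a, of p] eq AA by simp
 qed
 next
  case (Seg p)
  show ?thesis
 proof (cases e')
  case AA': (AA a')
  hence "a' : arcs D" using e by (auto simp: medges)
  thus ?thesis using no[of a' p] eq Seg AA' by simp
 next
  case (Seg p')
  note e' = this
  show ?thesis
 proof -
  have "p : circ_pts D" "p' : circ_pts D" "nxt D p = nxt D p'" using \<open>e = Seg p\<close> e' e eq by (auto simp: medges etgt_def)
  hence "p = p'" using nxt_prv(3) by metis
  thus ?thesis using \<open>e = Seg p\<close> e' by simp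
 qed
 qed
 qed
 qed
 show "esrc D ` medges D Int etgt D ` medges D = {}"
 proof -
  have "out_pos s ~= (p, 2)" if "p : circ_pts D" for s p using that by (cases s) (auto simp: circ_pts_def)
  moreover have "in_pos s ~= (p, 1)" if "p : circ_pts D" for s p using that by (cases s) (auto simp: circ_pts_def)
  ultimately show ?thesis unfolding src_image tgt_image using in_out_pos by fastforce
 qed
 show "esrc D ` medges D Un etgt D ` medges D = (SIGMA p:mpts D. {..<deg_of p})"
 proof (intro equalityI subsetI)
  fix z assume "z : esrc D ` medges D Un etgt D ` medges D"
  thus "z : (SIGMA p:mpts D. {..<deg_of p})" unfolding src_image tgt_image by (auto simp: in_slots_def out_slots_def mpts_def circ_pts_def)
 next
  fix z assume "z : (SIGMA p:mpts D. {..<deg_of p})"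
  then obtain p i where z: "z = (p, i)" "p : mpts D" "i < deg_of p" by auto
  from z(2) consider x where "p = Cross (Dbl x)" "x : dpts D"
  | v j where "p = Cross (Circ v j)" "v : verts D" "j < length (ins D v)"
  | v j where "p = Out v j" "v : verts D" "j < length (outs D v)" by (auto simp: mpts_def circ_pts_def)
  hence "z : out_pos ` out_slots D \<or> z : in_pos ` in_slots D \<or> z : (%p. (p, 1)) ` circ_pts D \<or>
  z : (%p. (p, 2)) ` circ_pts D"
 proof cases
  case (1 x)
  hence "i = 0 \<or> i = 1 \<or> i = 2 \<or> i = 3" using z by auto
  moreover have "LeftSlot x : in_slots D" "RightSlot x : in_slots D" "LeftSlot x : out_slots D" "RightSlot x : out_slots D"
 using 1 by (auto simp: in_slots_def out_slots_def)
  moreover have "in_pos (LeftSlot x) = (p, 0)" "in_pos (RightSlot x) = (p, 1)" "out_pos (LeftSlot x) = (p, 3)" "out_pos (RightSlot x) = (p, 2)"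
 using 1 by auto
  ultimately show ?thesis unfolding z by (metis imageI)
 next
  case (2 v j)
  hence "i = 0 \<or> i = 1 \<or> i = 2" using z by auto
  moreover have "VertexSlot v j : in_slots D" "p : circ_pts D" using 2 by (auto simp: in_slots_def circ_pts_def)
  moreover have "in_pos (VertexSlot v j) = (p, 0)" using 2 by auto
  ultimately show ?thesis unfolding z by (metis imageI)
 next
  case (3 v j)
  hence "i = 0 \<or> i = 1 \<or> i = 2" using z by auto
  moreover have "VertexSlot v j : out_slots D" "p : circ_pts D" using 3 by (auto simp: out_slots_def circ_pts_def)
  moreover have "out_pos (VertexSlot v j) = (p, 0)" using 3 by auto
  ultimately show ?thesis unfolding z by (metis imageI)
 qed
  thus "z : esrc D ` medges D Un etgt D ` medges D" unfolding src_image tgt_image by blast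
 qed
 have "cor_at D (fst (esrc D e)) (snd (esrc D e)) =
  cor_at D (fst (etgt D e)) (prev (deg_of (fst (etgt D e))) (snd (etgt D e))) \<and>
  cor_at D (fst (esrc D e)) (prev (deg_of (fst (esrc D e))) (snd (esrc D e))) =
  cor_at D (fst (etgt D e)) (snd (etgt D e))" if e: "e : medges D" for e
 proof (cases e)
  case (AA a)
  hence "a : arcs D" using e by (auto simp: medges)
  then obtain s s' where "s : in_slots D" "s' : out_slots D" "in_arc D s = a" "out_arc D s' = a"
  "etgt D (AA a) = in_pos s" "esrc D (AA a) = out_pos s'" by (rule AA_cases)
  thus ?thesis using in_pos_corner[of s] out_pos_corner[of s'] AA by simp
 next
  case (Seg p)
  hence "p : circ_pts D" using e by (auto simp: medges)
  moreover have "deg_of (nxt D p) = 3" using nxt_prv(1)[OF \<open>p : circ_pts D\<close>] by (auto simp: circ_pts_def)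
  moreover have "deg_of p = 3" using \<open>p : circ_pts D\<close> by (auto simp: circ_pts_def)
  ultimately show ?thesis using circle_corner[of p] Seg by (simp add: esrc_def etgt_def prev_def del: nxt.simps cor_at.simps)
 qed
 thus "e : medges D ==> cor_at D (fst (esrc D e)) (snd (esrc D e)) =
  cor_at D (fst (etgt D e)) (prev (deg_of (fst (etgt D e))) (snd (etgt D e)))"
  "e : medges D ==> cor_at D (fst (esrc D e)) (prev (deg_of (fst (esrc D e))) (snd (esrc D e))) =
  cor_at D (fst (etgt D e)) (snd (etgt D e))" for e by blast+
 show "Re D = (\<Union>p\<in>mpts D. cor_at D p ` {..<deg_of p})" by (rule Re_corners)
 show "p : mpts D ==> q : mpts D ==>
  (p, q) : joined (fst \<circ> esrc D) (fst \<circ> etgt D) (medges D)" for p q by (rule map_connected)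
 show "mpts D ~= {}" using has_vertex ins_nonempty by (fastforce simp: mpts_def circ_pts_def)
 show "card (mpts D) + card (Re D) = card (medges D) + 2" by (rule map_euler)
qed

end

lemma (in sphere_map) potential_map:
 fixes ph :: "'a => int"
 assumes flow: "!!p. p : P ==> (SUM a | a : A & fst (tgt a) = p. ph a) = (SUM a | a : A & fst (src a) = p. ph a)"
 shows "EX ind. ALL a:A. ind (lf a) - ind (rf a) = ph a"
proof -
 define z where "z = (%p::'p. 0::nat)"
 interpret D: dual_graphs "split_P {}" "split_A {}" F "split_tail {} z z" "split_head {} z z"
  "split_lf z z" "split_rf z z" by (rule split_dual) auto
 have "EX ind. ALL a:split_A {}. ind (split_lf z z a) - ind (split_rf z z a) = case_sum ph (%_. 0) a"
 proof (rule D.potential)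
  fix q assume "q : split_P {}"
  then obtain p where p: "p : P" "q = (p, False)" by (auto simp: split_P_def)
  have "(SUM a:split_A {}. case_sum ph (%_. 0) a * (of_bool (split_head {} z z a = q) - of_bool (split_tail {} z z a = q))) =
  (SUM a:A. ph a * of_bool (fst (tgt a) = p)) - (SUM a:A. ph a * of_bool (fst (src a) = p))" unfolding split_A_def p(2)
 by (simp add: sum.reindex split_defs half_def case_prod_beta sum_subtractf right_diff_distrib)
  also have "... = (SUM a | a : A & fst (tgt a) = p. ph a) - (SUM a | a : A & fst (src a) = p. ph a)"
 using finA by (simp add: sum.inter_filter of_bool_def if_distrib[of "%t. _ * t"] cong: if_cong)
  finally show "(SUM a:split_A {}. case_sum ph (%_. 0) a * (of_bool (split_head {} z z a = q) - of_bool (split_tail {} z z a = q))) = 0"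
 using flow[OF p(1)] by simp
 qed
 then obtain ind where ind: "ALL a:split_A {}. ind (split_lf z z a) - ind (split_rf z z a) = case_sum ph (%_. 0) a" by blast
 have "ind (lf a) - ind (rf a) = ph a" if "a : A" for a using bspec[OF ind, of "Inl a"] that by (simp add: split_A_def split_defs)
 thus ?thesis by blast
qed

section \<open>Powers of the variable\<close>

lemma thalf_power: "thalf ^ n = Fract (monom 1 n) 1"
proof (induction n)
 case 0
 thus ?case by (simp add: One_fract_def)
next
 case (Suc n)
 thus ?case by (simp add: thalf_def monom_Suc)
qed

lemma thalf_nonzero [simp]: "thalf ~= 0" by (simp add: thalf_def Zero_fract_def eq_fract)

lemma thalf_power_eq_1: "thalf ^ n = 1 \<longleftrightarrow> n = 0"
proof
 assume "thalf ^ n = 1"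
 hence "monom (1::int) n = 1" by (simp add: thalf_power One_fract_def eq_fract)
 thus "n = 0" by (metis degree_1 degree_monom_eq one_neq_zero)
qed simp

lemma thalf_powi_eq_1: "thalf powi k = 1 \<longleftrightarrow> k = 0"
proof (cases "k >= 0")
 case True
 thus ?thesis by (simp add: power_int_def thalf_power_eq_1)
next
 case False
 thus ?thesis by (simp add: power_int_def power_inverse thalf_power_eq_1)
qed

lemma thalf_powi_eq: "thalf powi a = thalf powi b \<longleftrightarrow> a = b"
proof -
 have "thalf powi a = thalf powi (a - b) * thalf powi b" by (simp add: power_int_add[symmetric])
 hence "thalf powi a = thalf powi b \<longleftrightarrow> thalf powi (a - b) = 1" by (metis mult_cancel_right1 power_int_eq_0_iff thalf_nonzero)
 thus ?thesis by (simp add: thalf_powi_eq_1)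
qed

lemma thalf_powi_add: "thalf powi (a + b) = thalf powi a * thalf powi b" by (simp add: power_int_add)

section \<open>Independence of the base point for diagrams\<close>

fun csign :: "point => nat => int" where
 "csign (Cross (Dbl x)) i = (if i = 0 then - 1 else 1)"
| "csign (Cross (Circ v j)) i = (if i = 2 then 1 else - 1)"
| "csign (Out v j) i = 1"

fun cweight :: "moy => point => nat => int poly fract" where
 "cweight D (Cross C) i = weight_M C (corner_of C i) * weight_A D C (corner_of C i)"
| "cweight D (Out v j) i = 0"

fun index_of :: "crossing => corner => nat" where
 "index_of (Dbl x) c = (case c of South => 0 | East => 1 | North => 2 | West => 3)"
| "index_of (Circ v j) c = (case c of South => 0 | East => 0 | North => 1 | West => 2)"

lemma corner_index:
 shows "c : corners C ==> corner_of C (index_of C c) = c"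
  "i < deg_of (Cross C) ==> index_of C (corner_of C i) = i"
  "i < deg_of (Cross C) ==> corner_of C i : corners C"
  "c : corners C ==> index_of C c < deg_of (Cross C)"
proof -
 show "c : corners C ==> corner_of C (index_of C c) = c" by (cases C; cases c) auto
 show "i < deg_of (Cross C) ==> index_of C (corner_of C i) = i" by (cases C) (auto simp: numeral_eq_Suc less_Suc_eq)
 show "i < deg_of (Cross C) ==> corner_of C i : corners C" by (cases C) auto
 show "c : corners C ==> index_of C c < deg_of (Cross C)" by (cases C; cases c) auto
qed

context connected_diagram
begin

lemma Cr_points: "Cross ` Cr D \<subseteq> mpts D" "mpts D - Cross ` Cr D = {Out v j |v j. v : verts D & j < length (outs D v)}"
 by (auto simp: Cr_def mpts_def circ_pts_def)

lemma in_slot_simps: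
 "(Cross (Dbl x), i) : etgt D ` medges D \<longleftrightarrow> x : dpts D & (i = 0 \<or> i = 1)"
 "(Cross (Circ v j), i) : etgt D ` medges D \<longleftrightarrow> v : verts D & j < length (ins D v) & (i = 0 \<or> i = 2)"
 "(Out v j, i) : etgt D ` medges D \<longleftrightarrow> v : verts D & j < length (outs D v) & i = 2"
proof -
 have A: "in_pos ` in_slots D = (%x. (Cross (Dbl x), 0)) ` dpts D Un (%x. (Cross (Dbl x), 1)) ` dpts D \<union>
  {(Cross (Circ v j), 0) |v j. v : verts D & j < length (ins D v)}" unfolding in_slots_def image_Un image_image by force
 show "(Cross (Dbl x), i) : etgt D ` medges D \<longleftrightarrow> x : dpts D & (i = 0 \<or> i = 1)"
  "(Cross (Circ v j), i) : etgt D ` medges D \<longleftrightarrow> v : verts D & j < length (ins D v) & (i = 0 \<or> i = 2)"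
  "(Out v j, i) : etgt D ` medges D \<longleftrightarrow> v : verts D & j < length (outs D v) & i = 2"
 unfolding tgt_image A by (auto simp: circ_pts_def)
qed

lemma Seg_ends: "etgt D (Seg p) = (nxt D p, 2)" "esrc D (Seg p) = (p, 1)" by (auto simp: etgt_def esrc_def)

sublocale signed_map "mpts D" deg_of "medges D" "esrc D" "etgt D" "cor_at D" "Re D"
 "Cross ` Cr D" csign
proof
 show "Cross ` Cr D \<subseteq> mpts D" by (rule Cr_points)
 show "csign p i = 1 \<or> csign p i = - 1" for p i by (cases "(p, i)" rule: csign.cases) auto
 show "csign p (prev (deg_of p) i) * csign p i = (if (p, i) : etgt D ` medges D then - 1 else 1)"
  if pi: "p : Cross ` Cr D" "i < deg_of p" for p i
 proof -
  obtain C where C: "p = Cross C" "C : Cr D" using pi by auto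
  show ?thesis
 proof (cases C)
  case (Dbl x)
  hence "x : dpts D" "i = 0 \<or> i = 1 \<or> i = 2 \<or> i = 3" using C pi by (auto simp: Cr_def)
  thus ?thesis using C Dbl by (elim disjE) (simp_all add: in_slot_simps prev_def)
 next
  case (Circ v j)
  hence "v : verts D" "j < length (ins D v)" "i = 0 \<or> i = 1 \<or> i = 2" using C pi by (auto simp: Cr_def)
  thus ?thesis using C Circ by (elim disjE) (simp_all add: in_slot_simps prev_def)
 qed
 qed
 show "(PROD i<deg_of p. if (p, i) : etgt D ` medges D then - 1 else 1 :: int) = - 1"
  if "p : mpts D - Cross ` Cr D" for p
 proof -
  obtain v j where p: "p = Out v j" "v : verts D" "j < length (outs D v)" using \<open>p : _\<close> unfolding Cr_points by auto
  have "(PROD i<deg_of p. if (p, i) : etgt D ` medges D then - 1 else 1 :: int) =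
  (PROD i<3::nat. if i = 2 then - 1 else 1)" using p by (intro prod.cong) (auto simp: in_slot_simps)
  also have "... = - 1" by (simp add: numeral_3_eq_3 numeral_2_eq_2)
  finally show ?thesis .
 qed
qed

lemma lf_AA: "a : arcs D ==> lf (AA a) = Regular (lreg D a)"
 and rf_AA: "a : arcs D ==> rf (AA a) = Regular (rreg D a)"
proof -
 assume a: "a : arcs D"
 obtain s where s: "s : out_slots D" "out_arc D s = a" "esrc D (AA a) = out_pos s" using AA_cases[OF a] by metis
 show "lf (AA a) = Regular (lreg D a)" "rf (AA a) = Regular (rreg D a)" unfolding lf_def rf_def using out_pos_corner[OF s(1)] s by simp_all
qed

definition to_state :: "(crossing => corner) => point => nat" where
 "to_state s = restrict (%p. case p of Cross C => index_of C (s C) | Out v j => 0) (Cross ` Cr D)"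

definition of_state :: "(point => nat) => crossing => corner" where
 "of_state t = restrict (%C. corner_of C (t (Cross C))) (Cr D)"

lemma to_state:
 assumes dl: "dl : arcs D" and s: "s : states D dl"
 shows "to_state s : states_at (AA dl)" "of_state (to_state s) = s"
  "C : Cr D ==> cor_at D (Cross C) (to_state s (Cross C)) = corner_region D C (s C)"
proof -
 have sc: "s C : corners C" if "C : Cr D" for C using s that by (auto simp: states_def)
 have ts: "to_state s (Cross C) = index_of C (s C)" if "C : Cr D" for C using that by (simp add: to_state_def)
 have cor: "cor_at D (Cross C) (to_state s (Cross C)) = corner_region D C (s C)" if "C : Cr D" for C
 using that corner_index(1)[OF sc[OF that]] by (simp add: ts)
 thus "C : Cr D ==> cor_at D (Cross C) (to_state s (Cross C)) = corner_region D C (s C)" .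
 have "bij_betw (%C. corner_region D C (s C)) (Cr D) (Re D - {lf (AA dl), rf (AA dl)})" using s by (simp add: states_def lf_AA[OF dl] rf_AA[OF dl])
 hence "bij_betw ((%p. cor_at D p (to_state s p)) \<circ> Cross) (Cr D) (Re D - {lf (AA dl), rf (AA dl)})"
 by (subst bij_betw_cong[of _ _ "%C. corner_region D C (s C)"]) (use cor in auto)
 moreover have "bij_betw Cross (Cr D) (Cross ` Cr D)" by (auto simp: bij_betw_def inj_on_def)
 ultimately have "bij_betw (%p. cor_at D p (to_state s p)) (Cross ` Cr D) (Re D - {lf (AA dl), rf (AA dl)})" using bij_betw_comp_iff by metis
 moreover have "to_state s p < deg_of p" if "p : Cross ` Cr D" for p using that ts sc corner_index(4) by (metis imageE)
 ultimately have "state (AA dl) (to_state s)" by (simp add: state_def)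
 moreover have "to_state s : (\<Pi>\<^sub>E p\<in>Cross ` Cr D. {..<deg_of p})"
 using \<open>!!p. p : Cross ` Cr D ==> to_state s p < deg_of p\<close> by (auto simp: to_state_def)
 ultimately show "to_state s : states_at (AA dl)" by (simp add: states_at_def)
 show "of_state (to_state s) = s"
 proof
  fix C
  show "of_state (to_state s) C = s C"
 proof (cases "C : Cr D")
  case True
  thus ?thesis using corner_index(1)[OF sc[OF True]] ts by (simp add: of_state_def)
 next
  case False
  moreover have "s : extensional (Cr D)" using s by (auto simp: states_def PiE_def)
  ultimately show ?thesis by (auto simp: of_state_def extensional_def)
 qed
 qed
qed

lemma of_state:
 assumes dl: "dl : arcs D" and t: "t : states_at (AA dl)"
 shows "of_state t : states D dl" "to_state (of_state t) = t"
proof -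
 have tc: "t (Cross C) < deg_of (Cross C)" if "C : Cr D" for C using t that by (auto simp: states_at_def state_def)
 have "bij_betw (%p. cor_at D p (t p)) (Cross ` Cr D) (Re D - {lf (AA dl), rf (AA dl)})" using t by (auto simp: states_at_def state_def)
 moreover have "bij_betw Cross (Cr D) (Cross ` Cr D)" by (auto simp: bij_betw_def inj_on_def)
 ultimately have "bij_betw ((%p. cor_at D p (t p)) \<circ> Cross) (Cr D) (Re D - {lf (AA dl), rf (AA dl)})" using bij_betw_comp_iff by metis
 hence "bij_betw (%C. corner_region D C (of_state t C)) (Cr D) (Re D - {Regular (lreg D dl), Regular (rreg D dl)})"
 unfolding lf_AA[OF dl] rf_AA[OF dl] by (subst bij_betw_cong[of _ _ "(%p. cor_at D p (t p)) \<circ> Cross"]) (auto simp: of_state_def)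
 moreover have "of_state t : (\<Pi>\<^sub>E C\<in>Cr D. corners C)" using tc corner_index(3) by (auto simp: of_state_def)
 ultimately show "of_state t : states D dl" by (simp add: states_def)
 show "to_state (of_state t) = t"
 proof
  fix p
  show "to_state (of_state t) p = t p"
 proof (cases "p : Cross ` Cr D")
  case True
  then obtain C where C: "p = Cross C" "C : Cr D" by auto
  thus ?thesis using corner_index(2)[OF tc[OF C(2)]] by (simp add: to_state_def of_state_def)
 next
  case False
  moreover have "t : extensional (Cross ` Cr D)" using t by (auto simp: states_at_def PiE_def)
  ultimately show ?thesis by (auto simp: to_state_def extensional_def)
 qed
 qed
qed

lemma state_sum_diagram:
 assumes dl: "dl : arcs D"
 shows "(SUM s:states D dl. state_M D s * state_A D s) = state_sum (cweight D) (AA dl)" unfolding state_sum_def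
proof (rule sum.reindex_bij_witness[of _ of_state to_state])
 fix s assume s: "s : states D dl"
 show "of_state (to_state s) = s" "to_state s : states_at (AA dl)" using to_state[OF dl s] by auto
 have sc: "s C : corners C" if "C : Cr D" for C using s that by (auto simp: states_def)
 have "(PROD p:Cross ` Cr D. cweight D p (to_state s p)) = (PROD C:Cr D. weight_M C (s C) * weight_A D C (s C))"
 proof (subst prod.reindex)
  show "inj_on Cross (Cr D)" by (auto simp: inj_on_def)
  show "prod ((%p. cweight D p (to_state s p)) \<circ> Cross) (Cr D) = (PROD C:Cr D. weight_M C (s C) * weight_A D C (s C))"
 by (rule prod.cong[OF refl]) (use corner_index(1)[OF sc] in \<open>simp add: to_state_def\<close>)
 qed
 thus "(PROD p:Cross ` Cr D. cweight D p (to_state s p)) = state_M D s * state_A D s" by (simp add: state_M_def state_A_def prod.distrib)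
qed (use of_state[OF dl] in auto)

lemma edges_at:
 shows "x : dpts D ==> {e : medges D. fst (etgt D e) = Cross (Dbl x)} = {AA (sw D x), AA (se D x)}"
  "x : dpts D ==> {e : medges D. fst (esrc D e) = Cross (Dbl x)} = {AA (nw D x), AA (ne D x)}"
  "v : verts D ==> j < length (ins D v) ==>
  {e : medges D. fst (etgt D e) = Cross (Circ v j)} = {AA (ins D v ! j), Seg (prv D (Cross (Circ v j)))}"
  "v : verts D ==> j < length (ins D v) ==>
  {e : medges D. fst (esrc D e) = Cross (Circ v j)} = {Seg (Cross (Circ v j))}"
  "v : verts D ==> j < length (outs D v) ==>
  {e : medges D. fst (etgt D e) = Out v j} = {Seg (prv D (Out v j))}"
  "v : verts D ==> j < length (outs D v) ==>
  {e : medges D. fst (esrc D e) = Out v j} = {AA (outs D v ! j), Seg (Out v j)}"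
proof -
 have tgt: "{e : medges D. fst (etgt D e) = p} =
  (%s. AA (in_arc D s)) ` {s : in_slots D. fst (in_pos s) = p} Un Seg ` {q : circ_pts D. nxt D q = p}" for p
 proof (intro equalityI subsetI)
  fix e assume "e : {e : medges D. fst (etgt D e) = p}"
  hence e: "e : medges D" "fst (etgt D e) = p" by auto
  show "e : (%s. AA (in_arc D s)) ` {s : in_slots D. fst (in_pos s) = p} Un Seg ` {q : circ_pts D. nxt D q = p}"
 proof (cases e)
  case (AA a)
  hence "a : arcs D" using e by (auto simp: medges)
  then obtain s where "s : in_slots D" "in_arc D s = a" "etgt D (AA a) = in_pos s" using AA_cases by metis
  thus ?thesis using AA e by force
 next
  case (Seg q)
  thus ?thesis using e by (auto simp: medges etgt_def)
 qed
 qed (auto simp: tgt_AA medges in_arc_arcs Seg_ends)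
 have src: "{e : medges D. fst (esrc D e) = p} =
  (%s. AA (out_arc D s)) ` {s : out_slots D. fst (out_pos s) = p} Un Seg ` {q : circ_pts D. q = p}" for p
 proof (intro equalityI subsetI)
  fix e assume "e : {e : medges D. fst (esrc D e) = p}"
  hence e: "e : medges D" "fst (esrc D e) = p" by auto
  show "e : (%s. AA (out_arc D s)) ` {s : out_slots D. fst (out_pos s) = p} Un Seg ` {q : circ_pts D. q = p}"
 proof (cases e)
  case (AA a)
  hence "a : arcs D" using e by (auto simp: medges)
  then obtain s where "s : out_slots D" "out_arc D s = a" "esrc D (AA a) = out_pos s" using AA_cases by metis
  thus ?thesis using AA e by force
 next
  case (Seg q)
  thus ?thesis using e by (auto simp: medges esrc_def)
 qed
 qed (auto simp: src_AA medges out_arc_arcs Seg_ends)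
 have nxt: "{q : circ_pts D. nxt D q = p} = (if p : circ_pts D then {prv D p} else {})" for p using nxt_prv by auto
 have islot: "{s : in_slots D. fst (in_pos s) = Cross (Dbl x)} = (if x : dpts D then {LeftSlot x, RightSlot x} else {})"
  "{s : in_slots D. fst (in_pos s) = Cross (Circ v j)} = (if v : verts D & j < length (ins D v) then {VertexSlot v j} else {})"
  "{s : in_slots D. fst (in_pos s) = Out v j} = {}" for x v j by (auto simp: in_slots_def)
 have oslot: "{s : out_slots D. fst (out_pos s) = Cross (Dbl x)} = (if x : dpts D then {LeftSlot x, RightSlot x} else {})"
  "{s : out_slots D. fst (out_pos s) = Out v j} = (if v : verts D & j < length (outs D v) then {VertexSlot v j} else {})"
  "{s : out_slots D. fst (out_pos s) = Cross (Circ v j)} = {}" for x v j by (auto simp: out_slots_def)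
 have cp: "Cross (Dbl x) ~: circ_pts D" "Cross (Circ v j) : circ_pts D \<longleftrightarrow> v : verts D & j < length (ins D v)"
  "Out v j : circ_pts D \<longleftrightarrow> v : verts D & j < length (outs D v)" for x v j by (auto simp: circ_pts_def)
 show "x : dpts D ==> {e : medges D. fst (etgt D e) = Cross (Dbl x)} = {AA (sw D x), AA (se D x)}" unfolding tgt nxt islot by (simp add: cp)
 show "x : dpts D ==> {e : medges D. fst (esrc D e) = Cross (Dbl x)} = {AA (nw D x), AA (ne D x)}" unfolding src oslot by (auto simp: cp)
 show "v : verts D ==> j < length (ins D v) ==>
  {e : medges D. fst (etgt D e) = Cross (Circ v j)} = {AA (ins D v ! j), Seg (prv D (Cross (Circ v j)))}"
 unfolding tgt nxt islot by (simp add: cp insert_commute del: prv.simps)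
 show "v : verts D ==> j < length (ins D v) ==>
  {e : medges D. fst (esrc D e) = Cross (Circ v j)} = {Seg (Cross (Circ v j))}" unfolding src oslot by (auto simp: cp)
 show "v : verts D ==> j < length (outs D v) ==>
  {e : medges D. fst (etgt D e) = Out v j} = {Seg (prv D (Out v j))}" unfolding tgt nxt islot by (simp add: cp insert_commute del: prv.simps)
 show "v : verts D ==> j < length (outs D v) ==>
  {e : medges D. fst (esrc D e) = Out v j} = {AA (outs D v ! j), Seg (Out v j)}" unfolding src oslot by (auto simp: cp)
qed

definition flow :: "edge => int" where
 "flow e = (case e of AA a => int (color D a)
  | Seg (Cross (Circ v j)) => int (sum_list (map (color D) (take (Suc j) (ins D v))))
  | Seg (Out v j) => int (sum_list (map (color D) (take j (outs D v))))
  | Seg (Cross (Dbl x)) => 0)"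

lemma balanced: "v : verts D ==> sum_list (map (color D) (ins D v)) = sum_list (map (color D) (outs D v))"
 using diagram by (auto simp: moy_diagram_def vert_ok_def)

lemma index_exists: "EX ind :: region => int. ALL a:arcs D. ind (Regular (lreg D a)) - ind (Regular (rreg D a)) = int (color D a)"
proof -
 have "EX ind. ALL e:medges D. ind (lf e) - ind (rf e) = flow e"
 proof (rule potential_map)
  fix p assume "p : mpts D"
  then consider x where "p = Cross (Dbl x)" "x : dpts D"
  | v j where "p = Cross (Circ v j)" "v : verts D" "j < length (ins D v)"
  | v j where "p = Out v j" "v : verts D" "j < length (outs D v)" by (auto simp: mpts_def circ_pts_def)
  thus "(SUM e | e : medges D & fst (etgt D e) = p. flow e) = (SUM e | e : medges D & fst (esrc D e) = p. flow e)"
 proof cases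
  case (1 x)
  have s: "LeftSlot x : in_slots D" "RightSlot x : in_slots D" "LeftSlot x : out_slots D" "RightSlot x : out_slots D"
 using 1 by (auto simp: in_slots_def out_slots_def)
  have "sw D x ~= se D x" using inj_onD[OF slots_bij(1), of "LeftSlot x" "RightSlot x"] s by auto
  moreover have "nw D x ~= ne D x" using inj_onD[OF slots_bij(2), of "LeftSlot x" "RightSlot x"] s by auto
  ultimately show ?thesis unfolding 1(1) edges_at(1,2)[OF 1(2)] by (simp add: flow_def dptD[OF 1(2)])
 next
  case (2 v j)
  have "flow (Seg (prv D p)) + int (color D (ins D v ! j)) = flow (Seg p)"
 proof (cases "0 < j")
  case True
  thus ?thesis using 2 by (simp add: flow_def take_Suc_conv_app_nth)
 next
  case False
  show ?thesis
 proof (cases "outs D v = []")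
  case True
  hence z: "sum_list (map (color D) (ins D v)) = 0" using balanced[OF 2(2)] by simp
  moreover have "color D (ins D v ! 0) = 0" using z ins_nonempty[OF 2(2)] by (auto simp: sum_list_eq_0_iff)
  ultimately show ?thesis using 2 False True ins_nonempty[OF 2(2)] by (simp add: flow_def take_Suc_conv_app_nth)
 next
  case F: False
  thus ?thesis using 2 False by (simp add: flow_def take_Suc_conv_app_nth)
 qed
 qed
  thus ?thesis unfolding 2(1) edges_at(3,4)[OF 2(2,3)] by (simp add: flow_def del: prv.simps)
 next
  case (3 v j)
  have "flow (Seg (prv D p)) = flow (Seg p) + int (color D (outs D v ! j))"
 proof (cases "Suc j < length (outs D v)")
  case True
  thus ?thesis using 3 by (simp add: flow_def take_Suc_conv_app_nth)
 next
  case False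
  hence "outs D v = take j (outs D v) @ [outs D v ! j]" using take_Suc_conv_app_nth[OF 3(3)] by simp
  from arg_cong[OF this, of "%l. sum_list (map (color D) l)"] have "sum_list (map (color D) (outs D v)) = sum_list (map (color D) (take j (outs D v))) + color D (outs D v ! j)"
 by (simp only: map_append sum_list_append list.map sum_list.Cons sum_list.Nil add_0_right)
  thus ?thesis using 3 False ins_nonempty[OF 3(2)] balanced[OF 3(2)] by (simp add: flow_def)
 qed
  thus ?thesis unfolding 3(1) edges_at(5,6)[OF 3(2,3)] by (simp add: flow_def del: prv.simps)
 qed
 qed
 then obtain ind where ind: "ALL e:medges D. ind (lf e) - ind (rf e) = flow e" by blast
 have "ind (Regular (lreg D a)) - ind (Regular (rreg D a)) = int (color D a)" if "a : arcs D" for a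
 using bspec[OF ind, of "AA a"] that by (simp add: medges lf_AA rf_AA flow_def)
 thus ?thesis by blast
qed

lemma region_index: "a : arcs D ==> region_index D (lreg D a) - region_index D (rreg D a) = int (color D a)"
proof -
 obtain ind :: "region => int" where ind: "ALL a:arcs D. ind (Regular (lreg D a)) - ind (Regular (rreg D a)) = int (color D a)"
 using index_exists by blast
 let ?P = "%ind. ind (unbounded D) = 0 & (ALL a:arcs D. ind (lreg D a) - ind (rreg D a) = int (color D a))"
 have "?P (%r. ind (Regular r) - ind (Regular (unbounded D)))" using ind by simp
 hence "?P (SOME ind. ?P ind)" by (rule someI[of ?P])
 hence "?P (region_index D)" unfolding region_index_def .
 thus "a : arcs D ==> region_index D (lreg D a) - region_index D (rreg D a) = int (color D a)" by blast
qed

lemma kernel_one: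
 assumes "p : Cross ` Cr D"
 shows "(SUM i<deg_of p. of_int (csign p i) * cweight D p i) = 0"
proof -
 obtain C where C: "p = Cross C" using assms by auto
 show ?thesis by (cases C) (simp_all add: C numeral_eq_Suc Let_def)
qed

lemma kernel_index:
 assumes "p : Cross ` Cr D"
 shows "(SUM i<deg_of p. of_int (csign p i) * cweight D p i *
  (case cor_at D p i of Regular r => thalf powi (2 * region_index D r) | Disc v => 0)) = 0"
proof -
 obtain C where C: "p = Cross C" "C : Cr D" using assms by auto
 let ?n = "region_index D"
 show ?thesis
 proof (cases C)
  case (Dbl x)
  hence x: "x : dpts D" using C by (auto simp: Cr_def)
  have a: "sw D x : arcs D" "se D x : arcs D" "nw D x : arcs D"
 using in_arc_arcs[of "LeftSlot x"] in_arc_arcs[of "RightSlot x"] out_arc_arcs[of "LeftSlot x"] x by (auto simp: in_slots_def out_slots_def)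
  define w where "w = ?n (lreg D (sw D x))"
  have s: "?n (rreg D (sw D x)) = w - int (color D (sw D x))" using region_index[OF a(1)] by (simp add: w_def)
  have n: "?n (rreg D (nw D x)) = w - int (color D (se D x))" using region_index[OF a(3)] dptD[OF x] by (simp add: w_def)
  have e: "?n (rreg D (se D x)) = w - int (color D (sw D x)) - int (color D (se D x))" using region_index[OF a(2)] dptD[OF x] s by simp
  show ?thesis by (simp add: C(1) Dbl numeral_eq_Suc over_color_def s n e flip: w_def)
  (simp add: thalf_powi_add[symmetric] algebra_simps)
 next
  case (Circ v j)
  hence v: "v : verts D" "j < length (ins D v)" using C by (auto simp: Cr_def)
  hence a: "ins D v ! j : arcs D" using in_arc_arcs[of "VertexSlot v j"] by (auto simp: in_slots_def)
  define w where "w = ?n (lreg D (ins D v ! j))"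
  have e: "?n (rreg D (ins D v ! j)) = w - int (color D (ins D v ! j))" using region_index[OF a] by (simp add: w_def)
  show ?thesis by (simp add: C(1) Circ numeral_eq_Suc Let_def e flip: w_def)
  (simp add: algebra_simps flip: thalf_powi_add power_int_of_nat)
 qed
qed

theorem bracket_base:
 assumes "base_point D dl" "base_point D dl'"
 shows "bracket D dl = bracket D dl'"
proof -
 define y where "y f = (case f of Regular r => thalf powi (2 * region_index D r) | Disc v => 0)" for f
 have val: "1 * y (rf (AA d)) - 1 * y (lf (AA d)) = base_value D d & base_value D d ~= 0" if "base_point D d" for d
 proof -
  have d: "d : arcs D" "color D d ~= 0" using that by (auto simp: base_point_def)
  have n: "region_index D (rreg D d) = region_index D (lreg D d) - int (color D d)" using region_index[OF d(1)] by simp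
  show ?thesis using d by (simp add: lf_AA rf_AA y_def base_value_def Let_def n thalf_powi_eq)
 qed
 have d: "dl : arcs D" "dl' : arcs D" using assms by (auto simp: base_point_def)
 have e: "AA dl : medges D" "AA dl' : medges D" using d by (auto simp: medges)
 have "state_sum (cweight D) (AA dl) * (1 * y (rf (AA dl')) - 1 * y (lf (AA dl'))) =
  state_sum (cweight D) (AA dl') * (1 * y (rf (AA dl)) - 1 * y (lf (AA dl)))" by (rule base_change[where x = "%_. 1"])
  (use kernel_one kernel_index val[OF assms(1)] val[OF assms(2)] e in \<open>auto simp: y_def\<close>)
 hence eq: "state_sum (cweight D) (AA dl) * base_value D dl' = state_sum (cweight D) (AA dl') * base_value D dl" using val assms by simp
 show ?thesis unfolding bracket_def state_sum_diagram[OF d(1)] state_sum_diagram[OF d(2)]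
 using eq val[OF assms(1)] val[OF assms(2)] by (simp add: field_simps)
qed

text \<open>Two states that differ by exchanging the regions at two double points differ by a transposition, so the corner signs have to compensate its sign.\<close>

lemma no_swap:
 assumes dl: "dl : arcs D" "lreg D dl ~= rreg D dl"
  and s: "s : states D dl" "s' : states D dl"
  and xy: "x : dpts D" "y : dpts D" "x ~= y"
  and other: "!!C. C : Cr D ==> C ~= Dbl x ==> C ~= Dbl y ==> s C = s' C"
  and swap: "corner_region D (Dbl x) (s' (Dbl x)) = corner_region D (Dbl y) (s (Dbl y))"
  "corner_region D (Dbl y) (s' (Dbl y)) = corner_region D (Dbl x) (s (Dbl x))"
 shows "csign (Cross (Dbl x)) (index_of (Dbl x) (s (Dbl x))) * csign (Cross (Dbl x)) (index_of (Dbl x) (s' (Dbl x))) *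
  (csign (Cross (Dbl y)) (index_of (Dbl y) (s (Dbl y))) * csign (Cross (Dbl y)) (index_of (Dbl y) (s' (Dbl y)))) = -1"
proof -
 define f where "f = corner_region D (Dbl x) (s (Dbl x))"
 define g where "g = corner_region D (Dbl y) (s (Dbl y))"
 define pm where "pm = transpose f g"
 have C: "Dbl x : Cr D" "Dbl y : Cr D" using xy by (auto simp: Cr_def)
 have bij: "bij_betw (%C. corner_region D C (s C)) (Cr D) (Re D - {Regular (lreg D dl), Regular (rreg D dl)})" using s by (simp add: states_def)
 have fg: "f : Re D - {Regular (lreg D dl), Regular (rreg D dl)}" "g : Re D - {Regular (lreg D dl), Regular (rreg D dl)}"
 using bij_betwE[OF bij] C unfolding f_def g_def by blast+
 have inj: "corner_region D A (s A) = corner_region D B (s B) ==> A = B" if "A : Cr D" "B : Cr D" for A B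
 using bij that by (auto simp: bij_betw_def dest: inj_onD)
 have ne: "f ~= g" using inj[OF C] xy by (auto simp: f_def g_def)
 have st: "state (AA dl) (to_state s)" "state (AA dl) (to_state s')" using to_state(1)[OF dl(1)] s by (auto simp: states_at_def)
 have "sign pm = (PROD p:Cross ` Cr D. csign p (to_state s p) * csign p (to_state s' p))"
 proof (rule coherence[OF _ _ _ _ st])
  show "AA dl : medges D" "AA dl : medges D" using dl by (auto simp: medges)
  show "lf (AA dl) ~= rf (AA dl)" "lf (AA dl) ~= rf (AA dl)" using dl by (auto simp: lf_AA rf_AA)
  show "pm permutes Re D" unfolding pm_def using fg by (intro permutes_swap_id) auto
  show "pm (lf (AA dl)) = lf (AA dl)" "pm (rf (AA dl)) = rf (AA dl)" unfolding pm_def using fg dl by (auto simp: lf_AA rf_AA transpose_apply_other)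
  fix p assume "p : Cross ` Cr D"
  then obtain B where B: "p = Cross B" "B : Cr D" by auto
  have "pm (corner_region D B (s B)) = corner_region D B (s' B)"
 proof (cases "B = Dbl x \<or> B = Dbl y")
  case True
  thus ?thesis using swap by (auto simp: pm_def f_def g_def)
 next
  case False
  hence "corner_region D B (s B) ~= f" "corner_region D B (s B) ~= g" using inj[OF B(2) C(1)] inj[OF B(2) C(2)] by (auto simp: f_def g_def)
  thus ?thesis using other[OF B(2)] False by (simp add: pm_def transpose_apply_other)
 qed
  thus "pm (cor_at D p (to_state s p)) = cor_at D p (to_state s' p)" unfolding B(1) to_state(3)[OF dl(1) s(1) B(2)] to_state(3)[OF dl(1) s(2) B(2)] .
 qed
 also have "... = (PROD B:Cr D. csign (Cross B) (to_state s (Cross B)) * csign (Cross B) (to_state s' (Cross B)))"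
 by (subst prod.reindex) (auto simp: inj_on_def)
 also have "... = (PROD B:{Dbl x, Dbl y}. csign (Cross B) (to_state s (Cross B)) * csign (Cross B) (to_state s' (Cross B)))"
 proof (rule prod.mono_neutral_right)
  have "finite (Cross ` Cr D)" using Cr_points(1) finP finite_subset by blast
  thus "finite (Cr D)" by (rule finite_imageD) (auto simp: inj_on_def)
  show "{Dbl x, Dbl y} \<subseteq> Cr D" using C by simp
  show "ALL B:Cr D - {Dbl x, Dbl y}. csign (Cross B) (to_state s (Cross B)) * csign (Cross B) (to_state s' (Cross B)) = 1"
 proof
  fix B assume "B : Cr D - {Dbl x, Dbl y}"
  hence "to_state s' (Cross B) = to_state s (Cross B)" using other[of B] by (simp add: to_state_def)
  thus "csign (Cross B) (to_state s (Cross B)) * csign (Cross B) (to_state s' (Cross B)) = 1" by (cases B) auto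
 qed
 qed
 finally have "sign pm = (PROD B:{Dbl x, Dbl y}. csign (Cross B) (to_state s (Cross B)) * csign (Cross B) (to_state s' (Cross B)))" .
 moreover have "sign pm = -1" unfolding pm_def using ne by (simp add: sign_swap_id)
 ultimately show ?thesis using xy C by (simp add: to_state_def)
qed

end

text \<open>Each end of an arc is a slot; counting slots turns Euler's formula into a comparison of crossings and regions.\<close>

lemma card_Re_Cr:
 assumes D: "moy_diagram D"
 shows "card (Re D) = card (Cr D) + card (components D) + 1" "card (components D) >= 1"
proof -
 have fin: "finite (arcs D)" "finite (dpts D)" "finite (verts D)" "finite (regs D)" using D by (auto simp: moy_diagram_def)
 define VS where "VS = {VertexSlot v j |v j. v : verts D & j < length (ins D v)}"
 have finVS: "finite VS"
 proof -
  have "VS \<subseteq> (\<Union>v\<in>verts D. VertexSlot v ` {..<length (ins D v)})" by (auto simp: VS_def)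
  thus ?thesis by (rule finite_subset) (use fin in auto)
 qed
 have "in_slots D = LeftSlot ` dpts D Un (RightSlot ` dpts D Un VS)" by (auto simp: in_slots_def VS_def)
 moreover have "card (RightSlot ` dpts D Un VS) = card (dpts D) + card VS"
 using fin finVS by (subst card_Un_disjoint) (auto simp: VS_def card_image inj_on_def)
 moreover have "LeftSlot ` dpts D Int (RightSlot ` dpts D Un VS) = {}" by (auto simp: VS_def)
 ultimately have "card (in_slots D) = 2 * card (dpts D) + card VS" using fin finVS by (simp add: card_Un_disjoint card_image inj_on_def)
 moreover have "card (open_arcs D) = card (in_slots D)"
 proof -
  have "inj_on (in_arc D) (in_slots D)" using D by (simp add: moy_diagram_def)
  thus ?thesis unfolding open_arcs_def by (rule card_image)
 qed
 ultimately have o: "card (open_arcs D) = 2 * card (dpts D) + card VS" by simp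
 have "Cr D = Dbl ` dpts D Un {Circ v j |v j. v : verts D & j < length (ins D v)}" by (simp add: Cr_def)
 moreover have "{Circ v j |v j. v : verts D & j < length (ins D v)} = (%s. case s of VertexSlot v j => Circ v j) ` VS" by (force simp: VS_def)
 moreover have "inj_on (%s. case s of VertexSlot v j => Circ v j) VS" by (auto simp: inj_on_def VS_def)
 moreover have "Dbl ` dpts D Int (%s. case s of VertexSlot v j => Circ v j) ` VS = {}" by (auto simp: VS_def)
 ultimately have c: "card (Cr D) = card (dpts D) + card VS" using fin finVS by (simp add: card_Un_disjoint card_image inj_on_def)
 have r: "card (Re D) = card (regs D) + card (verts D)" unfolding Re_def using fin by (subst card_Un_disjoint) (auto simp: card_image inj_on_def)
 have e: "int (card (dpts D) + card (verts D)) - int (card (open_arcs D)) + int (card (regs D)) = 1 + int (card (components D))"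
 using D by (auto simp: moy_diagram_def planar_def)
 show "card (Re D) = card (Cr D) + card (components D) + 1" using c r e o by linarith
 have "components D = (%c. linked (graph_inc D) `` {c}) ` graph_cells D" by (auto simp: components_def quotient_def)
 moreover have "finite (graph_cells D)" using fin by (auto simp: graph_cells_def)
 moreover have "graph_cells D ~= {}" using D by (auto simp: graph_cells_def moy_diagram_def)
 ultimately show "card (components D) >= 1" by (simp add: card_gt_0_iff Suc_le_eq)
qed

text \<open>A state is a bijection, so its existence pins down the number of regions, and by Euler's formula the number of components.\<close>

lemma states_nonempty:
 assumes D: "moy_diagram D" and dl: "dl : arcs D" and ne: "states D dl ~= {}"
 shows "card (components D) = 1" "lreg D dl ~= rreg D dl" "v : verts D ==> ins D v ~= []"
proof -
 obtain s where s: "s : states D dl" using ne by auto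
 hence bij: "bij_betw (%C. corner_region D C (s C)) (Cr D) (Re D - {Regular (lreg D dl), Regular (rreg D dl)})" by (simp add: states_def)
 have lr: "{Regular (lreg D dl), Regular (rreg D dl)} \<subseteq> Re D" using D dl by (auto simp: moy_diagram_def Re_def)
 have finRe: "finite (Re D)" using D by (auto simp: Re_def moy_diagram_def)
 have "card (Cr D) = card (Re D) - card {Regular (lreg D dl), Regular (rreg D dl)}"
 using bij_betw_same_card[OF bij] lr finRe by (simp add: card_Diff_subset)
 moreover have "card {Regular (lreg D dl), Regular (rreg D dl)} <= card (Re D)" using lr finRe by (rule card_mono[rotated])
 ultimately have "card (components D) + 1 = card {Regular (lreg D dl), Regular (rreg D dl)}" using card_Re_Cr(1)[OF D] by linarith
 moreover note card_Re_Cr(2)[OF D]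
 ultimately show "card (components D) = 1" "lreg D dl ~= rreg D dl" by (auto simp: card_insert_if split: if_splits)
 show "ins D v ~= []" if "v : verts D"
 proof -
  have "Disc v : Re D - {Regular (lreg D dl), Regular (rreg D dl)}" using that by (auto simp: Re_def)
  hence "Disc v : (%C. corner_region D C (s C)) ` Cr D" using bij_betw_imp_surj_on[OF bij] by simp
  then obtain C where C: "C : Cr D" "corner_region D C (s C) = Disc v" by auto
  have "s C : corners C" using s C by (auto simp: states_def)
  thus ?thesis using C by (cases C; cases "s C") (auto simp: Cr_def)
 qed
qed

theorem bracket_base_independent:
 assumes D: "moy_diagram D" "verts D ~= {}" and dl: "base_point D dl" "base_point D dl'"
 shows "bracket D dl = bracket D dl'"
proof (cases "states D dl = {} & states D dl' = {}")
 case True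
 thus ?thesis by (simp add: bracket_def)
next
 case False
 then obtain d where "d : arcs D" "states D d ~= {}" using dl by (auto simp: base_point_def)
 then interpret connected_diagram D using states_nonempty[OF D(1)] D by unfold_locales auto
 show ?thesis using bracket_base dl .
qed

section \<open>Square-free polynomials\<close>

typedef (overloaded) ('a, 'b :: zero) zeon = "{p :: 'a set => 'b. ALL T. infinite T --> p T = 0}"
 morphisms zcoef Zeon by (rule exI[of _ "%_. 0"]) simp

setup_lifting type_definition_zeon

lemma zeon_eqI: "(!!T. finite T ==> zcoef p T = zcoef q T) ==> p = q"
proof -
 assume *: "!!T. finite T ==> zcoef p T = zcoef q T"
 have "zcoef p T = zcoef q T" for T using * zcoef[of p] zcoef[of q] by (cases "finite T") auto
 thus "p = q" by (simp add: zcoef_inject[symmetric] fun_eq_iff)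
qed

lemma zcoef_infinite [simp]: "infinite T ==> zcoef p T = 0" using zcoef[of p] by simp

instantiation zeon :: (type, comm_ring_1) comm_ring_1
begin

lift_definition zero_zeon :: "('a, 'b) zeon" is "%_. 0" by simp
lift_definition one_zeon :: "('a, 'b) zeon" is "%T. if T = {} then 1 else 0" by auto
lift_definition plus_zeon :: "('a, 'b) zeon => ('a, 'b) zeon => ('a, 'b) zeon" is "%p q T. p T + q T" by simp
lift_definition minus_zeon :: "('a, 'b) zeon => ('a, 'b) zeon => ('a, 'b) zeon" is "%p q T. p T - q T" by simp
lift_definition uminus_zeon :: "('a, 'b) zeon => ('a, 'b) zeon" is "%p T. - p T" by simp
lift_definition times_zeon :: "('a, 'b) zeon => ('a, 'b) zeon => ('a, 'b) zeon"
 is "%p q T. SUM S:Pow T. p S * q (T - S)" by simp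

lemma zcoef_times: "zcoef (p * q) T = (SUM S:Pow T. zcoef p S * zcoef q (T - S))" by transfer simp

instance
proof
 fix a b c :: "('a, 'b) zeon"
 show "a + b + c = a + (b + c)" by transfer (simp add: add.assoc)
 show "a + b = b + a" by transfer (simp add: add.commute)
 show "0 + a = a" by transfer simp
 show "- a + a = 0" by transfer simp
 show "a - b = a + - b" by transfer simp
 show "(0::('a, 'b) zeon) ~= 1" by transfer (auto simp: fun_eq_iff)
 show "(a + b) * c = a * c + b * c" by (rule zeon_eqI) (simp add: zcoef_times plus_zeon.rep_eq distrib_right sum.distrib)
 show "a * b = b * a"
 proof (rule zeon_eqI)
  fix T :: "'a set" assume "finite T"
  show "zcoef (a * b) T = zcoef (b * a) T" unfolding zcoef_times
 by (rule sum.reindex_bij_witness[of _ "%S. T - S" "%S. T - S"]) (auto simp: mult.commute double_diff)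
 qed
 show "1 * a = a"
 proof (rule zeon_eqI)
  fix T :: "'a set" assume T: "finite T"
  have "zcoef (1 * a) T = (SUM S:{{}}. zcoef 1 S * zcoef a (T - S))"
 unfolding zcoef_times using T by (intro sum.mono_neutral_right) (auto simp: one_zeon.rep_eq)
  thus "zcoef (1 * a) T = zcoef a T" by (simp add: one_zeon.rep_eq)
 qed
 show "a * b * c = a * (b * c)"
 proof (rule zeon_eqI)
  fix T :: "'a set" assume T: "finite T"
  have "zcoef (a * b * c) T = (SUM S:Pow T. SUM U:Pow S. zcoef a U * zcoef b (S - U) * zcoef c (T - S))" by (simp add: zcoef_times sum_distrib_right)
  also have "... = (\<Sum>(S, U)\<in>Sigma (Pow T) Pow. zcoef a U * zcoef b (S - U) * zcoef c (T - S))"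
 using T by (subst sum.Sigma) (auto intro: finite_subset)
  also have "... = (\<Sum>(U, V)\<in>Sigma (Pow T) (%U. Pow (T - U)). zcoef a U * zcoef b V * zcoef c (T - U - V))"
 by (rule sum.reindex_bij_witness[of _ "%(U, V). (U Un V, U)" "%(S, U). (U, S - U)"])
  (auto simp: Diff_Un Int_absorb2 double_diff Un_Diff intro!: arg_cong2[of _ _ _ _ "(*)"] arg_cong[of _ _ "zcoef _"])
  also have "... = (SUM U:Pow T. SUM V:Pow (T - U). zcoef a U * zcoef b V * zcoef c (T - U - V))" using T by (subst sum.Sigma) auto
  also have "... = zcoef (a * (b * c)) T" by (simp add: zcoef_times sum_distrib_left mult.assoc)
  finally show "zcoef (a * b * c) T = zcoef (a * (b * c)) T" .
 qed
qed

end

lift_definition zvar :: "'a => ('a, 'b :: comm_ring_1) zeon" is "%a T. if T = {a} then 1 else 0" by auto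
lift_definition zc :: "'b => ('a, 'b :: comm_ring_1) zeon" is "%c T. if T = {} then c else 0" by auto

lemma zc_hom:
 fixes a b :: "'b :: comm_ring_1"
 shows "zc 0 = (0 :: ('a, 'b) zeon)" "zc 1 = (1 :: ('a, 'b) zeon)"
  "zc (a + b) = (zc a + zc b :: ('a, 'b) zeon)" "zc (a - b) = (zc a - zc b :: ('a, 'b) zeon)"
  "zc (- a) = (- zc a :: ('a, 'b) zeon)" "zc (a * b) = (zc a * zc b :: ('a, 'b) zeon)"
proof -
 show "zc 0 = (0 :: ('a, 'b) zeon)" "zc 1 = (1 :: ('a, 'b) zeon)" by (transfer, auto)+
 show "zc (a + b) = (zc a + zc b :: ('a, 'b) zeon)" "zc (a - b) = (zc a - zc b :: ('a, 'b) zeon)"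
  "zc (- a) = (- zc a :: ('a, 'b) zeon)" by (transfer, auto)+
 show "zc (a * b) = (zc a * zc b :: ('a, 'b) zeon)"
 proof (rule zeon_eqI)
  fix T :: "'a set" assume T: "finite T"
  have "zcoef (zc a * zc b) T = (SUM S:{{}}. zcoef (zc a) S * zcoef (zc b :: ('a, 'b) zeon) (T - S))"
 unfolding zcoef_times using T by (intro sum.mono_neutral_right) (auto simp: zc.rep_eq)
  thus "zcoef (zc (a * b)) T = zcoef (zc a * zc b :: ('a, 'b) zeon) T" by (simp add: zc.rep_eq)
 qed
qed

lemma zc_prod: "zc (PROD x:S. f x) = (PROD x:S. zc (f x))" by (induction S rule: infinite_finite_induct) (auto simp: zc_hom)

lemma zcoef_sum: "zcoef (SUM x:S. f x) T = (SUM x:S. zcoef (f x) T)"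
 by (induction S rule: infinite_finite_induct) (auto simp: plus_zeon.rep_eq zero_zeon.rep_eq)

lemma zcoef_zc_times: "zcoef (zc c * p) T = c * zcoef p T"
proof (cases "finite T")
 case True
 hence "zcoef (zc c * p) T = (SUM S:{{}}. zcoef (zc c) S * zcoef p (T - S))"
 unfolding zcoef_times by (intro sum.mono_neutral_right) (auto simp: zc.rep_eq)
 thus ?thesis by (simp add: zc.rep_eq)
qed simp

lemma zcoef_zvar_times: "zcoef (zvar a * p) T = (if a : T then zcoef p (T - {a}) else 0)"
proof (cases "finite T")
 case True
 show ?thesis
 proof (cases "a : T")
  case a: True
  have "zcoef (zvar a * p) T = (SUM S:{{a}}. zcoef (zvar a) S * zcoef p (T - S))"
 unfolding zcoef_times using True a by (intro sum.mono_neutral_right) (auto simp: zvar.rep_eq)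
  thus ?thesis using a by (simp add: zvar.rep_eq)
 next
  case False
  thus ?thesis unfolding zcoef_times by (auto simp: zvar.rep_eq intro!: sum.neutral)
 qed
qed simp

lemma zvar_square: "zvar a * zvar a = 0" by (rule zeon_eqI) (auto simp: zcoef_zvar_times zvar.rep_eq zero_zeon.rep_eq)

lemma zcoef_prod_zvar:
 assumes "finite S"
 shows "zcoef (PROD x:S. zvar (f x)) T = of_bool (bij_betw f S T)" using assms
proof (induction S arbitrary: T rule: finite_induct)
 case empty
 thus ?case by (auto simp: one_zeon.rep_eq bij_betw_def)
next
 case (insert x S)
 have "bij_betw f (insert x S) T \<longleftrightarrow> f x : T & bij_betw f S (T - {f x})"
 using insert.hyps(2) unfolding bij_betw_def by (auto simp: inj_on_insert) (metis imageI)
 thus ?case using insert by (simp add: zcoef_zvar_times)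
qed

text \<open>Coefficients of a product of linear forms are sums over bijections.\<close>

lemma zcoef_prod_linear:
 assumes "finite S" "!!x. x : S ==> finite (K x)"
 shows "zcoef (PROD x:S. SUM c:K x. zc (w x c) * zvar (rh x c)) T =
  (SUM s:{s : PiE S K. bij_betw (%x. rh x (s x)) S T}. PROD x:S. w x (s x))"
proof -
 have "(PROD x:S. SUM c:K x. zc (w x c) * zvar (rh x c)) =
  (SUM s:Pi\<^sub>E S K. PROD x:S. zc (w x (s x)) * zvar (rh x (s x)))" using assms by (subst prod_sum_PiE) auto
 also have "... = (SUM s:Pi\<^sub>E S K. zc (PROD x:S. w x (s x)) * (PROD x:S. zvar (rh x (s x))))" by (simp add: prod.distrib zc_prod)
 finally have "zcoef (PROD x:S. SUM c:K x. zc (w x c) * zvar (rh x c)) T =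
  (SUM s:Pi\<^sub>E S K. (PROD x:S. w x (s x)) * of_bool (bij_betw (%x. rh x (s x)) S T))"
 using assms by (simp add: zcoef_sum zcoef_zc_times zcoef_prod_zvar)
 also have "... = (SUM s:{s : PiE S K. bij_betw (%x. rh x (s x)) S T}. PROD x:S. w x (s x))" using assms finite_PiE[OF assms(1), of K]
 by (subst sum.mono_neutral_right[of "PiE S K" "{s : PiE S K. bij_betw (%x. rh x (s x)) S T}"]) auto
 finally show ?thesis .
qed

subsection \<open>Extracting variables\<close>

definition free :: "'a set => ('a, 'b :: comm_ring_1) zeon => bool" where
 "free N p \<longleftrightarrow> (ALL T. T Int N ~= {} --> zcoef p T = 0)"

lemma free_add: "free N p ==> free N q ==> free N (p + q)"
 and free_diff: "free N p ==> free N q ==> free N (p - q)"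
 and free_uminus: "free N p ==> free N (- p)"
 and free_zero: "free N 0" and free_one: "free N 1" and free_zc: "free N (zc c)"
 and free_zvar: "a ~: N ==> free N (zvar a)" by (auto simp: free_def plus_zeon.rep_eq minus_zeon.rep_eq uminus_zeon.rep_eq zero_zeon.rep_eq
  one_zeon.rep_eq zc.rep_eq zvar.rep_eq)

lemma free_mult: "free N p ==> free N q ==> free N (p * q)" unfolding free_def zcoef_times
proof (intro allI impI sum.neutral ballI)
 fix T S assume pq: "ALL T. T Int N ~= {} --> zcoef p T = 0" "ALL T. T Int N ~= {} --> zcoef q T = 0"
  and T: "T Int N ~= {}" "S : Pow T"
 hence "S Int N ~= {} \<or> (T - S) Int N ~= {}" by blast
 thus "zcoef p S * zcoef q (T - S) = 0"
 proof
  assume "S Int N ~= {}"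
  thus ?thesis using pq(1) by simp
 next
  assume "(T - S) Int N ~= {}"
  thus ?thesis using pq(2) by simp
 qed
qed

lemma free_sum: "(!!x. x : S ==> free N (f x)) ==> free N (SUM x:S. f x)"
 by (induction S rule: infinite_finite_induct) (auto intro: free_add free_zero)

lemma free_prod: "(!!x. x : S ==> free N (f x)) ==> free N (PROD x:S. f x)"
 by (induction S rule: infinite_finite_induct) (auto intro: free_mult free_one)

lemma free_subset: "free N p ==> M \<subseteq> N ==> free M p" unfolding free_def by blast

lemmas free_intros = free_add free_diff free_uminus free_mult free_zero free_one free_zc free_zvar

definition extracts :: "'a set => ('a, 'b :: comm_ring_1) zeon => ('a, 'b) zeon => bool" where
 "extracts N p e \<longleftrightarrow> (ALL q T. free N q --> T Int N = {} --> zcoef (p * q) (N Un T) = zcoef (e * q) T)"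

lemma extractsD: "extracts N p e ==> free N q ==> T Int N = {} ==> zcoef (p * q) (N Un T) = zcoef (e * q) T" by (simp add: extracts_def)

lemma extracts_empty: "extracts {} p p" by (simp add: extracts_def)

lemma extracts_var:
 assumes "free {a} b"
 shows "extracts {a} (zvar a * e + b) e" unfolding extracts_def
proof (intro allI impI)
 fix q :: "('a, 'b) zeon" and T assume q: "free {a} q" "T Int {a} = {}"
 have "zcoef (b * q) ({a} Un T) = 0" using free_mult[OF assms q(1)] by (auto simp: free_def)
 moreover have "zcoef (zvar a * (e * q)) ({a} Un T) = zcoef (e * q) T" using q by (simp add: zcoef_zvar_times)
 ultimately show "zcoef ((zvar a * e + b) * q) ({a} Un T) = zcoef (e * q) T" by (simp add: distrib_right plus_zeon.rep_eq mult.assoc)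
qed

lemma extracts_var':
 assumes "p = zvar a * e + b" "free {a} b"
 shows "extracts {a} p e" using extracts_var assms by simp

lemma extracts_mult:
 assumes "extracts N p e" "free N m"
 shows "extracts N (p * m) (e * m)" unfolding extracts_def using assms free_mult[OF assms(2)] by (simp add: mult.assoc extractsD)

lemma extracts_step:
 assumes "extracts M p e" "free M m" "extracts N (e * m) e'" "M Int N = {}"
 shows "extracts (M Un N) (p * m) e'" unfolding extracts_def
proof (intro allI impI)
 fix q :: "('a, 'b) zeon" and T assume q: "free (M Un N) q" and T: "T Int (M Un N) = {}"
 have fq: "free M q" "free N q" using q by (auto intro: free_subset)
 have "zcoef (p * m * q) (M Un N Un T) = zcoef (p * (m * q)) (M Un (N Un T))" by (simp add: mult.assoc Un_assoc)
 also have "... = zcoef (e * m * q) (N Un T)" using extractsD[OF assms(1) free_mult[OF assms(2) fq(1)], of "N Un T"] T assms(4)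
 by (simp add: mult.assoc Int_Un_distrib2 Int_commute Int_Un_distrib)
 also have "... = zcoef (e' * q) T" using extractsD[OF assms(3) fq(2), of T] T by (simp add: Int_Un_distrib)
 finally show "zcoef (p * m * q) (M Un N Un T) = zcoef (e' * q) T" .
qed

lemma extracts_chain:
 assumes "extracts M p e" "extracts N e e'" "M Int N = {}"
 shows "extracts (M Un N) p e'" using extracts_step[OF assms(1) free_one, of N e'] assms by simp

lemma extracts_scale: "extracts N p e ==> extracts N (zc c * p) (zc c * e)" unfolding extracts_def by (simp add: mult.assoc zcoef_zc_times)

subsection \<open>Renaming and identifying variables\<close>

lift_definition push :: "'a set => ('a => 'c) => ('a, 'b :: comm_ring_1) zeon => ('c, 'b) zeon"
 is "%U g p T. if finite T then SUM S | S \<subseteq> U & inj_on g S & g ` S = T. p S else 0" by simp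

lemma zcoef_push:
 "finite T ==> zcoef (push U g p) T = (SUM S | S \<subseteq> U & inj_on g S & g ` S = T. zcoef p S)" by transfer simp

lemma push_add: "push U g (p + q) = push U g p + push U g q" by (rule zeon_eqI) (simp add: zcoef_push plus_zeon.rep_eq sum.distrib)

lemma push_diff: "push U g (p - q) = push U g p - push U g q" by (rule zeon_eqI) (simp add: zcoef_push minus_zeon.rep_eq sum_subtractf)

lemma push_uminus: "push U g (- p) = - push U g p" by (rule zeon_eqI) (simp add: zcoef_push uminus_zeon.rep_eq sum_negf)

lemma push_zc:
 fixes g :: "'a => 'c" and c :: "'b :: comm_ring_1"
 shows "push U g (zc c) = zc c"
proof (rule zeon_eqI)
 fix T :: "'c set" assume T: "finite T"
 have "(SUM S | S \<subseteq> U & inj_on g S & g ` S = T. zcoef (zc c) S) = (if T = {} then c else 0)"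
 proof (cases "T = {}")
  case True
  hence "{S. S \<subseteq> U & inj_on g S & g ` S = T} = {{}}" by auto
  thus ?thesis using True by (simp add: zc.rep_eq)
 next
  case False
  hence "zcoef (zc c :: ('a, 'b) zeon) S = 0" if "g ` S = T" for S using that by (auto simp: zc.rep_eq)
  thus ?thesis using False by (auto intro!: sum.neutral)
 qed
 thus "zcoef (push U g (zc c)) T = zcoef (zc c) T" using T by (simp add: zcoef_push zc.rep_eq)
qed

lemma push_zvar:
 assumes "finite U" "a : U"
 shows "push U g (zvar a) = zvar (g a)"
proof (rule zeon_eqI)
 fix T :: "'b set" assume T: "finite T"
 have "(SUM S | S \<subseteq> U & inj_on g S & g ` S = T. zcoef (zvar a) S) =
  (SUM S:{S. S = {a} & T = {g a}}. zcoef (zvar a) S)" using assms by (intro sum.mono_neutral_right) (auto simp: zvar.rep_eq)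
 also have "... = (if T = {g a} then 1 else 0)" by (auto simp: zvar.rep_eq)
 finally show "zcoef (push U g (zvar a)) T = zcoef (zvar (g a)) T" using T by (simp add: zcoef_push zvar.rep_eq)
qed

lemma push_mult:
 assumes "finite U"
 shows "push U g (p * q) = push U g p * push U g q"
proof (rule zeon_eqI)
 fix T :: "'b set" assume T: "finite T"
 let ?M = "%T. {S. S \<subseteq> U & inj_on g S & g ` S = T}"
 have finM: "finite (?M T)" for T using assms by simp
 have finS: "finite S" if "S \<subseteq> U" for S using that assms finite_subset by blast
 have "zcoef (push U g (p * q)) T = (SUM S:?M T. SUM B:Pow S. zcoef p B * zcoef q (S - B))" using T by (simp add: zcoef_push zcoef_times)
 also have "... = (\<Sum>(S, B)\<in>Sigma (?M T) Pow. zcoef p B * zcoef q (S - B))" using finM finS by (subst sum.Sigma) auto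
 also have "... = (\<Sum>(Z, B, B')\<in>Sigma (Pow T) (%Z. ?M Z \<times> ?M (T - Z)). zcoef p B * zcoef q B')"
 proof (rule sum.reindex_bij_witness[of _ "%(Z, B, B'). (B Un B', B)" "%(S, B). (g ` B, B, S - B)"])
  fix x assume "x : Sigma (?M T) Pow"
  then obtain S B where x: "x = (S, B)" "S \<subseteq> U" "inj_on g S" "g ` S = T" "B \<subseteq> S" by auto
  show "(case case x of (S, B) => (g ` B, B, S - B) of (Z, B, B') => (B Un B', B)) = x" using x by auto
  show "(case x of (S, B) => (g ` B, B, S - B)) : Sigma (Pow T) (%Z. ?M Z \<times> ?M (T - Z))"
 using x by (auto intro: inj_on_subset simp: inj_on_image_set_diff[OF x(3)])
  show "(case case x of (S, B) => (g ` B, B, S - B) of (Z, B, B') => zcoef p B * zcoef q B') =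
  (case x of (S, B) => zcoef p B * zcoef q (S - B))" using x by simp
 next
  fix y assume "y : Sigma (Pow T) (%Z. ?M Z \<times> ?M (T - Z))"
  then obtain Z B B' where y: "y = (Z, B, B')" "Z \<subseteq> T" "B \<subseteq> U" "inj_on g B" "g ` B = Z"
  "B' \<subseteq> U" "inj_on g B'" "g ` B' = T - Z" by auto
  hence d: "g ` B Int g ` B' = {}" by auto
  hence d': "B Int B' = {}" by auto
  show "(case case y of (Z, B, B') => (B Un B', B) of (S, B) => (g ` B, B, S - B)) = y" using y d' by auto
  show "(case y of (Z, B, B') => (B Un B', B)) : Sigma (?M T) Pow" using y d by (auto simp: inj_on_Un)
 qed
 also have "... = (SUM Z:Pow T. (SUM B:?M Z. zcoef p B) * (SUM B':?M (T - Z). zcoef q B'))"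
 using T finM by (subst sum.Sigma[symmetric]) (auto simp: sum_product sum.cartesian_product)
 also have "... = zcoef (push U g p * push U g q) T" unfolding zcoef_times using T by (intro sum.cong refl) (auto simp: zcoef_push finite_subset)
 finally show "zcoef (push U g (p * q)) T = zcoef (push U g p * push U g q) T" .
qed

lemma push_one: "push U g 1 = 1" using push_zc[of U g 1] by (simp add: zc_hom)

lemma push_prod: "finite U ==> push U g (PROD x:S. f x) = (PROD x:S. push U g (f x))"
 by (induction S rule: infinite_finite_induct) (auto simp: push_mult push_one)

lemma push_sum: "push U g (SUM x:S. f x) = (SUM x:S. push U g (f x))"
proof (induction S rule: infinite_finite_induct)
 case (infinite S)
 thus ?case using push_zc[of U g 0] by (simp add: zc_hom)
next
 case empty
 thus ?case using push_zc[of U g 0] by (simp add: zc_hom)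
qed (simp add: push_add)

lemma zcoef_push_inj:
 assumes "inj_on g U" "S \<subseteq> U" "finite S"
 shows "zcoef (push U g p) (g ` S) = zcoef p S"
proof -
 have "{S'. S' \<subseteq> U & inj_on g S' & g ` S' = g ` S} = {S}" using assms by (auto simp: inj_on_image_eq_iff intro: inj_on_subset)
 thus ?thesis using assms by (simp add: zcoef_push)
qed

lemma free_push:
 assumes "!!a. a : U ==> g a : N' ==> a : N" "free N p"
 shows "free N' (push U g p)" unfolding free_def
proof (intro allI impI)
 fix T assume T: "T Int N' ~= {}"
 show "zcoef (push U g p) T = 0"
 proof (cases "finite T")
  case True
  have "zcoef p S = 0" if "S \<subseteq> U" "g ` S = T" for S
 proof -
  have "S Int N ~= {}" using T that assms(1) by blast
  thus ?thesis using assms(2) by (simp add: free_def)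
 qed
  thus ?thesis using True by (auto simp: zcoef_push intro!: sum.neutral)
 qed simp
qed

section \<open>Replacing the inside of a disc\<close>

type_synonym region_poly = "(region, int poly fract) zeon"

definition zrow :: "moy => crossing => region_poly" where
 "zrow D C = (SUM c:corners C. zc (weight_M C c * weight_A D C c) * zvar (corner_region D C c))"

abbreviation zreg :: "nat => region_poly" where
 "zreg r \<equiv> zvar (Regular r)"

definition state_total :: "moy => nat => int poly fract" where
 "state_total D dl = (SUM s:states D dl. state_M D s * state_A D s)"

lemma finite_Cr: "moy_diagram D ==> finite (Cr D)"
proof -
 assume D: "moy_diagram D"
 have "{Circ v j |v j. v : verts D & j < length (ins D v)} = (\<Union>v\<in>verts D. (%j. Circ v j) ` {..<length (ins D v)})" by auto
 thus ?thesis using D by (simp add: Cr_def moy_diagram_def)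
qed

lemma finite_Re: "moy_diagram D ==> finite (Re D)" by (simp add: Re_def moy_diagram_def)

lemma total_zcoef:
 assumes "moy_diagram D"
 shows "state_total D dl = zcoef (PROD C:Cr D. zrow D C) (Re D - {Regular (lreg D dl), Regular (rreg D dl)})"
proof -
 have "finite (corners C)" for C by (cases C) auto
 thus ?thesis unfolding zrow_def state_total_def states_def state_M_def state_A_def
 using finite_Cr[OF assms] by (subst zcoef_prod_linear) (auto simp: prod.distrib)
qed

lemma zrow_positive:
 assumes "positive D x"
 shows "zrow D (Dbl x) = zc (thalf powi (- 2 * int (color D (sw D x)))) * (zreg (lreg D (sw D x)) - zreg (rreg D (nw D x)))
  + zreg (rreg D (sw D x)) + zreg (rreg D (se D x))" using assms by (simp add: zrow_def over_color_def zc_hom algebra_simps)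

lemma zrow_negative:
 assumes "~ positive D x"
 shows "zrow D (Dbl x) = zc (thalf powi (2 * int (color D (se D x)))) * (zreg (rreg D (se D x)) - zreg (rreg D (nw D x)))
  + zreg (rreg D (sw D x)) + zreg (lreg D (sw D x))" using assms by (simp add: zrow_def over_color_def zc_hom algebra_simps)

definition circ_row :: "moy => nat => nat => region_poly" where
 "circ_row D v a = (let i = int (color D a) in
  zc (thalf powi (- i) - thalf powi i) * zvar (Disc v) + zc (thalf powi (- i)) * zreg (lreg D a)
  + zc (thalf powi i) * zreg (rreg D a))"

lemma zrow_Circ: "zrow D (Circ v j) = circ_row D v (ins D v ! j)" by (simp add: circ_row_def zrow_def Let_def algebra_simps)

fun inner_slot :: "inside => nat set => slot => bool" where
 "inner_slot I X (LeftSlot x) \<longleftrightarrow> x : idpts I"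
| "inner_slot I X (RightSlot x) \<longleftrightarrow> x : idpts I"
| "inner_slot I X (VertexSlot v j) \<longleftrightarrow> v : X"

definition inner_cr :: "moy => inside => nat set => crossing set" where
 "inner_cr D I X = Dbl ` idpts I Un {Circ v j |v j. v : X & j < length (ins D v)}"

lemma inner_prod:
 assumes "finite (idpts I)"
 shows "(PROD C:inner_cr D I {v}. zrow D C) = (PROD x:idpts I. zrow D (Dbl x)) * (PROD j<length (ins D v). zrow D (Circ v j))"
proof -
 have "inner_cr D I {v} = Dbl ` idpts I Un (%j. Circ v j) ` {..<length (ins D v)}" by (auto simp: inner_cr_def)
 moreover have "(PROD C:Dbl ` idpts I Un (%j. Circ v j) ` {..<length (ins D v)}. zrow D C) =
  (PROD C:Dbl ` idpts I. zrow D C) * (PROD C:(%j. Circ v j) ` {..<length (ins D v)}. zrow D C)" using assms by (intro prod.union_disjoint) auto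
 ultimately show ?thesis by (simp add: prod.reindex inj_on_def)
qed

locale replacement =
 fixes D D' :: moy and I I' :: inside and X :: "nat set" and f g h k :: "nat => nat"
 assumes diagrams: "moy_diagram D" "moy_diagram D'"
  and agree: "agree_outside D I D' I' X f g h k"
  and inside: "X \<subseteq> verts D" "idpts I \<subseteq> dpts D" "idpts I' \<subseteq> dpts D'" "iregs I \<subseteq> regs D" "iregs I' \<subseteq> regs D'"
  and local_in: "!!a. a : iarcs I ==> EX s:in_slots D. in_arc D s = a & inner_slot I X s"
  and local_out: "!!a. a : iarcs I ==> EX s:out_slots D. out_arc D s = a & inner_slot I X s"
  and local_reg: "!!a. a : arcs D ==> a ~: iarcs I ==> lreg D a ~: iregs I & rreg D a ~: iregs I"
begin

definition outer_cr :: "crossing set" where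
 "outer_cr = Dbl ` (dpts D - idpts I) Un {Circ v j |v j. v : verts D - X & j < length (ins D v)}"

fun crossing_map :: "crossing => crossing" where
 "crossing_map (Dbl x) = Dbl (h x)"
| "crossing_map (Circ v j) = Circ (k v) j"

fun rmap :: "region => region" where
 "rmap (Regular r) = Regular (g r)"
| "rmap (Disc v) = Disc (k v)"

lemma agreeD:
 "bij_betw h (dpts D - idpts I) (dpts D' - idpts I')"
 "x : dpts D ==> x ~: idpts I ==> positive D' (h x) = positive D x & sw D' (h x) = f (sw D x) \<and>
  se D' (h x) = f (se D x) & nw D' (h x) = f (nw D x) & ne D' (h x) = f (ne D x)"
 "bij_betw k (verts D) (verts D')"
 "v : verts D ==> v ~: X ==> ins D' (k v) = map f (ins D v) & outs D' (k v) = map f (outs D v)"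
 "f ` (arcs D - iarcs I) = arcs D' - iarcs I'"
 "a : arcs D ==> a ~: iarcs I ==> color D' (f a) = color D a & lreg D' (f a) = g (lreg D a) & rreg D' (f a) = g (rreg D a)"
 "g ` (regs D - iregs I) = regs D' - iregs I'" using agree unfolding agree_outside_def by auto

lemma slot_arcs: "s : in_slots D ==> in_arc D s : arcs D" "s : out_slots D ==> out_arc D s : arcs D"
proof -
 show "s : in_slots D ==> in_arc D s : arcs D" using diagrams(1) by (auto simp: moy_diagram_def open_arcs_def)
 assume "s : out_slots D"
 hence "out_arc D s : in_arc D ` in_slots D" using diagrams(1) by (auto simp: moy_diagram_def)
 thus "out_arc D s : arcs D" using diagrams(1) by (auto simp: moy_diagram_def open_arcs_def)
qed

lemma outer_slot:
 shows "s : in_slots D ==> ~ inner_slot I X s ==> in_arc D s : arcs D & in_arc D s ~: iarcs I"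
  and "s : out_slots D ==> ~ inner_slot I X s ==> out_arc D s : arcs D & out_arc D s ~: iarcs I"
proof -
 have inj: "inj_on (in_arc D) (in_slots D)" "inj_on (out_arc D) (out_slots D)" using diagrams(1) by (auto simp: moy_diagram_def)
 show "s : in_slots D ==> ~ inner_slot I X s ==> in_arc D s : arcs D & in_arc D s ~: iarcs I" using slot_arcs(1) local_in inj_onD[OF inj(1)] by metis
 show "s : out_slots D ==> ~ inner_slot I X s ==> out_arc D s : arcs D & out_arc D s ~: iarcs I"
 using slot_arcs(2) local_out inj_onD[OF inj(2)] by metis
qed

lemma outer_arcs:
 "x : dpts D ==> x ~: idpts I ==> {sw D x, se D x, nw D x, ne D x} \<subseteq> arcs D - iarcs I"
 "v : verts D ==> v ~: X ==> j < length (ins D v) ==> ins D v ! j : arcs D - iarcs I"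
proof -
 assume "x : dpts D" "x ~: idpts I"
 thus "{sw D x, se D x, nw D x, ne D x} \<subseteq> arcs D - iarcs I" using outer_slot(1)[of "LeftSlot x"] outer_slot(1)[of "RightSlot x"]
  outer_slot(2)[of "LeftSlot x"] outer_slot(2)[of "RightSlot x"] by (auto simp: in_slots_def out_slots_def)
next
 assume "v : verts D" "v ~: X" "j < length (ins D v)"
 thus "ins D v ! j : arcs D - iarcs I" using outer_slot(1)[of "VertexSlot v j"] by (auto simp: in_slots_def)
qed

lemma arc_sides:
 "a : arcs D - iarcs I ==> lreg D a : regs D - iregs I"
 "a : arcs D - iarcs I ==> rreg D a : regs D - iregs I" using diagrams(1) local_reg by (auto simp: moy_diagram_def)

lemma Cr_split: "Cr D = inner_cr D I X Un outer_cr" "inner_cr D I X Int outer_cr = {}"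
 "Cr D' = inner_cr D' I' (k ` X) Un crossing_map ` outer_cr" "inner_cr D' I' (k ` X) Int crossing_map ` outer_cr = {}"
proof -
 show "Cr D = inner_cr D I X Un outer_cr" "inner_cr D I X Int outer_cr = {}" using inside by (auto simp: Cr_def inner_cr_def outer_cr_def)
 have kX: "k ` X \<subseteq> verts D'" "verts D' - k ` X = k ` (verts D - X)"
 using agreeD(3) inside(1) inj_on_image_set_diff[of k "verts D" "verts D" X] unfolding bij_betw_def by blast+
 have h: "h ` (dpts D - idpts I) = dpts D' - idpts I'" using agreeD(1) by (simp add: bij_betw_def)
 have out: "crossing_map ` outer_cr = Dbl ` (dpts D' - idpts I') Un {Circ w j |w j. w : verts D' - k ` X & j < length (ins D' w)}"
  (is "?l = ?r")
 proof (intro equalityI subsetI)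
  fix C assume "C : ?l"
  then consider x where "C = Dbl (h x)" "x : dpts D - idpts I"
  | v j where "C = Circ (k v) j" "v : verts D - X" "j < length (ins D v)" by (auto simp: outer_cr_def)
  thus "C : ?r"
 proof cases
  case 1
  thus ?thesis using h by blast
 next
  case 2
  hence "length (ins D' (k v)) = length (ins D v)" using agreeD(4) by simp
  thus ?thesis using 2 kX by auto
 qed
 next
  fix C assume "C : ?r"
  then consider x where "C = Dbl x" "x : dpts D' - idpts I'"
  | v j where "C = Circ v j" "v : verts D' - k ` X" "j < length (ins D' v)" by auto
  thus "C : ?l"
 proof cases
  case 1
  then obtain y where y: "y : dpts D - idpts I" "h y = x" using h by (metis imageE)
  hence "C = crossing_map (Dbl y)" "Dbl y : outer_cr" using 1 by (auto simp: outer_cr_def)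
  thus ?thesis by blast
 next
  case 2
  then obtain w where w: "w : verts D - X" "k w = v" using kX by (metis imageE)
  hence "length (ins D' v) = length (ins D w)" using agreeD(4) by auto
  hence "C = crossing_map (Circ w j)" "Circ w j : outer_cr" using w 2 by (auto simp: outer_cr_def)
  thus ?thesis by blast
 qed
 qed
 show "Cr D' = inner_cr D' I' (k ` X) Un crossing_map ` outer_cr" "inner_cr D' I' (k ` X) Int crossing_map ` outer_cr = {}"
 unfolding out using inside kX(1) by (auto simp: Cr_def inner_cr_def)
qed

lemma inj_crossing_map: "inj_on crossing_map outer_cr"
proof (rule inj_onI)
 fix C C' assume "C : outer_cr" "C' : outer_cr" "crossing_map C = crossing_map C'"
 moreover have "inj_on h (dpts D - idpts I)" "inj_on k (verts D)" using agreeD(1,3) by (simp_all add: bij_betw_def)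
 ultimately show "C = C'" by (cases C; cases C') (auto simp: outer_cr_def dest: inj_onD)
qed

context
 fixes Y :: "nat set" and U :: "region set"
 assumes Y: "Y \<subseteq> X"
 defines "U \<equiv> Re D - (Regular ` iregs I Un Disc ` Y)"
begin

lemma fin_U: "finite U" unfolding U_def using finite_Re[OF diagrams(1)] by simp

lemma outer_corner:
 assumes "C : outer_cr" "c : corners C"
 shows "corner_region D C c : U"
  "corner_region D' (crossing_map C) c = rmap (corner_region D C c)"
proof -
 consider x where "C = Dbl x" "x : dpts D" "x ~: idpts I"
  | v j where "C = Circ v j" "v : verts D" "v ~: X" "j < length (ins D v)" using assms(1) by (auto simp: outer_cr_def)
 hence "corner_region D C c : U & corner_region D' (crossing_map C) c = rmap (corner_region D C c)"
 proof cases
  case (1 x)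
  have a: "{sw D x, se D x, nw D x, ne D x} \<subseteq> arcs D - iarcs I" using outer_arcs(1) 1 by simp
  thus ?thesis using agreeD(2)[OF 1(2,3)] agreeD(6) arc_sides 1 by (cases c) (auto simp: U_def Re_def)
 next
  case (2 v j)
  have a: "ins D v ! j : arcs D - iarcs I" using outer_arcs(2) 2 by simp
  have "ins D' (k v) ! j = f (ins D v ! j)" using agreeD(4)[of v] 2 by simp
  thus ?thesis using a agreeD(6) arc_sides 2 assms(2) Y by (cases c) (auto simp: U_def Re_def)
 qed
 thus "corner_region D C c : U" "corner_region D' (crossing_map C) c = rmap (corner_region D C c)" by simp_all
qed

lemma outer_weight:
 assumes "C : outer_cr"
 shows "weight_M (crossing_map C) c = weight_M C c" "weight_A D' (crossing_map C) c = weight_A D C c"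
proof -
 consider x where "C = Dbl x" "x : dpts D" "x ~: idpts I"
  | v j where "C = Circ v j" "v : verts D" "v ~: X" "j < length (ins D v)" using assms(1) by (auto simp: outer_cr_def)
 hence "weight_M (crossing_map C) c = weight_M C c & weight_A D' (crossing_map C) c = weight_A D C c"
 proof cases
  case (1 x)
  have a: "{sw D x, se D x, nw D x, ne D x} \<subseteq> arcs D - iarcs I" using outer_arcs(1) 1 by simp
  hence "over_color D' (h x) = over_color D x" using agreeD(2)[OF 1(2,3)] agreeD(6) by (auto simp: over_color_def)
  thus ?thesis using agreeD(2)[OF 1(2,3)] 1 by simp
 next
  case (2 v j)
  have a: "ins D v ! j : arcs D - iarcs I" using outer_arcs(2) 2 by simp
  have "ins D' (k v) ! j = f (ins D v ! j)" using agreeD(4)[of v] 2 by simp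
  thus ?thesis using a agreeD(6) 2 by auto
 qed
 thus "weight_M (crossing_map C) c = weight_M C c" "weight_A D' (crossing_map C) c = weight_A D C c" by simp_all
qed

definition outer_prod :: region_poly where
 "outer_prod = (PROD C:outer_cr. zrow D C)"

lemma outer_row: "C : outer_cr ==> zrow D' (crossing_map C) = push U rmap (zrow D C)"
proof -
 assume C: "C : outer_cr"
 have cc: "corners (crossing_map C) = corners C" by (cases C) auto
 show ?thesis unfolding zrow_def cc push_sum
 proof (rule sum.cong[OF refl])
  fix c assume c: "c : corners C"
  show "zc (weight_M (crossing_map C) c * weight_A D' (crossing_map C) c) * zvar (corner_region D' (crossing_map C) c) =
  push U rmap (zc (weight_M C c * weight_A D C c) * zvar (corner_region D C c))"
 unfolding push_mult[OF fin_U] push_zc push_zvar[OF fin_U outer_corner(1)[OF C c]] outer_corner(2)[OF C c] outer_weight[OF C] ..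
 qed
qed

lemma outer_prod_image: "(PROD C:crossing_map ` outer_cr. zrow D' C) = push U rmap outer_prod" unfolding outer_prod_def
 unfolding prod.reindex[OF inj_crossing_map] push_prod[OF fin_U] o_def by (rule prod.cong[OF refl]) (rule outer_row)

lemma free_outer_prod: "free (Regular ` iregs I Un Disc ` Y) outer_prod" unfolding outer_prod_def zrow_def
proof (intro free_prod free_sum free_mult free_zc free_zvar)
 fix C c assume "C : outer_cr" "c : corners C"
 thus "corner_region D C c ~: Regular ` iregs I Un Disc ` Y" using outer_corner(1) by (auto simp: U_def)
qed

lemma rmap_U: "rmap ` U = Re D' - (Regular ` iregs I' Un Disc ` k ` Y)"
proof -
 have "U = Regular ` (regs D - iregs I) Un Disc ` (verts D - Y)" by (auto simp: U_def Re_def)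
 moreover have "Re D' - (Regular ` iregs I' Un Disc ` k ` Y) = Regular ` (regs D' - iregs I') Un Disc ` (verts D' - k ` Y)" by (auto simp: Re_def)
 moreover have "verts D' - k ` Y = k ` (verts D - Y)"
 using agreeD(3) inside(1) Y inj_on_image_set_diff[of k "verts D" "verts D" Y] unfolding bij_betw_def by blast
 moreover have "rmap ` (Regular ` S Un Disc ` S') = Regular ` g ` S Un Disc ` k ` S'" for S S' by (simp add: image_Un image_image)
 ultimately show ?thesis using agreeD(7) by simp
qed

lemma free_push_U: "free (Regular ` iregs I' Un Disc ` k ` Y) (push U rmap p)"
proof (rule free_push[where N = "{}"])
 fix a assume "a : U" "rmap a : Regular ` iregs I' Un Disc ` k ` Y"
 thus "a : {}" using rmap_U by blast
qed (simp add: free_def)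

lemma total_outside:
 assumes "dl : arcs D - iarcs I"
  and "extracts (Regular ` iregs I Un Disc ` Y) (PROD C:inner_cr D I X. zrow D C) E"
 shows "state_total D dl = zcoef (E * outer_prod) (U - {Regular (lreg D dl), Regular (rreg D dl)})"
proof -
 let ?T = "U - {Regular (lreg D dl), Regular (rreg D dl)}" and ?N = "Regular ` iregs I Un Disc ` Y"
 have fin: "finite (inner_cr D I X)" "finite outer_cr" using finite_Cr[OF diagrams(1)] Cr_split(1) by auto
 have "(PROD C:Cr D. zrow D C) = (PROD C:inner_cr D I X. zrow D C) * outer_prod"
 unfolding outer_prod_def Cr_split(1) using fin Cr_split(2) by (rule prod.union_disjoint)
 moreover have "Re D - {Regular (lreg D dl), Regular (rreg D dl)} = ?N Un ?T" using local_reg assms(1) inside Y by (auto simp: U_def Re_def)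
 ultimately have "state_total D dl = zcoef ((PROD C:inner_cr D I X. zrow D C) * outer_prod) (?N Un ?T)" using total_zcoef[OF diagrams(1)] by simp
 also have "... = zcoef (E * outer_prod) ?T" by (rule extractsD[OF assms(2) free_outer_prod]) (auto simp: U_def)
 finally show ?thesis .
qed

lemma total_image:
 assumes "dl : arcs D - iarcs I"
  and "extracts (Regular ` iregs I' Un Disc ` k ` Y) (PROD C:inner_cr D' I' (k ` X). zrow D' C) E'"
 shows "state_total D' (f dl) = zcoef (E' * push U rmap outer_prod)
  (rmap ` U - {Regular (g (lreg D dl)), Regular (g (rreg D dl))})"
proof -
 let ?T = "rmap ` U - {Regular (g (lreg D dl)), Regular (g (rreg D dl))}"
  and ?N = "Regular ` iregs I' Un Disc ` k ` Y"
 have fin: "finite (inner_cr D' I' (k ` X))" "finite (crossing_map ` outer_cr)" using finite_Cr[OF diagrams(2)] Cr_split(3) by (metis finite_Un)+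
 have sides: "lreg D' (f dl) = g (lreg D dl)" "rreg D' (f dl) = g (rreg D dl)" using agreeD(6) assms(1) by auto
 have "(PROD C:Cr D'. zrow D' C) = (PROD C:inner_cr D' I' (k ` X). zrow D' C) * push U rmap outer_prod"
 unfolding outer_prod_image[symmetric] Cr_split(3) using fin Cr_split(4) by (rule prod.union_disjoint)
 moreover have "Re D' - {Regular (g (lreg D dl)), Regular (g (rreg D dl))} = ?N Un ?T"
 proof -
  have "g (lreg D dl) ~: iregs I'" "g (rreg D dl) ~: iregs I'" using arc_sides[OF assms(1)] agreeD(7) by blast+
  moreover have "k ` Y \<subseteq> verts D'" using inside(1) Y agreeD(3) unfolding bij_betw_def by blast
  hence "Disc ` k ` Y \<subseteq> Re D'" "Regular ` iregs I' \<subseteq> Re D'" using inside(5) by (auto simp: Re_def)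
  ultimately show ?thesis unfolding rmap_U by auto
 qed
 ultimately have "state_total D' (f dl) = zcoef ((PROD C:inner_cr D' I' (k ` X). zrow D' C) * push U rmap outer_prod) (?N Un ?T)"
 using total_zcoef[OF diagrams(2)] sides by simp
 also have "... = zcoef (E' * push U rmap outer_prod) ?T" by (rule extractsD[OF assms(2) free_push_U]) (auto simp: rmap_U)
 finally show ?thesis .
qed

text \<open>The factors outside the disc correspond under the renaming of regions, which is a ring homomorphism; hence only the coefficients of the inner regions have to be compared.\<close>

lemma total_transfer:
 assumes "dl : arcs D - iarcs I"
  and "extracts (Regular ` iregs I Un Disc ` Y) (PROD C:inner_cr D I X. zrow D C) E"
  and "extracts (Regular ` iregs I' Un Disc ` k ` Y) (PROD C:inner_cr D' I' (k ` X). zrow D' C) E'"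
  and "push U rmap E = zc u * E'" and g: "inj_on g (regs D - iregs I)"
 shows "state_total D dl = u * state_total D' (f dl)"
proof -
 have inj: "inj_on rmap U"
 proof (rule inj_onI)
  fix a b assume "a : U" "b : U" "rmap a = rmap b"
  thus "a = b" using g agreeD(3) by (cases a; cases b) (auto simp: U_def Re_def bij_betw_def dest: inj_onD)
 qed
 let ?T = "U - {Regular (lreg D dl), Regular (rreg D dl)}"
 have lr: "Regular (lreg D dl) : U" "Regular (rreg D dl) : U" using arc_sides[OF assms(1)] by (auto simp: U_def Re_def)
 have "rmap ` ?T = rmap ` U - rmap ` {Regular (lreg D dl), Regular (rreg D dl)}" using lr by (intro inj_on_image_set_diff[OF inj]) auto
 hence T: "rmap ` ?T = rmap ` U - {Regular (g (lreg D dl)), Regular (g (rreg D dl))}" by simp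
 have "state_total D dl = zcoef (push U rmap (E * outer_prod)) (rmap ` ?T)" unfolding total_outside[OF assms(1,2)]
 by (rule zcoef_push_inj[OF inj, symmetric]) (use fin_U in auto)
 also have "... = u * state_total D' (f dl)"
 unfolding T total_image[OF assms(1,3)] push_mult[OF fin_U] assms(4) by (simp add: mult.assoc zcoef_zc_times)
 finally show ?thesis .
qed

lemma push_reg: "r : regs D ==> r ~: iregs I ==> push U rmap (zreg r) = zreg (g r)" by (subst push_zvar[OF fin_U]) (auto simp: U_def Re_def)

lemma push_disc: "v : verts D ==> v ~: Y ==> push U rmap (zvar (Disc v)) = zvar (Disc (k v))" by (subst push_zvar[OF fin_U]) (auto simp: U_def Re_def)

lemma circ_push:
 assumes "v : verts D" "v ~: Y" "a : arcs D - iarcs I" "ins D' (k v) ! j' = f a"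
 shows "zrow D' (Circ (k v) j') = push U rmap (circ_row D v a)" using assms arc_sides[OF assms(3)] agreeD(6)[of a]
 by (simp add: zrow_Circ circ_row_def Let_def push_add push_mult[OF fin_U] push_zc push_reg push_disc)

end

lemma base_value_image:
 assumes "dl : arcs D - iarcs I" "color D dl ~= 0"
 shows "base_value D dl = thalf powi (2 * (region_index D (lreg D dl) - region_index D' (lreg D' (f dl)))) * base_value D' (f dl)"
 using assms agreeD(6)[of dl] by (simp add: base_value_def Let_def right_diff_distrib power_int_add[symmetric] algebra_simps)

end

lemma bracket_total: "bracket D dl = inverse (base_value D dl) * state_total D dl" by (simp add: bracket_def state_total_def)

definition same_bracket :: "moy => moy => bool" where
 "same_bracket D D' \<longleftrightarrow> card (verts D) = card (verts D') \<and>
  (EX dl dl' m. base_point D dl & base_point D' dl' & bracket D dl = thalf powi m * bracket D' dl')"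

context replacement
begin

lemma same_card: "card (verts D) = card (verts D')" using agreeD(3) by (rule bij_betw_same_card)

lemma same_bracketI:
 assumes d: "dl : arcs D - iarcs I" "color D dl ~= 0" and tot: "state_total D dl = thalf powi m * state_total D' (f dl)"
 shows "same_bracket D D'"
proof -
 define n where "n = 2 * (region_index D (lreg D dl) - region_index D' (lreg D' (f dl)))"
 have "base_value D dl = thalf powi n * base_value D' (f dl)" using base_value_image[OF d] by (simp add: n_def)
 hence "bracket D dl = inverse (thalf powi n) * thalf powi m * bracket D' (f dl)" using tot by (simp add: bracket_total mult_ac)
 also have "inverse (thalf powi n) * thalf powi m = thalf powi (m - n)" by (simp add: power_int_diff field_simps)
 finally have "bracket D dl = thalf powi (m - n) * bracket D' (f dl)" .
 moreover have "base_point D dl" "base_point D' (f dl)" using d agreeD(5,6) by (auto simp: base_point_def)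
 ultimately show ?thesis using same_card unfolding same_bracket_def by blast
qed

text \<open>When nothing new appears inside, every arc of the other diagram, coloured ones included, comes from outside.\<close>

lemma colored_outside:
 assumes "iarcs I' = {}"
 shows "EX dl:arcs D - iarcs I. color D dl ~= 0"
proof -
 obtain a where a: "a : arcs D'" "color D' a ~= 0" using diagrams(2) by (auto simp: moy_diagram_def)
 then obtain dl where "dl : arcs D - iarcs I" "f dl = a" using agreeD(5) assms by (metis Diff_empty imageE)
 thus ?thesis using a agreeD(6)[of dl] by auto
qed

end

lemma same_bracket_zero:
 assumes "moy_diagram D" "moy_diagram D'" "card (verts D) = card (verts D')"
  and "!!dl. dl : arcs D ==> state_total D dl = 0" "!!dl. dl : arcs D' ==> state_total D' dl = 0"
 shows "same_bracket D D'"
proof -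
 obtain a a' where "base_point D a" "base_point D' a'" using assms(1,2) by (auto simp: moy_diagram_def base_point_def)
 moreover from this have "bracket D a = 0" "bracket D' a' = 0" using assms(4,5) by (auto simp: bracket_def state_total_def base_point_def)
 ultimately show ?thesis using assms(3) unfolding same_bracket_def by fastforce
qed

lemma identifies_inj: "identifies g A {} ==> inj_on g A" unfolding identifies_def inj_on_def by simp

lemma identifies_pair:
 assumes "identifies g A {(u, u')}" "a : A" "b : A"
 shows "g a = g b \<longleftrightarrow> a = b \<or> a = u & b = u' \<or> a = u' & b = u"
proof -
 have "(a, b) : ({(u, u')} Un {(u, u')}\<inverse>)\<^sup>* \<longleftrightarrow> a = b \<or> a = u & b = u' \<or> a = u' & b = u" (is "?l \<longleftrightarrow> ?r")
 proof
  assume ?l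
  thus ?r by (induction rule: rtrancl_induct) auto
 next
  assume ?r
  thus ?l by (auto intro: r_into_rtrancl)
 qed
 thus ?thesis using assms by (simp add: identifies_def)
qed

lemma bounded_side:
 assumes "bounded_by D r S" "a : arcs D"
 shows "lreg D a = r \<longleftrightarrow> (a, L) : S" "rreg D a = r \<longleftrightarrow> (a, R) : S"
proof -
 have S: "S = {(a, s). a : arcs D & side_reg D s a = r}" using assms(1) by (auto simp: bounded_by_def)
 show "lreg D a = r \<longleftrightarrow> (a, L) : S" "rreg D a = r \<longleftrightarrow> (a, R) : S" unfolding S using assms(2) by auto
qed

lemma bounded_in_regs: "bounded_by D r S ==> r : regs D" by (simp add: bounded_by_def)

text \<open>Squares of variables vanish, so only one of the two factors contributes the variable.\<close>

lemma extracts_two: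
 assumes "free {v} A" "free {v} B"
 shows "extracts {v} ((zvar v * a + A) * (zvar v * b + B)) (a * B + A * b)"
proof (rule extracts_var')
 have "(zvar v * a + A) * (zvar v * b + B) = (zvar v * zvar v) * (a * b) + zvar v * (a * B + A * b) + A * B" by (simp add: algebra_simps)
 thus "(zvar v * a + A) * (zvar v * b + B) = zvar v * (a * B + A * b) + A * B" by (simp add: zvar_square)
 show "free {v} (A * B)" using assms by (rule free_mult)
qed

lemma extracts_three:
 assumes "free {v} A" "free {v} B" "free {v} C"
 shows "extracts {v} ((zvar v * a + A) * (zvar v * b + B) * (zvar v * c + C)) ((a * B + A * b) * C + A * B * c)"
proof -
 have "(zvar v * a + A) * (zvar v * b + B) = (zvar v * zvar v) * (a * b) + zvar v * (a * B + A * b) + A * B" by (simp add: algebra_simps)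
 hence "(zvar v * a + A) * (zvar v * b + B) = zvar v * (a * B + A * b) + A * B" by (simp add: zvar_square)
 thus ?thesis using extracts_two[OF free_mult[OF assms(1,2)] assms(3), of "a * B + A * b" c] by simp
qed

section \<open>Isotopies and the moves (I), (II) and (V)\<close>

lemma slot_neq:
 assumes D: "moy_diagram D"
 shows "x : dpts D ==> y : dpts D ==> sw D x = sw D y \<longleftrightarrow> x = y"
  "x : dpts D ==> y : dpts D ==> se D x = se D y \<longleftrightarrow> x = y"
  "x : dpts D ==> y : dpts D ==> nw D x = nw D y \<longleftrightarrow> x = y"
  "x : dpts D ==> y : dpts D ==> ne D x = ne D y \<longleftrightarrow> x = y"
  "x : dpts D ==> y : dpts D ==> sw D x ~= se D y"
  "x : dpts D ==> y : dpts D ==> se D x ~= sw D y"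
  "x : dpts D ==> y : dpts D ==> nw D x ~= ne D y"
  "x : dpts D ==> y : dpts D ==> ne D x ~= nw D y"
  "x : dpts D ==> v : verts D ==> j < length (ins D v) ==> ins D v ! j ~= sw D x & ins D v ! j ~= se D x"
  "x : dpts D ==> v : verts D ==> j < length (outs D v) ==> outs D v ! j ~= nw D x & outs D v ! j ~= ne D x"
  "v : verts D ==> i < length (ins D v) ==> j < length (ins D v) ==> ins D v ! i = ins D v ! j \<longleftrightarrow> i = j"
  "v : verts D ==> i < length (outs D v) ==> j < length (outs D v) ==> outs D v ! i = outs D v ! j \<longleftrightarrow> i = j"
proof -
 have inj: "s : in_slots D ==> s' : in_slots D ==> in_arc D s = in_arc D s' \<longleftrightarrow> s = s'"
  "s : out_slots D ==> s' : out_slots D ==> out_arc D s = out_arc D s' \<longleftrightarrow> s = s'" for s s'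
 using D by (auto simp: moy_diagram_def dest: inj_onD)
 have slots: "LeftSlot x : in_slots D" "RightSlot x : in_slots D" "LeftSlot x : out_slots D" "RightSlot x : out_slots D"
  if "x : dpts D" for x using that by (auto simp: in_slots_def out_slots_def)
 have vslots: "VertexSlot v j : in_slots D \<longleftrightarrow> v : verts D & j < length (ins D v)"
  "VertexSlot v j : out_slots D \<longleftrightarrow> v : verts D & j < length (outs D v)" for v j by (auto simp: in_slots_def out_slots_def)
 show "x : dpts D ==> y : dpts D ==> sw D x = sw D y \<longleftrightarrow> x = y" using inj(1)[OF slots(1) slots(1), of x y] by simp
 show "x : dpts D ==> y : dpts D ==> se D x = se D y \<longleftrightarrow> x = y" using inj(1)[OF slots(2) slots(2), of x y] by simp
 show "x : dpts D ==> y : dpts D ==> nw D x = nw D y \<longleftrightarrow> x = y" using inj(2)[OF slots(3) slots(3), of x y] by simp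
 show "x : dpts D ==> y : dpts D ==> ne D x = ne D y \<longleftrightarrow> x = y" using inj(2)[OF slots(4) slots(4), of x y] by simp
 show 1: "x : dpts D ==> y : dpts D ==> sw D x ~= se D y" for x y using inj(1)[OF slots(1) slots(2), of x y] by simp
 thus "x : dpts D ==> y : dpts D ==> se D x ~= sw D y" by metis
 show 2: "x : dpts D ==> y : dpts D ==> nw D x ~= ne D y" for x y using inj(2)[OF slots(3) slots(4), of x y] by simp
 thus "x : dpts D ==> y : dpts D ==> ne D x ~= nw D y" by metis
 show "x : dpts D ==> v : verts D ==> j < length (ins D v) ==> ins D v ! j ~= sw D x & ins D v ! j ~= se D x"
 using inj(1)[of "VertexSlot v j" "LeftSlot x"] inj(1)[of "VertexSlot v j" "RightSlot x"] slots vslots by simp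
 show "x : dpts D ==> v : verts D ==> j < length (outs D v) ==> outs D v ! j ~= nw D x & outs D v ! j ~= ne D x"
 using inj(2)[of "VertexSlot v j" "LeftSlot x"] inj(2)[of "VertexSlot v j" "RightSlot x"] slots vslots by simp
 show "v : verts D ==> i < length (ins D v) ==> j < length (ins D v) ==> ins D v ! i = ins D v ! j \<longleftrightarrow> i = j"
 using inj(1)[of "VertexSlot v i" "VertexSlot v j"] vslots by simp
 show "v : verts D ==> i < length (outs D v) ==> j < length (outs D v) ==> outs D v ! i = outs D v ! j \<longleftrightarrow> i = j"
 using inj(2)[of "VertexSlot v i" "VertexSlot v j"] vslots by simp
qed

lemma slot_arcs:
 assumes D: "moy_diagram D"
 shows "x : dpts D ==> sw D x : arcs D & se D x : arcs D & nw D x : arcs D & ne D x : arcs D"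
  "v : verts D ==> j < length (ins D v) ==> ins D v ! j : arcs D"
  "v : verts D ==> j < length (outs D v) ==> outs D v ! j : arcs D"
proof -
 have a: "s : in_slots D ==> in_arc D s : arcs D" "s : out_slots D ==> out_arc D s : arcs D" for s
 using D by (auto simp: moy_diagram_def open_arcs_def)
 show "x : dpts D ==> sw D x : arcs D & se D x : arcs D & nw D x : arcs D & ne D x : arcs D"
 using a(1)[of "LeftSlot x"] a(1)[of "RightSlot x"] a(2)[of "LeftSlot x"] a(2)[of "RightSlot x"] by (simp add: in_slots_def out_slots_def)
 show "v : verts D ==> j < length (ins D v) ==> ins D v ! j : arcs D" using a(1)[of "VertexSlot v j"] by (simp add: in_slots_def)
 show "v : verts D ==> j < length (outs D v) ==> outs D v ! j : arcs D" using a(2)[of "VertexSlot v j"] by (simp add: out_slots_def)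
qed

lemma dpt_sides:
 assumes "moy_diagram D" "x : dpts D"
 shows "color D (sw D x) = color D (ne D x)" "color D (se D x) = color D (nw D x)"
  "lreg D (sw D x) = lreg D (nw D x)" "rreg D (sw D x) = lreg D (se D x)"
  "rreg D (nw D x) = lreg D (ne D x)" "rreg D (se D x) = rreg D (ne D x)" using assms by (auto simp: moy_diagram_def dpt_ok_def)

lemma arc_regs: "moy_diagram D ==> a : arcs D ==> lreg D a : regs D & rreg D a : regs D" by (auto simp: moy_diagram_def)

lemma in_slotI:
 "x : dpts D ==> LeftSlot x : in_slots D" "x : dpts D ==> RightSlot x : in_slots D"
 "x : dpts D ==> LeftSlot x : out_slots D" "x : dpts D ==> RightSlot x : out_slots D"
 "v : verts D ==> j < length (ins D v) ==> VertexSlot v j : in_slots D"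
 "v : verts D ==> j < length (outs D v) ==> VertexSlot v j : out_slots D" by (auto simp: in_slots_def out_slots_def)

lemma local_inI:
 "x : dpts D ==> x : idpts I ==> a = sw D x \<or> a = se D x ==> EX s:in_slots D. in_arc D s = a & inner_slot I X s"
 "v : verts D ==> v : X ==> j < length (ins D v) ==> a = ins D v ! j ==> EX s:in_slots D. in_arc D s = a & inner_slot I X s"
proof -
 assume "x : dpts D" "x : idpts I" "a = sw D x \<or> a = se D x"
 thus "EX s:in_slots D. in_arc D s = a & inner_slot I X s"
 using in_slotI(1)[of x D] in_slotI(2)[of x D] by (metis in_arc.simps(1,2) inner_slot.simps(1,2))
next
 assume "v : verts D" "v : X" "j < length (ins D v)" "a = ins D v ! j"
 thus "EX s:in_slots D. in_arc D s = a & inner_slot I X s" using in_slotI(5)[of v D j] by (intro bexI[of _ "VertexSlot v j"]) auto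
qed

lemma local_outI:
 "x : dpts D ==> x : idpts I ==> a = nw D x \<or> a = ne D x ==> EX s:out_slots D. out_arc D s = a & inner_slot I X s"
 "v : verts D ==> v : X ==> j < length (outs D v) ==> a = outs D v ! j ==> EX s:out_slots D. out_arc D s = a & inner_slot I X s"
proof -
 assume "x : dpts D" "x : idpts I" "a = nw D x \<or> a = ne D x"
 thus "EX s:out_slots D. out_arc D s = a & inner_slot I X s"
 using in_slotI(3)[of x D] in_slotI(4)[of x D] by (metis out_arc.simps(1,2) inner_slot.simps(1,2))
next
 assume "v : verts D" "v : X" "j < length (outs D v)" "a = outs D v ! j"
 thus "EX s:out_slots D. out_arc D s = a & inner_slot I X s" using in_slotI(6)[of v D j] by (intro bexI[of _ "VertexSlot v j"]) auto
qed

lemma same_bracket_isotopic: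
 assumes "moy_diagram D" "moy_diagram D'" "isotopic D D'"
 shows "same_bracket D D'"
proof -
 obtain f g h k where agree: "agree_outside D nothing D' nothing {} f g h k"
  and g: "inj_on g (regs D)" using assms(3) identifies_inj unfolding isotopic_def by blast
 interpret replacement D D' nothing nothing "{}" f g h k by unfold_locales (use assms agree in \<open>auto simp: nothing_def\<close>)
 obtain dl where d: "dl : arcs D - iarcs nothing" "color D dl ~= 0" using colored_outside by (auto simp: nothing_def)
 have "state_total D dl = 1 * state_total D' (f dl)" by (rule total_transfer[where Y = "{}" and E = 1 and E' = 1])
  (use d g in \<open>auto simp: nothing_def inner_cr_def extracts_empty push_one zc_hom\<close>)
 thus ?thesis using same_bracketI[OF d, of 0] by simp
qed

lemma free_zreg: "r ~= r' ==> free {Regular r} (zreg r')" by (rule free_zvar) simp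

lemma same_bracket_move1:
 assumes D: "moy_diagram D" "moy_diagram D'" and m: "move1 D D'"
 shows "same_bracket D D'"
proof -
 obtain x l r a b f g h k where kink: "kink D x l r a b"
  and agree: "agree_outside D \<lparr>idpts = {x}, iarcs = {l}, iregs = {r}\<rparr> D' nothing {} f g h k"
  and g: "inj_on g (regs D - {r})" using m identifies_inj unfolding move1_def by blast
 let ?I = "\<lparr>idpts = {x}, iarcs = {l}, iregs = {r}\<rparr>"
 have x: "x : dpts D" using kink by (auto simp: kink_def)
 note arcsx = slot_arcs(1)[OF D(1) x] and sides = dpt_sides[OF D(1) x]
 obtain sd where bd: "bounded_by D r {(l, sd)}" using kink by (auto simp: kink_def)
 note bs = bounded_side[OF bd]
 interpret replacement D D' ?I nothing "{}" f g h k
 proof unfold_locales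
  show "agree_outside D ?I D' nothing {} f g h k" by (rule agree)
  show "EX s:in_slots D. in_arc D s = a & inner_slot ?I {} s" if "a : iarcs ?I" for a
 using kink that by (intro local_inI(1)[OF x]) (auto simp: kink_def)
  show "EX s:out_slots D. out_arc D s = a & inner_slot ?I {} s" if "a : iarcs ?I" for a
 using kink that by (intro local_outI(1)[OF x]) (auto simp: kink_def)
  show "lreg D a ~: iregs ?I & rreg D a ~: iregs ?I" if "a : arcs D" "a ~: iarcs ?I" for a using bs[OF that(1)] that by auto
 qed (use D x bounded_in_regs[OF bd] in \<open>auto simp: nothing_def\<close>)
 obtain dl where d: "dl : arcs D - iarcs ?I" "color D dl ~= 0" using colored_outside by (auto simp: nothing_def)
 have inner: "inner_cr D ?I {} = {Dbl x}" "inner_cr D' nothing (k ` {}) = {}" by (auto simp: inner_cr_def nothing_def)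
 have "EX m B. zrow D (Dbl x) = zreg r * zc (thalf powi m) + B & free {Regular r} B" using kink[unfolded kink_def]
 proof (elim conjE disjE)
  assume k: "ne D x = l" "se D x = l" "bounded_by D r {(l, R)}"
  note bs = bounded_side[OF k(3)]
  have r: "rreg D (se D x) = r" "rreg D (nw D x) ~= r" "rreg D (sw D x) ~= r" "lreg D (sw D x) ~= r"
 using bs arcsx sides k slot_neq(5)[OF D(1) x x] by auto
  define m where "m = (if positive D x then 0 else 2 * int (color D (se D x)))"
  define B where "B = zrow D (Dbl x) - zreg r * zc (thalf powi m)"
  have "B = (if positive D x then zc (thalf powi (- 2 * int (color D (sw D x)))) * (zreg (lreg D (sw D x)) - zreg (rreg D (nw D x))) + zreg (rreg D (sw D x))
  else zreg (rreg D (sw D x)) + zreg (lreg D (sw D x)) - zc (thalf powi (2 * int (color D (se D x)))) * zreg (rreg D (nw D x)))"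
 unfolding B_def m_def using r(1) by (simp add: zrow_positive zrow_negative zc_hom algebra_simps)
  hence "free {Regular r} B" using r by (auto intro!: free_intros)
  thus ?thesis by (intro exI[of _ m] exI[of _ B]) (simp add: B_def)
 next
  assume k: "nw D x = l" "sw D x = l" "bounded_by D r {(l, L)}"
  note bs = bounded_side[OF k(3)]
  have r: "lreg D (sw D x) = r" "rreg D (nw D x) ~= r" "rreg D (sw D x) ~= r" "rreg D (se D x) ~= r"
 using bs arcsx sides k slot_neq(5)[OF D(1) x x] by auto
  define m where "m = (if positive D x then - 2 * int (color D (sw D x)) else 0)"
  define B where "B = zrow D (Dbl x) - zreg r * zc (thalf powi m)"
  have "B = (if positive D x then zreg (rreg D (sw D x)) + zreg (rreg D (se D x)) - zc (thalf powi (- 2 * int (color D (sw D x)))) * zreg (rreg D (nw D x))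
  else zc (thalf powi (2 * int (color D (se D x)))) * (zreg (rreg D (se D x)) - zreg (rreg D (nw D x))) + zreg (rreg D (sw D x)))"
 unfolding B_def m_def using r(1) by (simp add: zrow_positive zrow_negative zc_hom algebra_simps)
  hence "free {Regular r} B" using r by (auto intro!: free_intros)
  thus ?thesis by (intro exI[of _ m] exI[of _ B]) (simp add: B_def)
 qed
 then obtain m B where row: "zrow D (Dbl x) = zreg r * zc (thalf powi m) + B" "free {Regular r} B" by blast
 have "state_total D dl = thalf powi m * state_total D' (f dl)"
 proof (rule total_transfer[where Y = "{}"])
  show "extracts (Regular ` iregs ?I Un Disc ` {}) (PROD C:inner_cr D ?I {}. zrow D C) (zc (thalf powi m))"
 unfolding inner using extracts_var[OF row(2), of "zc (thalf powi m)"] row(1) by simp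
  show "extracts (Regular ` iregs nothing Un Disc ` k ` {}) (PROD C:inner_cr D' nothing (k ` {}). zrow D' C) 1"
 unfolding inner by (simp add: nothing_def extracts_empty)
 qed (use d g in \<open>auto simp: push_zc\<close>)
 thus ?thesis by (rule same_bracketI[OF d])
qed

lemma zc_powi_cancel:
 "zc (thalf powi (- (2 * i))) * (zc (thalf powi (2 * i)) * z) = z"
 "zc (thalf powi (2 * i)) * (zc (thalf powi (- (2 * i))) * z) = z"
proof -
 have "thalf powi (- (2 * i)) * thalf powi (2 * i) = 1" "thalf powi (2 * i) * thalf powi (- (2 * i)) = 1" by (simp_all add: thalf_powi_add[symmetric])
 thus "zc (thalf powi (- (2 * i))) * (zc (thalf powi (2 * i)) * z) = z"
  "zc (thalf powi (2 * i)) * (zc (thalf powi (- (2 * i))) * z) = z" by (simp_all add: mult.assoc[symmetric] zc_hom(6)[symmetric] zc_hom(2))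
qed

lemma bigon_parallel:
 assumes "X = zvar v * (- a) + (a * w + (u + e))" "Y = zvar v * 1 + (b * (e - u') + w)"
  and "!!z. a * (b * z) = z" "free {v} a" "free {v} b" "free {v} w" "free {v} e" "free {v} u" "free {v} u'"
 shows "extracts {v} (X * Y) (u + u')"
proof -
 have "extracts {v} (X * Y) (- a * (b * (e - u') + w) + (a * w + (u + e)) * 1)" unfolding assms(1,2) by (intro extracts_two free_intros assms)
 also have "- a * (b * (e - u') + w) + (a * w + (u + e)) * 1 = u + u'" by (simp add: distrib_left assms(3))
 finally show ?thesis .
qed

lemma bigon_antiparallel:
 assumes "X = zvar v * 1 + (a * (u - P) + Q)" "Y = zvar v * b + ((P + u') - b * Q)"
  and "!!z. b * (a * z) = z" "free {v} a" "free {v} b" "free {v} P" "free {v} Q" "free {v} u" "free {v} u'"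
 shows "extracts {v} (X * Y) (u + u')"
proof -
 have "extracts {v} (X * Y) (1 * ((P + u') - b * Q) + (a * (u - P) + Q) * b)" unfolding assms(1,2) by (intro extracts_two free_intros assms)
 also have "1 * ((P + u') - b * Q) + (a * (u - P) + Q) * b = u + u'" by (simp add: mult.commute[of _ b] distrib_left assms(3))
 finally show ?thesis .
qed

text \<open>The contributions in which the bigon is taken at \<open>x\<close> and at \<open>y\<close> cancel except for the two opposite regions: the weights there are inverse to each other.\<close>

lemma bigon_rows:
 assumes D: "moy_diagram D" and b: "bigon D x y p q r aa' bb' (u, u')"
 shows "extracts {Regular r} (zrow D (Dbl x) * zrow D (Dbl y)) (zreg u + zreg u')" (is ?ex)
  and "u : regs D" "u' : regs D" "u ~= r" "u' ~= r"
  and "EX cx cx' cy cy'. corner_region D (Dbl x) cx = Regular r & corner_region D (Dbl x) cx' = Regular u \<and>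
  corner_region D (Dbl y) cy = Regular r & corner_region D (Dbl y) cy' = Regular u' \<and>
  (cx = South \<longleftrightarrow> False) & (cx' = South \<longleftrightarrow> cy = South) & cy' ~= South" (is ?corners)
proof -
 have xy: "x : dpts D" "y : dpts D" "x ~= y" "positive D x ~= positive D y" using b by (auto simp: bigon_def)
 note ax = slot_arcs(1)[OF D xy(1)] and ay = slot_arcs(1)[OF D xy(2)]
 note sx = dpt_sides[OF D xy(1)] and sy = dpt_sides[OF D xy(2)]
 note neq = slot_neq[OF D]
 consider (par) "nw D x = p" "sw D y = p" "ne D x = q" "se D y = q" "bounded_by D r {(p, R), (q, L)}"
  "u = rreg D (sw D x)" "u' = rreg D (nw D y)"
  | (anti1) "ne D x = p" "se D y = p" "se D x = q" "ne D y = q" "bounded_by D r {(p, R), (q, R)}"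
  "u = lreg D (sw D x)" "u' = lreg D (sw D y)"
  | (anti2) "nw D x = p" "sw D y = p" "sw D x = q" "nw D y = q" "bounded_by D r {(p, L), (q, L)}"
  "u = rreg D (se D x)" "u' = rreg D (se D y)" using b unfolding bigon_def by blast
 hence *: "?ex & u : regs D & u' : regs D & u ~= r & u' ~= r & ?corners"
 proof cases
  case par
  note bs = bounded_side[OF par(5)]
  have pq: "p ~= q" "sw D x ~= p" "sw D x ~= q" "nw D y ~= p" "nw D y ~= q"
 using neq(7)[OF xy(1) xy(1)] neq(1)[OF xy(1,2)] neq(5)[OF xy(1,2)] neq(3)[OF xy(2,1)] neq(7)[OF xy(2,1)] par xy by auto
  have r: "rreg D p = r" "lreg D q = r" "lreg D p ~= r" "rreg D q ~= r" "u ~= r" "u' ~= r" using bs ax ay par pq by auto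
  have reg: "u : regs D" "u' : regs D" using par arc_regs[OF D] ax ay by auto
  let ?a = "%i. zc (thalf powi (- (2 * int i)))" and ?b = "%i. zc (thalf powi (2 * int i))"
  have ?ex
 proof (cases "positive D x")
  case True
  show ?thesis by (rule bigon_parallel[where a = "?a (color D q)" and b = "?b (color D q)" and w = "zreg (lreg D p)" and e = "zreg (rreg D q)"])
  (rule zc_powi_cancel | use True xy(4) par r sx sy in \<open>simp add: zrow_positive zrow_negative algebra_simps free_intros free_zreg\<close>)+
 next
  case False
  show ?thesis by (rule bigon_parallel[where a = "?b (color D p)" and b = "?a (color D p)" and w = "zreg (rreg D q)" and e = "zreg (lreg D p)"])
  (rule zc_powi_cancel | use False xy(4) par r sx sy in \<open>simp add: zrow_positive zrow_negative algebra_simps free_intros free_zreg\<close>)+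
 qed
  moreover have "corner_region D (Dbl x) North = Regular r & corner_region D (Dbl x) South = Regular u \<and>
  corner_region D (Dbl y) South = Regular r & corner_region D (Dbl y) North = Regular u'" using par r by simp
  ultimately show ?thesis using reg r by blast
 next
  case anti1
  note bs = bounded_side[OF anti1(5)]
  have pq: "p ~= q" "sw D x ~= p" "sw D x ~= q" "sw D y ~= p" "sw D y ~= q"
 using neq(2)[OF xy(1,2)] neq(5)[OF xy(1,2)] neq(5)[OF xy(1) xy(1)] neq(5)[OF xy(2) xy(2)] neq(5)[OF xy(2,1)] anti1 xy by auto
  have r: "rreg D p = r" "rreg D q = r" "lreg D p ~= r" "lreg D q ~= r" "u ~= r" "u' ~= r" using bs ax ay anti1 pq by auto
  have reg: "u : regs D" "u' : regs D" using anti1 arc_regs[OF D] ax ay by auto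
  let ?a = "%i. zc (thalf powi (- (2 * int i)))" and ?b = "%i. zc (thalf powi (2 * int i))"
  have ?ex
 proof (cases "positive D x")
  case True
  show ?thesis by (rule bigon_antiparallel[where a = "?a (color D p)" and b = "?b (color D p)" and P = "zreg (lreg D p)" and Q = "zreg (lreg D q)"])
  (rule zc_powi_cancel | use True xy(4) anti1 r sx sy in \<open>simp add: zrow_positive zrow_negative algebra_simps free_intros free_zreg\<close>)+
 next
  case False
  have "extracts {Regular r} (zrow D (Dbl y) * zrow D (Dbl x)) (zreg u' + zreg u)"
 by (rule bigon_antiparallel[where a = "?a (color D q)" and b = "?b (color D q)" and P = "zreg (lreg D q)" and Q = "zreg (lreg D p)"])
  (rule zc_powi_cancel | use False xy(4) anti1 r sx sy in \<open>simp add: zrow_positive zrow_negative algebra_simps free_intros free_zreg\<close>)+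
  thus ?thesis by (simp add: mult.commute add.commute)
 qed
  moreover have "corner_region D (Dbl x) East = Regular r & corner_region D (Dbl x) West = Regular u \<and>
  corner_region D (Dbl y) East = Regular r & corner_region D (Dbl y) West = Regular u'" using anti1 r by simp
  ultimately show ?thesis using reg r by blast
 next
  case anti2
  note bs = bounded_side[OF anti2(5)]
  have pq: "p ~= q" "se D x ~= p" "se D x ~= q" "se D y ~= p" "se D y ~= q"
 using neq(1)[OF xy(1,2)] neq(5)[OF xy(2,1)] neq(5)[OF xy(1) xy(1)] neq(5)[OF xy(2) xy(2)] neq(5)[OF xy(1,2)] anti2 xy by auto
  have r: "lreg D p = r" "lreg D q = r" "rreg D p ~= r" "rreg D q ~= r" "u ~= r" "u' ~= r" using bs ax ay anti2 pq by auto
  have reg: "u : regs D" "u' : regs D" using anti2 arc_regs[OF D] ax ay by auto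
  let ?a = "%i. zc (thalf powi (- (2 * int i)))" and ?b = "%i. zc (thalf powi (2 * int i))"
  have ?ex
 proof (cases "positive D x")
  case True
  have "extracts {Regular r} (zrow D (Dbl y) * zrow D (Dbl x)) (zreg u' + zreg u)"
 by (rule bigon_antiparallel[where a = "?b (color D q)" and b = "?a (color D q)" and P = "zreg (rreg D q)" and Q = "zreg (rreg D p)"])
  (rule zc_powi_cancel | use True xy(4) anti2 r sx sy in \<open>simp add: zrow_positive zrow_negative algebra_simps free_intros free_zreg\<close>)+
  thus ?thesis by (simp add: mult.commute add.commute)
 next
  case False
  show ?thesis by (rule bigon_antiparallel[where a = "?b (color D p)" and b = "?a (color D p)" and P = "zreg (rreg D p)" and Q = "zreg (rreg D q)"])
  (rule zc_powi_cancel | use False xy(4) anti2 r sx sy in \<open>simp add: zrow_positive zrow_negative algebra_simps free_intros free_zreg\<close>)+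
 qed
  moreover have "corner_region D (Dbl x) West = Regular r & corner_region D (Dbl x) East = Regular u \<and>
  corner_region D (Dbl y) West = Regular r & corner_region D (Dbl y) East = Regular u'" using anti2 r by simp
  ultimately show ?thesis using reg r by blast
 qed
 show ?ex "u : regs D" "u' : regs D" "u ~= r" "u' ~= r" ?corners using * by blast+
qed

lemma state_total_loop:
 assumes "moy_diagram D" "dl : arcs D" "lreg D dl = rreg D dl"
 shows "state_total D dl = 0" using states_nonempty(2)[OF assms(1,2)] assms(3) by (cases "states D dl = {}") (auto simp: state_total_def)

text \<open>If a map identifies just two points \<open>c\<close> and \<open>c'\<close>, the sets it maps bijectively to the image without two points arise by dropping \<open>c\<close> or \<open>c'\<close>.\<close>

lemma merged_sections:
 assumes cc: "c : U" "c' : U" "c ~= c'" and G: "!!a b. a : U ==> b : U ==> G a = G b \<longleftrightarrow> a = b \<or> a = c & b = c' \<or> a = c' & b = c"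
  and l: "l : U" "m : U" "G l ~= G m"
 defines "T \<equiv> U - {l, m}"
 shows "{S. S \<subseteq> U & inj_on G S & G ` S = G ` U - {G l, G m}} = (%v. T - {v}) ` ({c, c'} Int T)"
proof (intro equalityI subsetI)
 fix S assume "S : {S. S \<subseteq> U & inj_on G S & G ` S = G ` U - {G l, G m}}"
 hence S: "S \<subseteq> U" "inj_on G S" "G ` S = G ` U - {G l, G m}" by auto
 have ST: "S \<subseteq> T" using S by (auto simp: T_def)
 have in_S: "a : S" if "a : T" "a ~= c" "a ~= c'" for a
 proof -
  have a: "a : U" "a ~= l" "a ~= m" using that by (auto simp: T_def)
  have "G a ~= G l" "G a ~= G m" using G[OF a(1) l(1)] G[OF a(1) l(2)] that a by auto
  hence "G a : G ` S" using S(3) a by auto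
  then obtain b where b: "b : S" "G b = G a" by auto
  hence "b = a" using G[of b a] S(1) a that by auto
  thus ?thesis using b by simp
 qed
 have not_both: "~ (c : S & c' : S)" using inj_onD[OF S(2), of c c'] G[OF cc(1,2)] cc(3) by auto
 have Gc: "G c = G c'" using G[OF cc(1,2)] by simp
 have lm: "~ (l = c & m = c')" "~ (l = c' & m = c)" using l(3) Gc by auto
 have lm': "l ~= m" using l(3) by auto
 have one: "c : S \<or> c' : S" if "c : T" "c' : T"
 proof -
  have "G c ~= G l" "G c ~= G m" using that G[OF cc(1) l(1)] G[OF cc(1) l(2)] by (auto simp: T_def)
  hence "G c : G ` S" using S(3) cc by auto
  then obtain b where b: "b : S" "G b = G c" by auto
  hence "b = c \<or> b = c'" using G[of b c] S(1) cc by auto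
  thus ?thesis using b by auto
 qed
 have only: "v ~: S" if "{v, v'} = {c, c'}" "v' ~: T" for v v'
 proof
  assume v: "v : S"
  have "v' = l \<or> v' = m" using that cc by (auto simp: T_def doubleton_eq_iff)
  moreover have "G v = G v'" using that Gc by (auto simp: doubleton_eq_iff)
  ultimately show False using v S(3) by auto
 qed
 consider "c : T" "c' : T" "c : S" | "c : T" "c' : T" "c' : S" "c ~: S" | "c : T" "c' ~: T" | "c ~: T" "c' : T" | "c ~: T" "c' ~: T"
 using one by blast
 thus "S : (%v. T - {v}) ` ({c, c'} Int T)"
 proof cases
  case 1
  hence "S = T - {c'}" using ST in_S not_both by blast
  thus ?thesis using 1 by blast
 next
  case 2
  hence "S = T - {c}" using ST in_S by blast
  thus ?thesis using 2 by blast
 next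
  case 3
  hence "S = T - {c}" using ST in_S only[of c c'] by blast
  thus ?thesis using 3 by blast
 next
  case 4
  hence "S = T - {c'}" using ST in_S only[of c' c] by blast
  thus ?thesis using 4 by blast
 next
  case 5
  thus ?thesis using cc lm lm' by (auto simp: T_def)
 qed
next
 fix S assume "S : (%v. T - {v}) ` ({c, c'} Int T)"
 then obtain v where v: "v : {c, c'}" "v : T" "S = T - {v}" by auto
 have SU: "S \<subseteq> U" using v by (auto simp: T_def)
 have "inj_on G S"
 proof (rule inj_onI)
  fix a b assume "a : S" "b : S" "G a = G b"
  thus "a = b" using G[of a b] SU v by auto
 qed
 moreover have "G ` S = G ` U - {G l, G m}"
 proof (intro equalityI subsetI)
  fix y assume "y : G ` S"
  then obtain a where a: "a : S" "y = G a" by auto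
  have "G a ~= G l" "G a ~= G m" using G[of a l] G[of a m] a l v SU by (auto simp: T_def)
  thus "y : G ` U - {G l, G m}" using a SU by auto
 next
  fix y assume "y : G ` U - {G l, G m}"
  then obtain a where a: "a : U" "y = G a" "G a ~= G l" "G a ~= G m" by auto
  show "y : G ` S"
 proof (cases "a = v")
  case True
  obtain v' where v': "{v, v'} = {c, c'}" "v' ~= v" using v(1) cc(3) by blast
  have "v' : U" using v'(1) cc by (auto simp: doubleton_eq_iff)
  moreover have e: "G v' = G v" using G[OF \<open>v' : U\<close> a(1)] v' True by (auto simp: doubleton_eq_iff)
  ultimately have "v' : S" using a v' True v by (auto simp: T_def)
  moreover have "y = G v'" using e a True by simp
  ultimately show ?thesis by (rule rev_image_eqI)
 next
  case False
  hence "a : S" using a v by (auto simp: T_def)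
  thus ?thesis using a by auto
 qed
 qed
 ultimately show "S : {S. S \<subseteq> U & inj_on G S & G ` S = G ` U - {G l, G m}}" using SU by simp
qed

text \<open>If the opposite regions \<open>u\<close>, \<open>u'\<close> differ, a state of the simpler diagram uses their union, and it lifts by leaving out \<open>u\<close> or \<open>u'\<close>. If they coincide, the strands are pulled apart into different components and the second diagram has no states. In the first diagram a partial state would extend in two ways that exchange two regions without the sign change that \<open>no_swap\<close> demands.\<close>

lemma same_bracket_move2:
 assumes D: "moy_diagram D" "moy_diagram D'" and m: "move2 D D'" and ne: "verts D ~= {}"
 shows "same_bracket D D'"
proof -
 obtain x y p q r aa' bb' u u' f g h k where big: "bigon D x y p q r aa' bb' (u, u')"
  and agree: "agree_outside D \<lparr>idpts = {x, y}, iarcs = {p, q}, iregs = {r}\<rparr> D' nothing {} f g h k"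
  and g: "identifies g (regs D - {r}) {(u, u')}" using m unfolding move2_def by (metis surj_pair)
 let ?I = "\<lparr>idpts = {x, y}, iarcs = {p, q}, iregs = {r}\<rparr>"
 have xy: "x : dpts D" "y : dpts D" "x ~= y" using big by (auto simp: bigon_def)
 obtain sp sq where bd: "bounded_by D r {(p, sp), (q, sq)}" using big unfolding bigon_def by blast
 note bs = bounded_side[OF bd]
 have slots: "p : {sw D x, se D x, sw D y, se D y}" "q : {sw D x, se D x, sw D y, se D y}"
  "p : {nw D x, ne D x, nw D y, ne D y}" "q : {nw D x, ne D x, nw D y, ne D y}" using big by (auto simp: bigon_def)
 interpret replacement D D' ?I nothing "{}" f g h k
 proof unfold_locales
  show "agree_outside D ?I D' nothing {} f g h k" by (rule agree)
  fix a assume "a : iarcs ?I"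
  hence "a : {sw D x, se D x, sw D y, se D y}" "a : {nw D x, ne D x, nw D y, ne D y}" using slots by auto
  thus "EX s:in_slots D. in_arc D s = a & inner_slot ?I {} s" "EX s:out_slots D. out_arc D s = a & inner_slot ?I {} s"
 using local_inI(1)[OF xy(1), of ?I a "{}"] local_inI(1)[OF xy(2), of ?I a "{}"]
  local_outI(1)[OF xy(1), of ?I a "{}"] local_outI(1)[OF xy(2), of ?I a "{}"] by auto
 next
  show "lreg D a ~: iregs ?I & rreg D a ~: iregs ?I" if "a : arcs D" "a ~: iarcs ?I" for a using bs[OF that(1)] that by auto
 qed (use D xy bounded_in_regs[OF bd] in \<open>auto simp: nothing_def\<close>)
 obtain dl where d: "dl : arcs D - iarcs ?I" "color D dl ~= 0" using colored_outside by (auto simp: nothing_def)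
 have inner: "inner_cr D ?I {} = {Dbl x, Dbl y}" "inner_cr D' nothing (k ` {}) = {}" by (auto simp: inner_cr_def nothing_def)
 note rows = bigon_rows[OF D(1) big]
 define U where "U = Re D - {Regular r}"
 define l m where "l = Regular (lreg D dl)" and "m = Regular (rreg D dl)"
 define T where "T = U - {l, m}"
 define Q where "Q = (PROD C:outer_cr. zrow D C)"
 have e1: "extracts (Regular ` iregs ?I Un Disc ` {}) (PROD C:inner_cr D ?I {}. zrow D C) (zreg u + zreg u')" unfolding inner using rows(1) xy by simp
 have e2: "extracts (Regular ` iregs nothing Un Disc ` k ` {}) (PROD C:inner_cr D' nothing (k ` {}). zrow D' C) 1"
 unfolding inner by (simp add: nothing_def extracts_empty)
 have t1: "state_total D dl = zcoef ((zreg u + zreg u') * Q) T"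
 using total_outside[OF _ d(1) e1] by (simp add: outer_prod_def Q_def T_def U_def l_def m_def)
 have t2: "state_total D' (f dl) = zcoef (push U rmap Q) (rmap ` U - {rmap l, rmap m})"
 using total_image[OF _ d(1) e2] by (simp add: outer_prod_def Q_def U_def l_def m_def)
 have finU: "finite U" using finite_Re[OF D(1)] by (simp add: U_def)
 have dd: "dl : arcs D" "f dl : arcs D'" using d agreeD(5) by (auto simp: nothing_def)
 have lm: "l : U" "m : U" using arc_sides[OF d(1)] by (auto simp: U_def l_def m_def Re_def)
 have uU: "Regular u : U" "Regular u' : U" using rows by (auto simp: U_def Re_def)
 have kinj: "inj_on k (verts D)" using agreeD(3) by (simp add: bij_betw_def)
 have G: "rmap a = rmap b \<longleftrightarrow> a = b \<or> a = Regular u & b = Regular u' \<or> a = Regular u' & b = Regular u"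
  if ab: "a : U" "b : U" for a b using ab identifies_pair[OF g] inj_on_eq_iff[OF kinj] by (cases a; cases b) (auto simp: U_def Re_def)
 have "state_total D dl = state_total D' (f dl)"
 proof (cases "l = m \<or> rmap l = rmap m")
  case True
  have z2: "state_total D' (f dl) = 0"
 by (rule state_total_loop[OF D(2) dd(2)]) (use True agreeD(6)[of dl] d(1) in \<open>auto simp: l_def m_def\<close>)
  have "state_total D dl = 0"
 proof (cases "l = m")
  case True
  thus ?thesis by (intro state_total_loop[OF D(1) dd(1)]) (auto simp: l_def m_def)
 next
  case False
  hence "l = Regular u & m = Regular u' \<or> l = Regular u' & m = Regular u" using G[OF lm] True by auto
  hence "Regular u ~: T" "Regular u' ~: T" by (auto simp: T_def)
  thus ?thesis unfolding t1 by (simp add: distrib_right plus_zeon.rep_eq zcoef_zvar_times)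
 qed
  thus ?thesis using z2 by simp
 next
  case lmne: False
  show ?thesis
 proof (cases "u = u'")
  case False
  have "state_total D' (f dl) = (SUM S | S \<subseteq> U & inj_on rmap S & rmap ` S = rmap ` U - {rmap l, rmap m}. zcoef Q S)"
 unfolding t2 using finU by (subst zcoef_push) auto
  also have "{S. S \<subseteq> U & inj_on rmap S & rmap ` S = rmap ` U - {rmap l, rmap m}} =
  (%v. T - {v}) ` ({Regular u, Regular u'} Int T)" unfolding T_def by (rule merged_sections) (use uU False G lm lmne in auto)
  also have "(SUM S:.... zcoef Q S) = (SUM v:{Regular u, Regular u'} Int T. zcoef Q (T - {v}))" by (subst sum.reindex) (auto simp: inj_on_def)
  also have "... = (SUM v:{Regular u, Regular u'}. zcoef (zvar v * Q) T)" by (rule sum.mono_neutral_cong_left) (auto simp: zcoef_zvar_times)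
  also have "... = state_total D dl" unfolding t1 using False by (simp add: distrib_right plus_zeon.rep_eq)
  finally show ?thesis by simp
 next
  case True
  have lm': "l ~= m" using lmne by simp
  have ginj: "inj_on rmap U" using G True by (auto simp: inj_on_def)
  have fino: "finite outer_cr" using finite_Cr[OF D(1)] Cr_split(1) by auto
  have finc: "finite (corners C)" for C by (cases C) auto
  have Cr: "Cr D = outer_cr Un {Dbl x, Dbl y}" "Dbl x ~: outer_cr" "Dbl y ~: outer_cr" using Cr_split(1,2) unfolding inner by auto
  have ReT: "Re D - {l, m} = insert (Regular r) T" "Regular r ~: T" using bounded_in_regs[OF bd] lm by (auto simp: T_def U_def Re_def)
  have expand: "zcoef Q S = (SUM s:{s : PiE outer_cr corners. bij_betw (%C. corner_region D C (s C)) outer_cr S}.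
  PROD C:outer_cr. weight_M C (s C) * weight_A D C (s C))" for S unfolding Q_def zrow_def by (rule zcoef_prod_linear[OF fino]) (use finc in auto)
  have z2: "state_total D' (f dl) = 0"
 proof -
  have "card outer_cr ~= card T"
 proof -
  have "card (Cr D) = card outer_cr + 2" unfolding Cr(1) using fino Cr xy by (subst card_Un_disjoint) auto
  moreover have "card (Re D - {l, m}) = card T + 1" unfolding ReT(1) using ReT(2) finU by (simp add: T_def)
  moreover have "card (Re D - {l, m}) = card (Re D) - 2" using lm lm' by (subst card_Diff_subset) (auto simp: U_def)
  ultimately show ?thesis using card_Re_Cr[OF D(1)] by linarith
 qed
  hence "zcoef Q T = 0" unfolding expand by (auto intro!: sum.neutral dest: bij_betw_same_card)
  moreover have "rmap ` U - {rmap l, rmap m} = rmap ` T"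
 proof -
  have "rmap ` (U - {l, m}) = rmap ` U - rmap ` {l, m}" using lm by (intro inj_on_image_set_diff[OF ginj]) auto
  thus ?thesis by (simp add: T_def)
 qed
  moreover have "zcoef (push U rmap Q) (rmap ` T) = zcoef Q T" by (rule zcoef_push_inj[OF ginj]) (use finU in \<open>auto simp: T_def\<close>)
  ultimately show ?thesis unfolding t2 by simp
 qed
  have "zcoef Q (T - {Regular u}) = 0" if uT: "Regular u : T"
 proof (rule ccontr)
  assume "zcoef Q (T - {Regular u}) ~= 0"
  hence "{s : PiE outer_cr corners. bij_betw (%C. corner_region D C (s C)) outer_cr (T - {Regular u})} ~= {}"
 unfolding expand by (metis (no_types, lifting) sum.empty)
  then obtain sg where sg: "sg : PiE outer_cr corners" "bij_betw (%C. corner_region D C (sg C)) outer_cr (T - {Regular u})" by auto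
  obtain cx cx' cy cy' where c: "corner_region D (Dbl x) cx = Regular r" "corner_region D (Dbl x) cx' = Regular u"
  "corner_region D (Dbl y) cy = Regular r" "corner_region D (Dbl y) cy' = Regular u'"
  "cx ~= South" "cx' = South \<longleftrightarrow> cy = South" "cy' ~= South" using rows(6) by auto
  define ext where "ext = (%c c' C. if C = Dbl x then c else if C = Dbl y then c' else sg C)"
  have st: "ext c c' : states D dl"
  if cc: "{corner_region D (Dbl x) c, corner_region D (Dbl y) c'} = {Regular r, Regular u}"
  "corner_region D (Dbl x) c ~= corner_region D (Dbl y) c'" for c c'
 proof -
  have "bij_betw (%C. corner_region D C (ext c c' C)) outer_cr (T - {Regular u})"
 using sg(2) Cr by (subst bij_betw_cong[where g = "%C. corner_region D C (sg C)"]) (auto simp: ext_def)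
  moreover have "bij_betw (%C. corner_region D C (ext c c' C)) {Dbl x, Dbl y} {Regular r, Regular u}"
 using cc xy by (auto simp: bij_betw_def ext_def simp del: corner_region.simps)
  ultimately have "bij_betw (%C. corner_region D C (ext c c' C)) (outer_cr Un {Dbl x, Dbl y}) ((T - {Regular u}) Un {Regular r, Regular u})"
 by (rule bij_betw_combine) (use ReT in auto)
  moreover have "(T - {Regular u}) Un {Regular r, Regular u} = Re D - {l, m}" using ReT uT by auto
  ultimately have "bij_betw (%C. corner_region D C (ext c c' C)) (Cr D) (Re D - {l, m})" using Cr by simp
  moreover have "c : corners (Dbl x)" "c' : corners (Dbl y)" by (cases c; simp) (cases c'; simp)
  hence "ext c c' : PiE (Cr D) corners" using sg(1) unfolding Cr(1) by (auto simp: ext_def PiE_def extensional_def Pi_def)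
  ultimately show ?thesis by (simp add: states_def l_def m_def)
 qed
  have ur: "u ~= r" using rows(4) .
  have s1: "ext cx cy' : states D dl" and s2: "ext cx' cy : states D dl" using st[of cx cy'] st[of cx' cy] c True ur by auto
  interpret connected_diagram D using states_nonempty[OF D(1) dd(1)] s1 D(1) ne by unfold_locales auto
  have "lreg D dl ~= rreg D dl" using lm' by (auto simp: l_def m_def)
  from no_swap[OF dd(1) this s1 s2 xy] c True xy
  show False by (auto simp: ext_def split: corner.splits simp del: corner_region.simps)
 qed
  hence "state_total D dl = 0" unfolding t1 distrib_right plus_zeon.rep_eq zcoef_zvar_times using True by auto
  thus ?thesis using z2 by simp
 qed
 qed
 thus ?thesis using same_bracketI[OF d, of 0] by simp
qed

text \<open>The identity behind removing a crossing next to a vertex. Dividing by \<open>P1 * Q1\<close> leaves an identity of polynomials in \<open>P * P\<close> and \<open>Q * Q\<close>, with squares of the variables equal to zero.\<close>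

lemma vertex_twist:
 fixes d w s e :: "'a :: comm_ring_1"
 assumes sq: "d * d = 0" "w * w = 0" "s * s = 0" "e * e = 0" and P: "P * P1 = 1" "Q * Q1 = 1"
 shows "(- (Q1 * Q1) * ((P1 - P) * d + P1 * w) + (Q1 * Q1 * w + (s + e)) * P) * ((Q1 - Q) * d + Q * e)
  + (Q1 * Q1 * w + (s + e)) * ((P1 - P) * d + P1 * w) * Q1
  = ((Q1 - Q) * d + Q1 * w + Q * s) * ((P1 - P) * d + P1 * s + P * e)" (is "?l1 = ?r")
  and "(- (P * P) * ((P1 - P) * d + P1 * w) + (P * P * e + (s + w)) * P) * ((Q1 - Q) * d + Q * e)
  + (P * P * e + (s + w)) * ((P1 - P) * d + P1 * w) * Q1
  = ((Q1 - Q) * d + Q1 * w + Q * s) * ((P1 - P) * d + P1 * s + P * e)" (is "?l2 = ?r")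
proof -
 define p q where "p = P * P" and "q = Q * Q"
 have P': "P = P1 * p" and Q': "Q = Q1 * q" using P by (simp_all add: p_def q_def mult.assoc[symmetric] mult.commute[of P1] mult.commute[of Q1])
 have q1: "Q1 * Q1 * q = 1" using P(2) unfolding q_def by (metis mult.assoc mult.commute mult.left_neutral)
 have sq': "d * (d * z) = 0" "w * (w * z) = 0" "s * (s * z) = 0" "e * (e * z) = 0" for z using sq by (simp_all add: mult.assoc[symmetric])
 define F where "F = ((1 - q) * d + w + q * s) * ((1 - p) * d + s + p * e)"
 have r: "?r = P1 * Q1 * F" unfolding F_def by (subst (1 2) P', subst (1 2) Q') (simp add: algebra_simps)
 have "(- ((1 - p) * d + w) + (w + q * (s + e)) * p) * ((1 - q) * d + q * e) + (w + q * (s + e)) * ((1 - p) * d + w) = q * F"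
 unfolding F_def by (simp add: algebra_simps sq sq')
 moreover have "?l1 = Q1 * Q1 * (P1 * Q1 * ((- ((1 - p) * d + w) + (w + q * (s + e)) * p) * ((1 - q) * d + q * e) + (w + q * (s + e)) * ((1 - p) * d + w)))"
 proof -
  have se: "s + e = Q1 * Q1 * (q * (s + e))" using q1 by (simp add: mult.assoc[symmetric])
  have x: "Q1 * Q1 * w + (s + e) = Q1 * Q1 * (w + q * (s + e))" by (subst se) (simp add: distrib_left)
  have c: "(P1 - P) * d + P1 * w = P1 * ((1 - p) * d + w)" "(Q1 - Q) * d + Q * e = Q1 * ((1 - q) * d + q * e)"
 by (subst P', simp add: algebra_simps) (subst (1 2) Q', simp add: algebra_simps)
  show ?thesis unfolding x c by (subst P') (simp add: algebra_simps)
 qed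
 ultimately have "?l1 = (Q1 * Q1 * q) * (P1 * Q1 * F)" by (simp add: mult_ac)
 thus "?l1 = ?r" unfolding r q1 by simp
 have "(- p * ((1 - p) * d + w) + (p * e + (s + w)) * p) * ((1 - q) * d + q * e) + (p * e + (s + w)) * ((1 - p) * d + w) = F"
 unfolding F_def by (simp add: algebra_simps sq sq')
 moreover have "?l2 = P1 * Q1 * ((- p * ((1 - p) * d + w) + (p * e + (s + w)) * p) * ((1 - q) * d + q * e) + (p * e + (s + w)) * ((1 - p) * d + w))"
 proof -
  have c: "(P1 - P) * d + P1 * w = P1 * ((1 - p) * d + w)" "(Q1 - Q) * d + Q * e = Q1 * ((1 - q) * d + q * e)"
 by (subst P', simp add: algebra_simps) (subst (1 2) Q', simp add: algebra_simps)
  have "?l2 = (- p * ((P1 - P) * d + P1 * w) + (p * e + (s + w)) * P) * ((Q1 - Q) * d + Q * e)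
  + (p * e + (s + w)) * ((P1 - P) * d + P1 * w) * Q1" by (simp add: p_def)
  also have "... = P1 * Q1 * ((- p * ((1 - p) * d + w) + (p * e + (s + w)) * p) * ((1 - q) * d + q * e) + (p * e + (s + w)) * ((1 - p) * d + w))"
 unfolding c by (subst P') (simp add: algebra_simps)
  finally show ?thesis .
 qed
 ultimately show "?l2 = ?r" unfolding r by simp
qed

lemma free_circ_row:
 assumes "lreg D a ~= r" "rreg D a ~= r"
 shows "free {Regular r} (circ_row D v a)" unfolding circ_row_def Let_def using assms by (intro free_intros) auto

lemma zc_powi_pair: "zc (thalf powi i) * zc (thalf powi (- i)) = 1" by (simp add: zc_hom(6)[symmetric] zc_hom(2) thalf_powi_add[symmetric])

lemma same_bracket_move5:
 assumes D: "moy_diagram D" "moy_diagram D'" and m: "move5 D D'"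
 shows "same_bracket D D'"
proof -
 obtain x v p q r as bs f g h k where x: "x : dpts D" and v: "v : verts D"
  and bd: "bounded_by D r {(p, R), (q, L)}" and cases:
  "nw D x = p & ne D x = q & ins D v = as @ [p, q] @ bs \<and>
  ins D' (k v) = map f (as @ [sw D x, se D x] @ bs) & outs D' (k v) = map f (outs D v) \<or>
  sw D x = p & se D x = q & outs D v = as @ [p, q] @ bs \<and>
  outs D' (k v) = map f (as @ [nw D x, ne D x] @ bs) & ins D' (k v) = map f (ins D v)"
  and agree: "agree_outside D \<lparr>idpts = {x}, iarcs = {p, q}, iregs = {r}\<rparr> D' nothing {v} f g h k"
  and g: "inj_on g (regs D - {r})" using m identifies_inj unfolding move5_def by (elim exE conjE) metis
 let ?I = "\<lparr>idpts = {x}, iarcs = {p, q}, iregs = {r}\<rparr>"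
 note ax = slot_arcs(1)[OF D(1) x] and vin = slot_arcs(2)[OF D(1) v] and sides = dpt_sides[OF D(1) x] and neq = slot_neq[OF D(1)]
 note bs = bounded_side[OF bd]
 define j where "j = length as"
 interpret replacement D D' ?I nothing "{v}" f g h k
 proof unfold_locales
  show "agree_outside D ?I D' nothing {v} f g h k" by (rule agree)
  fix a assume a: "a : iarcs ?I"
  show "EX s:in_slots D. in_arc D s = a & inner_slot ?I {v} s" using cases
 proof
  assume c: "nw D x = p & ne D x = q & ins D v = as @ [p, q] @ bs \<and>
  ins D' (k v) = map f (as @ [sw D x, se D x] @ bs) & outs D' (k v) = map f (outs D v)"
  hence "a = ins D v ! j \<or> a = ins D v ! Suc j" "Suc j < length (ins D v)" using a by (auto simp: j_def nth_append)
  thus ?thesis using local_inI(2)[OF v, of "{v}" j a ?I] local_inI(2)[OF v, of "{v}" "Suc j" a ?I] by auto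
 next
  assume "sw D x = p & se D x = q & outs D v = as @ [p, q] @ bs \<and>
  outs D' (k v) = map f (as @ [nw D x, ne D x] @ bs) & ins D' (k v) = map f (ins D v)"
  thus ?thesis using a by (intro local_inI(1)[OF x]) auto
 qed
  show "EX s:out_slots D. out_arc D s = a & inner_slot ?I {v} s" using cases
 proof
  assume "nw D x = p & ne D x = q & ins D v = as @ [p, q] @ bs \<and>
  ins D' (k v) = map f (as @ [sw D x, se D x] @ bs) & outs D' (k v) = map f (outs D v)"
  thus ?thesis using a by (intro local_outI(1)[OF x]) auto
 next
  assume c: "sw D x = p & se D x = q & outs D v = as @ [p, q] @ bs \<and>
  outs D' (k v) = map f (as @ [nw D x, ne D x] @ bs) & ins D' (k v) = map f (ins D v)"
  hence "a = outs D v ! j \<or> a = outs D v ! Suc j" "Suc j < length (outs D v)" using a by (auto simp: j_def nth_append)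
  thus ?thesis using local_outI(2)[OF v, of "{v}" j a ?I] local_outI(2)[OF v, of "{v}" "Suc j" a ?I] by auto
 qed
 next
  show "lreg D a ~: iregs ?I & rreg D a ~: iregs ?I" if "a : arcs D" "a ~: iarcs ?I" for a using bs[OF that(1)] that by auto
 qed (use D x v bounded_in_regs[OF bd] in \<open>auto simp: nothing_def\<close>)
 obtain dl where d: "dl : arcs D - iarcs ?I" "color D dl ~= 0" using colored_outside by (auto simp: nothing_def)
 define n where "n = length (ins D v)"
 have n': "length (ins D' (k v)) = n" using cases by (auto simp: n_def)
 define U where "U = Re D - (Regular ` iregs ?I Un Disc ` {})"
 have finU: "finite U" using finite_Re[OF D(1)] by (simp add: U_def)
 have inner: "(PROD C:inner_cr D ?I {v}. zrow D C) = zrow D (Dbl x) * (PROD i<n. circ_row D v (ins D v ! i))"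
  "(PROD C:inner_cr D' nothing (k ` {v}). zrow D' C) = (PROD i<n. zrow D' (Circ (k v) i))"
 using inner_prod[of ?I D v] inner_prod[of nothing D' "k v"] n' by (simp_all add: n_def nothing_def zrow_Circ)
 have push: "zrow D' (Circ (k v) i) = push U rmap (circ_row D v a)" if "a : arcs D - iarcs ?I" "ins D' (k v) ! i = f a" for a i
 unfolding U_def by (rule circ_push) (use v that in auto)
 have row_sides: "lreg D a ~= r" "rreg D a ~= r" if "a : arcs D" "a ~= p" "a ~= q" for a using bs that by auto
 have "EX E. extracts {Regular r} (zrow D (Dbl x) * (PROD i<n. circ_row D v (ins D v ! i))) E \<and>
  push U rmap E = (PROD i<n. zrow D' (Circ (k v) i))" using cases
 proof
  assume c: "sw D x = p & se D x = q & outs D v = as @ [p, q] @ bs \<and>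
  outs D' (k v) = map f (as @ [nw D x, ne D x] @ bs) & ins D' (k v) = map f (ins D v)"
  have ins: "ins D v ! i : arcs D" "ins D v ! i ~= p" "ins D v ! i ~= q" if "i < n" for i using vin neq(9)[OF x v] that c by (auto simp: n_def)
  have r: "rreg D p = r" "lreg D p ~= r" "rreg D q ~= r" "rreg D (nw D x) ~= r"
 proof -
  have pq: "p ~= q" using neq(5)[OF x x] c by auto
  show "rreg D p = r" using bs(2)[of p] ax c by auto
  show "lreg D p ~= r" "rreg D q ~= r" using bs ax c pq by auto
  show "rreg D (nw D x) ~= r"
 proof
  assume a: "rreg D (nw D x) = r"
  hence "nw D x = p" "lreg D (ne D x) = r" using bs ax sides by auto
  hence "nw D x = p" "ne D x = q" using bs ax by auto
  moreover have "Suc j < length (outs D v)" "outs D v ! j = p" using c by (auto simp: j_def nth_append)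
  ultimately show False using neq(10)[OF x v, of j] by auto
 qed
 qed
  define B where "B = zrow D (Dbl x) - zreg r"
  have "B = (if positive D x then zc (thalf powi (- 2 * int (color D p))) * (zreg (lreg D p) - zreg (rreg D (nw D x))) + zreg (rreg D q)
  else zc (thalf powi (2 * int (color D q))) * (zreg (rreg D q) - zreg (rreg D (nw D x))) + zreg (lreg D p))"
 unfolding B_def using r c by (simp add: zrow_positive zrow_negative)
  hence B: "free {Regular r} B" using r by (auto intro!: free_intros)
  have "extracts {Regular r} (zrow D (Dbl x)) 1" using extracts_var[OF B, of 1] by (simp add: B_def)
  hence "extracts {Regular r} (zrow D (Dbl x) * (PROD i<n. circ_row D v (ins D v ! i))) (1 * (PROD i<n. circ_row D v (ins D v ! i)))"
 by (rule extracts_mult) (intro free_prod free_circ_row row_sides, use ins in auto)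
  moreover have "push U rmap (1 * (PROD i<n. circ_row D v (ins D v ! i))) = (PROD i<n. zrow D' (Circ (k v) i))" unfolding mult_1 push_prod[OF finU]
 by (intro prod.cong refl push[symmetric]) (use ins c in \<open>auto simp: n_def\<close>)
  ultimately show ?thesis by blast
 next
  assume c: "nw D x = p & ne D x = q & ins D v = as @ [p, q] @ bs \<and>
  ins D' (k v) = map f (as @ [sw D x, se D x] @ bs) & outs D' (k v) = map f (outs D v)"
  have jn: "Suc j < n" "j < n" and jp: "ins D v ! j = p" "ins D v ! Suc j = q" using c by (auto simp: j_def n_def nth_append)
  have jp': "ins D' (k v) ! j = f (sw D x)" "ins D' (k v) ! Suc j = f (se D x)" using c by (auto simp: j_def nth_append)
  have pq: "p ~= q" using neq(7)[OF x x] c by auto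
  have swp: "sw D x ~= p" "sw D x ~= q" "se D x ~= p" "se D x ~= q" using neq(9)[OF x v, of j] neq(9)[OF x v, of "Suc j"] jn jp by (auto simp: n_def)
  let ?J = "{..<n} - {j, Suc j}"
  have ins: "ins D v ! i : arcs D" "ins D v ! i ~= p" "ins D v ! i ~= q" "ins D' (k v) ! i = f (ins D v ! i)" if "i : ?J" for i
 proof -
  show "ins D v ! i : arcs D" using vin that by (auto simp: n_def)
  show "ins D v ! i ~= p" "ins D v ! i ~= q" using neq(11)[OF v, of i j] neq(11)[OF v, of i "Suc j"] jn jp that by (auto simp: n_def)
  have l: "length (as @ [p, q] @ bs) = length (as @ [sw D x, se D x] @ bs)" by simp
  have "(as @ [sw D x, se D x] @ bs) ! i = (as @ [p, q] @ bs) ! i" using that by (auto simp: nth_append nth_Cons j_def split: nat.splits)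
  moreover have "ins D' (k v) ! i = f ((as @ [sw D x, se D x] @ bs) ! i)" using c that l by (simp only: n_def) (rule nth_map, auto)
  ultimately show "ins D' (k v) ! i = f (ins D v ! i)" using c by simp
 qed
  define w s e where "w = zreg (lreg D p)" and "s = zreg (rreg D (sw D x))" and "e = zreg (rreg D q)"
  define d where "d = (zvar (Disc v) :: region_poly)"
  define P P1 Q Q1 :: region_poly where "P = zc (thalf powi (int (color D p)))" and "P1 = zc (thalf powi (- int (color D p)))"
  and "Q = zc (thalf powi (int (color D q)))" and "Q1 = zc (thalf powi (- int (color D q)))"
  have PP: "P * P1 = 1" "Q * Q1 = 1" unfolding P_def P1_def Q_def Q1_def by (rule zc_powi_pair)+
  have PQ2: "zc (thalf powi (2 * int (color D p))) = P * P" "zc (thalf powi (- (2 * int (color D q)))) = Q1 * Q1"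
 proof -
  have dbl: "zc (thalf powi (i + i)) = zc (thalf powi i) * zc (thalf powi i)" for i by (simp only: thalf_powi_add zc_hom)
  show "zc (thalf powi (2 * int (color D p))) = P * P" unfolding P_def dbl[symmetric] mult_2 ..
  have "- (2 * int (color D q)) = - int (color D q) + - int (color D q)" by simp
  thus "zc (thalf powi (- (2 * int (color D q)))) = Q1 * Q1" unfolding Q1_def dbl[symmetric] by simp
 qed
  have sq: "d * d = 0" "w * w = 0" "s * s = 0" "e * e = 0" by (simp_all add: d_def w_def s_def e_def zvar_square)
  have r: "rreg D p = r" "lreg D q = r" "lreg D p ~= r" "rreg D q ~= r" "rreg D (sw D x) ~= r" using bs ax c pq swp by auto
  have colors: "color D (sw D x) = color D q" "color D (se D x) = color D p" using sides c by auto
  have regs': "lreg D (sw D x) = lreg D p" "rreg D (se D x) = rreg D q" "lreg D (se D x) = rreg D (sw D x)" using sides c by auto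
  have fr: "free {Regular r} w" "free {Regular r} s" "free {Regular r} e" "free {Regular r} d"
  "free {Regular r} P" "free {Regular r} P1" "free {Regular r} Q" "free {Regular r} Q1"
 unfolding w_def s_def e_def d_def P_def P1_def Q_def Q1_def using r by (auto intro!: free_intros)
  have Cp: "circ_row D v p = zreg r * P + ((P1 - P) * d + P1 * w)" "circ_row D v q = zreg r * Q1 + ((Q1 - Q) * d + Q * e)"
 using r by (simp_all add: circ_row_def Let_def P_def P1_def Q_def Q1_def w_def e_def d_def zc_hom algebra_simps)
  have Cs: "circ_row D v (sw D x) = (Q1 - Q) * d + Q1 * w + Q * s" "circ_row D v (se D x) = (P1 - P) * d + P1 * s + P * e"
 using colors regs' by (simp_all add: circ_row_def Let_def P_def P1_def Q_def Q1_def w_def e_def s_def d_def zc_hom algebra_simps)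
  define F where "F = circ_row D v (sw D x) * circ_row D v (se D x)"
  have "extracts {Regular r} (zrow D (Dbl x) * circ_row D v p * circ_row D v q) F"
 proof (cases "positive D x")
  case True
  have X: "zrow D (Dbl x) = zreg r * (- (Q1 * Q1)) + (Q1 * Q1 * w + (s + e))"
 using True r regs' colors c by (simp add: zrow_positive PQ2 w_def s_def e_def algebra_simps)
  show ?thesis unfolding F_def Cs Cp X vertex_twist(1)[OF sq PP, symmetric] by (intro extracts_three free_intros fr)
 next
  case False
  have X: "zrow D (Dbl x) = zreg r * (- (P * P)) + (P * P * e + (s + w))"
 using False r regs' colors c by (simp add: zrow_negative PQ2 w_def s_def e_def algebra_simps)
  show ?thesis unfolding F_def Cs Cp X vertex_twist(2)[OF sq PP, symmetric] by (intro extracts_three free_intros fr)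
 qed
  hence "extracts {Regular r} (zrow D (Dbl x) * circ_row D v p * circ_row D v q * (PROD i:?J. circ_row D v (ins D v ! i)))
  (F * (PROD i:?J. circ_row D v (ins D v ! i)))" by (rule extracts_mult) (intro free_prod free_circ_row row_sides, use ins in auto)
  moreover have split: "(PROD i<n. ph i) = ph j * ph (Suc j) * (PROD i:?J. ph i)" for ph :: "nat => region_poly"
 proof -
  have "{..<n} = insert j (insert (Suc j) ?J)" using jn by auto
  hence "(PROD i<n. ph i) = (PROD i:insert j (insert (Suc j) ?J). ph i)" by simp
  thus ?thesis by (simp add: mult.assoc)
 qed
  moreover have "push U rmap (F * (PROD i:?J. circ_row D v (ins D v ! i))) = (PROD i<n. zrow D' (Circ (k v) i))"
 proof -
  have "zrow D' (Circ (k v) j) = push U rmap (circ_row D v (sw D x))" using jp' ax swp by (intro push) auto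
  moreover have "zrow D' (Circ (k v) (Suc j)) = push U rmap (circ_row D v (se D x))" using jp' ax swp by (intro push) auto
  moreover have "(PROD i:?J. zrow D' (Circ (k v) i)) = (PROD i:?J. push U rmap (circ_row D v (ins D v ! i)))"
 by (intro prod.cong refl push) (use ins in auto)
  ultimately show ?thesis unfolding split F_def push_mult[OF finU] push_prod[OF finU] by simp
 qed
  ultimately show ?thesis by (intro exI[of _ "F * (PROD i:?J. circ_row D v (ins D v ! i))"]) (simp add: split jp mult.assoc)
 qed
 then obtain E where E: "extracts {Regular r} (zrow D (Dbl x) * (PROD i<n. circ_row D v (ins D v ! i))) E"
  "push U rmap E = (PROD i<n. zrow D' (Circ (k v) i))" by blast
 have "state_total D dl = 1 * state_total D' (f dl)"
 proof (rule total_transfer[where Y = "{}"])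
  show "extracts (Regular ` iregs ?I Un Disc ` {}) (PROD C:inner_cr D ?I {v}. zrow D C) E" unfolding inner using E(1) by simp
  show "extracts (Regular ` iregs nothing Un Disc ` k ` {}) (PROD C:inner_cr D' nothing (k ` {v}). zrow D' C) (PROD i<n. zrow D' (Circ (k v) i))"
 unfolding inner by (simp add: nothing_def extracts_empty)
  show "push (Re D - (Regular ` iregs ?I Un Disc ` {})) rmap E = zc 1 * (PROD i<n. zrow D' (Circ (k v) i))" using E(2) by (simp add: U_def zc_hom)
 qed (use d g in auto)
 thus ?thesis using same_bracketI[OF d, of 0] by simp
qed

section \<open>The move (III)\<close>

fun other :: "side => side" where
 "other L = R"
| "other R = L"

text \<open>The row of a corner of the triangle, \<open>m\<close> and \<open>z\<close> being the arcs of the upper strand that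
 bound the triangle and do not.  The strand has the triangle on its side \<open>s\<close>, and \<open>m\<close> leaves
 the double point iff \<open>f\<close>.\<close>

fun corner_coef :: "'a :: comm_ring_1 => bool => side => bool => 'a" where
 "corner_coef q f R l = (if f & ~ l then - 1 else 1)"
| "corner_coef q f L l = (if f & l then - q else q)"

fun corner_rest :: "'a :: comm_ring_1 => bool => side => bool => 'a => 'a => 'a => 'a" where
 "corner_rest q True R True F1 F2 Q = q * (Q - F1) + F2"
| "corner_rest q True R False F1 F2 Q = F2 + q * (Q + F1)"
| "corner_rest q True L True F1 F2 Q = q * F2 + Q + F1"
| "corner_rest q True L False F1 F2 Q = Q - F1 + q * F2"
| "corner_rest q False R True F1 F2 Q = q * (F1 - Q) + F2"
| "corner_rest q False R False F1 F2 Q = q * (F1 + Q) - F2"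
| "corner_rest q False L True F1 F2 Q = F1 + Q - q * F2"
| "corner_rest q False L False F1 F2 Q = F1 - Q + q * F2"

definition triangle_sum where
 "triangle_sum q1 q2 s1 s2 o1 o2 l12 l13 l23 F1 F2 F3 Q12 Q13 Q23 =
  (corner_coef q1 o1 s1 l12 * corner_rest q1 (~ o1) s1 l13 F1 F3 Q13
  + corner_rest q1 o1 s1 l12 F1 F2 Q12 * corner_coef q1 (~ o1) s1 l13) * corner_rest q2 (~ o2) s2 l23 F2 F3 Q23
  + corner_rest q1 o1 s1 l12 F1 F2 Q12 * corner_rest q1 (~ o1) s1 l13 F1 F3 Q13 * corner_coef q2 (~ o2) s2 l23"

text \<open>The triangle before and after the move meets the same six outer regions, those adjacent to a side and those opposite to a corner exchanging their roles.\<close>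

lemma triangle_sum_turn:
 fixes F1 F2 F3 Q12 Q13 Q23 q1 q2 :: "'a :: comm_ring_1"
 assumes sq: "F1 * F1 = 0" "F2 * F2 = 0" "F3 * F3 = 0" "Q12 * Q12 = 0" "Q13 * Q13 = 0" "Q23 * Q23 = 0"
  and s: "s1 = (if l12 = o2 then L else R)" "s1 = (if l13 = o3 then L else R)"
  "s2 = (if l12 = o1 then R else L)" "s2 = (if l23 = o3 then R else L)"
 shows "triangle_sum q1 q2 s1 s2 o1 o2 l12 l13 l23 F1 F2 F3 Q12 Q13 Q23 =
  triangle_sum q1 q2 (other s1) (other s2) (~ o1) (~ o2) l12 l13 l23 Q23 Q13 Q12 F3 F2 F1"
proof -
 have sq': "F1 * (F1 * z) = 0" "F2 * (F2 * z) = 0" "F3 * (F3 * z) = 0" "Q12 * (Q12 * z) = 0" "Q13 * (Q13 * z) = 0"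
  "Q23 * (Q23 * z) = 0" for z using sq by (simp_all add: mult.assoc[symmetric])
 show ?thesis using s unfolding triangle_sum_def
 by (cases o1; cases o2; cases o3; cases l12; cases l13; cases l23) (simp_all add: algebra_simps sq sq')
qed

text \<open>The triangle is a disc, so it occupies exactly one corner at each of its double points. This forces its side on both strands and rules out inconsistent data.\<close>

lemma corner_sides:
 assumes D: "moy_diagram D" "x : dpts D"
  and p: "passes D x l (if f then z else m) (if f then m else z)"
  "passes D x (~ l) (if f' then z' else m') (if f' then m' else z')"
  and nz: "lreg D z ~= r" "rreg D z ~= r" "lreg D z' ~= r" "rreg D z' ~= r"
  and m: "side_reg D s m = r" "side_reg D (other s) m ~= r" "side_reg D s' m' = r" "side_reg D (other s') m' ~= r"
 shows "s = (if l = f' then L else R)" "s' = (if l = f then R else L)"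
  "side_reg D s z = side_reg D (other s') m'" "side_reg D s' z' = side_reg D (other s) m"
  "side_reg D (other s) z = side_reg D (other s') z'"
proof -
 note sides = dpt_sides[OF D]
 have "s = (if l = f' then L else R) & s' = (if l = f then R else L) \<and>
  side_reg D s z = side_reg D (other s') m' & side_reg D s' z' = side_reg D (other s) m \<and>
  side_reg D (other s) z = side_reg D (other s') z'"
 proof (cases l)
  case True
  hence p': "sw D x = (if f then z else m)" "ne D x = (if f then m else z)"
  "se D x = (if f' then z' else m')" "nw D x = (if f' then m' else z')" using p by (auto simp: passes_def)
  have q: "lreg D (if f then z else m) = lreg D (if f' then m' else z')" "rreg D (if f then z else m) = lreg D (if f' then z' else m')"
  "rreg D (if f' then m' else z') = lreg D (if f then m else z)" "rreg D (if f' then z' else m') = rreg D (if f then m else z)"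
 using sides(3-6) unfolding p' by blast+
  show ?thesis using q nz m True by (cases f; cases f'; cases s; cases s') simp_all
 next
  case False
  hence p': "se D x = (if f then z else m)" "nw D x = (if f then m else z)"
  "sw D x = (if f' then z' else m')" "ne D x = (if f' then m' else z')" using p by (auto simp: passes_def)
  have q: "lreg D (if f' then z' else m') = lreg D (if f then m else z)" "rreg D (if f' then z' else m') = lreg D (if f then z else m)"
  "rreg D (if f then m else z) = lreg D (if f' then m' else z')" "rreg D (if f then z else m) = rreg D (if f' then m' else z')"
 using sides(3-6) unfolding p' by blast+
  show ?thesis using q nz m False by (cases f; cases f'; cases s; cases s') simp_all
 qed
 thus "s = (if l = f' then L else R)" "s' = (if l = f then R else L)"
  "side_reg D s z = side_reg D (other s') m'" "side_reg D s' z' = side_reg D (other s) m"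
  "side_reg D (other s) z = side_reg D (other s') z'" by blast+
qed

lemma corner_row:
 assumes D: "moy_diagram D" "x : dpts D" and pos: "positive D x = l"
  and p: "passes D x l (if f then z else m) (if f then m else z)"
  and r: "side_reg D s m = r"
 shows "zrow D (Dbl x) = zc (thalf powi (if l then 0 else 2 * int (color D m))) *
  (zreg r * corner_coef (zc (thalf powi (- (2 * int (color D m))))) f s l
  + corner_rest (zc (thalf powi (- (2 * int (color D m))))) f s l
  (zreg (side_reg D (other s) m)) (zreg (side_reg D s z)) (zreg (side_reg D (other s) z)))"
  and "color D z = color D m"
proof -
 note sides = dpt_sides[OF D]
 show "color D z = color D m" using sides(1,2) p unfolding passes_def by (cases l; cases f) auto
 define Q Q' :: region_poly where "Q = zc (thalf powi (2 * int (color D m)))" and "Q' = zc (thalf powi (- (2 * int (color D m))))"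
 have QQ: "Q * (Q' * y) = y" for y :: region_poly unfolding Q_def Q'_def by (rule zc_powi_cancel)
 have row: "zrow D (Dbl x) = (if l then Q' * (zreg (lreg D (sw D x)) - zreg (rreg D (nw D x))) + zreg (rreg D (sw D x)) + zreg (rreg D (se D x))
  else Q * (zreg (rreg D (se D x)) - zreg (rreg D (nw D x)) + Q' * (zreg (rreg D (sw D x)) + zreg (lreg D (sw D x)))))"
 proof (cases l)
  case True
  hence "color D (sw D x) = color D m" using sides(1,2) p unfolding passes_def by (cases f) auto
  thus ?thesis using True pos by (simp add: zrow_positive Q'_def)
 next
  case False
  hence "color D (se D x) = color D m" using sides(1,2) p unfolding passes_def by (cases f) auto
  hence "zrow D (Dbl x) = Q * (zreg (rreg D (se D x)) - zreg (rreg D (nw D x))) + (zreg (rreg D (sw D x)) + zreg (lreg D (sw D x)))"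
 using False pos by (simp add: zrow_negative Q_def add.assoc)
  thus ?thesis using False by (simp only: distrib_left[of Q] QQ) simp
 qed
 have kap: "zc (thalf powi (if l then 0 else 2 * int (color D m))) = (if l then 1 else Q)" by (simp add: Q_def zc_hom)
 show "zrow D (Dbl x) = zc (thalf powi (if l then 0 else 2 * int (color D m))) *
  (zreg r * corner_coef (zc (thalf powi (- (2 * int (color D m))))) f s l
  + corner_rest (zc (thalf powi (- (2 * int (color D m))))) f s l
  (zreg (side_reg D (other s) m)) (zreg (side_reg D s z)) (zreg (side_reg D (other s) z)))" unfolding row kap Q'_def[symmetric]
 using sides p r unfolding passes_def by (cases l; cases f; cases s) (auto simp: algebra_simps)
qed

lemma passes_neq:
 assumes "moy_diagram D" "x : dpts D" "y : dpts D" "passes D x l a b" "passes D y l' a' b'" "x ~= y \<or> l ~= l'"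
 shows "a ~= a'" "b ~= b'"
proof -
 note n = slot_neq[OF assms(1)]
 have "a ~= a' & b ~= b'" using assms(4-6) n(1)[OF assms(2,3)] n(2)[OF assms(2,3)] n(3)[OF assms(2,3)] n(4)[OF assms(2,3)]
  n(5)[OF assms(2,3)] n(5)[OF assms(3,2)] n(7)[OF assms(2,3)] n(7)[OF assms(3,2)] unfolding passes_def by (cases l; cases l') auto
 thus "a ~= a'" "b ~= b'" by auto
qed

lemma passes_arcs:
 assumes "moy_diagram D" "x : dpts D" "passes D x l a b"
 shows "a : arcs D" "b : arcs D" using slot_arcs(1)[OF assms(1,2)] assms(3) unfolding passes_def by (cases l; auto)+

lemma passes_color:
 assumes "moy_diagram D" "x : dpts D" "passes D x l a b"
 shows "color D a = color D b" using dpt_sides(1,2)[OF assms(1,2)] assms(3) unfolding passes_def by (cases l) auto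

definition triangle_regions where
 "triangle_regions D s1 s2 s3 l12 l13 l23 o1 o2 o3 a1 a2 a3 m1 m2 m3 b1 b2 b3 \<longleftrightarrow>
  s1 = (if l12 = o2 then L else R) & s1 = (if l13 = o3 then L else R) \<and>
  s2 = (if l12 = o1 then R else L) & s2 = (if l23 = o3 then R else L) \<and>
  s3 = (if l13 = o1 then L else R) \<and>
  side_reg D s1 (if o1 then a1 else b1) = side_reg D (other s2) m2 \<and>
  side_reg D s1 (if o1 then b1 else a1) = side_reg D (other s3) m3 \<and>
  side_reg D s2 (if o2 then a2 else b2) = side_reg D (other s1) m1 \<and>
  side_reg D s2 (if o2 then b2 else a2) = side_reg D (other s3) m3 \<and>
  side_reg D (other s2) (if o2 then a2 else b2) = side_reg D (other s1) (if o1 then a1 else b1)"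

definition triangle_value where
 "triangle_value D s1 s2 s3 l12 l13 l23 o1 o2 a1 a2 m1 m2 m3 b1 b2 =
  zc (thalf powi ((if l12 then 0 else 2 * int (color D a1)) + (if l13 then 0 else 2 * int (color D a1)) +
  (if l23 then 0 else 2 * int (color D a2)))) *
  triangle_sum (zc (thalf powi (- (2 * int (color D a1))))) (zc (thalf powi (- (2 * int (color D a2)))))
  s1 s2 o1 o2 l12 l13 l23 (zreg (side_reg D (other s1) m1)) (zreg (side_reg D (other s2) m2)) (zreg (side_reg D (other s3) m3))
  (zreg (side_reg D (other s1) (if o1 then a1 else b1))) (zreg (side_reg D (other s1) (if o1 then b1 else a1)))
  (zreg (side_reg D (other s2) (if o2 then b2 else a2)))"

lemma triangle_rows:
 assumes D: "moy_diagram D"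
  and t: "triangle D (x12, x13, x23) (l12, l13, l23) (o1, o2, o3) (a1, a2, a3) (m1, m2, m3) (b1, b2, b3) r"
 shows "EX s1 s2 s3. bounded_by D r {(m1, s1), (m2, s2), (m3, s3)} \<and>
  triangle_regions D s1 s2 s3 l12 l13 l23 o1 o2 o3 a1 a2 a3 m1 m2 m3 b1 b2 b3 \<and>
  extracts {Regular r} (zrow D (Dbl x12) * zrow D (Dbl x13) * zrow D (Dbl x23))
  (triangle_value D s1 s2 s3 l12 l13 l23 o1 o2 a1 a2 m1 m2 m3 b1 b2)" (is ?rows)
  and "color D m1 = color D a1" "color D m2 = color D a2" "color D m3 = color D a3"
  and "distinct [a1, m1, a2, m2, a3, m3]" "distinct [b1, m1, b2, m2, b3, m3]" "{a1, m1, a2, m2, a3, m3, b1, b2, b3} \<subseteq> arcs D"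
proof -
 have x: "x12 : dpts D" "x13 : dpts D" "x23 : dpts D" and xd: "x12 ~= x13" "x12 ~= x23" "x13 ~= x23"
  and pos: "positive D x12 = l12" "positive D x13 = l13" "positive D x23 = l23"
  and ps: "passes2 D o1 x12 l12 x13 l13 a1 m1 b1" "passes2 D o2 x12 (~ l12) x23 l23 a2 m2 b2"
  "passes2 D o3 x13 (~ l13) x23 (~ l23) a3 m3 b3" using t by auto
 obtain s1 s2 s3 where bd: "bounded_by D r {(m1, s1), (m2, s2), (m3, s3)}" using t by auto
 note bs = bounded_side[OF bd]
 have p1: "passes D x12 l12 (if o1 then a1 else m1) (if o1 then m1 else b1)"
  "passes D x13 l13 (if o1 then m1 else a1) (if o1 then b1 else m1)"
  and p2: "passes D x12 (~ l12) (if o2 then a2 else m2) (if o2 then m2 else b2)"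
  "passes D x23 l23 (if o2 then m2 else a2) (if o2 then b2 else m2)"
  and p3: "passes D x13 (~ l13) (if o3 then a3 else m3) (if o3 then m3 else b3)"
  "passes D x23 (~ l23) (if o3 then m3 else a3) (if o3 then b3 else m3)" using ps by (auto simp: passes2_def)
 note n = passes_neq[OF D]
 have d1: "(if o1 then a1 else m1) ~= (if o1 then m1 else a1)" "(if o1 then m1 else b1) ~= (if o1 then b1 else m1)"
 using n[OF x(1,2) p1(1,2)] xd by auto
 have d2: "(if o2 then a2 else m2) ~= (if o2 then m2 else a2)" "(if o2 then m2 else b2) ~= (if o2 then b2 else m2)"
 using n[OF x(1,3) p2(1,2)] xd by auto
 have d3: "(if o3 then a3 else m3) ~= (if o3 then m3 else a3)" "(if o3 then m3 else b3) ~= (if o3 then b3 else m3)"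
 using n[OF x(2,3) p3(1,2)] xd by auto
 have d12: "{a1, m1} Int {a2, m2} = {}" "{b1, m1} Int {b2, m2} = {}"
 using n[OF x(1) x(1) p1(1) p2(1)] n[OF x(1) x(3) p1(1) p2(2)] n[OF x(2) x(1) p1(2) p2(1)] n[OF x(2) x(3) p1(2) p2(2)] xd
 by (cases o1; cases o2; auto)+
 have d13: "{a1, m1} Int {a3, m3} = {}" "{b1, m1} Int {b3, m3} = {}"
 using n[OF x(1) x(2) p1(1) p3(1)] n[OF x(1) x(3) p1(1) p3(2)] n[OF x(2) x(2) p1(2) p3(1)] n[OF x(2) x(3) p1(2) p3(2)] xd
 by (cases o1; cases o3; auto)+
 have d23: "{a2, m2} Int {a3, m3} = {}" "{b2, m2} Int {b3, m3} = {}"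
 using n[OF x(1) x(2) p2(1) p3(1)] n[OF x(1) x(3) p2(1) p3(2)] n[OF x(3) x(2) p2(2) p3(1)] n[OF x(3) x(3) p2(2) p3(2)] xd
 by (cases o2; cases o3; auto)+
 have dd: "a1 ~= m1" "b1 ~= m1" "a2 ~= m2" "b2 ~= m2" "a3 ~= m3" "b3 ~= m3" using d1 d2 d3 by (auto split: if_splits)
 show "distinct [a1, m1, a2, m2, a3, m3]" "distinct [b1, m1, b2, m2, b3, m3]" using dd d12 d13 d23 by auto
 have ain: "a1 : arcs D" "m1 : arcs D" "b1 : arcs D" "a2 : arcs D" "m2 : arcs D" "b2 : arcs D"
  "a3 : arcs D" "m3 : arcs D" "b3 : arcs D" using passes_arcs[OF D x(1) p1(1)] passes_arcs[OF D x(2) p1(2)] passes_arcs[OF D x(1) p2(1)]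
  passes_arcs[OF D x(3) p2(2)] passes_arcs[OF D x(2) p3(1)] passes_arcs[OF D x(3) p3(2)] by (auto split: if_splits)
 thus "{a1, m1, a2, m2, a3, m3, b1, b2, b3} \<subseteq> arcs D" by simp
 have md: "m1 ~= m2" "m1 ~= m3" "m2 ~= m3" using d12 d13 d23 by auto
 have nr: "lreg D z ~= r & rreg D z ~= r" if "z : {a1, a2, a3, b1, b2, b3}" for z
 proof -
  have "z : arcs D" "z ~= m1" "z ~= m2" "z ~= m3" using that ain dd d12 d13 d23 by auto
  thus ?thesis using bs by auto
 qed
 have mr: "side_reg D s1 m1 = r" "side_reg D (other s1) m1 ~= r" using bs[OF ain(2)] md by (cases s1; simp)+
 have mr': "side_reg D s2 m2 = r" "side_reg D (other s2) m2 ~= r" using bs[OF ain(5)] md by (cases s2; simp)+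
 have mr'': "side_reg D s3 m3 = r" "side_reg D (other s3) m3 ~= r" using bs[OF ain(8)] md by (cases s3; simp)+
 note mr = mr mr' mr''
 let ?z1 = "if o1 then a1 else b1" and ?y1 = "if o1 then b1 else a1" and ?z2 = "if o2 then a2 else b2"
  and ?y2 = "if o2 then b2 else a2" and ?z3 = "if o3 then a3 else b3" and ?y3 = "if o3 then b3 else a3"
 have q1: "passes D x12 l12 (if o1 then ?z1 else m1) (if o1 then m1 else ?z1)"
  "passes D x13 l13 (if ~ o1 then ?y1 else m1) (if ~ o1 then m1 else ?y1)"
  and q2: "passes D x12 (~ l12) (if o2 then ?z2 else m2) (if o2 then m2 else ?z2)"
  "passes D x23 l23 (if ~ o2 then ?y2 else m2) (if ~ o2 then m2 else ?y2)"
  and q3: "passes D x13 (~ l13) (if o3 then ?z3 else m3) (if o3 then m3 else ?z3)"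
  "passes D x23 (~ l23) (if ~ o3 then ?y3 else m3) (if ~ o3 then m3 else ?y3)" using p1 p2 p3 by (cases o1; cases o2; cases o3; simp)+
 have nrz: "lreg D ?z1 ~= r" "rreg D ?z1 ~= r" "lreg D ?y1 ~= r" "rreg D ?y1 ~= r" "lreg D ?z2 ~= r" "rreg D ?z2 ~= r"
  "lreg D ?y2 ~= r" "rreg D ?y2 ~= r" "lreg D ?z3 ~= r" "rreg D ?z3 ~= r" "lreg D ?y3 ~= r" "rreg D ?y3 ~= r" using nr by auto
 note c12 = corner_sides[OF D x(1) q1(1) q2(1) nrz(1,2,5,6) mr(1,2,3,4)]
 note c13 = corner_sides[OF D x(2) q1(2) q3(1) nrz(3,4,9,10) mr(1,2,5,6)]
 note c23 = corner_sides[OF D x(3) q2(2) q3(2) nrz(7,8,11,12) mr(3,4,5,6)]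
 note r12 = corner_row[OF D x(1) pos(1) q1(1) mr(1)]
 note r13 = corner_row[OF D x(2) pos(2) q1(2) mr(1)]
 note r23 = corner_row[OF D x(3) pos(3) q2(2) mr(3)]
 have col: "color D m1 = color D a1" "color D m2 = color D a2" "color D m3 = color D a3"
 using passes_color[OF D x(1) p1(1)] passes_color[OF D x(2) p1(2)] passes_color[OF D x(1) p2(1)]
  passes_color[OF D x(3) p2(2)] passes_color[OF D x(2) p3(1)] passes_color[OF D x(3) p3(2)] by (auto split: if_splits)
 thus "color D m1 = color D a1" "color D m2 = color D a2" "color D m3 = color D a3" by auto
 have reg: "triangle_regions D s1 s2 s3 l12 l13 l23 o1 o2 o3 a1 a2 a3 m1 m2 m3 b1 b2 b3" unfolding triangle_regions_def
 using c12 c13 c23 by (auto split: if_splits)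
 define F1 F2 F3 where "F1 = zreg (side_reg D (other s1) m1)" and "F2 = zreg (side_reg D (other s2) m2)"
  and "F3 = zreg (side_reg D (other s3) m3)"
 define Q12 Q13 Q23 where "Q12 = zreg (side_reg D (other s1) ?z1)" and "Q13 = zreg (side_reg D (other s1) ?y1)"
  and "Q23 = zreg (side_reg D (other s2) ?y2)"
 define q1 q2 :: region_poly where "q1 = zc (thalf powi (- (2 * int (color D a1))))"
  and "q2 = zc (thalf powi (- (2 * int (color D a2))))"
 define K :: "bool => nat => int" where "K = (%l c. if l then 0 else 2 * int c)"
 have rows: "zrow D (Dbl x12) = zc (thalf powi K l12 (color D a1)) * (zreg r * corner_coef q1 o1 s1 l12 + corner_rest q1 o1 s1 l12 F1 F2 Q12)"
  "zrow D (Dbl x13) = zc (thalf powi K l13 (color D a1)) * (zreg r * corner_coef q1 (~ o1) s1 l13 + corner_rest q1 (~ o1) s1 l13 F1 F3 Q13)"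
  "zrow D (Dbl x23) = zc (thalf powi K l23 (color D a2)) * (zreg r * corner_coef q2 (~ o2) s2 l23 + corner_rest q2 (~ o2) s2 l23 F2 F3 Q23)"
 using r12(1) r13(1) r23(1) c12(3) c13(3) c23(3) col unfolding K_def q1_def q2_def F1_def F2_def F3_def Q12_def Q13_def Q23_def by simp_all
 have sidene: "side_reg D s z ~= r" if "z : {a1, a2, a3, b1, b2, b3}" for s z using nr[OF that] by (cases s) auto
 have fr: "free {Regular r} F1" "free {Regular r} F2" "free {Regular r} F3" "free {Regular r} Q12" "free {Regular r} Q13"
  "free {Regular r} Q23" "free {Regular r} q1" "free {Regular r} q2"
 unfolding F1_def F2_def F3_def Q12_def Q13_def Q23_def q1_def q2_def using mr sidene by (auto intro!: free_intros)
 have frr: "free {Regular r} (corner_rest q f s l A B C)"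
  if "free {Regular r} q" "free {Regular r} A" "free {Regular r} B" "free {Regular r} C" for q A B C :: region_poly and f s l
 using that by (cases f; cases s; cases l) (auto intro!: free_intros)
 have "extracts {Regular r} ((zreg r * corner_coef q1 o1 s1 l12 + corner_rest q1 o1 s1 l12 F1 F2 Q12) *
  (zreg r * corner_coef q1 (~ o1) s1 l13 + corner_rest q1 (~ o1) s1 l13 F1 F3 Q13) *
  (zreg r * corner_coef q2 (~ o2) s2 l23 + corner_rest q2 (~ o2) s2 l23 F2 F3 Q23))
  (triangle_sum q1 q2 s1 s2 o1 o2 l12 l13 l23 F1 F2 F3 Q12 Q13 Q23)" unfolding triangle_sum_def by (intro extracts_three frr fr)
 hence "extracts {Regular r} (zc (thalf powi (K l12 (color D a1) + K l13 (color D a1) + K l23 (color D a2))) *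
  ((zreg r * corner_coef q1 o1 s1 l12 + corner_rest q1 o1 s1 l12 F1 F2 Q12) *
  (zreg r * corner_coef q1 (~ o1) s1 l13 + corner_rest q1 (~ o1) s1 l13 F1 F3 Q13) *
  (zreg r * corner_coef q2 (~ o2) s2 l23 + corner_rest q2 (~ o2) s2 l23 F2 F3 Q23)))
  (zc (thalf powi (K l12 (color D a1) + K l13 (color D a1) + K l23 (color D a2))) *
  triangle_sum q1 q2 s1 s2 o1 o2 l12 l13 l23 F1 F2 F3 Q12 Q13 Q23)" by (rule extracts_scale)
 also have "zc (thalf powi (K l12 (color D a1) + K l13 (color D a1) + K l23 (color D a2))) *
  ((zreg r * corner_coef q1 o1 s1 l12 + corner_rest q1 o1 s1 l12 F1 F2 Q12) *
  (zreg r * corner_coef q1 (~ o1) s1 l13 + corner_rest q1 (~ o1) s1 l13 F1 F3 Q13) *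
  (zreg r * corner_coef q2 (~ o2) s2 l23 + corner_rest q2 (~ o2) s2 l23 F2 F3 Q23)) =
  zrow D (Dbl x12) * zrow D (Dbl x13) * zrow D (Dbl x23)" unfolding rows thalf_powi_add zc_hom(6) by (simp only: mult_ac)
 finally show ?rows unfolding triangle_value_def K_def q1_def q2_def F1_def F2_def F3_def Q12_def Q13_def Q23_def using bd reg by blast
qed

lemma push_corner_rest:
 assumes "finite U"
 shows "push U g (corner_rest q f s l a b c) = corner_rest (push U g q) f s l (push U g a) (push U g b) (push U g c)"
 by (cases f; cases s; cases l) (simp_all add: push_add push_diff push_mult[OF assms])

lemma push_corner_coef:
 "push U g (corner_coef q f s l) = corner_coef (push U g q) f s l" by (cases f; cases s; cases l) (simp_all add: push_uminus push_one)

lemma same_bracket_move3: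
 assumes D: "moy_diagram D" "moy_diagram D'" and m: "move3 D D'"
 shows "same_bracket D D'"
proof -
 obtain x12 x13 x23 y12 y13 y23 ls o1 o2 o3 a1 a2 a3 b1 b2 b3 m1 m2 m3 n1 n2 n3 r r' f g h k where
  t: "triangle D (x12, x13, x23) ls (o1, o2, o3) (a1, a2, a3) (m1, m2, m3) (b1, b2, b3) r"
  and t': "triangle D' (y12, y13, y23) ls (~ o1, ~ o2, ~ o3) (f a1, f a2, f a3) (n1, n2, n3) (f b1, f b2, f b3) r'"
  and agree: "agree_outside D \<lparr>idpts = {x12, x13, x23}, iarcs = {m1, m2, m3}, iregs = {r}\<rparr>
  D' \<lparr>idpts = {y12, y13, y23}, iarcs = {n1, n2, n3}, iregs = {r'}\<rparr> {} f g h k"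
  and g: "inj_on g (regs D - {r})" using m identifies_inj unfolding move3_def by (elim exE conjE) metis
 obtain l12 l13 l23 where ls: "ls = (l12, l13, l23)" by (metis surj_pair)
 let ?I = "\<lparr>idpts = {x12, x13, x23}, iarcs = {m1, m2, m3}, iregs = {r}\<rparr>"
 let ?I' = "\<lparr>idpts = {y12, y13, y23}, iarcs = {n1, n2, n3}, iregs = {r'}\<rparr>"
 note T = triangle_rows[OF D(1) t[unfolded ls]] and T' = triangle_rows[OF D(2) t'[unfolded ls]]
 obtain s1 s2 s3 where bd: "bounded_by D r {(m1, s1), (m2, s2), (m3, s3)}"
  and reg: "triangle_regions D s1 s2 s3 l12 l13 l23 o1 o2 o3 a1 a2 a3 m1 m2 m3 b1 b2 b3"
  and ex: "extracts {Regular r} (zrow D (Dbl x12) * zrow D (Dbl x13) * zrow D (Dbl x23))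
  (triangle_value D s1 s2 s3 l12 l13 l23 o1 o2 a1 a2 m1 m2 m3 b1 b2)" using T(1) by blast
 obtain s1' s2' s3' where bd': "bounded_by D' r' {(n1, s1'), (n2, s2'), (n3, s3')}"
  and reg': "triangle_regions D' s1' s2' s3' l12 l13 l23 (~ o1) (~ o2) (~ o3) (f a1) (f a2) (f a3) n1 n2 n3 (f b1) (f b2) (f b3)"
  and ex': "extracts {Regular r'} (zrow D' (Dbl y12) * zrow D' (Dbl y13) * zrow D' (Dbl y23))
  (triangle_value D' s1' s2' s3' l12 l13 l23 (~ o1) (~ o2) (f a1) (f a2) n1 n2 n3 (f b1) (f b2))" using T'(1) by blast
 have x: "x12 : dpts D" "x13 : dpts D" "x23 : dpts D" "x12 ~= x13" "x12 ~= x23" "x13 ~= x23" using t by (auto simp: ls)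
 have y: "y12 : dpts D'" "y13 : dpts D'" "y23 : dpts D'" "y12 ~= y13" "y12 ~= y23" "y13 ~= y23" using t' by (auto simp: ls)
 note bs = bounded_side[OF bd]
 have slots: "a : {sw D x12, se D x12, sw D x13, se D x13, sw D x23, se D x23} \<and>
  a : {nw D x12, ne D x12, nw D x13, ne D x13, nw D x23, ne D x23}" if "a : {m1, m2, m3}" for a
 using t that by (auto simp: ls passes2_def passes_def split: if_splits)
 interpret replacement D D' ?I ?I' "{}" f g h k
 proof unfold_locales
  show "agree_outside D ?I D' ?I' {} f g h k" by (rule agree)
  fix a assume "a : iarcs ?I"
  hence a: "a : {m1, m2, m3}" by simp
  show "EX s:in_slots D. in_arc D s = a & inner_slot ?I {} s"
 using slots[OF a] local_inI(1)[OF x(1), of ?I a "{}"] local_inI(1)[OF x(2), of ?I a "{}"] local_inI(1)[OF x(3), of ?I a "{}"] by auto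
  show "EX s:out_slots D. out_arc D s = a & inner_slot ?I {} s"
 using slots[OF a] local_outI(1)[OF x(1), of ?I a "{}"] local_outI(1)[OF x(2), of ?I a "{}"] local_outI(1)[OF x(3), of ?I a "{}"] by auto
 next
  show "lreg D a ~: iregs ?I & rreg D a ~: iregs ?I" if "a : arcs D" "a ~: iarcs ?I" for a using bs[OF that(1)] that by auto
 qed (use D x y bounded_in_regs[OF bd] bounded_in_regs[OF bd'] in auto)
 have outer: "a : arcs D - iarcs ?I" if "a : {a1, a2, a3, b1, b2, b3}" for a using that T(5-7) by auto
 have col: "color D' (f a) = color D a" "side_reg D' s (f a) = g (side_reg D s a)" if "a : {a1, a2, a3, b1, b2, b3}" for a s
 using agreeD(6)[of a] outer[OF that] by (cases s; auto)+
 obtain dl where d: "dl : arcs D - iarcs ?I" "color D dl ~= 0"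
 proof -
  obtain a where a: "a : arcs D" "color D a ~= 0" using D(1) by (auto simp: moy_diagram_def)
  show thesis
 proof (cases "a : {m1, m2, m3}")
  case True
  hence "color D a1 ~= 0 \<or> color D a2 ~= 0 \<or> color D a3 ~= 0" using a(2) T(2-4) by auto
  thus ?thesis
 proof (elim disjE)
  assume "color D a1 ~= 0" thus thesis using that[OF outer[of a1]] by blast
 next
  assume "color D a2 ~= 0" thus thesis using that[OF outer[of a2]] by blast
 next
  assume "color D a3 ~= 0" thus thesis using that[OF outer[of a3]] by blast
 qed
 next
  case False
  thus ?thesis using that[of a] a by simp
 qed
 qed
 have s': "s1' = other s1" "s2' = other s2" "s3' = other s3" using reg reg' unfolding triangle_regions_def by (auto split: if_splits)
 have oo: "other (other s) = s" for s by (cases s) auto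
 define U where "U = Re D - (Regular ` iregs ?I Un Disc ` {})"
 have finU: "finite U" using finite_Re[OF D(1)] by (simp add: U_def)
 have pr: "push U rmap (zreg (side_reg D s a)) = zreg (g (side_reg D s a))" if "a : {a1, a2, a3, b1, b2, b3}" for s a
 unfolding U_def using arc_sides[OF outer[OF that]] by (intro push_reg) (cases s; auto)+
 define F1 F2 F3 Q12 Q13 Q23 where "F1 = side_reg D (other s1) m1" and "F2 = side_reg D (other s2) m2" and "F3 = side_reg D (other s3) m3"
  and "Q12 = side_reg D (other s1) (if o1 then a1 else b1)" and "Q13 = side_reg D (other s1) (if o1 then b1 else a1)"
  and "Q23 = side_reg D (other s2) (if o2 then b2 else a2)"
 have D1: "side_reg D s1 (if o1 then a1 else b1) = F2" "side_reg D s1 (if o1 then b1 else a1) = F3"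
  "side_reg D s2 (if o2 then a2 else b2) = F1" using reg unfolding triangle_regions_def F1_def F2_def F3_def by blast+
 have D2: "side_reg D' s1 n1 = g Q23" "side_reg D' s2 n2 = g Q13" "side_reg D' s3 n3 = g Q12"
 proof -
  have "side_reg D' (other s1) (if ~ o1 then f a1 else f b1) = side_reg D' s2 n2"
  "side_reg D' (other s1) (if ~ o1 then f b1 else f a1) = side_reg D' s3 n3"
  "side_reg D' (other s2) (if ~ o2 then f a2 else f b2) = side_reg D' s1 n1" using reg' unfolding triangle_regions_def s' oo by blast+
  thus "side_reg D' s1 n1 = g Q23" "side_reg D' s2 n2 = g Q13" "side_reg D' s3 n3 = g Q12"
 unfolding Q12_def Q13_def Q23_def using col(2) by (auto split: if_splits)
 qed
 have D3: "side_reg D' s1 (if ~ o1 then f a1 else f b1) = g F3" "side_reg D' s1 (if ~ o1 then f b1 else f a1) = g F2"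
  "side_reg D' s2 (if ~ o2 then f b2 else f a2) = g F1" using D1 col(2) by (auto split: if_splits)
 have pu: "push U rmap (zreg F1) = zreg (g F1)" "push U rmap (zreg F2) = zreg (g F2)" "push U rmap (zreg F3) = zreg (g F3)"
  "push U rmap (zreg Q12) = zreg (g Q12)" "push U rmap (zreg Q13) = zreg (g Q13)" "push U rmap (zreg Q23) = zreg (g Q23)"
 using pr unfolding D1[symmetric] Q12_def Q13_def Q23_def by (auto split: if_splits)
 have inn: "(PROD C:inner_cr D ?I {}. zrow D C) = zrow D (Dbl x12) * zrow D (Dbl x13) * zrow D (Dbl x23)"
  "(PROD C:inner_cr D' ?I' (k ` {}). zrow D' C) = zrow D' (Dbl y12) * zrow D' (Dbl y13) * zrow D' (Dbl y23)"
 using x y by (simp_all add: inner_cr_def mult.assoc)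
 note ex2 = ex[unfolded triangle_value_def, folded F1_def F2_def F3_def Q12_def Q13_def Q23_def]
 have col12: "color D' (f a1) = color D a1" "color D' (f a2) = color D a2" using col(1) by auto
 note ex'2 = ex'[unfolded triangle_value_def s' oo D2 D3 col12]
 have tq: "s1 = (if l12 = o2 then L else R)" "s1 = (if l13 = o3 then L else R)"
  "s2 = (if l12 = o1 then R else L)" "s2 = (if l23 = o3 then R else L)" using reg unfolding triangle_regions_def by blast+
 let ?K = "zc (thalf powi ((if l12 then 0 else 2 * int (color D a1)) + (if l13 then 0 else 2 * int (color D a1)) +
  (if l23 then 0 else 2 * int (color D a2)))) :: region_poly"
 let ?S = "triangle_sum (zc (thalf powi (- (2 * int (color D a1))))) (zc (thalf powi (- (2 * int (color D a2)))))"
 let ?E = "?K * ?S s1 s2 o1 o2 l12 l13 l23 (zreg F1) (zreg F2) (zreg F3) (zreg Q12) (zreg Q13) (zreg Q23)"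
 let ?E' = "?K * ?S (other s1) (other s2) (~ o1) (~ o2) l12 l13 l23 (zreg (g Q23)) (zreg (g Q13)) (zreg (g Q12)) (zreg (g F3)) (zreg (g F2)) (zreg (g F1))"
 have "state_total D dl = 1 * state_total D' (f dl)"
 proof (rule total_transfer[where Y = "{}"])
  show "extracts (Regular ` iregs ?I Un Disc ` {}) (PROD C:inner_cr D ?I {}. zrow D C) ?E"
 using ex2 unfolding inn(1) by (simp only: inside.select_convs image_insert image_empty Un_empty_right)
  show "extracts (Regular ` iregs ?I' Un Disc ` k ` {}) (PROD C:inner_cr D' ?I' (k ` {}). zrow D' C) ?E'"
 using ex'2 unfolding inn(2) by (simp only: inside.select_convs image_insert image_empty Un_empty_right)
  show "push (Re D - (Regular ` iregs ?I Un Disc ` {})) rmap ?E = zc 1 * ?E'"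
 unfolding U_def[symmetric] triangle_sum_turn[OF zvar_square zvar_square zvar_square zvar_square zvar_square zvar_square tq, symmetric]
 unfolding triangle_sum_def push_mult[OF finU] push_add push_zc push_corner_rest[OF finU] push_corner_coef pu zc_hom(2) mult_1 ..
 qed (use d g in auto)
 thus ?thesis using same_bracketI[OF d, of 0] by simp
qed

section \<open>A strand next to a vertex\<close>

text \<open>The coefficient of \<open>d\<close> in the product of the forms \<open>(w l - e l) * d + w l * X l + e l * X (l + 1)\<close>.\<close>

fun vertex_coef :: "(nat => 'a :: comm_ring_1) => (nat => 'a) => (nat => 'a) => nat => 'a" where
 "vertex_coef w e X 0 = 0"
| "vertex_coef w e X (Suc n) = vertex_coef w e X n * (w n * X n + e n * X (Suc n))
  + (w n - e n) * (PROD l<n. w l * X l + e l * X (Suc l))"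

lemma vertex_prod:
 fixes d :: "'a :: comm_ring_1"
 assumes "d * d = 0"
 shows "(PROD l<n. (w l - e l) * d + w l * X l + e l * X (Suc l)) =
  d * vertex_coef w e X n + (PROD l<n. w l * X l + e l * X (Suc l))"
proof (induction n)
 case (Suc n)
 define h where "h = w n * X n + e n * X (Suc n)"
 define H where "H = (PROD l<n. w l * X l + e l * X (Suc l))"
 have "(PROD l<Suc n. (w l - e l) * d + w l * X l + e l * X (Suc l)) =
  (d * vertex_coef w e X n + H) * ((w n - e n) * d + h)" using Suc by (simp add: h_def H_def add.assoc)
 also have "... = (d * d) * (vertex_coef w e X n * (w n - e n)) + d * (vertex_coef w e X n * h + (w n - e n) * H) + H * h"
 by (simp add: algebra_simps)
 finally show ?case using assms by (simp add: h_def H_def)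
qed simp

text \<open>The identities that keep the induction along the vertex going when the strand is the upper one.\<close>

lemma over_invariants:
 fixes X :: "nat => 'a :: comm_ring_1"
 assumes sq: "!!l. X l * X l = 0"
 shows "(PROD l<j. w l * X l + e l * X (Suc l)) = (PROD l<j. X l + X (Suc l)) * (PROD l<j. e l) + vertex_coef w e X j * X 0"
  "(PROD l<j. w l * X l + e l * X (Suc l)) = (PROD l<j. X l + X (Suc l)) * (PROD l<j. w l) - vertex_coef w e X j * X j"
  "(PROD l<j. X l + X (Suc l)) * X j = (PROD l<j. X l + X (Suc l)) * X 0"
proof (induction j)
 case 0
 { case 1 show ?case by simp next case 2 show ?case by simp next case 3 show ?case by simp }
next
 case (Suc j)
 define H N G ph ps where "H = (PROD l<j. w l * X l + e l * X (Suc l))" and "N = (PROD l<j. X l + X (Suc l))"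
  and "G = vertex_coef w e X j" and "ph = (PROD l<j. e l)" and "ps = (PROD l<j. w l)"
 define W E' B0 B B' where "W = w j" and "E' = e j" and "B0 = X 0" and "B = X j" and "B' = X (Suc j)"
 have I: "H = N * ph + G * B0" "H = N * ps - G * B" "N * B = N * B0" using Suc unfolding H_def N_def G_def ph_def ps_def B0_def B_def by simp_all
 have s: "B0 * B0 = 0" "B * B = 0" "B' * B' = 0" using sq by (simp_all add: B0_def B_def B'_def)
 have HB0: "H * B0 = N * ph * B0" unfolding I(1) using s(1) by (simp add: distrib_right mult.assoc)
 have HB': "H * B' = N * ps * B' - G * B * B'" unfolding I(2) by (simp add: left_diff_distrib)
 { case 1
  have "H * (W * B + E' * B') = (N * (B + B')) * (ph * E') + (G * (W * B + E' * B') + (W - E') * H) * B0"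
 proof -
  have "H * (W * B + E' * B') - ((N * (B + B')) * (ph * E') + (G * (W * B + E' * B') + (W - E') * H) * B0) =
  H * (W * B + E' * B') - (N * (B + B')) * (ph * E') - G * (W * B + E' * B') * B0 - (W - E') * (H * B0)" by (simp add: algebra_simps)
  also have "... = (N * ph + G * B0) * (W * B + E' * B') - (N * (B + B')) * (ph * E') - G * (W * B + E' * B') * B0 - (W - E') * (N * ph * B0)"
 unfolding HB0 by (simp only: I(1))
  also have "... = ph * (W - E') * (N * B - N * B0)" by (simp add: algebra_simps)
  finally show ?thesis using I(3) by simp
 qed
  thus ?case unfolding H_def N_def G_def ph_def ps_def W_def E'_def B0_def B_def B'_def by simp
 next
  case 2
  have GB: "B * B = 0" by (rule s)
  have "H * (W * B + E' * B') = (N * (B + B')) * (ps * W) - (G * (W * B + E' * B') + (W - E') * H) * B'"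
 proof -
  have "H * (W * B + E' * B') - ((N * (B + B')) * (ps * W) - (G * (W * B + E' * B') + (W - E') * H) * B') =
  H * (W * B + E' * B') - (N * (B + B')) * (ps * W) + G * (W * B + E' * B') * B' + (W - E') * (H * B')" by (simp add: algebra_simps)
  also have "... = (N * ps - G * B) * (W * B + E' * B') - (N * (B + B')) * (ps * W) + G * (W * B + E' * B') * B' + (W - E') * (N * ps * B' - G * B * B')"
 unfolding HB' by (simp only: I(2))
  also have "... = G * E' * (B' * B') - G * W * (B * B)" by (simp add: algebra_simps)
  finally show ?thesis using s by simp
 qed
  thus ?case unfolding H_def N_def G_def ph_def ps_def W_def E'_def B0_def B_def B'_def by simp
 next
  case 3
  have "(N * (B + B')) * B' - (N * (B + B')) * B0 = N * (B' * B') + (N * B - N * B0) * B' - (N * B - N * B0) * B0 - N * (B0 * B0)"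
 by (simp add: algebra_simps)
  hence "(N * (B + B')) * B' = (N * (B + B')) * B0" using I(3) s by simp
  thus ?case unfolding N_def B0_def B_def B'_def by simp
 }
qed

lemma under_invariants:
 fixes X :: "nat => 'a :: comm_ring_1"
 assumes sq: "!!l. X l * X l = 0" and e: "!!l. l < j ==> e l = q l * w l"
 shows "(PROD l<j. e l) = (PROD l<j. q l) * (PROD l<j. w l)"
  "(PROD l<j. w l * X l + e l * X (Suc l)) = (PROD l<j. X l + q l * X (Suc l)) * (PROD l<j. w l)"
  "(PROD l<j. X l + q l * X (Suc l)) * (PROD l<j. q l) * X j = (PROD l<j. X l + q l * X (Suc l)) * X 0"
proof -
 show "(PROD l<j. e l) = (PROD l<j. q l) * (PROD l<j. w l)" using e by (simp add: prod.distrib[symmetric])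
 have "(PROD l<j. w l * X l + e l * X (Suc l)) = (PROD l<j. (X l + q l * X (Suc l)) * w l)" using e by (intro prod.cong) (auto simp: algebra_simps)
 thus "(PROD l<j. w l * X l + e l * X (Suc l)) = (PROD l<j. X l + q l * X (Suc l)) * (PROD l<j. w l)" by (simp add: prod.distrib)
 show "(PROD l<j. X l + q l * X (Suc l)) * (PROD l<j. q l) * X j = (PROD l<j. X l + q l * X (Suc l)) * X 0"
 proof (induction j)
  case (Suc j)
  define N Q p B0 B B' where "N = (PROD l<j. X l + q l * X (Suc l))" and "Q = (PROD l<j. q l)" and "p = q j"
  and "B0 = X 0" and "B = X j" and "B' = X (Suc j)"
  have I: "N * Q * B = N * B0" using Suc by (simp add: N_def Q_def B0_def B_def)
  have s: "B0 * B0 = 0" "B * B = 0" "B' * B' = 0" using sq by (simp_all add: B0_def B_def B'_def)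
  have "(N * (B + p * B')) * (Q * p) * B' - (N * (B + p * B')) * B0 =
  (N * Q * B - N * B0) * p * B' + N * Q * p * p * (B' * B') - N * B0 * B" by (simp add: algebra_simps)
  moreover have "N * B0 * B = 0" unfolding I[symmetric] using s by (simp add: mult.assoc)
  ultimately have "(N * (B + p * B')) * (Q * p) * B' = (N * (B + p * B')) * B0" using I s by simp
  thus ?case unfolding N_def Q_def p_def B0_def B_def B'_def by simp
 qed simp
qed

text \<open>One step of moving the strand below the vertex.\<close>

lemma over_step:
 fixes d :: "'a :: comm_ring_1"
 assumes d: "d * d = 0" and s: "B0 * B0 = 0" "B * B = 0" "B' * B' = 0"
  and I: "H = N * ph + G * B0" "H = N * ps - G * B" "N * B = N * B0"
  and G': "G' = G * (w * B + e * B') + (w - e) * H"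
 shows "(d * (- rh * G) + (N * ph - rh * T0 * G)) * ((w - e) * d * (B + B' - rh * T') + e * (B + B') * T') +
  (d * ((rh * T0 + B0 + B) * G) + N * ps * T0) * (rh * (w - e) * d + w * (B + B') + rh * (e - w) * T') =
  d * ((rh * (T0 - T') + B0 + B') * G') + (N * (B + B') * (ph * e * T' + ps * w * T0) - rh * T0 * T' * G')"
proof -
 have g1: "G' = G * e * (B + B') + (w - e) * N * ps" unfolding G' I(2) by (simp add: algebra_simps)
 have g2: "G' = G * e * (B + B') + N * ph * (w - e) + (B0 + B) * G * (w - e)" unfolding G' I(1) by (simp add: algebra_simps)
 have g3: "(B0 + B') * G' = N * ph * (w - e) * (B + B') + (B0 + B) * G * w * (B + B')"
 proof -
  have "(B0 + B') * G' - (N * ph * (w - e) * (B + B') + (B0 + B) * G * w * (B + B')) =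
  ph * (w - e) * (N * B0 - N * B) + G * (w - e) * (B0 * B0) + G * e * (B' * B') - G * w * (B * B)" unfolding g2 by (simp add: algebra_simps)
  thus ?thesis using s I(3) by simp
 qed
 have "(d * (- rh * G) + (N * ph - rh * T0 * G)) * ((w - e) * d * (B + B' - rh * T') + e * (B + B') * T') +
  (d * ((rh * T0 + B0 + B) * G) + N * ps * T0) * (rh * (w - e) * d + w * (B + B') + rh * (e - w) * T') =
  (d * d) * ((- rh * G) * (w - e) * (B + B' - rh * T') + (rh * T0 + B0 + B) * G * rh * (w - e)) +
  d * (rh * T0 * (G * e * (B + B') + (w - e) * N * ps)
  - rh * T' * (G * e * (B + B') + N * ph * (w - e) + (B0 + B) * G * (w - e))
  + (N * ph * (w - e) * (B + B') + (B0 + B) * G * w * (B + B')))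
  + (N * (B + B') * (ph * e * T' + ps * w * T0) - rh * T0 * T' * (G * e * (B + B') + (w - e) * N * ps))" by (simp add: algebra_simps)
 also have "... = d * (rh * T0 * G' - rh * T' * G' + (B0 + B') * G') + (N * (B + B') * (ph * e * T' + ps * w * T0) - rh * T0 * T' * G')"
 unfolding g1[symmetric] g2[symmetric] g3[symmetric] d by simp
 also have "... = d * ((rh * (T0 - T') + B0 + B') * G') + (N * (B + B') * (ph * e * T' + ps * w * T0) - rh * T0 * T' * G')"
 by (simp add: algebra_simps)
 finally show ?thesis .
qed

lemma under_step:
 fixes d :: "'a :: comm_ring_1"
 assumes d: "d * d = 0" and s: "B0 * B0 = 0" "B * B = 0" "B' * B' = 0"
  and I: "ph = Q * ps" "H = N * ps" "N * Q * B = N * B0" and e: "e = q * w"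
  and G': "G' = G * (w * B + e * B') + (w - e) * H"
 shows "(d * (- rh * Q * G) + N * ph) * ((w - e) * d * (B + q * B' - rh * q * T') + e * (B + q * B') * T') +
  (d * ((rh * T0 + B0 + Q * B) * G) + N * ps * T0) * (rh * (w - e) * d + w * (B + q * B') + rh * (e - q * w) * T') =
  d * ((rh * (T0 - Q * q * T') + B0 + Q * q * B') * G') + N * (B + q * B') * (ph * e * T' + ps * w * T0)"
proof -
 have g1: "G' = G * w * (B + q * B') + (w - q * w) * N * ps" unfolding G' I(2) e by (simp add: algebra_simps)
 have g3: "(B0 + Q * q * B') * G' = N * Q * ps * (w - q * w) * (B + q * B') + (B0 + Q * B) * G * w * (B + q * B')"
 proof -
  have "(B0 + Q * q * B') * G' - (N * Q * ps * (w - q * w) * (B + q * B') + (B0 + Q * B) * G * w * (B + q * B')) =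
  ps * (w - q * w) * (N * B0 - N * Q * B) + G * w * Q * q * q * (B' * B') - G * w * Q * (B * B)" unfolding g1 by (simp add: algebra_simps)
  thus ?thesis using s I(3) by simp
 qed
 have "(d * (- rh * Q * G) + N * ph) * ((w - e) * d * (B + q * B' - rh * q * T') + e * (B + q * B') * T') +
  (d * ((rh * T0 + B0 + Q * B) * G) + N * ps * T0) * (rh * (w - e) * d + w * (B + q * B') + rh * (e - q * w) * T') =
  (d * d) * ((- rh * Q * G) * (w - q * w) * (B + q * B' - rh * q * T') + (rh * T0 + B0 + Q * B) * G * rh * (w - q * w)) +
  d * (rh * T0 * (G * w * (B + q * B') + (w - q * w) * N * ps)
  - rh * Q * q * T' * (G * w * (B + q * B') + (w - q * w) * N * ps)
  + (N * Q * ps * (w - q * w) * (B + q * B') + (B0 + Q * B) * G * w * (B + q * B')))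
  + N * (B + q * B') * (ph * e * T' + ps * w * T0)" unfolding I(1) e by (simp add: algebra_simps)
 also have "... = d * (rh * T0 * G' - rh * Q * q * T' * G' + (B0 + Q * q * B') * G') + N * (B + q * B') * (ph * e * T' + ps * w * T0)"
 unfolding g1[symmetric] g3[symmetric] d by simp
 also have "... = d * ((rh * (T0 - Q * q * T') + B0 + Q * q * B') * G') + N * (B + q * B') * (ph * e * T' + ps * w * T0)" by (simp add: algebra_simps)
 finally show ?thesis .
qed

subsection \<open>Products of rows\<close>

definition strand_row :: "'a :: comm_ring_1 => (nat => 'a) => (nat => 'a) => (nat => 'a) => nat => 'a" where
 "strand_row rh q T B l = rh * (T l - q l * T (Suc l)) + B l + q l * B (Suc l)"

text \<open>Eliminating the region between two adjacent beams joins the crossings to one long crossing, whose row has the same shape.\<close>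

lemma strand_above_extract:
 fixes t b :: "nat => 'r" and rh :: "('r, 'c :: comm_ring_1) zeon" and q :: "nat => ('r, 'c) zeon"
 assumes const: "!!N. free N rh" "!!N l. free N (q l)"
  and dist: "!!i l. 1 <= i ==> i < n ==> l <= n ==> b l = b i ==> l = i"
  "!!i l. 1 <= i ==> i < n ==> l <= n ==> t l ~= b i"
  and j: "1 <= j" "j <= n"
 shows "extracts (b ` {1..<j}) (PROD l<j. strand_row rh q (%l. zvar (t l)) (%l. zvar (b l)) l)
  (rh * (zvar (t 0) - (PROD l<j. q l) * zvar (t j)) + zvar (b 0) + (PROD l<j. q l) * zvar (b j))" using j
proof (induction j rule: dec_induct)
 case base
 thus ?case by (simp add: extracts_empty strand_row_def)
next
 case (step j)
 define Q where "Q = (PROD l<j. q l)"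
 have cQ: "free N Q" for N unfolding Q_def using const by (intro free_prod)
 have fr: "free {b j} (zvar (t 0))" "free {b j} (zvar (t j))" "free {b j} (zvar (t (Suc j)))" "free {b j} (zvar (b 0))" "free {b j} (zvar (b (Suc j)))"
 using dist(2)[of j 0] dist(2)[of j j] dist(2)[of j "Suc j"] dist(1)[of j 0] dist(1)[of j "Suc j"] step.hyps step.prems by (auto intro!: free_zvar)
 have nb: "b l ~: b ` {1..<j}" if l: "j <= l" "l <= n" for l
 proof
  assume "b l : b ` {1..<j}"
  then obtain i where i: "1 <= i" "i < j" "b l = b i" by auto
  have "l = i" by (rule dist(1)[OF i(1) _ l(2) i(3)]) (use i step.hyps step.prems in linarith)
  thus False using i l by simp
 qed
 have nt: "t l ~: b ` {1..<j}" if l: "l <= n" for l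
 proof
  assume "t l : b ` {1..<j}"
  then obtain i where i: "1 <= i" "i < j" "t l = b i" by auto
  have "t l ~= b i" by (rule dist(2)[OF i(1) _ l]) (use i step.hyps step.prems in linarith)
  thus False using i by simp
 qed
 have ins: "b ` {1..<Suc j} = b ` {1..<j} Un {b j}" using step.hyps by (auto simp: atLeastLessThanSuc)
 have E: "extracts {b j} ((zvar (b j) * Q + (rh * (zvar (t 0) - Q * zvar (t j)) + zvar (b 0))) *
  (zvar (b j) * 1 + (rh * (zvar (t j) - q j * zvar (t (Suc j))) + q j * zvar (b (Suc j)))))
  (Q * (rh * (zvar (t j) - q j * zvar (t (Suc j))) + q j * zvar (b (Suc j))) + (rh * (zvar (t 0) - Q * zvar (t j)) + zvar (b 0)) * 1)"
 by (intro extracts_two free_intros const cQ fr)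
 have "extracts (b ` {1..<j} Un {b j}) ((PROD l<j. strand_row rh q (%l. zvar (t l)) (%l. zvar (b l)) l) *
  strand_row rh q (%l. zvar (t l)) (%l. zvar (b l)) j)
  (rh * (zvar (t 0) - (Q * q j) * zvar (t (Suc j))) + zvar (b 0) + (Q * q j) * zvar (b (Suc j)))"
 proof (rule extracts_step)
  show "extracts (b ` {1..<j}) (PROD l<j. strand_row rh q (%l. zvar (t l)) (%l. zvar (b l)) l)
  (rh * (zvar (t 0) - Q * zvar (t j)) + zvar (b 0) + Q * zvar (b j))" using step unfolding Q_def by simp
  show "free (b ` {1..<j}) (strand_row rh q (%l. zvar (t l)) (%l. zvar (b l)) j)" unfolding strand_row_def
 by (intro free_intros const nb nt) (use step.hyps step.prems in linarith)+
  show "extracts {b j} ((rh * (zvar (t 0) - Q * zvar (t j)) + zvar (b 0) + Q * zvar (b j)) * strand_row rh q (%l. zvar (t l)) (%l. zvar (b l)) j)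
  (rh * (zvar (t 0) - (Q * q j) * zvar (t (Suc j))) + zvar (b 0) + (Q * q j) * zvar (b (Suc j)))"
 proof -
  have "Q * (rh * (zvar (t j) - q j * zvar (t (Suc j))) + q j * zvar (b (Suc j))) + (rh * (zvar (t 0) - Q * zvar (t j)) + zvar (b 0)) * 1 =
  rh * (zvar (t 0) - (Q * q j) * zvar (t (Suc j))) + zvar (b 0) + (Q * q j) * zvar (b (Suc j))" by (simp add: algebra_simps)
  moreover have "(zvar (b j) * Q + (rh * (zvar (t 0) - Q * zvar (t j)) + zvar (b 0))) *
  (zvar (b j) * 1 + (rh * (zvar (t j) - q j * zvar (t (Suc j))) + q j * zvar (b (Suc j)))) =
  (rh * (zvar (t 0) - Q * zvar (t j)) + zvar (b 0) + Q * zvar (b j)) * strand_row rh q (%l. zvar (t l)) (%l. zvar (b l)) j"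
 unfolding strand_row_def by (simp add: mult.commute[of _ Q] add_ac)
  ultimately show ?thesis using E by (simp only:)
 qed
  show "b ` {1..<j} Int {b j} = {}" using nb[of j] step.hyps step.prems by simp
 qed
 thus ?case unfolding ins Q_def by simp
qed

text \<open>The value of a strand next to a vertex whose entering edges are separated by the regions \<open>X\<close>
 below the strand, \<open>T\<close> and \<open>T'\<close> being the regions above the ends of the strand.\<close>

definition strand_value :: "'a :: comm_ring_1 => 'a => 'a => 'a => (nat => 'a) => (nat => 'a) => (nat => 'a) => nat => 'a" where
 "strand_value rh Q T T' w e X m = (rh * (T - Q * T') + X 0 + Q * X m) * vertex_coef w e X m"

lemma free_vertex_coef:
 assumes "!!l. free N (w l)" "!!l. free N (e l)" "!!l. l <= m ==> free N (X l)"
 shows "free N (vertex_coef w e X m)" using assms(3)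
proof (induction m)
 case (Suc m)
 thus ?case by (auto intro!: free_intros free_prod assms(1,2))
qed (simp add: free_zero)

lemma extracts_disc:
 fixes d :: 'r and w e X :: "nat => ('r, 'c :: comm_ring_1) zeon"
 assumes "!!l. free {d} (w l)" "!!l. free {d} (e l)" "!!l. l <= m ==> free {d} (X l)" "free {d} E"
 shows "extracts {d} (E * (PROD l<m. (w l - e l) * zvar d + w l * X l + e l * X (Suc l))) (E * vertex_coef w e X m)"
proof (rule extracts_var')
 show "E * (PROD l<m. (w l - e l) * zvar d + w l * X l + e l * X (Suc l)) =
  zvar d * (E * vertex_coef w e X m) + E * (PROD l<m. w l * X l + e l * X (Suc l))" unfolding vertex_prod[OF zvar_square] by (simp add: algebra_simps)
 show "free {d} (E * (PROD l<m. w l * X l + e l * X (Suc l)))" using assms by (auto intro!: free_intros free_prod)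
qed

text \<open>The part with the vertex disc behaves as if the strand had already passed the vertex. The part without it is recorded because it feeds the disc at the next edge; there \<open>kp\<close> tells the upper strand from the lower one.\<close>

lemma strand_below_extract:
 fixes t b :: "nat => 'r" and rh :: "('r, 'c :: comm_ring_1) zeon" and q w e :: "nat => ('r, 'c) zeon"
 assumes const: "!!N. free N rh" "!!N l. free N (q l)" "!!N l. free N (w l)" "!!N l. free N (e l)"
  and dist: "!!i l. 1 <= i ==> i < m ==> l <= m ==> t l = t i ==> l = i"
  "!!i l. 1 <= i ==> i < m ==> l <= m ==> b l ~= t i"
  and d: "!!l. t l ~= d" "!!l. b l ~= d"
  and ou: "(ALL l. q l = 1) & kp = 1 \<or> (ALL l. e l = q l * w l) & kp = 0"
  and j: "1 <= j" "j <= m"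
 shows "extracts (t ` {1..<j}) (PROD l<j. strand_row rh q (%l. zvar (t l)) (%l. zvar (b l)) l *
  ((w l - e l) * zvar d + w l * zvar (t l) + e l * zvar (t (Suc l))))
  (zvar d * strand_value rh (PROD l<j. q l) (zvar (t 0)) (zvar (t j)) w e (%l. zvar (b l)) j +
  ((PROD l<j. zvar (b l) + q l * zvar (b (Suc l))) * ((PROD l<j. e l) * zvar (t j) + (PROD l<j. w l) * zvar (t 0))
  - kp * (rh * zvar (t 0) * zvar (t j) * vertex_coef w e (%l. zvar (b l)) j)))" using j
proof (induction j rule: dec_induct)
 case base
 define T0 T1 B0 B1 D :: "('r, 'c) zeon" where "T0 = zvar (t 0)" and "T1 = zvar (t 1)" and "B0 = zvar (b 0)" and "B1 = zvar (b 1)" and "D = zvar d"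
 have sq: "T0 * T0 = 0" "T1 * T1 = 0" unfolding T0_def T1_def by (rule zvar_square)+
 have ez: "e 0 - q 0 * w 0 = - kp * (w 0 - e 0)" using ou by auto
 have "(rh * (T0 - q 0 * T1) + B0 + q 0 * B1) * ((w 0 - e 0) * D + w 0 * T0 + e 0 * T1) =
  D * ((rh * (T0 - q 0 * T1) + B0 + q 0 * B1) * (w 0 - e 0)) + (B0 + q 0 * B1) * (e 0 * T1 + w 0 * T0) +
  rh * T0 * T1 * (e 0 - q 0 * w 0) + rh * w 0 * (T0 * T0) - rh * q 0 * e 0 * (T1 * T1)" by (simp add: algebra_simps)
 also have "... = D * ((rh * (T0 - q 0 * T1) + B0 + q 0 * B1) * (w 0 - e 0)) + ((B0 + q 0 * B1) * (e 0 * T1 + w 0 * T0)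
  - kp * (rh * T0 * T1 * (w 0 - e 0)))" unfolding sq ez by (simp add: algebra_simps)
 finally have "(PROD l<1. strand_row rh q (%l. zvar (t l)) (%l. zvar (b l)) l *
  ((w l - e l) * zvar d + w l * zvar (t l) + e l * zvar (t (Suc l)))) =
  (zvar d * strand_value rh (PROD l<1. q l) (zvar (t 0)) (zvar (t 1)) w e (%l. zvar (b l)) 1 +
  ((PROD l<1. zvar (b l) + q l * zvar (b (Suc l))) * ((PROD l<1. e l) * zvar (t 1) + (PROD l<1. w l) * zvar (t 0))
  - kp * (rh * zvar (t 0) * zvar (t 1) * vertex_coef w e (%l. zvar (b l)) 1)))"
 by (simp add: strand_row_def strand_value_def T0_def T1_def B0_def B1_def D_def)
 thus ?case by (simp only: extracts_empty atLeastLessThan_empty[OF order_refl] image_empty)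
next
 case (step j)
 define Q N ph ps G where "Q = (PROD l<j. q l)" and "N = (PROD l<j. zvar (b l) + q l * zvar (b (Suc l)))"
  and "ph = (PROD l<j. e l)" and "ps = (PROD l<j. w l)" and "G = vertex_coef w e (%l. zvar (b l)) j"
 define H where "H = (PROD l<j. w l * zvar (b l) + e l * zvar (b (Suc l)))"
 define T0 T T' B0 B B' D :: "('r, 'c) zeon" where "T0 = zvar (t 0)" and "T = zvar (t j)" and "T' = zvar (t (Suc j))"
  and "B0 = zvar (b 0)" and "B = zvar (b j)" and "B' = zvar (b (Suc j))" and "D = zvar d"
 define G' where "G' = vertex_coef w e (%l. zvar (b l)) (Suc j)"
 have sq: "D * D = 0" "B0 * B0 = 0" "B * B = 0" "B' * B' = 0" "T * T = 0" "T' * T' = 0"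
 unfolding D_def B0_def B_def B'_def T_def T'_def by (rule zvar_square)+
 have G': "G' = G * (w j * B + e j * B') + (w j - e j) * H" by (simp add: G'_def G_def H_def B_def B'_def)
 have ez: "e j - q j * w j = - kp * (w j - e j)" using ou by auto
 have cst: "free M Q" "free M ph" "free M ps" "free M kp" for M unfolding Q_def ph_def ps_def using const ou by (auto intro!: free_prod free_intros)
 have tj: "t 0 ~= t j" "t (Suc j) ~= t j" "b l ~= t j" if "l <= m" for l
 using dist(1)[of j 0] dist(1)[of j "Suc j"] dist(2)[of j l] step.hyps step.prems that by auto
 have fv: "free {t j} T0" "free {t j} T'" "free {t j} B0" "free {t j} B" "free {t j} B'" "free {t j} D"
 unfolding T0_def T'_def B0_def B_def B'_def D_def using tj step.hyps step.prems d(1)[of j] by (auto intro!: free_zvar)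
 have fG: "free {t j} G" "free {t j} N"
 unfolding G_def N_def using tj step.hyps step.prems by (auto intro!: free_vertex_coef free_prod free_intros const)
 define U where "U = D * ((rh * (T0 - Q * T) + B0 + Q * B) * G) + (N * (ph * T + ps * T0) - kp * (rh * T0 * T * G))"
 define V where "V = (rh * (T - q j * T') + B + q j * B') * ((w j - e j) * D + w j * T + e j * T')"
 define a where "a = D * (- rh * Q * G) + (N * ph - kp * (rh * T0 * G))"
 define a' where "a' = D * ((rh * T0 + B0 + Q * B) * G) + N * ps * T0"
 define c where "c = rh * (w j - e j) * D + w j * (B + q j * B') + rh * (e j - q j * w j) * T'"
 define c' where "c' = (w j - e j) * D * (B + q j * B' - rh * q j * T') + e j * (B + q j * B') * T'"
 have U: "U = T * a + a'" unfolding U_def a_def a'_def by (simp add: algebra_simps)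
 have V: "V = T * c + c'"
 proof -
  have "V = T * c + c' + rh * w j * (T * T) - rh * q j * e j * (T' * T')" unfolding V_def c_def c'_def by (simp add: algebra_simps)
  thus ?thesis using sq by simp
 qed
 have e1: "extracts {t j} (U * V) (a * c' + a' * c)" unfolding U V unfolding T_def
 by (rule extracts_two) (unfold a'_def c'_def, intro free_intros const cst fv fG, intro free_intros const cst fv fG)
 have e2: "a * c' + a' * c = D * ((rh * (T0 - (Q * q j) * T') + B0 + (Q * q j) * B') * G') +
  ((N * (B + q j * B')) * ((ph * e j) * T' + (ps * w j) * T0) - kp * (rh * T0 * T' * G'))" using ou
 proof
  assume o: "(ALL l. q l = 1) & kp = 1"
  hence q1: "q l = 1" "Q = 1" "kp = 1" for l by (auto simp: Q_def)
  have I: "H = N * ph + G * B0" "H = N * ps - G * B" "N * B = N * B0"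
 using over_invariants(1,2)[where X = "%l. zvar (b l)" and w = w and e = e and j = j, OF zvar_square]
  over_invariants(3)[where X = "%l. zvar (b l)" and j = j, OF zvar_square] q1 unfolding H_def N_def ph_def ps_def G_def B0_def B_def by simp_all
  show ?thesis using over_step[OF sq(1-4) I G', of rh T0 T'] unfolding a_def a'_def c_def c'_def q1 by simp
 next
  assume u: "(ALL l. e l = q l * w l) & kp = 0"
  hence e: "e l = q l * w l" and k: "kp = 0" for l by auto
  have I: "ph = Q * ps" "H = N * ps" "N * Q * B = N * B0" using under_invariants[of "%l. zvar (b l)" j e q w, OF zvar_square e]
 unfolding H_def N_def ph_def ps_def Q_def B0_def B_def by simp_all
  show ?thesis using under_step[OF sq(1-4) I e[of j] G', of rh T' T0] unfolding a_def a'_def c_def c'_def k by (simp add: mult.assoc)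
 qed
 have nb: "t l ~: t ` {1..<j}" if l: "j <= l" "l <= m" for l
 proof
  assume "t l : t ` {1..<j}"
  then obtain i where i: "1 <= i" "i < j" "t l = t i" by auto
  have "l = i" by (rule dist(1)[OF i(1) _ l(2) i(3)]) (use i step.hyps step.prems in linarith)
  thus False using i l by simp
 qed
 have nt: "b l ~: t ` {1..<j}" if l: "l <= m" for l
 proof
  assume "b l : t ` {1..<j}"
  then obtain i where i: "1 <= i" "i < j" "b l = t i" by auto
  have "b l ~= t i" by (rule dist(2)[OF i(1) _ l]) (use i step.hyps step.prems in linarith)
  thus False using i by simp
 qed
 have nd: "d ~: t ` {1..<j}" using d(1) by force
 have ins: "t ` {1..<Suc j} = t ` {1..<j} Un {t j}" using step.hyps by (auto simp: atLeastLessThanSuc)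
 have "extracts (t ` {1..<j} Un {t j}) ((PROD l<j. strand_row rh q (%l. zvar (t l)) (%l. zvar (b l)) l *
  ((w l - e l) * zvar d + w l * zvar (t l) + e l * zvar (t (Suc l)))) * V) (a * c' + a' * c)"
 proof (rule extracts_step)
  show "extracts (t ` {1..<j}) (PROD l<j. strand_row rh q (%l. zvar (t l)) (%l. zvar (b l)) l *
  ((w l - e l) * zvar d + w l * zvar (t l) + e l * zvar (t (Suc l)))) U"
 using step unfolding U_def strand_value_def Q_def N_def ph_def ps_def G_def T0_def T_def B0_def B_def D_def by simp
  show "free (t ` {1..<j}) V" unfolding V_def T_def T'_def B_def B'_def D_def
 by (intro free_intros const nb nt nd) (use step.hyps step.prems in linarith)+
  show "extracts {t j} (U * V) (a * c' + a' * c)" by (rule e1)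
  show "t ` {1..<j} Int {t j} = {}" using nb[of j] step.hyps step.prems by simp
 qed
 thus ?case unfolding ins e2 V_def strand_value_def Q_def N_def ph_def ps_def G'_def T0_def T_def T'_def B0_def B_def B'_def D_def strand_row_def
 by simp
qed

section \<open>The move (IV)\<close>

definition upper :: "bool => side" where
 "upper lr = (if lr then L else R)"

definition strand_weight :: "bool => bool => nat => int poly fract" where
 "strand_weight lr over i = (if over then (if lr then thalf powi (- (2 * int i)) else - (thalf powi (2 * int i))) else if lr then 1 else - 1)"

definition beam_weight :: "bool => nat => region_poly" where
 "beam_weight over c = zc (thalf powi (if over then 0 else 2 * int c))"

lemma crossing_row:
 assumes D: "moy_diagram D" "x : dpts D" and c: "crosses_beam D up lr x west east b e" and p: "positive D x \<longleftrightarrow> over = lr"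
 shows "color D west = color D east" "color D b = color D e"
  and "lreg D (if up then b else e) = side_reg D (other (upper lr)) west" "rreg D (if up then b else e) = side_reg D (other (upper lr)) east"
  "lreg D (if up then e else b) = side_reg D (upper lr) west" "rreg D (if up then e else b) = side_reg D (upper lr) east"
  and "zrow D (Dbl x) = zc (thalf powi (if ~ lr & ~ over then - (2 * int (color D b)) else 0)) *
  (zc (strand_weight lr over (color D west)) * (zreg (side_reg D (upper lr) west) - beam_weight over (color D b) * zreg (side_reg D (upper lr) east))
  + zreg (side_reg D (other (upper lr)) west) + beam_weight over (color D b) * zreg (side_reg D (other (upper lr)) east))"
proof -
 note sides = dpt_sides[OF D]
 define low high where "low = (if up then b else e)" and "high = (if up then e else b)"
 have c': "if lr then sw D x = west & ne D x = east & se D x = low & nw D x = high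
  else se D x = east & nw D x = west & sw D x = low & ne D x = high" using c by (simp add: crosses_beam_def low_def high_def Let_def)
 show col: "color D west = color D east" using c' sides(1,2) by (cases lr) auto
 have lh: "color D low = color D high" using c' sides(1,2) by (cases lr) auto
 thus cb: "color D b = color D e" by (auto simp: low_def high_def split: if_splits)
 have clow: "color D low = color D b" using cb by (simp add: low_def)
 show "lreg D (if up then b else e) = side_reg D (other (upper lr)) west" "rreg D (if up then b else e) = side_reg D (other (upper lr)) east"
  "lreg D (if up then e else b) = side_reg D (upper lr) west" "rreg D (if up then e else b) = side_reg D (upper lr) east"
 unfolding low_def[symmetric] high_def[symmetric] using c' sides(3-6) by (cases lr; simp add: upper_def)+
 have one: "zc 1 = (1 :: region_poly)" by (rule zc_hom)
 show "zrow D (Dbl x) = zc (thalf powi (if ~ lr & ~ over then - (2 * int (color D b)) else 0)) *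
  (zc (strand_weight lr over (color D west)) * (zreg (side_reg D (upper lr) west) - beam_weight over (color D b) * zreg (side_reg D (upper lr) east))
  + zreg (side_reg D (other (upper lr)) west) + beam_weight over (color D b) * zreg (side_reg D (other (upper lr)) east))"
 proof (cases lr)
  case True
  hence e: "sw D x = west" "ne D x = east" "se D x = low" "nw D x = high" using c' by auto
  have r: "rreg D (nw D x) = lreg D east" "rreg D (se D x) = rreg D east" using sides e by auto
  show ?thesis
 using True p r clow by (cases over) (simp_all add: zrow_positive zrow_negative e upper_def strand_weight_def beam_weight_def one algebra_simps)
 next
  case False
  hence e: "se D x = east" "nw D x = west" "sw D x = low" "ne D x = high" using c' by auto
  have r: "rreg D (sw D x) = lreg D east" "lreg D (sw D x) = lreg D west" using sides e by auto
  show ?thesis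
 proof (cases over)
  case True
  thus ?thesis using False p r col by (simp add: zrow_negative e upper_def strand_weight_def beam_weight_def one zc_hom(5) algebra_simps)
 next
  case over: False
  define q q' :: region_poly where "q = zc (thalf powi (2 * int (color D b)))" and "q' = zc (thalf powi (- (2 * int (color D b))))"
  have qq: "q' * (q * z) = z" for z unfolding q_def q'_def by (rule zc_powi_cancel)
  have "zrow D (Dbl x) = q' * (zreg (lreg D west) - zreg (rreg D west)) + zreg (lreg D east) + zreg (rreg D east)"
 using over False p r clow by (simp add: zrow_positive e q'_def)
  also have "... = q' * (- (zreg (rreg D west) - q * zreg (rreg D east)) + zreg (lreg D west) + q * zreg (lreg D east))"
 by (simp add: distrib_left right_diff_distrib qq)
  finally show ?thesis using over False by (simp add: upper_def strand_weight_def beam_weight_def zc_hom(5) one q_def q'_def)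
 qed
 qed
qed

lemma prod_zc_powi: "(PROD l<n :: nat. zc (thalf powi (a l))) = zc (thalf powi (SUM l<n. a l))" by (induction n) (simp_all add: zc_hom thalf_powi_add)

definition low_arcs :: "moy => bool => nat => nat list => nat list" where
 "low_arcs D up v es = (if up then ins D v else es)"

definition low_reg :: "moy => nat list => nat => nat" where
 "low_reg D low l = (if l < length low then lreg D (low ! l) else rreg D (last low))"

locale strand_across =
 fixes D :: moy and v :: nat and up lr over :: bool and xs ss es :: "nat list"
 assumes D: "moy_diagram D" and across: "across D v up lr over xs ss es"
  and edges: "ins D v ~= []" "outs D v ~= []"
begin

abbreviation "n \<equiv> length xs"
abbreviation "bs \<equiv> beams D up v"
abbreviation "I \<equiv> inside_across D v up xs ss"
abbreviation "T j \<equiv> side_reg D (upper lr) (ss ! j)"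
abbreviation "B j \<equiv> side_reg D (other (upper lr)) (ss ! j)"
abbreviation "W j \<equiv> side_reg D (toward up lr) (ss ! j)"
abbreviation "V j \<equiv> side_reg D (away up lr) (ss ! j)"

lemma parts:
 "v : verts D" "distinct xs" "set xs \<subseteq> dpts D" "set ss \<subseteq> arcs D" "length ss = Suc n" "length es = n" "length bs = n"
 "j < n ==> positive D (xs ! j) \<longleftrightarrow> over = lr"
 "j < n ==> crosses_beam D up lr (xs ! j) (ss ! j) (ss ! Suc j) (bs ! j) (es ! j)"
 "Suc j < n ==> bounded_by D (rreg D (bs ! j)) {(bs ! j, R), (bs ! Suc j, L), (ss ! Suc j, toward up lr)}"
 "W 0 = wreg D v" "W n = ereg D v" "n > 0" "hd ss = ss ! 0" "last ss = ss ! n"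
proof -
 show l: "length ss = Suc n" "length bs = n" using across by (auto simp: across_def)
 hence s: "ss ~= []" by auto
 thus h: "hd ss = ss ! 0" "last ss = ss ! n" using l by (auto simp: hd_conv_nth last_conv_nth)
 show "n > 0" using l(2) edges by (auto simp: beams_def split: if_splits)
 show "W 0 = wreg D v" "W n = ereg D v" using across h by (auto simp: across_def)
qed (use across in \<open>auto simp: across_def\<close>)

lemma x_in: "j < n ==> xs ! j : dpts D" using parts(3) nth_mem by blast

lemma x_eq: "i < n ==> j < n ==> xs ! i = xs ! j \<longleftrightarrow> i = j" using parts(2) by (rule nth_eq_iff_index_eq)

lemma slots_lr:
 assumes "j < n" "lr"
 shows "ss ! j = sw D (xs ! j)" "ss ! Suc j = ne D (xs ! j)"
  "up ==> outs D v ! j = se D (xs ! j) & es ! j = nw D (xs ! j)"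
  "~ up ==> ins D v ! j = nw D (xs ! j) & es ! j = se D (xs ! j)"
 using parts(9)[OF assms(1)] assms(2) by (auto simp: crosses_beam_def Let_def beams_def)

lemma slots_rl:
 assumes "j < n" "~ lr"
 shows "ss ! j = nw D (xs ! j)" "ss ! Suc j = se D (xs ! j)"
  "up ==> outs D v ! j = sw D (xs ! j) & es ! j = ne D (xs ! j)"
  "~ up ==> ins D v ! j = ne D (xs ! j) & es ! j = sw D (xs ! j)"
 using parts(9)[OF assms(1)] assms(2) by (auto simp: crosses_beam_def Let_def beams_def)

lemma len: "up ==> length (outs D v) = n" "~ up ==> length (ins D v) = n" using parts(7) by (simp_all add: beams_def)

lemma strand_neq:
 assumes i: "1 <= i" "i < n"
 shows "l <= n ==> ss ! l = ss ! i ==> l = i"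
  "j < n ==> es ! j ~= ss ! i"
  "up ==> j < length (ins D v) ==> ins D v ! j ~= ss ! i"
proof -
 note neq = slot_neq[OF D]
 obtain i' where i': "i = Suc i'" "i' < n" using i by (cases i) auto
 { assume l: "l <= n" "ss ! l = ss ! i"
  show "l = i"
 proof (cases lr)
  case True
  show ?thesis
 proof (cases "l < n")
  case ln: True
  thus ?thesis using slots_lr(1)[OF ln True] slots_lr(1)[OF i(2) True] l(2) neq(1)[OF x_in[OF ln] x_in[OF i(2)]] x_eq[OF ln i(2)] by simp
 next
  case False
  then obtain l' where l': "l = Suc l'" "l' < n" using l(1) parts(13) by (cases l) auto
  thus ?thesis
 using slots_lr(2)[OF l'(2) True] slots_lr(2)[OF i'(2) True] l(2) neq(4)[OF x_in[OF l'(2)] x_in[OF i'(2)]] x_eq[OF l'(2) i'(2)] i' by simp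
 qed
 next
  case False
  show ?thesis
 proof (cases "l < n")
  case ln: True
  thus ?thesis using slots_rl(1)[OF ln False] slots_rl(1)[OF i(2) False] l(2) neq(3)[OF x_in[OF ln] x_in[OF i(2)]] x_eq[OF ln i(2)] by simp
 next
  case nl: False
  then obtain l' where l': "l = Suc l'" "l' < n" using l(1) parts(13) by (cases l) auto
  thus ?thesis
 using slots_rl(2)[OF l'(2) False] slots_rl(2)[OF i'(2) False] l(2) neq(2)[OF x_in[OF l'(2)] x_in[OF i'(2)]] x_eq[OF l'(2) i'(2)] i' by simp
 qed
 qed }
 show "es ! j ~= ss ! i" if j: "j < n"
 using slots_lr[OF j] slots_rl[OF j] slots_lr(1)[OF i(2)] slots_lr(2)[OF i'(2)] slots_rl(1)[OF i(2)] slots_rl(2)[OF i'(2)] i'(1)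
  neq(5-8)[OF x_in[OF j] x_in[OF i(2)]] neq(5-8)[OF x_in[OF j] x_in[OF i'(2)]] by (cases lr; cases up) simp_all
 show "ins D v ! j ~= ss ! i" if "up" "j < length (ins D v)"
 using slots_lr(1)[OF i(2)] slots_rl(2)[OF i'(2)] i'(1) neq(9)[OF x_in[OF i(2)] parts(1) that(2)] neq(9)[OF x_in[OF i'(2)] parts(1) that(2)]
 by (cases lr) simp_all
qed

lemma beam_neq:
 assumes j: "j < n"
 shows "l <= n ==> ss ! l ~= bs ! j" "l < n ==> es ! l ~= bs ! j"
  "up ==> l < length (ins D v) ==> ins D v ! l ~= bs ! j"
proof -
 note neq = slot_neq[OF D]
 have bup: "bs ! j = outs D v ! j" "j < length (outs D v)" if up using that j len by (auto simp: beams_def)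
 have bdn: "bs ! j = ins D v ! j" "j < length (ins D v)" if "~ up" using that j len by (auto simp: beams_def)
 { assume l: "l <= n"
  consider (in_part) "l < n" | (last) l' where "l = Suc l'" "l' < n" using l parts(13) by (cases l) (auto simp: le_less)
  note lcases = this
  have first: "l < n \<or> (EX l'. l = Suc l' & l' < n)" using l parts(13) by (cases l) (auto simp: le_less)
  show "ss ! l ~= bs ! j"
 proof (cases up)
  case True
  note b = bup[OF True]
  show ?thesis
 proof (cases lr)
  case lr: True
  show ?thesis using lcases
 proof cases
  case in_part
  thus ?thesis using slots_lr(1)[OF in_part lr] slots_lr(3)[OF j lr True] b neq(5)[OF x_in[OF in_part] x_in[OF j]] by simp
 next
  case last
  thus ?thesis using slots_lr(2)[OF last(2) lr] b neq(10)[OF x_in[OF last(2)] parts(1) b(2)] by auto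
 qed
 next
  case rl: False
  show ?thesis
 proof (cases l)
  case 0
  thus ?thesis using slots_rl(1)[OF parts(13) rl] b neq(10)[OF x_in[OF parts(13)] parts(1) b(2)] by auto
 next
  case (Suc l')
  hence l': "l' < n" using l by simp
  thus ?thesis using slots_rl(2)[OF l' rl] slots_rl(3)[OF j rl True] b neq(6)[OF x_in[OF l'] x_in[OF j]] Suc by simp
 qed
 qed
 next
  case False
  note b = bdn[OF False]
  show ?thesis
 proof (cases lr)
  case lr: True
  show ?thesis
 proof (cases l)
  case 0
  thus ?thesis using slots_lr(1)[OF parts(13) lr] b neq(9)[OF x_in[OF parts(13)] parts(1) b(2)] by auto
 next
  case (Suc l')
  hence l': "l' < n" using l by simp
  thus ?thesis using slots_lr(2)[OF l' lr] slots_lr(4)[OF j lr False] b neq(8)[OF x_in[OF l'] x_in[OF j]] Suc by simp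
 qed
 next
  case rl: False
  show ?thesis using lcases
 proof cases
  case in_part
  thus ?thesis using slots_rl(1)[OF in_part rl] slots_rl(4)[OF j rl False] b neq(7)[OF x_in[OF in_part] x_in[OF j]] by simp
 next
  case last
  thus ?thesis using slots_rl(2)[OF last(2) rl] b neq(9)[OF x_in[OF last(2)] parts(1) b(2)] by auto
 qed
 qed
 qed }
 show "es ! l ~= bs ! j" if l: "l < n"
 proof (cases up)
  case True
  thus ?thesis using bup[OF True] neq(10)[OF x_in[OF l] parts(1) bup(2)[OF True]] slots_lr(3)[OF l] slots_rl(3)[OF l] by (cases lr) auto
 next
  case False
  thus ?thesis using bdn[OF False] neq(9)[OF x_in[OF l] parts(1) bdn(2)[OF False]] slots_lr(4)[OF l] slots_rl(4)[OF l] by (cases lr) auto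
 qed
 show "ins D v ! l ~= bs ! j" if "up" "l < length (ins D v)"
 using bup[OF that(1)] slots_lr(3)[OF j] slots_rl(3)[OF j] neq(9)[OF x_in[OF j] parts(1) that(2)] that(1) by (cases lr) auto
qed

lemma beam_sides: "j < n ==> lreg D (bs ! j) = W j" "j < n ==> rreg D (bs ! j) = W (Suc j)"
 "j < n ==> lreg D (es ! j) = V j" "j < n ==> rreg D (es ! j) = V (Suc j)"
 "j < n ==> color D (bs ! j) = color D (es ! j)" "j < n ==> color D (ss ! Suc j) = color D (ss ! j)"
proof -
 assume j: "j < n"
 note c = crossing_row[OF D x_in[OF j] parts(9)[OF j] parts(8)[OF j]]
 have tw: "toward up lr = (if up then other (upper lr) else upper lr)" "away up lr = (if up then upper lr else other (upper lr))"
 by (auto simp: toward_def away_def upper_def)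
 show "lreg D (bs ! j) = W j" "rreg D (bs ! j) = W (Suc j)" "lreg D (es ! j) = V j" "rreg D (es ! j) = V (Suc j)"
 unfolding tw using c(3-6) by (cases up; simp)+
 show "color D (bs ! j) = color D (es ! j)" "color D (ss ! Suc j) = color D (ss ! j)" using c(1,2) by simp_all
qed

lemma strand_color: "j <= n ==> color D (ss ! j) = color D (hd ss)"
 by (induction j) (use parts(14) beam_sides(6) in \<open>auto simp: Suc_le_eq\<close>)

lemma inner_arcs: "iarcs I = {bs ! j |j. j < n} Un {ss ! i |i. 1 <= i & i < n}"
proof -
 have "set bs = {bs ! j |j. j < n}" using parts(7) by (auto simp: set_conv_nth)
 moreover have "set (butlast (tl ss)) = {ss ! i |i. 1 <= i & i < n}"
 proof -
  have nth: "butlast (tl ss) ! i = ss ! Suc i" if "i < n - 1" for i using that parts(5) by (simp add: nth_butlast nth_tl)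
  have "set (butlast (tl ss)) = {butlast (tl ss) ! i |i. i < n - 1}" using parts(5) by (auto simp: set_conv_nth)
  also have "... = {ss ! Suc i |i. i < n - 1}" using nth by (metis (lifting))
  also have "... = {ss ! i |i. 1 <= i & i < n}"
 proof (intro equalityI subsetI)
  fix a assume "a : {ss ! i |i. 1 <= i & i < n}"
  then obtain i where "a = ss ! i" "1 <= i" "i < n" by auto
  thus "a : {ss ! Suc i |i. i < n - 1}" by (intro CollectI exI[of _ "i - 1"]) auto
 qed fastforce
  finally show ?thesis .
 qed
 ultimately show ?thesis by (simp add: inside_across_def)
qed

lemma inner_regs: "iregs I = W ` {1..<n}"
proof -
 have "iregs I = {rreg D (bs ! j) |j. Suc j < n}" by (simp add: inside_across_def)
 also have "... = W ` {1..<n}"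
 proof (intro equalityI subsetI)
  fix r assume "r : {rreg D (bs ! j) |j. Suc j < n}"
  then obtain j where "r = rreg D (bs ! j)" "Suc j < n" by auto
  thus "r : W ` {1..<n}" using beam_sides(2)[of j] by (intro image_eqI[of _ _ "Suc j"]) auto
 next
  fix r assume "r : W ` {1..<n}"
  then obtain i where i: "r = W i" "1 <= i" "i < n" by auto
  then obtain j where "i = Suc j" by (cases i) auto
  thus "r : {rreg D (bs ! j) |j. Suc j < n}" using i beam_sides(2)[of j] by (intro CollectI exI[of _ j]) simp
 qed
 finally show ?thesis .
qed

lemma bounded_W:
 assumes "1 <= i" "i < n"
 shows "bounded_by D (W i) {(bs ! (i - 1), R), (bs ! i, L), (ss ! i, toward up lr)}"
proof -
 obtain j where j: "i = Suc j" using assms by (cases i) auto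
 thus ?thesis using parts(10)[of j] beam_sides(2)[of j] assms by simp
qed

lemma outside_regs:
 assumes "a : arcs D" "a ~: iarcs I"
 shows "lreg D a ~: iregs I" "rreg D a ~: iregs I"
proof -
 have "lreg D a ~= W i & rreg D a ~= W i" if i: "1 <= i" "i < n" for i
 proof -
  have "a ~= bs ! (i - 1)" "a ~= bs ! i" "a ~= ss ! i" using assms(2) i unfolding inner_arcs by auto
  thus ?thesis using bounded_side[OF bounded_W[OF i] assms(1)] by auto
 qed
 note away = this
 show "lreg D a ~: iregs I"
 proof
  assume "lreg D a : iregs I"
  then obtain i where "i : {1..<n}" "lreg D a = W i" unfolding inner_regs by (rule imageE)
  thus False using away[of i] by simp
 qed
 show "rreg D a ~: iregs I"
 proof
  assume "rreg D a : iregs I"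
  then obtain i where "i : {1..<n}" "rreg D a = W i" unfolding inner_regs by (rule imageE)
  thus False using away[of i] by simp
 qed
qed

lemma W_distinct:
 assumes i: "1 <= i" "i < n" and l: "l <= n"
 shows "W l = W i ==> l = i" "V l ~= W i"
proof -
 have a: "ss ! l : arcs D" using parts(4,5) l by (auto intro!: subsetD[OF parts(4)])
 have b: "ss ! l ~= bs ! (i - 1)" "ss ! l ~= bs ! i" using beam_neq(1)[of "i - 1" l] beam_neq(1)[of i l] i l by auto
 note s = bounded_side[OF bounded_W[OF i] a]
 show "W l = W i ==> l = i" using s b strand_neq(1)[OF i l] by (cases "toward up lr") auto
 show "V l ~= W i" using s b by (auto simp: toward_def away_def)
qed

lemma outside_arcs:
 "hd ss : arcs D - iarcs I" "last ss : arcs D - iarcs I" "j < n ==> es ! j : arcs D - iarcs I"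
 "up ==> j < length (ins D v) ==> ins D v ! j : arcs D - iarcs I"
proof -
 have ends: "ss ! l : arcs D - iarcs I" if "l = 0 \<or> l = n" for l
 proof -
  have "ss ! l : arcs D" using parts(4,5) that by (auto intro!: subsetD[OF parts(4)])
  moreover have "ss ! l ~: iarcs I" unfolding inner_arcs using beam_neq(1)[of _ l] strand_neq(1)[of _ l] that by force
  ultimately show ?thesis by simp
 qed
 show "hd ss : arcs D - iarcs I" "last ss : arcs D - iarcs I" unfolding parts(14,15) using ends by auto
 show "es ! j : arcs D - iarcs I" if j: "j < n"
 proof -
  have "es ! j : arcs D" using slots_lr(3,4)[OF j] slots_rl(3,4)[OF j] slot_arcs(1)[OF D x_in[OF j]] by (cases lr; cases up) auto
  thus ?thesis unfolding inner_arcs using beam_neq(2)[of _ j] strand_neq(2)[of _ j] j by force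
 qed
 show "ins D v ! j : arcs D - iarcs I" if j: "up" "j < length (ins D v)"
 proof -
  have "ins D v ! j : arcs D" using slot_arcs(2)[OF D parts(1) j(2)] .
  thus ?thesis unfolding inner_arcs using beam_neq(3)[of _ j] strand_neq(3)[of _ j] j by force
 qed
qed

lemma local_slots:
 assumes "a : iarcs I"
 shows "EX s:in_slots D. in_arc D s = a & inner_slot I {v} s" "EX s:out_slots D. out_arc D s = a & inner_slot I {v} s"
proof -
 have xI: "xs ! j : idpts I" if "j < n" for j using that by (simp add: inside_across_def)
 have "(EX s:in_slots D. in_arc D s = a & inner_slot I {v} s) & (EX s:out_slots D. out_arc D s = a & inner_slot I {v} s)"
 using assms unfolding inner_arcs
 proof
  assume "a : {bs ! j |j. j < n}"
  then obtain j where j: "j < n" "a = bs ! j" by auto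
  show ?thesis
 proof (cases up)
  case True
  hence "a = outs D v ! j" "j < length (outs D v)" "a = se D (xs ! j) \<or> a = sw D (xs ! j)"
 using j len slots_lr(3)[OF j(1)] slots_rl(3)[OF j(1)] by (cases lr; simp add: beams_def)+
  thus ?thesis using local_inI(1)[OF x_in[OF j(1)] xI[OF j(1)], of a "{v}"] local_outI(2)[OF parts(1), of "{v}" j a I] by auto
 next
  case False
  hence "a = ins D v ! j" "j < length (ins D v)" "a = ne D (xs ! j) \<or> a = nw D (xs ! j)"
 using j len slots_lr(4)[OF j(1)] slots_rl(4)[OF j(1)] by (cases lr; simp add: beams_def)+
  thus ?thesis using local_outI(1)[OF x_in[OF j(1)] xI[OF j(1)], of a "{v}"] local_inI(2)[OF parts(1), of "{v}" j a I] by auto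
 qed
 next
  assume "a : {ss ! i |i. 1 <= i & i < n}"
  then obtain i where i: "1 <= i" "i < n" "a = ss ! i" by auto
  then obtain i' where i': "i = Suc i'" "i' < n" by (cases i) auto
  show ?thesis using local_inI(1)[OF x_in[OF i(2)] xI[OF i(2)], of a "{v}"] local_inI(1)[OF x_in[OF i'(2)] xI[OF i'(2)], of a "{v}"]
  local_outI(1)[OF x_in[OF i(2)] xI[OF i(2)], of a "{v}"] local_outI(1)[OF x_in[OF i'(2)] xI[OF i'(2)], of a "{v}"]
  slots_lr(1)[OF i(2)] slots_lr(2)[OF i'(2)] slots_rl(1)[OF i(2)] slots_rl(2)[OF i'(2)] i i' by (cases lr) auto
 qed
 thus "EX s:in_slots D. in_arc D s = a & inner_slot I {v} s" "EX s:out_slots D. out_arc D s = a & inner_slot I {v} s" by blast+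
qed

end

context strand_across
begin

abbreviation "low \<equiv> low_arcs D up v es"
abbreviation "total_color \<equiv> int (sum_list (map (color D) low))"

definition outer_value :: region_poly where
 "outer_value = strand_value (zc (strand_weight lr over (color D (hd ss)))) (beam_weight over (nat total_color))
  (zreg (side_reg D (upper lr) (hd ss))) (zreg (side_reg D (upper lr) (last ss)))
  (%l. zc (thalf powi (- int (color D (low ! l))))) (%l. zc (thalf powi (int (color D (low ! l)))))
  (%l. zreg (low_reg D low l)) (length low)"

lemma sum_list_int: "int (sum_list (map (color D) as)) = (SUM l<length as. int (color D (as ! l)))"
 by (induction as) (simp_all del: sum.lessThan_Suc add: sum.lessThan_Suc_shift)

lemma total_color: "(SUM j<n. int (color D (bs ! j))) = total_color" "length low = length (ins D v)"
 "l < length low ==> color D (low ! l) = color D (ins D v ! l)"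
proof -
 show len': "length low = length (ins D v)" using len parts(6) by (simp add: low_arcs_def)
 show "l < length low ==> color D (low ! l) = color D (ins D v ! l)" unfolding low_arcs_def
 using len beam_sides(5)[of l] by (cases up) (simp_all add: beams_def parts(6))
 have bal: "sum_list (map (color D) (ins D v)) = sum_list (map (color D) (outs D v))" using D parts(1) by (auto simp: moy_diagram_def vert_ok_def)
 show "(SUM j<n. int (color D (bs ! j))) = total_color"
 proof (cases up)
  case True
  thus ?thesis using bal sum_list_int[of "outs D v"] len by (simp add: low_arcs_def beams_def)
 next
  case False
  have "(SUM j<n. int (color D (bs ! j))) = (SUM j<n. int (color D (es ! j)))" using beam_sides(5) by (intro sum.cong) auto
  thus ?thesis using False sum_list_int[of es] parts(6) by (simp add: low_arcs_def)
 qed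
qed

lemma beam_weight_prod: "(PROD j<n. beam_weight over (color D (bs ! j))) = beam_weight over (nat total_color)"
proof -
 have "(PROD j<n. beam_weight over (color D (bs ! j))) = zc (thalf powi (SUM j<n. if over then 0 else 2 * int (color D (bs ! j))))"
 unfolding beam_weight_def by (rule prod_zc_powi)
 also have "(SUM j<n. if over then 0 else 2 * int (color D (bs ! j))) = (if over then 0 else 2 * total_color)"
 using total_color(1) by (simp add: sum_distrib_left[symmetric])
 finally show ?thesis by (simp add: beam_weight_def)
qed

lemma low_regs:
 "l < length low ==> lreg D (low ! l) = low_reg D low l" "l < length low ==> rreg D (low ! l) = low_reg D low (Suc l)"
 "low_reg D low 0 = B 0" "low_reg D low (length low) = B n"
 "~ up ==> l <= n ==> low_reg D low l = B l"
proof -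
 show "l < length low ==> lreg D (low ! l) = low_reg D low l" by (simp add: low_reg_def)
 have fan: "fan D (wreg D v) (ins D v) (ereg D v)" using D parts(1) by (auto simp: moy_diagram_def vert_ok_def)
 have ne: "low ~= []" using total_color(2) edges by auto
 have down: "lreg D (low ! l) = B l & rreg D (low ! l) = B (Suc l)" if "~ up" "l < n" for l unfolding low_arcs_def
 using that beam_sides(3,4)[of l] by (auto simp: away_def upper_def split: if_splits)
 show "rreg D (low ! l) = low_reg D low (Suc l)" if l: "l < length low"
 proof (cases "Suc l < length low")
  case True
  show ?thesis
 proof (cases up)
  case up: True
  thus ?thesis using fan_nth[OF fan, of l] True by (simp add: low_reg_def low_arcs_def)
 next
  case False
  hence "low = es" "length low = n" using parts(6) by (simp_all add: low_arcs_def)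
  thus ?thesis using down[OF False, of l] down[OF False, of "Suc l"] True by (simp add: low_reg_def)
 qed
 next
  case False
  hence "l = length low - 1" using l by simp
  thus ?thesis using ne False l by (simp add: low_reg_def last_conv_nth)
 qed
 show *: "low_reg D low l = B l" if "~ up" "l <= n" for l
 proof -
  have ll: "length low = n" using that parts(6) by (simp add: low_arcs_def)
  show ?thesis
 proof (cases "l < n")
  case True
  thus ?thesis using down[OF that(1)] ll by (simp add: low_reg_def)
 next
  case False
  hence "l = n" "last low = low ! (n - 1)" "n - 1 < n" using that ll ne parts(13) by (simp_all add: last_conv_nth)
  thus ?thesis using down[OF that(1), of "n - 1"] ll parts(13) by (simp add: low_reg_def)
 qed
 qed
 have upB: "W l = B l" if up for l using that by (simp add: toward_def upper_def)
 show "low_reg D low 0 = B 0"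
 proof (cases up)
  case True
  thus ?thesis using fan_zero[OF fan edges(1)] parts(11) upB edges(1) by (simp add: low_reg_def low_arcs_def)
 qed (use * in simp)
 show "low_reg D low (length low) = B n"
 proof (cases up)
  case True
  thus ?thesis using fan_last[OF fan edges(1)] parts(12) upB edges(1) by (simp add: low_reg_def low_arcs_def last_conv_nth)
 next
  case False
  hence "length low = n" using parts(6) by (simp add: low_arcs_def)
  thus ?thesis using * False by simp
 qed
qed

lemma strand_rows:
 "(PROD x:set xs. zrow D (Dbl x)) = zc (thalf powi (if ~ lr & ~ over then - (2 * total_color) else 0)) *
  (PROD j<n. strand_row (zc (strand_weight lr over (color D (hd ss)))) (%j. beam_weight over (color D (bs ! j))) (%j. zreg (T j)) (%j. zreg (B j)) j)"
proof -
 have "(PROD x:set xs. zrow D (Dbl x)) = (PROD j<n. zrow D (Dbl (xs ! j)))"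
 by (rule prod.reindex_bij_betw[symmetric]) (rule bij_betw_nth[OF parts(2)], auto)
 also have "... = (PROD j<n. zc (thalf powi (if ~ lr & ~ over then - (2 * int (color D (bs ! j))) else 0)) *
  strand_row (zc (strand_weight lr over (color D (hd ss)))) (%j. beam_weight over (color D (bs ! j))) (%j. zreg (T j)) (%j. zreg (B j)) j)"
 proof (rule prod.cong[OF refl])
  fix j assume "j : {..<n}"
  hence j: "j < n" by simp
  show "zrow D (Dbl (xs ! j)) = zc (thalf powi (if ~ lr & ~ over then - (2 * int (color D (bs ! j))) else 0)) *
  strand_row (zc (strand_weight lr over (color D (hd ss)))) (%j. beam_weight over (color D (bs ! j))) (%j. zreg (T j)) (%j. zreg (B j)) j"
 unfolding strand_row_def strand_color[OF less_imp_le[OF j], symmetric] by (rule crossing_row(7)[OF D x_in[OF j] parts(9)[OF j] parts(8)[OF j]])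
 qed
 also have "... = (PROD j<n. zc (thalf powi (if ~ lr & ~ over then - (2 * int (color D (bs ! j))) else 0))) *
  (PROD j<n. strand_row (zc (strand_weight lr over (color D (hd ss)))) (%j. beam_weight over (color D (bs ! j))) (%j. zreg (T j)) (%j. zreg (B j)) j)"
 by (rule prod.distrib)
 also have "(PROD j<n. zc (thalf powi (if ~ lr & ~ over then - (2 * int (color D (bs ! j))) else 0))) =
  (zc (thalf powi (if ~ lr & ~ over then - (2 * total_color) else 0)) :: region_poly)"
 unfolding prod_zc_powi total_color(1)[symmetric] by (simp add: sum_negf sum_distrib_left)
 finally show ?thesis .
qed

lemma circ_rows:
 assumes "!!l. l < length low ==> lreg D (ins D v ! l) = X l" "!!l. l < length low ==> rreg D (ins D v ! l) = X (Suc l)"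
 shows "(PROD l<length (ins D v). zrow D (Circ v l)) =
  (PROD l<length low. (zc (thalf powi (- int (color D (low ! l)))) - zc (thalf powi (int (color D (low ! l))))) * zvar (Disc v)
  + zc (thalf powi (- int (color D (low ! l)))) * zreg (X l) + zc (thalf powi (int (color D (low ! l)))) * zreg (X (Suc l)))"
 unfolding total_color(2)[symmetric] by (rule prod.cong[OF refl]) (simp add: zrow_Circ circ_row_def Let_def assms total_color(3) zc_hom)

lemma free_weights: "free N (beam_weight over c)" "free N (zc c')" by (simp_all add: beam_weight_def free_zc)

text \<open>Both positions of the strand give the same value, expressed by the regions above the ends of the strand and by the arcs below it. The colours that enter and leave balance, so the total weights of the beams agree as well.\<close>

lemma value_extract:
 "extracts (Regular ` iregs I Un Disc ` {v}) (PROD C:inner_cr D I {v}. zrow D C)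
  (zc (thalf powi (if ~ lr & ~ over then - (2 * total_color) else 0)) * outer_value)"
proof -
 define rh q where "rh = (zc (strand_weight lr over (color D (hd ss))) :: region_poly)"
  and "q = (%j. beam_weight over (color D (bs ! j)))"
 define w e :: "nat => region_poly" where "w = (%l. zc (thalf powi (- int (color D (low ! l)))))"
  and "e = (%l. zc (thalf powi (int (color D (low ! l)))))"
 let ?K = "zc (thalf powi (if ~ lr & ~ over then - (2 * total_color) else 0)) :: region_poly"
 let ?S = "PROD j<n. strand_row rh q (%j. zreg (T j)) (%j. zreg (B j)) j"
 let ?C = "PROD l<length (ins D v). zrow D (Circ v l)"
 have Q: "(PROD j<n. q j) = beam_weight over (nat total_color)" unfolding q_def by (rule beam_weight_prod)
 have inner: "(PROD C:inner_cr D I {v}. zrow D C) = ?K * (?S * ?C)"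
 using inner_prod[of I D v] strand_rows by (simp add: inside_across_def rh_def q_def mult.assoc)
 have cst: "free N rh" "free N (q j)" "free N (w j)" "free N (e j)" for N j unfolding rh_def q_def w_def e_def by (rule free_weights)+
 have regs: "Regular ` iregs I = (%i. Regular (W i)) ` {1..<n}" unfolding inner_regs by (simp add: image_image)
 have ov: "outer_value = strand_value rh (beam_weight over (nat total_color)) (zreg (T 0)) (zreg (T n)) w e (%l. zreg (low_reg D low l)) (length low)"
 unfolding outer_value_def rh_def w_def e_def parts(14,15) ..
 have "extracts (Regular ` iregs I Un {Disc v}) (?S * ?C) outer_value"
 proof (cases up)
  case True
  have WV: "W l = B l" "V l = T l" for l using True by (auto simp: toward_def away_def upper_def)
  define E where "E = rh * (zreg (T 0) - (PROD j<n. q j) * zreg (T n)) + zreg (B 0) + (PROD j<n. q j) * zreg (B n)"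
  have S: "extracts (Regular ` iregs I) ?S E" unfolding regs WV E_def
 by (rule strand_above_extract[where t = "%l. Regular (T l)" and b = "%l. Regular (B l)" and n = n])
  (use cst W_distinct parts(13) in \<open>auto simp: WV Suc_le_eq\<close>)
  have lowins: "low = ins D v" using True by (simp add: low_arcs_def)
  have C: "?C = (PROD l<length low. (w l - e l) * zvar (Disc v) + w l * zreg (low_reg D low l) + e l * zreg (low_reg D low (Suc l)))"
 unfolding w_def e_def by (rule circ_rows) (use low_regs(1,2) lowins in auto)
  have lr_out: "low_reg D low l ~: iregs I" if ll: "l <= length low" for l
 proof (cases "l < length low")
  case l: True
  thus ?thesis using outside_arcs(4)[OF True] outside_regs(1) lowins low_regs(1)[OF l] by (metis DiffD1 DiffD2)
 next
  case False
  then obtain l' where l': "l = Suc l'" "l' < length low" using ll edges lowins by (cases l) auto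
  thus ?thesis using outside_arcs(4)[OF True] outside_regs(2) lowins low_regs(2)[OF l'(2)] by (metis DiffD1 DiffD2)
 qed
  have fC: "free (Regular ` iregs I) ?C" unfolding C by (intro free_prod free_intros cst) (use lr_out in auto)
  have fE: "free {Disc v} E" unfolding E_def by (intro free_intros cst free_prod) auto
  have "extracts {Disc v} (E * ?C) (E * vertex_coef w e (%l. zreg (low_reg D low l)) (length low))"
 unfolding C by (rule extracts_disc) (auto intro!: cst fE free_zvar)
  moreover have "E * vertex_coef w e (%l. zreg (low_reg D low l)) (length low) = outer_value" unfolding ov strand_value_def E_def Q low_regs(3,4) ..
  ultimately have "extracts {Disc v} (E * ?C) outer_value" by simp
  thus ?thesis by (rule extracts_step[OF S fC]) auto
 next
  case False
  have WV: "W l = T l" "V l = B l" for l using False by (auto simp: toward_def away_def upper_def)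
  have ll: "length low = n" using False parts(6) by (simp add: low_arcs_def)
  have bins: "bs = ins D v" using False by (simp add: beams_def)
  have C: "?C = (PROD l<n. (w l - e l) * zvar (Disc v) + w l * zreg (T l) + e l * zreg (T (Suc l)))"
 unfolding w_def e_def ll[symmetric] by (rule circ_rows) (use beam_sides(1,2) ll bins WV in auto)
  have col: "color D (bs ! l) = color D (low ! l)" if "l < n" for l using that total_color(3)[of l] ll bins by simp
  define q' where "q' = (%j. beam_weight over (color D (low ! j)))"
  have qq: "q j = q' j" if "j < n" for j using col[OF that] by (simp add: q_def q'_def)
  define kp :: region_poly where "kp = (if over then 1 else 0)"
  have ou: "(ALL l. q' l = 1) & kp = 1 \<or> (ALL l. e l = q' l * w l) & kp = 0"
 proof (cases over)
  case True
  thus ?thesis by (simp add: q'_def beam_weight_def kp_def zc_hom)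
 next
  case no: False
  have "e l = q' l * w l" for l unfolding e_def q'_def w_def beam_weight_def using no
 by (simp add: zc_hom(6)[symmetric] thalf_powi_add[symmetric] del: power_int_of_nat)
  thus ?thesis using no by (simp add: kp_def)
 qed
  have S: "?S = (PROD j<n. strand_row rh q' (%j. zreg (T j)) (%j. zreg (B j)) j)" by (rule prod.cong) (auto simp: strand_row_def qq)
  define val where "val = strand_value rh (PROD l<n. q' l) (zreg (T 0)) (zreg (T n)) w e (%l. zreg (B l)) n"
  define rest where "rest = (PROD l<n. zreg (B l) + q' l * zreg (B (Suc l))) * ((PROD l<n. e l) * zreg (T n) + (PROD l<n. w l) * zreg (T 0))
  - kp * (rh * zreg (T 0) * zreg (T n) * vertex_coef w e (%l. zreg (B l)) n)"
  have cst': "free N (q' j)" "free N kp" for N j unfolding q'_def kp_def using free_weights free_zero free_one by auto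
  have e1: "extracts (Regular ` iregs I) (?S * ?C) (zvar (Disc v) * val + rest)" unfolding S C prod.distrib[symmetric] regs WV val_def rest_def
 by (rule strand_below_extract[where t = "%l. Regular (T l)" and b = "%l. Regular (B l)" and m = n])
  (use cst cst' W_distinct parts(13) ou in \<open>auto simp: WV Suc_le_eq\<close>)
  have fr: "free {Disc v} rest" unfolding rest_def by (intro free_intros free_prod free_vertex_coef cst cst') auto
  have "extracts (Regular ` iregs I Un {Disc v}) (?S * ?C) val" by (rule extracts_chain[OF e1 extracts_var[OF fr]]) auto
  moreover have "val = outer_value"
 proof -
  have "(PROD l<n. q' l) = (PROD l<n. q l)" by (rule prod.cong) (auto simp: qq)
  moreover have "vertex_coef w e (%l. zreg (B l)) k = vertex_coef w e (%l. zreg (low_reg D low l)) k" if "k <= n" for k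
 using that low_regs(5)[OF False] by (induction k) (auto intro!: prod.cong)
  ultimately show ?thesis unfolding val_def ov Q strand_value_def ll using low_regs(5)[OF False, of 0] low_regs(5)[OF False, of n] by simp
 qed
  ultimately show ?thesis by simp
 qed
 thus ?thesis unfolding inner by (simp add: extracts_scale)
qed

end

lemma push_vertex_coef:
 assumes "finite U"
 shows "push U g (vertex_coef w e X m) = vertex_coef (%l. push U g (w l)) (%l. push U g (e l)) (%l. push U g (X l)) m"
proof (induction m)
 case 0
 thus ?case using push_zc[of U g 0] by (simp add: zc_hom)
next
 case (Suc m)
 thus ?case by (simp add: push_add push_diff push_mult[OF assms] push_prod[OF assms])
qed

lemma vertex_coef_cong:
 "(!!l. l < m ==> w l = w' l) ==> (!!l. l < m ==> e l = e' l) ==> (!!l. l <= m ==> X l = X' l) ==>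
  vertex_coef w e X m = vertex_coef w' e' X' m" by (induction m) (auto intro!: prod.cong arg_cong2[of _ _ _ _ "(+)"] arg_cong2[of _ _ _ _ "(*)"])

text \<open>All edges at such a vertex have colour zero, and then the corner N has weight zero.\<close>

lemma state_total_dead_end:
 assumes D: "moy_diagram D" and v: "v : verts D" "ins D v = [] \<or> outs D v = []" and d: "dl : arcs D"
 shows "state_total D dl = 0"
proof -
 have "state_A D s = 0" if s: "s : states D dl" for s
 proof -
  have "ins D v ~= []" using states_nonempty(3)[OF D d _ v(1)] s by auto
  hence "outs D v = []" using v by simp
  moreover have "sum_list (map (color D) (ins D v)) = sum_list (map (color D) (outs D v))" using D v by (auto simp: moy_diagram_def vert_ok_def)
  ultimately have col: "color D (ins D v ! j) = 0" if "j < length (ins D v)" for j using that by auto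
  have bij: "bij_betw (%C. corner_region D C (s C)) (Cr D) (Re D - {Regular (lreg D dl), Regular (rreg D dl)})" using s by (simp add: states_def)
  have "Disc v : Re D - {Regular (lreg D dl), Regular (rreg D dl)}" using v by (auto simp: Re_def)
  then obtain C where C: "C : Cr D" "corner_region D C (s C) = Disc v" using bij_betw_imp_surj_on[OF bij] by (metis (no_types, lifting) imageE)
  have "s C : corners C" using s C by (auto simp: states_def)
  then obtain j where "C = Circ v j" "s C = North" "j < length (ins D v)" using C by (cases C; cases "s C") (auto simp: Cr_def)
  hence "weight_A D C (s C) = 0" using col by simp
  thus ?thesis unfolding state_A_def using C finite_Cr[OF D] by (auto intro!: prod_zero)
 qed
 thus ?thesis by (simp add: state_total_def)
qed

lemma same_bracket_move4:
 assumes D: "moy_diagram D" "moy_diagram D'" and m: "move4 D D'"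
 shows "same_bracket D D'"
proof -
 obtain v up lr over xs ss es xs' ss' es' f g h k where
  ac: "across D v up lr over xs ss es" and ac': "across D' (k v) (~ up) lr over xs' ss' es'"
  and xs: "xs = [] --> xs' = []"
  and agree: "agree_outside D (inside_across D v up xs ss) D' (inside_across D' (k v) (~ up) xs' ss') {v} f g h k"
  and es: "beams D' up (k v) = map f es" "es' = map f (beams D (~ up) v)"
  and ends: "hd ss' = f (hd ss)" "last ss' = f (last ss)"
  and g: "identifies g (regs D - iregs (inside_across D v up xs ss))
  (if xs' = [] then {(side_reg D (away up lr) (hd ss), side_reg D (away up lr) (last ss))} else {})"
 using m unfolding move4_def by (elim exE conjE) metis
 let ?I = "inside_across D v up xs ss" and ?I' = "inside_across D' (k v) (~ up) xs' ss'"
 have lens: "length (beams D up v) = length xs" "length es = length xs" "length es' = length xs'" "length (beams D' (~ up) (k v)) = length xs'"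
  and vv: "v : verts D" "k v : verts D'" using ac ac' by (auto simp: across_def)
 show ?thesis
 proof (cases "xs' = []")
  case True
  have "beams D (~ up) v = []" "beams D' (~ up) (k v) = []" using lens es True by auto
  hence e: "ins D v = [] \<or> outs D v = []" "ins D' (k v) = [] \<or> outs D' (k v) = []" by (auto simp: beams_def split: if_splits)
  have "card (verts D) = card (verts D')" using agree unfolding agree_outside_def by (meson bij_betw_same_card)
  thus ?thesis using same_bracket_zero[OF D] state_total_dead_end[OF D(1) vv(1) e(1)] state_total_dead_end[OF D(2) vv(2) e(2)] by blast
 next
  case False
  hence nonempty: "xs ~= []" "xs' ~= []" using xs by auto
  have "beams D up v ~= []" "beams D (~ up) v ~= []" "beams D' up (k v) ~= []" "beams D' (~ up) (k v) ~= []" using lens es nonempty by auto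
  hence edges: "ins D v ~= []" "outs D v ~= []" "ins D' (k v) ~= []" "outs D' (k v) ~= []" by (auto simp: beams_def split: if_splits)
  interpret A: strand_across D v up lr over xs ss es by unfold_locales (use D ac edges in auto)
  interpret A': strand_across D' "k v" "~ up" lr over xs' ss' es' by unfold_locales (use D ac' edges in auto)
  have ginj: "inj_on g (regs D - iregs ?I)" using g nonempty identifies_inj by simp
  interpret replacement D D' ?I ?I' "{v}" f g h k
 proof unfold_locales
  show "agree_outside D ?I D' ?I' {v} f g h k" by (rule agree)
  show "idpts ?I \<subseteq> dpts D" "idpts ?I' \<subseteq> dpts D'" using A.parts(3) A'.parts(3) by (auto simp: inside_across_def)
  show "iregs ?I \<subseteq> regs D"
 proof
  fix r assume "r : iregs ?I"
  then obtain i where "i : {1..<length xs}" "r = A.W i" unfolding A.inner_regs by (rule imageE)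
  thus "r : regs D" using bounded_in_regs[OF A.bounded_W[of i]] by simp
 qed
  show "iregs ?I' \<subseteq> regs D'"
 proof
  fix r assume "r : iregs ?I'"
  then obtain i where "i : {1..<length xs'}" "r = A'.W i" unfolding A'.inner_regs by (rule imageE)
  thus "r : regs D'" using bounded_in_regs[OF A'.bounded_W[of i]] by simp
 qed
  show "EX s:in_slots D. in_arc D s = a & inner_slot ?I {v} s" "EX s:out_slots D. out_arc D s = a & inner_slot ?I {v} s"
  if "a : iarcs ?I" for a using A.local_slots[OF that] .
  show "lreg D a ~: iregs ?I & rreg D a ~: iregs ?I" if "a : arcs D" "a ~: iarcs ?I" for a using A.outside_regs that by simp
 qed (use D vv in auto)
  obtain dl where d: "dl : arcs D - iarcs ?I" "color D dl ~= 0"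
 proof -
  obtain a where a: "a : arcs D" "color D a ~= 0" using D(1) by (auto simp: moy_diagram_def)
  show thesis
 proof (cases "a : iarcs ?I")
  case True
  then consider j where "a = beams D up v ! j" "j < length xs" | i where "a = ss ! i" "i < length xs" unfolding A.inner_arcs by auto
  thus thesis
 proof cases
  case 1
  thus thesis using that[OF A.outside_arcs(3)[OF 1(2)]] A.beam_sides(5)[OF 1(2)] a by simp
 next
  case 2
  thus thesis using that[OF A.outside_arcs(1)] A.strand_color[of i] a by simp
 qed
 next
  case False
  thus thesis using that[of a] a by simp
 qed
 qed
  have low': "A'.low = map f A.low" using es by (auto simp: low_arcs_def beams_def split: if_splits)
  have low_out: "A.low ! l : arcs D - iarcs ?I" if "l < length A.low" for l using that A.outside_arcs(3)[of l] A.outside_arcs(4)[of l] A.parts(6)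
 by (cases up) (auto simp: low_arcs_def)
  have low_col: "color D' (A'.low ! l) = color D (A.low ! l)" if "l < length A.low" for l using low_out[OF that] agreeD(6) that by (simp add: low')
  have low_ne: "A.low ~= []" using A.total_color(2) edges by auto
  have low_last: "last A.low = A.low ! (length A.low - 1)" "length A.low - 1 < length A.low" using low_ne by (simp_all add: last_conv_nth)
  have lowreg: "low_reg D' A'.low l = g (low_reg D A.low l)" "low_reg D A.low l : regs D - iregs ?I" for l
 proof -
  have m: "last A'.low = f (last A.low)" using low_ne by (simp add: low' last_map)
  have lst: "last A.low : arcs D - iarcs ?I" using low_out[OF low_last(2)] low_last(1) by simp
  show "low_reg D' A'.low l = g (low_reg D A.low l)" using low_out[of l] lst agreeD(6) unfolding low_reg_def m by (auto simp: low')
  show "low_reg D A.low l : regs D - iregs ?I" using arc_sides[OF low_out[of l]] arc_sides[OF lst] unfolding low_reg_def by auto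
 qed
  have tot: "A'.total_color = A.total_color"
 proof -
  have "map (color D') A'.low = map (color D) A.low" by (rule nth_equalityI) (use low_col in \<open>auto simp: low'\<close>)
  thus ?thesis by simp
 qed
  have end_regs: "side_reg D' s (hd ss') = g (side_reg D s (hd ss))" "side_reg D' s (last ss') = g (side_reg D s (last ss))"
  "side_reg D s (hd ss) : regs D - iregs ?I" "side_reg D s (last ss) : regs D - iregs ?I" for s
 using ends agreeD(6) A.outside_arcs(1,2) arc_sides[OF A.outside_arcs(1)] arc_sides[OF A.outside_arcs(2)] by (cases s; auto)+
  have ccol: "color D' (hd ss') = color D (hd ss)" using ends agreeD(6) A.outside_arcs(1) by auto
  define U where "U = Re D - (Regular ` iregs ?I Un Disc ` {v})"
  have finU: "finite U" using finite_Re[OF D(1)] by (simp add: U_def)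
  have pr: "push U rmap (zreg r) = zreg (g r)" if "r : regs D - iregs ?I" for r unfolding U_def using that by (intro push_reg) auto
  have vc: "vertex_coef (%l. zc (thalf powi (- int (color D (A.low ! l))))) (%l. zc (thalf powi (int (color D (A.low ! l))))) (%l. zreg (g (low_reg D A.low l))) (length A.low) =
  vertex_coef (%l. zc (thalf powi (- int (color D' (A'.low ! l))))) (%l. zc (thalf powi (int (color D' (A'.low ! l))))) (%l. zreg (g (low_reg D A.low l))) (length A.low)"
 by (rule vertex_coef_cong) (simp_all add: low_col)
  have pv: "push U rmap A.outer_value = A'.outer_value" unfolding A.outer_value_def A'.outer_value_def strand_value_def beam_weight_def
 unfolding push_mult[OF finU] push_add push_diff push_zc push_vertex_coef[OF finU] pr[OF end_regs(3)] pr[OF end_regs(4)] pr[OF lowreg(2)]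
  ccol tot lowreg(1) end_regs(1,2) vc by (simp add: low')
  let ?K = "thalf powi (if ~ lr & ~ over then - (2 * A.total_color) else 0)"
  have "state_total D dl = 1 * state_total D' (f dl)"
 proof (rule total_transfer[where Y = "{v}"])
  show "extracts (Regular ` iregs ?I Un Disc ` {v}) (PROD C:inner_cr D ?I {v}. zrow D C) (zc ?K * A.outer_value)" by (rule A.value_extract)
  show "extracts (Regular ` iregs ?I' Un Disc ` k ` {v}) (PROD C:inner_cr D' ?I' (k ` {v}). zrow D' C) (zc ?K * A'.outer_value)"
 using A'.value_extract unfolding tot by simp
  show "push (Re D - (Regular ` iregs ?I Un Disc ` {v})) rmap (zc ?K * A.outer_value) = zc 1 * (zc ?K * A'.outer_value)"
 unfolding U_def[symmetric] push_mult[OF finU] push_zc pv zc_hom(2) by simp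
 qed (use d ginj in auto)
  thus ?thesis using same_bracketI[OF d, of 0] by simp
 qed
qed

section \<open>Laurent polynomials with non-negative coefficients\<close>

lemma nonneg_laurentI: "finite K ==> (SUM k:K. of_nat (c k) * thalf powi k) : nonneg_laurent" unfolding nonneg_laurent_def by blast

lemma nonneg_zero: "0 : nonneg_laurent" using nonneg_laurentI[of "{}" "%_. 0"] by simp

lemma nonneg_powi: "thalf powi k : nonneg_laurent" using nonneg_laurentI[of "{k}" "%_. 1"] by simp

lemma nonneg_add:
 assumes "p : nonneg_laurent" "q : nonneg_laurent"
 shows "p + q : nonneg_laurent"
proof -
 obtain K c where p: "p = (SUM k:K. of_nat (c k) * thalf powi k)" "finite K" using assms(1) unfolding nonneg_laurent_def by blast
 obtain J d where q: "q = (SUM k:J. of_nat (d k) * thalf powi k)" "finite J" using assms(2) unfolding nonneg_laurent_def by blast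
 have "p = (SUM k:K Un J. of_nat (if k : K then c k else 0) * thalf powi k)" unfolding p(1) using p(2) q(2) by (intro sum.mono_neutral_cong_left) auto
 moreover have "q = (SUM k:K Un J. of_nat (if k : J then d k else 0) * thalf powi k)"
 unfolding q(1) using p(2) q(2) by (intro sum.mono_neutral_cong_left) auto
 ultimately have pq: "p + q = (SUM k:K Un J. of_nat ((if k : K then c k else 0) + (if k : J then d k else 0)) * thalf powi k)"
 by (simp only: sum.distrib[symmetric] of_nat_add distrib_right)
 show ?thesis unfolding pq by (rule nonneg_laurentI) (use p(2) q(2) in simp)
qed

lemma nonneg_sum: "(!!x. x : S ==> f x : nonneg_laurent) ==> (SUM x:S. f x) : nonneg_laurent"
 by (induction S rule: infinite_finite_induct) (auto intro: nonneg_zero nonneg_add)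

lemma nonneg_powi_mult:
 assumes "p : nonneg_laurent"
 shows "thalf powi m * p : nonneg_laurent"
proof -
 obtain K c where p: "p = (SUM k:K. of_nat (c k) * thalf powi k)" "finite K" using assms(1) unfolding nonneg_laurent_def by blast
 have "thalf powi m * p = (SUM k:K. of_nat (c k) * thalf powi (m + k))" unfolding p(1) by (simp add: sum_distrib_left thalf_powi_add mult_ac)
 also have "... = (SUM k:(%k. m + k) ` K. of_nat (c (k - m)) * thalf powi k)" by (subst sum.reindex) (auto simp: inj_on_def)
 finally show ?thesis using nonneg_laurentI[of "(%k. m + k) ` K"] p(2) by simp
qed

lemma nonneg_mult:
 assumes "p : nonneg_laurent" "q : nonneg_laurent"
 shows "p * q : nonneg_laurent"
proof -
 obtain K c where p: "p = (SUM k:K. of_nat (c k) * thalf powi k)" using assms(1) unfolding nonneg_laurent_def by blast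
 have nat: "of_nat n * r : nonneg_laurent" if "r : nonneg_laurent" for n r
 by (induction n) (auto simp: distrib_right intro: nonneg_zero nonneg_add that)
 have pq: "p * q = (SUM k:K. of_nat (c k) * (thalf powi k * q))" unfolding p by (simp add: sum_distrib_right mult.assoc)
 show ?thesis unfolding pq by (intro nonneg_sum nat nonneg_powi_mult assms(2))
qed

lemma nonneg_prod: "(!!x. x : S ==> f x : nonneg_laurent) ==> (PROD x:S. f x) : nonneg_laurent"
 using nonneg_powi[of 0] by (induction S rule: infinite_finite_induct) (auto intro: nonneg_mult)

lemma quantum_integer: "EX q:nonneg_laurent. thalf powi (- int c) - thalf powi (int c) = (thalf powi (- 1) - thalf) * q"
proof (induction c)
 case 0
 thus ?case using nonneg_zero by (intro bexI[of _ 0]) auto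
next
 case (Suc c)
 then obtain q where q: "q : nonneg_laurent" "thalf powi (- int c) - thalf powi (int c) = (thalf powi (- 1) - thalf) * q" by blast
 have x: "thalf powi (- int (Suc c)) = thalf powi (- int c) * thalf powi (- 1)" "thalf powi (int (Suc c)) = thalf powi (int c) * thalf"
 proof -
  have e: "- int (Suc c) = - int c + - 1" "int (Suc c) = int c + 1" by simp_all
  show "thalf powi (- int (Suc c)) = thalf powi (- int c) * thalf powi (- 1)" unfolding e(1) thalf_powi_add ..
  show "thalf powi (int (Suc c)) = thalf powi (int c) * thalf" unfolding e(2) thalf_powi_add by simp
 qed
 have "thalf powi (- int (Suc c)) - thalf powi (int (Suc c)) =
  thalf powi (- int c) * (thalf powi (- 1) - thalf) + thalf * (thalf powi (- int c) - thalf powi (int c))"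
 unfolding x by (simp only: right_diff_distrib mult.commute[of thalf])
 also have "... = (thalf powi (- 1) - thalf) * (thalf powi (- int c) + thalf powi 1 * q)" unfolding q(2) by (simp add: algebra_simps)
 finally show ?case using nonneg_add[OF nonneg_powi nonneg_powi_mult[OF q(1)]] by blast
qed

section \<open>Plane diagrams\<close>

lemma thalf_gap: "i ~= 0 ==> thalf powi (- i) - thalf powi i ~= 0" using thalf_powi_eq[of "- i" i] by auto

text \<open>The disc of the vertex at the base point uses up one factor \<open>t\<^sup>-\<^sup>i\<^sup>/\<^sup>2 - t\<^sup>i\<^sup>/\<^sup>2\<close>, the others leave \<open>card (verts D) - 1\<close> factors with quantum integers.\<close>

theorem plane_nonneg:
 assumes D: "moy_diagram D" "dpts D = {}" "verts D ~= {}" and dl: "base_point D dl"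
 shows "alexander D dl : nonneg_laurent"
proof (cases "states D dl = {}")
 case True
 thus ?thesis using nonneg_zero by (simp add: alexander_def bracket_def)
next
 case False
 have d: "dl : arcs D" "color D dl ~= 0" using dl by (auto simp: base_point_def)
 interpret connected_diagram D using states_nonempty[OF D(1) d(1) False] D by unfold_locales auto
 obtain v0 j0 where v0: "v0 : verts D" "j0 < length (ins D v0)" "dl = ins D v0 ! j0"
 using d(1) arcs_open D(2) by (auto simp: open_arcs_def in_slots_def)
 define i where "i = int (color D dl)"
 define z where "z = thalf powi (- 1) - thalf"
 define gap where "gap = thalf powi (- i) - thalf powi i"
 have z0: "z ~= 0" using thalf_gap[of 1] by (simp add: z_def)
 have g0: "gap ~= 0" using thalf_gap[of i] d(2) by (simp add: gap_def i_def)
 have Cr: "Cr D = {Circ v j |v j. v : verts D & j < length (ins D v)}" using D(2) by (simp add: Cr_def)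
 have finCr: "finite (Cr D)" by (rule finite_Cr[OF D(1)])
 let ?C0 = "Circ v0 j0"
 have summand: "EX p:nonneg_laurent. state_M D s * state_A D s = gap * z ^ (card (verts D) - 1) * p" if s: "s : states D dl" for s
 proof -
  have sc: "s C : corners C" if "C : Cr D" for C using s that by (auto simp: states_def)
  have bij: "bij_betw (%C. corner_region D C (s C)) (Cr D) (Re D - {Regular (lreg D dl), Regular (rreg D dl)})" using s by (simp add: states_def)
  define N where "N = {C : Cr D. s C = North}"
  have C0: "?C0 : Cr D" using v0 Cr by auto
  have "s ?C0 = North"
 proof -
  have "corner_region D ?C0 (s ?C0) ~: {Regular (lreg D dl), Regular (rreg D dl)}" using bij_betwE[OF bij] C0 by blast
  thus ?thesis using sc[OF C0] v0 by (cases "s ?C0") auto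
 qed
  hence C0N: "?C0 : N" using C0 by (simp add: N_def)
  have NR: "corner_region D C (s C) : Disc ` verts D \<longleftrightarrow> s C = North" if "C : Cr D" for C
 using that sc[OF that] Cr by (cases "s C") auto
  have "bij_betw (%C. corner_region D C (s C)) N (Disc ` verts D)"
 proof -
  have "(%C. corner_region D C (s C)) ` N = Disc ` verts D"
 proof (intro equalityI subsetI)
  fix B assume "B : Disc ` verts D"
  hence "B : Re D - {Regular (lreg D dl), Regular (rreg D dl)}" by (auto simp: Re_def)
  then obtain C where C: "C : Cr D" "corner_region D C (s C) = B" using bij_betw_imp_surj_on[OF bij] by (metis (no_types, lifting) imageE)
  have "s C = North" using NR[OF C(1)] C(2) \<open>B : Disc ` verts D\<close> by simp
  hence "C : N" using C(1) by (simp add: N_def)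
  thus "B : (%C. corner_region D C (s C)) ` N" by (rule rev_image_eqI) (rule C(2)[symmetric])
 next
  fix B assume "B : (%C. corner_region D C (s C)) ` N"
  then obtain C where C: "C : N" "B = corner_region D C (s C)" by (rule imageE)
  hence "C : Cr D" "s C = North" by (simp_all add: N_def)
  hence "corner_region D C (s C) : Disc ` verts D" using NR[of C] by blast
  thus "B : Disc ` verts D" unfolding C(2) .
 qed
  moreover have "inj_on (%C. corner_region D C (s C)) N" using bij unfolding bij_betw_def N_def by (auto intro: inj_on_subset)
  ultimately show ?thesis by (simp add: bij_betw_def)
 qed
  hence cardN: "card N = card (verts D)" by (simp add: bij_betw_same_card card_image inj_on_def)
  have finN: "finite N" using finCr by (simp add: N_def)
  have "ALL C:N. EX q:nonneg_laurent. weight_A D C (s C) = z * q"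
 proof
  fix C assume "C : N"
  then obtain v j where "C = Circ v j" "s C = North" using Cr by (auto simp: N_def)
  thus "EX q:nonneg_laurent. weight_A D C (s C) = z * q" using quantum_integer[of "color D (ins D v ! j)"] by (simp add: z_def Let_def)
 qed
  then obtain q where q: "!!C. C : N ==> q C : nonneg_laurent & weight_A D C (s C) = z * q C" by metis
  have rest: "weight_A D C (s C) : nonneg_laurent" if CN: "C : Cr D - N" for C
 proof -
  obtain v j where C: "C = Circ v j" using CN Cr by auto
  have "s C = West \<or> s C = East" using CN sc[of C] C by (cases "s C") (auto simp: N_def)
  thus ?thesis using C nonneg_powi by (auto simp: Let_def simp del: power_int_of_nat)
 qed
  have "state_A D s = (PROD C:N. weight_A D C (s C)) * (PROD C:Cr D - N. weight_A D C (s C))"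
 unfolding state_A_def using finCr by (subst prod.subset_diff[of N]) (auto simp: N_def mult.commute)
  also have "(PROD C:N. weight_A D C (s C)) = weight_A D ?C0 (s ?C0) * (PROD C:N - {?C0}. z * q C)"
 using q finN C0N by (subst prod.remove[of N ?C0]) auto
  also have "(PROD C:N - {?C0}. z * q C) = z ^ (card (verts D) - 1) * (PROD C:N - {?C0}. q C)" using cardN finN C0N by (simp add: prod.distrib)
  also have "weight_A D ?C0 (s ?C0) = gap" using C0N v0 by (simp add: N_def gap_def i_def Let_def)
  finally have "state_A D s = gap * z ^ (card (verts D) - 1) * ((PROD C:N - {?C0}. q C) * (PROD C:Cr D - N. weight_A D C (s C)))"
 by (simp add: mult.assoc)
  moreover have "state_M D s = 1" unfolding state_M_def Cr by (rule prod.neutral) auto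
  moreover have "(PROD C:N - {?C0}. q C) * (PROD C:Cr D - N. weight_A D C (s C)) : nonneg_laurent"
 using q rest by (intro nonneg_mult nonneg_prod) auto
  ultimately show ?thesis by auto
 qed
 then obtain p where p: "!!s. s : states D dl ==> p s : nonneg_laurent & state_M D s * state_A D s = gap * z ^ (card (verts D) - 1) * p s" by metis
 have tot: "(SUM s:states D dl. state_M D s * state_A D s) = gap * z ^ (card (verts D) - 1) * (SUM s:states D dl. p s)"
 using p by (simp add: sum_distrib_left)
 define r where "r = region_index D (lreg D dl)"
 have base: "base_value D dl = thalf powi (2 * r - i) * gap"
 proof -
  have e: "2 * (r - i) = (2 * r - i) + - i" "2 * r = (2 * r - i) + i" by simp_all
  show ?thesis unfolding base_value_def Let_def gap_def r_def[symmetric] i_def[symmetric] e(1) right_diff_distrib thalf_powi_add[symmetric] by simp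
 qed
 have V: "card (verts D) >= 1" using D(3) fin(3) by (simp add: Suc_le_eq card_gt_0_iff)
 have zp: "z powi (int (card (verts D)) - 1) = z ^ (card (verts D) - 1)"
 proof -
  have "int (card (verts D)) - 1 = int (card (verts D) - 1)" using V by simp
  thus ?thesis by (simp only: power_int_of_nat)
 qed
 have inv: "inverse (thalf powi (2 * r - i)) = thalf powi (i - 2 * r)" using power_int_minus[of thalf "2 * r - i"] by simp
 have "alexander D dl = inverse (thalf powi (2 * r - i)) * (SUM s:states D dl. p s)"
 unfolding alexander_def bracket_def tot base z_def[symmetric] zp using z0 g0 by simp
 thus ?thesis unfolding inv using p by (auto intro!: nonneg_powi_mult nonneg_sum)
qed

section \<open>Invariance\<close>

lemma moy_move_agree:
 assumes "moy_move D D'"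
 shows "EX I I' X f g h k. agree_outside D I D' I' X f g h k"
proof -
 have "isotopic D D' \<or> move1 D D' \<or> move2 D D' \<or> move3 D D' \<or> move4 D D' \<or> move5 D D'" using assms by (simp add: moy_move_def)
 moreover have "isotopic D D' ==> ?thesis" unfolding isotopic_def by blast
 moreover have "move1 D D' ==> ?thesis" unfolding move1_def by (elim exE conjE) blast
 moreover have "move2 D D' ==> ?thesis" unfolding move2_def by (elim exE conjE) blast
 moreover have "move3 D D' ==> ?thesis" unfolding move3_def by (elim exE conjE) blast
 moreover have "move4 D D' ==> ?thesis" unfolding move4_def by (elim exE conjE) blast
 moreover have "move5 D D' ==> ?thesis" unfolding move5_def by (elim exE conjE) blast
 ultimately show ?thesis by satx
qed

lemma moy_move_verts:
 assumes "moy_move D D'"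
 shows "verts D = {} \<longleftrightarrow> verts D' = {}"
proof -
 obtain k where "bij_betw k (verts D) (verts D')" using moy_move_agree[OF assms] unfolding agree_outside_def by blast
 thus ?thesis by (auto simp: bij_betw_def)
qed

lemma moy_move_bracket:
 assumes "moy_move D D'" "verts D ~= {}"
 shows "same_bracket D D'"
proof -
 have D: "moy_diagram D" "moy_diagram D'" using assms by (auto simp: moy_move_def)
 show ?thesis using assms same_bracket_isotopic[OF D] same_bracket_move1[OF D] same_bracket_move2[OF D _ assms(2)]
  same_bracket_move3[OF D] same_bracket_move4[OF D] same_bracket_move5[OF D] unfolding moy_move_def by satx
qed

definition nonneg_alexander :: "moy => bool" where
 "nonneg_alexander D \<longleftrightarrow> (ALL dl. base_point D dl --> alexander D dl : nonneg_laurent)"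

text \<open>The move relates one pair of base points; any other base point has the same bracket.\<close>

lemma moy_move_nonneg:
 assumes m: "moy_move D D'" "verts D ~= {}"
 shows "nonneg_alexander D \<longleftrightarrow> nonneg_alexander D'"
proof -
 have D: "moy_diagram D" "moy_diagram D'" "verts D' ~= {}" using m moy_move_verts[OF m(1)] by (auto simp: moy_move_def)
 obtain dl dl' m where b: "base_point D dl" "base_point D' dl'" "bracket D dl = thalf powi m * bracket D' dl'"
  and c: "card (verts D) = card (verts D')" using moy_move_bracket[OF assms] unfolding same_bracket_def by blast
 have ind: "alexander D d = alexander D dl" "alexander D' d' = alexander D' dl'" if "base_point D d" "base_point D' d'" for d d'
 using bracket_base_independent[OF D(1) assms(2) that(1) b(1)] bracket_base_independent[OF D(2,3) that(2) b(2)] by (simp_all add: alexander_def)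
 have e: "alexander D dl = thalf powi m * alexander D' dl'" using b(3) c by (simp add: alexander_def)
 have e': "alexander D' dl' = thalf powi (- m) * alexander D dl" unfolding e mult.assoc[symmetric] thalf_powi_add[symmetric] by simp
 have "nonneg_alexander D \<longleftrightarrow> alexander D dl : nonneg_laurent" "nonneg_alexander D' \<longleftrightarrow> alexander D' dl' : nonneg_laurent"
 unfolding nonneg_alexander_def using ind b by metis+
 moreover have "alexander D dl : nonneg_laurent \<longleftrightarrow> alexander D' dl' : nonneg_laurent"
 using nonneg_powi_mult[of "alexander D' dl'" m, folded e] nonneg_powi_mult[of "alexander D dl" "- m", folded e'] by blast
 ultimately show ?thesis by simp
qed

lemma equivalent_nonneg:
 assumes "equivclp moy_move D D'" "verts D ~= {}"
 shows "verts D' ~= {} & (nonneg_alexander D --> nonneg_alexander D')" using assms(1)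
proof (induction rule: equivclp_induct)
 case (step y z)
 from step.hyps(2) show ?case
 proof
  assume m: "moy_move y z"
  show ?thesis using moy_move_verts[OF m] moy_move_nonneg[OF m] step.IH by simp
 next
  assume m: "moy_move z y"
  show ?thesis using moy_move_verts[OF m] moy_move_nonneg[OF m] step.IH by simp
 qed
qed (use assms(2) in simp)

theorem theorem5p3:
  fixes G :: "moy set"
  assumes "G \<in> moy_graphs"
    and "\<exists>D \<in> G. verts D \<noteq> {}"
    and "\<exists>D \<in> G. dpts D = {}"
  shows "Alexander G \<subseteq> nonneg_laurent"
proof -
 obtain D1 where D1: "G = moy_equiv `` {D1}" using assms(1) unfolding moy_graphs_def by (rule quotientE)
 have G: "moy_diagram D & equivclp moy_move D D'" if "D : G" "D' : G" for D D'
 proof -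
  have d: "moy_diagram D" "equivclp moy_move D1 D" "equivclp moy_move D1 D'" using that unfolding D1 moy_equiv_def by simp_all
  show ?thesis by (rule conjI[OF d(1) equivclp_trans[OF equivclp_sym[OF d(2)] d(3)]])
 qed
 obtain E P where E: "E : G" "verts E ~= {}" and P: "P : G" "dpts P = {}" using assms(2,3) by blast
 have VP: "verts P ~= {}" using equivalent_nonneg[OF _ E(2), of P] G[OF E(1) P(1)] by simp
 have nP: "nonneg_alexander P" using plane_nonneg[OF _ P(2) VP] G[OF P(1) P(1)] by (simp add: nonneg_alexander_def)
 have all: "nonneg_alexander D" if "D : G" for D using equivalent_nonneg[OF _ VP, of D] nP G[OF P(1) that] by simp
 show ?thesis
 proof
  fix a assume "a : Alexander G"
  then obtain m D dl where a: "a = thalf powi (2 * m) * alexander D dl" "D : G" "base_point D dl" unfolding Alexander_def by blast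
  hence "alexander D dl : nonneg_laurent" using all[OF a(2)] by (simp add: nonneg_alexander_def)
  thus "a : nonneg_laurent" unfolding a(1) by (rule nonneg_powi_mult)
 qed
qed

end
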